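(* Let $M$ be a compact connected Riemannian manifold of constant sectional curvature $-1$ and dimension $n$, let $\pi:T^1M\to M$ be its unit tangent bundle, $(\phi_t)_{t\in\mathbb{R}}$ its geodesic flow on $T^1M$, and let $x_0\in M$. Then for Liouville-almost every $v$ in $T^1M$, $$\limsup_{t\to +\infty} \;\frac{-\log d(\pi\circ\phi_t(v),x_0)}{\log t}\;=\frac{1}{n-1}\;,$$ where $d$ is the Riemannian distance on $M$.
   Context: The Liouville measure on $T^1M$ is the standard smooth measure invariant under the geodesic flow. *)

theory Defs
  imports "HOL-Analysis.Analysis"
begin

section \<open>Smooth maps between open subsets of Euclidean spaces\<close>

primrec Ck_on :: "nat \<Rightarrow> ('a::real_normed_vector \<Rightarrow> 'b::real_normed_vector) \<Rightarrow> 'a set \<Rightarrow> bool" where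
  "Ck_on 0 f S \<longleftrightarrow> continuous_on S f"
| "Ck_on (Suc k) f S \<longleftrightarrow>
     (\<forall>x\<in>S. f differentiable (at x)) \<and> (\<forall>v. Ck_on k (\<lambda>x. frechet_derivative f (at x) v) S)"

definition smooth_on :: "('a::real_normed_vector \<Rightarrow> 'b::real_normed_vector) \<Rightarrow> 'a set \<Rightarrow> bool" where
  "smooth_on f S \<longleftrightarrow> (\<forall>k. Ck_on k f S)"

definition pderiv_at :: "'n::finite \<Rightarrow> (real^'n \<Rightarrow> real) \<Rightarrow> real^'n \<Rightarrow> real" where
  "pderiv_at i f x = frechet_derivative f (at x) (axis i 1)"

section \<open>Riemannian manifolds\<close>

text \<open>
  A chart is a pair of its domain and its coordinate map; the values of the coordinate map outside
  the domain are irrelevant.  The atlas need not be maximal.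
  A Riemannian metric is given by its Gram matrices in the charts of the atlas, as functions of the
  coordinates.  The dimension of the manifold is \<open>CARD('n)\<close>.
\<close>

type_synonym ('a, 'n) chart = "'a set \<times> ('a \<Rightarrow> real^'n)"

record ('a, 'n::finite) riem =
  man_top :: "'a topology"
  man_atlas :: "('a, 'n) chart set"
  man_metric :: "('a, 'n) chart \<Rightarrow> real^'n \<Rightarrow> real^'n^'n"

abbreviation chart_dom :: "('a, 'n::finite) chart \<Rightarrow> 'a set" where
  "chart_dom c \<equiv> fst c"

abbreviation chart_map :: "('a, 'n::finite) chart \<Rightarrow> 'a \<Rightarrow> real^'n" where
  "chart_map c \<equiv> snd c"

definition chart_img :: "('a, 'n::finite) chart \<Rightarrow> (real^'n) set" where
  "chart_img c = chart_map c ` chart_dom c"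

definition chart_inv :: "('a, 'n::finite) chart \<Rightarrow> real^'n \<Rightarrow> 'a" where
  "chart_inv c = inv_into (chart_dom c) (chart_map c)"

definition transition ::
    "('a, 'n::finite) chart \<Rightarrow> ('a, 'n) chart \<Rightarrow> real^'n \<Rightarrow> real^'n" where
  "transition c c' = chart_map c' \<circ> chart_inv c"

definition smooth_atlas :: "'a topology \<Rightarrow> ('a, 'n::finite) chart set \<Rightarrow> bool" where
  "smooth_atlas X A \<longleftrightarrow>
     (\<Union>c\<in>A. chart_dom c) = topspace X \<and>
     (\<forall>c\<in>A. openin X (chart_dom c) \<and> open (chart_img c) \<and>
        homeomorphic_map (subtopology X (chart_dom c)) (top_of_set (chart_img c)) (chart_map c)) \<and>
     (\<forall>c\<in>A. \<forall>c'\<in>A. smooth_on (transition c c') (chart_map c ` (chart_dom c \<inter> chart_dom c')))"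

text \<open>The last condition is the transformation law of a covariant 2-tensor.\<close>

definition riemannian_manifold :: "('a, 'n::finite) riem \<Rightarrow> bool" where
  "riemannian_manifold M \<longleftrightarrow>
     Hausdorff_space (man_top M) \<and> second_countable (man_top M) \<and>
     smooth_atlas (man_top M) (man_atlas M) \<and>
     (\<forall>c\<in>man_atlas M.
        smooth_on (man_metric M c) (chart_img c) \<and>
        (\<forall>x\<in>chart_img c.
           transpose (man_metric M c x) = man_metric M c x \<and>
           (\<forall>y. y \<noteq> 0 \<longrightarrow> y \<bullet> (man_metric M c x *v y) > 0))) \<and>
     (\<forall>c\<in>man_atlas M. \<forall>c'\<in>man_atlas M. \<forall>x\<in>chart_map c ` (chart_dom c \<inter> chart_dom c').
        let D = frechet_derivative (transition c c') (at x) in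
          \<forall>y z. y \<bullet> (man_metric M c x *v z) = D y \<bullet> (man_metric M c' (transition c c' x) *v D z))"

definition inner_at ::
    "('a, 'n::finite) riem \<Rightarrow> ('a, 'n) chart \<Rightarrow> real^'n \<Rightarrow> real^'n \<Rightarrow> real^'n \<Rightarrow> real" where
  "inner_at M c x y z = y \<bullet> (man_metric M c x *v z)"

section \<open>Levi-Civita connection and sectional curvature, in charts\<close>

definition christoffel ::
    "('a, 'n::finite) riem \<Rightarrow> ('a, 'n) chart \<Rightarrow> real^'n \<Rightarrow> 'n \<Rightarrow> 'n \<Rightarrow> 'n \<Rightarrow> real" where
  "christoffel M c x k i j =
     (\<Sum>l\<in>UNIV. matrix_inv (man_metric M c x) $ k $ l *
        (pderiv_at i (\<lambda>z. man_metric M c z $ j $ l) x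
         + pderiv_at j (\<lambda>z. man_metric M c z $ i $ l) x
         - pderiv_at l (\<lambda>z. man_metric M c z $ i $ j) x)) / 2"

text \<open>
  The component \<open>l\<close> of \<open>R(\<partial>\<^sub>i,\<partial>\<^sub>j)\<partial>\<^sub>k\<close>, with the convention
  \<open>R(X,Y)Z = \<nabla>\<^sub>X\<nabla>\<^sub>YZ - \<nabla>\<^sub>Y\<nabla>\<^sub>XZ - \<nabla>\<^bsub>[X,Y]\<^esub>Z\<close>.
\<close>

definition curvature_coeff ::
    "('a, 'n::finite) riem \<Rightarrow> ('a, 'n) chart \<Rightarrow> real^'n \<Rightarrow> 'n \<Rightarrow> 'n \<Rightarrow> 'n \<Rightarrow> 'n \<Rightarrow> real" where
  "curvature_coeff M c x l i j k =
     pderiv_at i (\<lambda>z. christoffel M c z l j k) x - pderiv_at j (\<lambda>z. christoffel M c z l i k) x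
     + (\<Sum>m\<in>UNIV. christoffel M c x m j k * christoffel M c x l i m
                - christoffel M c x m i k * christoffel M c x l j m)"

definition curvature_op ::
    "('a, 'n::finite) riem \<Rightarrow> ('a, 'n) chart \<Rightarrow> real^'n \<Rightarrow> real^'n \<Rightarrow> real^'n \<Rightarrow> real^'n \<Rightarrow> real^'n" where
  "curvature_op M c x u v w =
     (\<chi> l. \<Sum>i\<in>UNIV. \<Sum>j\<in>UNIV. \<Sum>k\<in>UNIV. curvature_coeff M c x l i j k * u $ i * v $ j * w $ k)"

definition sectional_curvature ::
    "('a, 'n::finite) riem \<Rightarrow> ('a, 'n) chart \<Rightarrow> real^'n \<Rightarrow> real^'n \<Rightarrow> real^'n \<Rightarrow> real" where
  "sectional_curvature M c x u v =
     inner_at M c x (curvature_op M c x u v v) u /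
     (inner_at M c x u u * inner_at M c x v v - (inner_at M c x u v)\<^sup>2)"

definition constant_curvature :: "('a, 'n::finite) riem \<Rightarrow> real \<Rightarrow> bool" where
  "constant_curvature M \<kappa> \<longleftrightarrow>
     (\<forall>c\<in>man_atlas M. \<forall>x\<in>chart_img c. \<forall>u v. u \<noteq> v \<and> independent {u, v} \<longrightarrow>
        sectional_curvature M c x u v = \<kappa>)"

section \<open>Tangent vectors\<close>

text \<open>
  A tangent vector is its base point together with the family of its coordinate vectors in all the
  charts around the base point (the coordinates being set to \<open>0\<close> in the other charts).
  \<open>tangent_vector M c x y\<close> is the one whose coordinate expression in the chart \<open>c\<close> is \<open>(x, y)\<close>.
\<close>

type_synonym ('a, 'n) tvec = "'a \<times> (('a, 'n) chart \<Rightarrow> real^'n)"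

definition tangent_vector ::
    "('a, 'n::finite) riem \<Rightarrow> ('a, 'n) chart \<Rightarrow> real^'n \<Rightarrow> real^'n \<Rightarrow> ('a, 'n) tvec" where
  "tangent_vector M c x y =
     (chart_inv c x,
      \<lambda>c'. if c' \<in> man_atlas M \<and> chart_inv c x \<in> chart_dom c'
           then frechet_derivative (transition c c') (at x) y else 0)"

definition tangent_bundle :: "('a, 'n::finite) riem \<Rightarrow> ('a, 'n) tvec set" where
  "tangent_bundle M = {tangent_vector M c x y | c x y. c \<in> man_atlas M \<and> x \<in> chart_img c}"

definition unit_tangent_bundle :: "('a, 'n::finite) riem \<Rightarrow> ('a, 'n) tvec set" where
  "unit_tangent_bundle M =
     {tangent_vector M c x y | c x y. c \<in> man_atlas M \<and> x \<in> chart_img c \<and> inner_at M c x y y = 1}"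

abbreviation base_point :: "('a, 'n::finite) tvec \<Rightarrow> 'a" where
  "base_point v \<equiv> fst v"

text \<open>The choice of the chart does not matter.\<close>

definition tangent_norm :: "('a, 'n::finite) riem \<Rightarrow> ('a, 'n) tvec \<Rightarrow> real" where
  "tangent_norm M v =
     (let c = (SOME c. c \<in> man_atlas M \<and> base_point v \<in> chart_dom c)
      in sqrt (inner_at M c (chart_map c (base_point v)) (snd v c) (snd v c)))"

definition coord_velocity :: "('a, 'n::finite) chart \<Rightarrow> (real \<Rightarrow> 'a) \<Rightarrow> real \<Rightarrow> real^'n" where
  "coord_velocity c \<gamma> t = vector_derivative (\<lambda>s. chart_map c (\<gamma> s)) (at t)"

definition velocity :: "('a, 'n::finite) riem \<Rightarrow> (real \<Rightarrow> 'a) \<Rightarrow> real \<Rightarrow> ('a, 'n) tvec" where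
  "velocity M \<gamma> t =
     (\<gamma> t, \<lambda>c. if c \<in> man_atlas M \<and> \<gamma> t \<in> chart_dom c then coord_velocity c \<gamma> t else 0)"

section \<open>Riemannian distance\<close>

text \<open>
  Curves are parametrised by \<open>[0,1]\<close>.  The library notion of piecewise \<open>C\<^sup>1\<close> does not require
  one-sided limits of the derivative at the exceptional points, so the length, a Lebesgue integral
  in \<open>[0,\<infinity>]\<close>, may be infinite; this does not affect the infimum.
\<close>

definition pw_C1_curve :: "('a, 'n::finite) riem \<Rightarrow> (real \<Rightarrow> 'a) \<Rightarrow> bool" where
  "pw_C1_curve M \<gamma> \<longleftrightarrow>
     continuous_map (top_of_set {0..1}) (man_top M) \<gamma> \<and>
     (\<forall>c\<in>man_atlas M. \<forall>a b. {a..b} \<subseteq> {0..1} \<and> \<gamma> ` {a..b} \<subseteq> chart_dom c \<longrightarrow>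
        (\<lambda>s. chart_map c (\<gamma> s)) piecewise_C1_differentiable_on {a..b})"

definition curve_length :: "('a, 'n::finite) riem \<Rightarrow> (real \<Rightarrow> 'a) \<Rightarrow> ennreal" where
  "curve_length M \<gamma> = (\<integral>\<^sup>+t\<in>{0..1}. ennreal (tangent_norm M (velocity M \<gamma> t)) \<partial>lborel)"

definition riem_dist :: "('a, 'n::finite) riem \<Rightarrow> 'a \<Rightarrow> 'a \<Rightarrow> real" where
  "riem_dist M p q =
     enn2real (INF \<gamma>\<in>{\<gamma>. pw_C1_curve M \<gamma> \<and> \<gamma> 0 = p \<and> \<gamma> 1 = q}. curve_length M \<gamma>)"

section \<open>Geodesic flow\<close>

definition complete_geodesic :: "('a, 'n::finite) riem \<Rightarrow> (real \<Rightarrow> 'a) \<Rightarrow> bool" where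
  "complete_geodesic M \<gamma> \<longleftrightarrow>
     continuous_map euclideanreal (man_top M) \<gamma> \<and>
     (\<forall>c\<in>man_atlas M. \<forall>t. \<gamma> t \<in> chart_dom c \<longrightarrow>
        (\<lambda>s. chart_map c (\<gamma> s)) differentiable (at t) \<and>
        (coord_velocity c \<gamma> has_vector_derivative
           (\<chi> k. - (\<Sum>i\<in>UNIV. \<Sum>j\<in>UNIV. christoffel M c (chart_map c (\<gamma> t)) k i j
                      * coord_velocity c \<gamma> t $ i * coord_velocity c \<gamma> t $ j))) (at t))"

text \<open>Meaningful when \<open>M\<close> is geodesically complete, in particular when \<open>M\<close> is compact.\<close>

definition geodesic_flow ::
    "('a, 'n::finite) riem \<Rightarrow> real \<Rightarrow> ('a, 'n) tvec \<Rightarrow> ('a, 'n) tvec" where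
  "geodesic_flow M t v =
     (THE w. \<exists>\<gamma>. complete_geodesic M \<gamma> \<and> velocity M \<gamma> 0 = v \<and> velocity M \<gamma> t = w)"

section \<open>Liouville measure\<close>

definition tangent_open :: "('a, 'n::finite) riem \<Rightarrow> ('a, 'n) tvec set \<Rightarrow> bool" where
  "tangent_open M W \<longleftrightarrow> W \<subseteq> tangent_bundle M \<and>
     (\<forall>c\<in>man_atlas M. open {(x, y). x \<in> chart_img c \<and> tangent_vector M c x y \<in> W})"

definition unit_tangent_borel :: "('a, 'n::finite) riem \<Rightarrow> ('a, 'n) tvec measure" where
  "unit_tangent_borel M =
     sigma (unit_tangent_bundle M) {W \<inter> unit_tangent_bundle M | W. tangent_open M W}"

text \<open>
  The Liouville measure is the product of the Riemannian volume of \<open>M\<close> and of the spherical measures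
  of the fibres.  The Riemannian volume of the tangent bundle has density \<open>det g(x)\<close> in the coordinates
  \<open>(x, y)\<close>, namely \<open>sqrt (det g(x))\<close> for the base and for the fibre each, and the measure of a Borel
  subset \<open>A\<close> of a Euclidean unit sphere is \<open>n\<close> times the volume of the cone \<open>{r v | 0 < r \<le> 1, v \<in> A}\<close>.
  Hence the restriction of the Liouville measure to the unit vectors based in the domain of a chart
  is the image, under the radial projection, of the measure \<open>n det g(x) dx dy\<close> on the punctured unit
  ball bundle.
\<close>

definition chart_liouville ::
    "('a, 'n::finite) riem \<Rightarrow> ('a, 'n) chart \<Rightarrow> ('a, 'n) tvec measure" where
  "chart_liouville M c =
     distr
       (density (restrict_space lborel {(x, y). x \<in> chart_img c \<and> y \<noteq> 0 \<and> inner_at M c x y y \<le> 1})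
          (\<lambda>(x, y). ennreal (real CARD('n) * det (man_metric M c x))))
       (unit_tangent_borel M)
       (\<lambda>(x, y). tangent_vector M c x (y /\<^sub>R sqrt (inner_at M c x y y)))"

text \<open>
  By the change of variables formula these measures are restrictions of one measure to open sets
  covering \<open>T\<^sup>1M\<close>.  That measure is their supremum in the complete lattice of measures (all of them
  have the same space and the same measurable sets).
\<close>

definition liouville :: "('a, 'n::finite) riem \<Rightarrow> ('a, 'n) tvec measure" where
  "liouville M = (SUP c\<in>man_atlas M. chart_liouville M c)"

section \<open>Logarithm of a distance\<close>

text \<open>The function \<open>- log\<close> on \<open>[0,\<infinity>)\<close>, with \<open>- log 0 = \<infinity>\<close>, whereas \<open>ln 0 = 0\<close> in the library.\<close>

definition neg_log :: "real \<Rightarrow> ereal" where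
  "neg_log r = (if r = 0 then \<infinity> else ereal (- ln r))"

end

theory Submission
  imports Defs "HOL-Real_Asymp.Real_Asymp"
begin

text \<open>
  \<open>M\<close> is developed on the hyperboloid model of hyperbolic space. Since the curvature is \<open>-1\<close>, the tractor
  connection \<open>(u, \<xi>) \<mapsto> (du - \<xi>, \<nabla>\<xi> - u id)\<close> is flat; its parallel sections are local isometries to the model, and by
  compactness their inverses continue to a local isometry \<open>F\<close> of the whole model onto \<open>M\<close>. The fibre \<open>Q\<close> of \<open>F\<close>
  over \<open>x0\<close> is uniformly separated and cobounded, and a geodesic of \<open>M\<close> comes \<open>r\<close>-close to \<open>x0\<close> when its lift
  comes \<open>r\<close>-close to \<open>Q\<close>. Seen from a base point, the points of \<open>Q\<close> at distance about \<open>k\<close> define roughly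
  \<open>e^((n-1)k)\<close> balls of directions, of radius \<open>e^-k k^-s\<close>, along which the distance at time \<open>k\<close> is below \<open>k^-s\<close>.
  If \<open>s (n - 1) > 1\<close>, the Borel-Cantelli lemma shows that almost every direction lies in finitely many of them.
  If \<open>s (n - 1) < 1\<close>, every cell of directions of size \<open>2^-m\<close> loses to these balls a proportion of about \<open>m^(-s (n - 1))\<close>
  at the next scales, whatever happened before, so that almost every direction lies in infinitely many of them.
  Fubini's theorem in the charts of the tangent bundle transfers this to the Liouville measure.
\<close>

text \<open>The threshold is where a sum of proportions changes its behaviour: the growth of a shell
  cancels the factor e^(-k(n-1)) in the solid angle of a ball, and k^(-s (n-1)) is left, which has a
  finite sum over k exactly when s (n - 1) > 1. In the divergent half the obstacle is that different
  shells are not independent. Coboundedness of \<open>Q\<close> takes the place of independence: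
  every dyadic cell of a late scale, whatever was removed before, contains a box of hit directions
  of the expected size.

  \<open>Q\<close> enters only as a separated and cobounded set. The bridge to it is rigidity: two
  local isometries from the model with a common value differ by a global isometry of the model. Such
  an isometry is linear on Minkowski space, so geodesics are given by cosh t h + sinh t w, and
  distances occur through their hyperbolic cosine, a simple algebraic expression.

  Directions are described by central projection to the faces of a cube. A face is thickened by a
  dummy coordinate, so that null sets of directions become Lebesgue null sets of
  \<open>real^'n\<close> itself.\<close>

section \<open>The hyperboloid in its space coordinates\<close>

text \<open>The time component of the point of the hyperboloid with space component
  \<open>x\<close>; hyperbolic space is thus a vector space with one global chart.\<close>

definition hz :: "'a::real_inner => real" where
 "hz x = sqrt (1 + x \<bullet> x)"

text \<open>Minus the Lorentz product of the points over \<open>x\<close> and \<open>y\<close>, that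
  is the hyperbolic cosine of their distance.\<close>

definition hB :: "'a::real_inner => 'a => real" where
 "hB x y = hz x*hz y - x \<bullet> y"

definition hzd :: "'a::real_inner => 'a => real" where
 "hzd x v = (x \<bullet> v)/hz x"

text \<open>The Minkowski form restricted to the hyperboloid: \<open>hzd x v\<close> is the time
  component of the tangent vector with space component \<open>v\<close>.\<close>

definition gH :: "'a::real_inner => 'a => 'a => real" where
 "gH x v w = v \<bullet> w - hzd x v * hzd x w"

lemma hz_square: "hz x*hz x = 1 + x \<bullet> x"
 unfolding hz_def by (simp add: add_nonneg_nonneg)

lemma hz_power2: "(hz x)\<^sup>2 = 1 + x \<bullet> x"
 using hz_square[of x] by (simp add: power2_eq_square)

lemma hz_ge_1: "1\<le>hz x"
 unfolding hz_def by simp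

lemma hz_pos [simp]: "0 < hz x"
 using hz_ge_1[of x] by linarith

lemma hz_nonzero [simp]: "hz x\<noteq>0"
 using hz_pos[of x] by linarith

lemma hz_0 [simp]: "hz 0 = 1"
 unfolding hz_def by simp

lemma hz_minus [simp]: "hz (- x) = hz x"
 unfolding hz_def by simp

lemma hz_norm: "hz x = sqrt (1 + (norm x)\<^sup>2)"
 unfolding hz_def by (simp add: dot_square_norm)

lemma norm_less_hz: "norm x < hz x"
 unfolding hz_norm by (rule real_less_rsqrt) simp

lemma hzd_mult: "hz x*hzd x v = x \<bullet> v"
 unfolding hzd_def by simp

lemma hz_has_derivative:
 "(hz has_derivative hzd x) (at x within S)"
proof -
 have p: "0 < 1 + x \<bullet> x" by (simp add: add_pos_nonneg)
 have "((\<lambda>x. sqrt (1 + x \<bullet> x)) has_derivative (\<lambda>v. (x \<bullet> v + v \<bullet> x) * inverse (sqrt (1 + x \<bullet> x))/2)) (at x within S)"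
  by (rule derivative_eq_intros refl p | simp)+
 moreover have "(\<lambda>v. (x \<bullet> v + v \<bullet> x) * inverse (sqrt (1 + x \<bullet> x))/2) = hzd x"
  unfolding hzd_def hz_def by (auto simp: inner_commute field_simps)
 ultimately show ?thesis unfolding hz_def[abs_def] by simp
qed

lemma continuous_on_hz [continuous_intros]:
 "continuous_on S f ==> continuous_on S (\<lambda>x. hz (f x))"
 unfolding hz_def by (intro continuous_intros)

lemma continuous_on_hB [continuous_intros]:
 "continuous_on S f ==> continuous_on S g ==> continuous_on S (\<lambda>x. hB (f x) (g x))"
 unfolding hB_def by (intro continuous_intros)

lemma hB_sym: "hB x y = hB y x"
 unfolding hB_def by (simp add: inner_commute mult.commute)

lemma hB_0_left [simp]: "hB 0 x = hz x"
 unfolding hB_def by simp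

lemma hB_0_right [simp]: "hB x 0 = hz x"
 unfolding hB_def by simp

lemma hB_minus_1: "hB x y - 1 = ((norm (x - y))\<^sup>2 - (hz x - hz y)\<^sup>2)/2"
proof -
 have "(norm (x - y))\<^sup>2 = x \<bullet> x + y \<bullet> y - 2*(x \<bullet> y)"
  by (simp add: power2_norm_eq_inner inner_diff inner_commute)
 moreover have "(hz x - hz y)\<^sup>2 = 2 + x \<bullet> x + y \<bullet> y - 2*(hz x*hz y)"
  by (simp add: power2_diff hz_power2)
 ultimately show ?thesis unfolding hB_def by simp
qed

lemma hB_le: "hB x y\<le>1 + (norm (x - y))\<^sup>2/2"
proof -
 have "((norm (x - y))\<^sup>2 - (hz x - hz y)\<^sup>2)/2\<le>(norm (x - y))\<^sup>2/2"
  by (simp add: divide_right_mono)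
 then show ?thesis unfolding hB_minus_1[symmetric] by simp
qed

text \<open>Both summands on the right are nonnegative, the second by Cauchy-Schwarz. This yields
  the reversed Cauchy-Schwarz inequality \<open>hB_ge_1\<close> and its equality case.\<close>

lemma hB_aux: "(hz x*hz y)\<^sup>2 - (1 + x \<bullet> y)\<^sup>2 = (norm (x - y))\<^sup>2 + ((x \<bullet> x) * (y \<bullet> y) - (x \<bullet> y)\<^sup>2)"
proof -
 have "(norm (x - y))\<^sup>2 = x \<bullet> x + y \<bullet> y - 2*(x \<bullet> y)"
  by (simp add: power2_norm_eq_inner inner_diff inner_commute)
 moreover have "(hz x*hz y)\<^sup>2 = (1 + x \<bullet> x) * (1 + y \<bullet> y)"
  by (simp only: power_mult_distrib hz_power2)
 ultimately show ?thesis
  by (simp add: algebra_simps power2_eq_square)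
qed

lemma hB_ge_1: "1\<le>hB x y"
proof -
 have "(1 + x \<bullet> y)\<^sup>2\<le>(hz x*hz y)\<^sup>2"
  using hB_aux[of x y] Cauchy_Schwarz_ineq[of x y] by (smt (verit) zero_le_power2)
 then have "1 + x \<bullet> y\<le>hz x*hz y"
  by (meson less_eq_real_def mult_pos_pos hz_pos power2_le_imp_le)
 then show ?thesis unfolding hB_def by simp
qed

lemma hB_self [simp]: "hB x x = 1"
 unfolding hB_def by (simp add: hz_square)

lemma hB_eq_1_iff: "hB x y = 1 \<longleftrightarrow> x = y"
proof
 assume "hB x y = 1"
 then have "hz x*hz y = 1 + x \<bullet> y" unfolding hB_def by simp
 then have "(norm (x - y))\<^sup>2\<le>0"
 by (smt (verit, ccfv_threshold) Cauchy_Schwarz_ineq hB_aux)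
 then show "x = y" by simp
qed simp

lemma hzd_power2_le: "(hzd x v)\<^sup>2*(1 + x \<bullet> x)\<le>(x \<bullet> x) * (v \<bullet> v)"
 using Cauchy_Schwarz_ineq[of x v] unfolding hzd_def
 by (simp add: power_divide hz_power2 add_nonneg_eq_0_iff)

lemma gH_le: "gH x v v\<le>v \<bullet> v"
 unfolding gH_def by simp

text \<open>Together with \<open>gH_le\<close> this compares the hyperbolic and the Euclidean
  metric, with a constant that depends only on the distance from the origin. Positive definiteness
  follows.\<close>

lemma gH_ge: "v \<bullet> v\<le>(1 + x \<bullet> x) * gH x v v"
 using hzd_power2_le[of x v] unfolding gH_def
 by (simp add: algebra_simps power2_eq_square)

lemma gH_nonneg: "0\<le>gH x v v"
 using gH_ge[of v x] by (smt (verit, best) inner_ge_zero mult_nonneg_nonneg zero_less_mult_pos mult_neg_pos mult_less_0_iff)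

lemma gH_eq_0_iff: "gH x v v = 0 \<longleftrightarrow> v = 0"
 using gH_ge[of v x] gH_le[of x v] by (metis inner_eq_zero_iff inner_ge_zero mult_zero_right order_antisym gH_nonneg)

lemma gH_0 [simp]: "gH 0 v w = v \<bullet> w"
 unfolding gH_def hzd_def by simp

section \<open>Isometries\<close>

text \<open>The Lorentz boost that takes the origin to \<open>y\<close>, read in space components.
  \<open>dhtr\<close> applies the same linear map of Minkowski space to the tangent vector with time
  component \<open>hzd x v\<close>.\<close>

definition htr :: "'a::real_inner => 'a => 'a" where
 "htr y x = x + ((x \<bullet> y)/(1 + hz y) + hz x) *\<^sub>R y"

definition dhtr :: "'a::real_inner => 'a => 'a => 'a" where
 "dhtr y x v = v + ((v \<bullet> y)/(1 + hz y) + hzd x v) *\<^sub>R y"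

text \<open>Invariance of the Lorentz product for arbitrary pairs of time and space components, on
  or off the hyperboloid. One identity thus serves for points, for tangent vectors and for the
  product of a point with a tangent vector.\<close>

lemma boost_form:
 fixes y u u' :: "'a::real_inner" and d d' :: real
 shows "(d*hz y + u \<bullet> y) * (d' * hz y + u' \<bullet> y)
   - (u + ((u \<bullet> y)/(1 + hz y) + d) *\<^sub>R y) \<bullet> (u' + ((u' \<bullet> y)/(1 + hz y) + d') *\<^sub>R y)
   = d*d' - u \<bullet> u'"
proof -
 define c a a' where "c = hz y" and "a = u \<bullet> y" and "a' = u' \<bullet> y"
 have c: "1 + c\<noteq>0" using hz_pos[of y] unfolding c_def by linarith
 have yy: "y \<bullet> y = (c - 1)*(c + 1)"
  using hz_square[of y] unfolding c_def by (simp add: algebra_simps)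
 have "(u + (a/(1 + c) + d) *\<^sub>R y) \<bullet> (u' + (a'/(1 + c) + d') *\<^sub>R y)
   = u \<bullet> u' + (a'/(1 + c) + d')*a + (a/(1 + c) + d) * a'
    + (a/(1 + c) + d) * (a'/(1 + c) + d')*((c - 1)*(c + 1))"
  unfolding yy[symmetric] by (simp add: inner_add a_def a'_def inner_commute algebra_simps)
 also have "\<dots> = u \<bullet> u' + (d*c + a) * (d' * c + a') - d*d'"
 proof -
  define p p' where "p = a/(1 + c)" and "p' = a'/(1 + c)"
  have "a = p*(1 + c)" "a' = p' * (1 + c)" unfolding p_def p'_def using c by auto
  then show ?thesis unfolding p_def[symmetric] p'_def[symmetric]
   by (simp add: algebra_simps)
 qed
 finally show ?thesis unfolding c_def a_def a'_def by simp
qed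

lemma hz_htr: "hz (htr y x) = hz x*hz y + x \<bullet> y"
proof -
 have "(hz x*hz y + x \<bullet> y) * (hz x*hz y + x \<bullet> y) - htr y x \<bullet> htr y x = hz x*hz x - x \<bullet> x"
  unfolding htr_def by (rule boost_form)
 then have "(hz x*hz y + x \<bullet> y)\<^sup>2 = (hz (htr y x))\<^sup>2"
  by (simp add: hz_power2 hz_square power2_eq_square[of "hz x*hz y + x \<bullet> y"])
 moreover have "0\<le>hz x*hz y + x \<bullet> y"
  using hB_ge_1[of x "- y"] unfolding hB_def by simp
 ultimately show ?thesis
  by (metis hz_pos less_eq_real_def power2_eq_iff_nonneg)
qed

lemma hB_htr: "hB (htr y x) (htr y x') = hB x x'"
 unfolding hB_def hz_htr unfolding htr_def by (rule boost_form)

lemma htr_at_0 [simp]: "htr y 0 = y"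
 unfolding htr_def by simp

lemma htr_minus_right [simp]: "htr y (htr (- y) x) = x"
proof -
 define c a d where "c = hz y" and "a = x \<bullet> y" and "d = hz x"
 have c: "1 + c\<noteq>0" using hz_pos[of y] unfolding c_def by linarith
 have yy: "y \<bullet> y = (c - 1)*(c + 1)"
  using hz_square[of y] unfolding c_def by (simp add: algebra_simps)
 define p where "p = a/(1 + c)"
 have a: "a = p*(1 + c)" using c unfolding p_def by auto
 have z: "htr (- y) x = x + (p - d) *\<^sub>R y"
  unfolding htr_def p_def a_def c_def d_def by (simp add: algebra_simps)
 have hz: "hz (htr (- y) x) = d*c - a"
  unfolding hz_htr a_def c_def d_def by simp
 have "htr (- y) x \<bullet> y = (a + (p - d) * (c - 1)* (c + 1))"
  unfolding z a_def by (simp add: inner_add yy)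
 also have "\<dots> = (p*c - d*(c - 1))*(1 + c)" unfolding a by (simp add: algebra_simps)
 finally have "(htr (- y) x \<bullet> y)/(1 + c) = p*c - d*(c - 1)" using c by simp
 then have "htr y (htr (- y) x) = htr (- y) x + (p*c - d*(c - 1) + (d*c - a)) *\<^sub>R y"
  by (simp add: htr_def[of y "htr (-y) x"] hz c_def[symmetric])
 also have "\<dots> = x + (p - d) *\<^sub>R y + (p*c - d*(c - 1) + (d*c - a)) *\<^sub>R y"
  unfolding z ..
 also have "p*c - d*(c - 1) + (d*c - a) = d - p"
  unfolding a by (simp add: algebra_simps)
 also have "x + (p - d) *\<^sub>R y + (d - p) *\<^sub>R y = x" by (simp add: scaleR_diff_left)
 finally show ?thesis .
qed

lemma htr_minus_left [simp]: "htr (- y) (htr y x) = x"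
 using htr_minus_right[of "- y" x] by simp

lemma hzd_dhtr: "hzd (htr y x) (dhtr y x v) = hzd x v * hz y + v \<bullet> y"
proof -
 have "hz (htr y x) * (hzd x v * hz y + v \<bullet> y) - htr y x \<bullet> dhtr y x v = hz x*hzd x v - x \<bullet> v"
  unfolding hz_htr unfolding htr_def dhtr_def by (rule boost_form)
 then have "htr y x \<bullet> dhtr y x v = hz (htr y x) * (hzd x v * hz y + v \<bullet> y)"
  by (simp add: hzd_mult)
 then show ?thesis unfolding hzd_def[of "htr y x"] by simp
qed

lemma gH_dhtr: "gH (htr y x) (dhtr y x v) (dhtr y x w) = gH x v w"
proof -
 have "hzd (htr y x) (dhtr y x v) * hzd (htr y x) (dhtr y x w) - dhtr y x v \<bullet> dhtr y x w
   = hzd x v * hzd x w - v \<bullet> w"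
  unfolding hzd_dhtr unfolding dhtr_def by (rule boost_form)
 then show ?thesis unfolding gH_def by simp
qed

lemma htr_has_derivative: "(htr y has_derivative dhtr y x) (at x within S)"
 unfolding htr_def[abs_def] dhtr_def[abs_def]
 by (auto intro!: derivative_eq_intros hz_has_derivative simp: divide_inverse algebra_simps)

lemma continuous_on_hzd: "continuous_on S (\<lambda>x. hzd x v)"
 unfolding hzd_def by (intro continuous_intros) auto

lemma continuous_on_dhtr: "continuous_on S (\<lambda>x. dhtr y x v)"
 unfolding dhtr_def by (intro continuous_intros continuous_on_hzd)

text \<open>Only the preservation of distances is required; \<open>hiso_cases\<close> recovers the
  form boost after rotation.\<close>

definition hiso :: "('a::euclidean_space => 'a) => bool" where
 "hiso k \<longleftrightarrow> surj k \<and> (\<forall>x y. hB (k x) (k y) = hB x y)"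

lemma hiso_hB: "hiso k ==> hB (k x) (k y) = hB x y"
 unfolding hiso_def by simp

lemma hiso_inj: "hiso k ==> inj k"
 unfolding hiso_def inj_def by (metis hB_eq_1_iff)

lemma hiso_bij: "hiso k ==> bij k"
 by (simp add: bij_def hiso_inj hiso_def)

lemma hiso_htr: "hiso (htr y)"
 unfolding hiso_def using hB_htr htr_minus_right by (metis surjI)

lemma hiso_id: "hiso (\<lambda>x. x)"
 unfolding hiso_def by auto

lemma hiso_comp: "hiso k ==> hiso l ==> hiso (k \<circ> l)"
 unfolding hiso_def by (metis comp_surj comp_apply)

lemma hiso_inv: "hiso k ==> hiso (inv k)"
by (smt (verit) hiso_bij hiso_def hiso_inj inj_iff inv_inv_eq surj_f_inv_f surj_iff)

lemma hiso_orth: "orthogonal_transformation A ==> hiso A"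
 unfolding hiso_def hB_def hz_def
 by (auto simp: orthogonal_transformation_surj orthogonal_transformation_def)

lemma hiso_fix0_orth:
 assumes k: "hiso k" and "k 0 = 0"
 shows "orthogonal_transformation k"
proof -
 have hz: "hz (k x) = hz x" for x using hiso_hB[OF k, of 0 x] assms by simp
 have dot: "k x \<bullet> k y = x \<bullet> y" for x y
  using hiso_hB[OF k, of x y] unfolding hB_def hz by simp
 have "dist (k x) (k y) = dist x y" for x y
  unfolding dist_norm norm_eq_sqrt_inner by (simp add: inner_diff dot)
 then show ?thesis using assms by (simp add: orthogonal_transformation_isometry)
qed

lemma hiso_cases:
 assumes "hiso k"
 obtains A where "orthogonal_transformation A" "k = htr (k 0) \<circ> A"
proof
 show "orthogonal_transformation (htr (- k 0) \<circ> k)"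
 by (metis assms comp_eq_dest_lhs hiso_comp hiso_fix0_orth hiso_htr htr_at_0 htr_minus_left)
 show "k = htr (k 0) \<circ> (htr (- k 0) \<circ> k)" by (rule ext) simp
qed

text \<open>The curve runs in a plane of Minkowski space and stays on the hyperboloid, so its time
  component is the same combination of time components. Comparing squares leaves a sign open, which
  is settled by the bound of \<open>hzd h w\<close> by \<open>hz h\<close>.\<close>

lemma geodesic_hz:
 assumes "gH h w w = 1"
 shows "hz (cosh t *\<^sub>R h + sinh t *\<^sub>R w) = cosh t*hz h + sinh t*hzd h w"
proof -
 have ww: "w \<bullet> w = 1 + (hzd h w)\<^sup>2" using assms unfolding gH_def by (simp add: power2_eq_square)
 have "(hzd h w)\<^sup>2*(1 + h \<bullet> h)\<le>(h \<bullet> h) * (1 + (hzd h w)\<^sup>2)"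
  using hzd_power2_le[of h w] unfolding ww .
 then have "(hzd h w)\<^sup>2\<le>h \<bullet> h" by (simp add: algebra_simps)
 then have "\<bar>hzd h w\<bar>\<^sup>2 < (hz h)\<^sup>2" by (simp add: hz_power2)
 then have lt: "\<bar>hzd h w\<bar> < hz h" by (rule power2_less_imp_less) (simp add: less_imp_le)
 have c: "\<bar>sinh t\<bar>\<le>cosh t" "0 < cosh t"
  using cosh_square_eq[of t] by (auto intro: power2_le_imp_le)
 have "\<bar>sinh t*hzd h w\<bar>\<le>cosh t*hz h"
  unfolding abs_mult using c lt by (intro mult_mono) auto
 then have pos: "0\<le>cosh t*hz h + sinh t*hzd h w" by linarith
 have "(cosh t*hz h + sinh t*hzd h w)\<^sup>2
   = (cosh t)\<^sup>2*(hz h)\<^sup>2 + (sinh t)\<^sup>2*(hzd h w)\<^sup>2 + 2*cosh t * sinh t*(hz h*hzd h w)"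
  by (simp add: power2_eq_square algebra_simps)
 also have "\<dots> = (cosh t)\<^sup>2*(1 + h \<bullet> h) + (sinh t)\<^sup>2*(w \<bullet> w - 1) + 2*cosh t * sinh t*(h \<bullet> w)"
  by (simp add: hz_power2 hzd_mult ww)
 also have "\<dots> = 1 + ((cosh t)\<^sup>2*(h \<bullet> h) + (sinh t)\<^sup>2*(w \<bullet> w) + 2*cosh t * sinh t*(h \<bullet> w))"
  using cosh_square_eq[of t] by (simp add: algebra_simps)
 also have "(cosh t)\<^sup>2*(h \<bullet> h) + (sinh t)\<^sup>2*(w \<bullet> w) + 2*cosh t * sinh t*(h \<bullet> w)
   = (cosh t *\<^sub>R h + sinh t *\<^sub>R w) \<bullet> (cosh t *\<^sub>R h + sinh t *\<^sub>R w)"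
  by (simp add: inner_add inner_commute power2_eq_square algebra_simps)
 finally have "(cosh t*hz h + sinh t*hzd h w)\<^sup>2 = (hz (cosh t *\<^sub>R h + sinh t *\<^sub>R w))\<^sup>2"
  by (simp add: hz_power2)
 then show ?thesis using pos hz_pos[of "cosh t *\<^sub>R h + sinh t *\<^sub>R w"]
  by (metis less_eq_real_def power2_eq_iff_nonneg)
qed

lemma htr_geodesic:
 assumes "gH h w w = 1"
 shows "htr y (cosh t *\<^sub>R h + sinh t *\<^sub>R w) = cosh t *\<^sub>R htr y h + sinh t *\<^sub>R dhtr y h w"
 unfolding htr_def dhtr_def geodesic_hz[OF assms]
 by (simp add: inner_add add_divide_distrib algebra_simps)

text \<open>By \<open>hiso_cases\<close> an isometry is the restriction of a linear map of Minkowski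
  space. This is why it is differentiable and why it respects the formula for geodesics.\<close>

lemma hiso_deriv:
 assumes "hiso k"
 obtains k' where "\<And>x S. (k has_derivative k' x) (at x within S)" "\<And>v. continuous_on UNIV (\<lambda>x. k' x v)"
  "\<And>x v w. gH (k x) (k' x v) (k' x w) = gH x v w"
  "\<And>h w t. gH h w w = 1 ==> k (cosh t *\<^sub>R h + sinh t *\<^sub>R w) = cosh t *\<^sub>R k h + sinh t *\<^sub>R k' h w"
proof -
 obtain A where A: "orthogonal_transformation A" and k: "k = htr (k 0) \<circ> A"
  using hiso_cases[OF assms] by blast
 define y where "y = k 0"
 have ky: "k = htr y \<circ> A" using k unfolding y_def .
 have lin: "linear A" and dot: "A v \<bullet> A w = v \<bullet> w" for v w
  using A unfolding orthogonal_transformation_def by auto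
 have bl: "bounded_linear A" using lin by (simp add: linear_conv_bounded_linear)
 have hzA: "hz (A x) = hz x" for x unfolding hz_def dot ..
 have hzdA: "hzd (A x) (A v) = hzd x v" for x v unfolding hzd_def hzA dot ..
 have gHA: "gH (A x) (A v) (A w) = gH x v w" for x v w unfolding gH_def hzdA dot ..
 show ?thesis
 proof (rule that[of "\<lambda>x v. dhtr y (A x) (A v)"])
  fix x S
  have "((\<lambda>x. htr y (A x)) has_derivative (\<lambda>v. dhtr y (A x) (A v))) (at x within S)"
   by (rule has_derivative_compose[OF bounded_linear.has_derivative[OF bl has_derivative_ident]
      htr_has_derivative])
  then show "(k has_derivative (\<lambda>v. dhtr y (A x) (A v))) (at x within S)" unfolding ky comp_def .
 next
  fix v show "continuous_on UNIV (\<lambda>x. dhtr y (A x) (A v))"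
   by (rule continuous_on_compose2[OF continuous_on_dhtr[of UNIV] linear_continuous_on[OF bl]]) auto
 next
  fix x v w show "gH (k x) (dhtr y (A x) (A v)) (dhtr y (A x) (A w)) = gH x v w"
   unfolding ky comp_def gH_dhtr gHA ..
 next
  fix h w :: 'a and t assume "gH h w w = 1"
  then have "gH (A h) (A w) (A w) = 1" by (simp add: gHA)
  then show "k (cosh t *\<^sub>R h + sinh t *\<^sub>R w) = cosh t *\<^sub>R k h + sinh t *\<^sub>R dhtr y (A h) (A w)"
   unfolding ky comp_def by (simp add: linear_add[OF lin] linear_scale[OF lin] htr_geodesic)
 qed
qed

lemma hiso_continuous_on: "hiso k ==> continuous_on S k"
 by (metis hiso_deriv has_derivative_continuous_on)

lemma hiso_open_image:
 assumes "hiso k" "open W" shows "open (k ` W)"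
proof -
 have "k ` W = inv k -` W"
  using bij_vimage_eq_inv_image[OF bij_imp_bij_inv[OF hiso_bij[OF assms(1)]], of W]
   inv_inv_eq[OF hiso_bij[OF assms(1)]] by simp
 then show ?thesis using hiso_continuous_on[OF hiso_inv[OF assms(1)], of UNIV] assms(2)
  by (simp add: open_vimage)
qed

text \<open>After a boost that moves a point of \<open>W\<close> to the origin, the value at the
  origin fixes the time component, and the values at small multiples of the basis vectors fix the
  space components.\<close>

lemma hB_determines:
 fixes a b :: "'a::euclidean_space"
 assumes "open W" "W\<noteq>{}" and eq: "\<And>y. y\<in>W ==> hB a y = hB b y"
 shows "a = b"
proof -
 obtain w where w: "w\<in>W" using assms by auto
 define W' where "W' = htr w -` W"
 have oW: "open W'" unfolding W'_def
  using assms(1) hiso_continuous_on[OF hiso_htr, of UNIV w] by (simp add: open_vimage)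
 have 0: "0\<in>W'" unfolding W'_def using w by simp
 define a' b' where "a' = htr (- w) a" and "b' = htr (- w) b"
 have eq': "hB a' y = hB b' y" if "y\<in>W'" for y
  using eq[of "htr w y"] that hB_htr[of w a' y] hB_htr[of w b' y]
  unfolding W'_def a'_def b'_def by simp
 have hz: "hz a' = hz b'" using eq'[OF 0] by simp
 have dot: "a' \<bullet> y = b' \<bullet> y" if "y\<in>W'" for y
  using eq'[OF that] unfolding hB_def hz by simp
 obtain e where e: "e > 0" "ball 0 e\<subseteq>W'" using oW 0 open_contains_ball by blast
 have "a' = b'"
 proof (rule euclidean_eqI)
  fix i :: 'a assume i: "i\<in>Basis"
  have "(e/2) *\<^sub>R i\<in>W'" using e i by (auto intro!: subsetD[OF e(2)])
  from dot[OF this] show "a' \<bullet> i = b' \<bullet> i" using e by simp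
 qed
 then show ?thesis unfolding a'_def b'_def by (metis htr_minus_right)
qed

lemma hiso_eqI:
 assumes k: "hiso k" and l: "hiso l" and "open W" "W\<noteq>{}" and eq: "\<And>y. y\<in>W ==> k y = l y"
 shows "k = l"
proof
 fix x
 define m where "m = inv l \<circ> k"
 have m: "hiso m" unfolding m_def by (intro hiso_comp hiso_inv k l)
 have "hB (m x) y = hB x y" if "y\<in>W" for y
 proof -
  have "m y = y" unfolding m_def using eq[OF that] hiso_inj[OF l] by simp
  then show ?thesis using hiso_hB[OF m, of x y] by simp
 qed
 then have "m x = x" using hB_determines assms(3,4) by blast
 then show "k x = l x" unfolding m_def using l unfolding hiso_def
  by (metis comp_apply surj_f_inv_f)
qed

text \<open>The images of the points \<open>r *\<^sub>R i\<close>, scaled back by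
  \<open>1/r\<close>, are orthonormal, and \<open>\<psi> x\<close> is determined by its inner
  products with them, which equal the coordinates of \<open>x\<close>.\<close>

lemma hB_local_isometry_extends_0:
 fixes \<psi> :: "'a::euclidean_space => 'a"
 assumes W: "open W" "0\<in>W" and \<psi>: "\<And>x y. x\<in>W ==> y\<in>W ==> hB (\<psi> x) (\<psi> y) = hB x y" and "\<psi> 0 = 0"
 shows "\<exists>A. orthogonal_transformation A \<and> (\<forall>x\<in>W. \<psi> x = A x)"
proof -
 have hz: "hz (\<psi> x) = hz x" if "x\<in>W" for x using \<psi>[OF W(2) that] assms by simp
 have dot: "\<psi> x \<bullet> \<psi> y = x \<bullet> y" if "x\<in>W" "y\<in>W" for x y
  using \<psi>[OF that] hz that unfolding hB_def by simp
 obtain e where e: "e > 0" "ball 0 e\<subseteq>W" using W open_contains_ball by blast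
 define r where "r = e/2"
 have r: "r > 0" "r *\<^sub>R i\<in>W" if "i\<in>Basis" for i :: 'a
  using e that by (auto intro!: subsetD[OF e(2)] simp: r_def)
 define a where "a i = (1/r) *\<^sub>R \<psi> (r *\<^sub>R i)" for i :: 'a
 have rpos: "r > 0" using e by (simp add: r_def)
 have aa: "a i \<bullet> a j = i \<bullet> j" if "i\<in>Basis" "j\<in>Basis" for i j
  unfolding a_def using dot[OF r(2)[OF that(1)] r(2)[OF that(2)]] rpos by simp
 have xa: "\<psi> x \<bullet> a i = x \<bullet> i" if "x\<in>W" "i\<in>Basis" for x i
  unfolding a_def using dot[OF that(1) r(2)[OF that(2)]] rpos by simp
 define A where "A x = (\<Sum>i\<in>Basis. (x \<bullet> i) *\<^sub>R a i)" for x
 have lin: "linear A" unfolding A_def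
  by (intro linearI) (auto simp: inner_add scaleR_add_left sum.distrib scaleR_sum_right)
 have dotA: "A v \<bullet> A w = v \<bullet> w" for v w
 proof -
  have "A v \<bullet> A w = (\<Sum>i\<in>Basis. \<Sum>j\<in>Basis. (v \<bullet> i) * (w \<bullet> j) * (a i \<bullet> a j))"
   unfolding A_def by (simp add: inner_sum_left inner_sum_right sum_distrib_left mult_ac) (rule sum.swap)
  also have "\<dots> = (\<Sum>i\<in>Basis. \<Sum>j\<in>Basis. (v \<bullet> i) * (w \<bullet> j) * (if i = j then 1 else 0))"
   by (intro sum.cong refl) (auto simp: aa inner_Basis)
  also have "\<dots> = v \<bullet> w" by (simp add: euclidean_inner[of v w] if_distrib sum.delta cong: if_cong)
  finally show ?thesis .
 qed
 have "\<psi> x = A x" if x: "x\<in>W" for x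
 proof -
  have "\<psi> x \<bullet> A x = x \<bullet> x"
   unfolding A_def by (simp add: inner_sum_right xa[OF x] euclidean_inner[of x x])
  then have "(\<psi> x - A x) \<bullet> (\<psi> x - A x) = 0"
   by (simp add: inner_diff inner_commute dot[OF x x] dotA)
  then show ?thesis by simp
 qed
 then show ?thesis using lin dotA unfolding orthogonal_transformation_def by blast
qed

lemma hB_local_isometry_extends:
 fixes \<psi> :: "'a::euclidean_space => 'a"
 assumes W: "open W" "W\<noteq>{}" and \<psi>: "\<And>x y. x\<in>W ==> y\<in>W ==> hB (\<psi> x) (\<psi> y) = hB x y"
 shows "\<exists>k. hiso k \<and> (\<forall>x\<in>W. \<psi> x = k x)"
proof -
 obtain w where w: "w\<in>W" using assms by auto
 define W' where "W' = htr w -` W"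
 have oW: "open W'" unfolding W'_def
  using assms(1) hiso_continuous_on[OF hiso_htr, of UNIV w] by (simp add: open_vimage)
 have 0: "0\<in>W'" unfolding W'_def using w by simp
 define \<psi>' where "\<psi>' = htr (- \<psi> w) \<circ> \<psi> \<circ> htr w"
 have "\<exists>A. orthogonal_transformation A \<and> (\<forall>x\<in>W'. \<psi>' x = A x)"
 proof (rule hB_local_isometry_extends_0[OF oW 0])
  fix x y assume "x\<in>W'" "y\<in>W'"
  then show "hB (\<psi>' x) (\<psi>' y) = hB x y"
   unfolding \<psi>'_def W'_def by (simp add: hB_htr \<psi>)
 next
  show "\<psi>' 0 = 0" unfolding \<psi>'_def using htr_minus_left[of "\<psi> w" 0] by simp
 qed
 then obtain A where A: "orthogonal_transformation A" "\<And>x. x\<in>W' ==> \<psi>' x = A x" by auto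
 define k where "k = htr (\<psi> w) \<circ> (A \<circ> htr (- w))"
 have "hiso k" unfolding k_def by (intro hiso_comp hiso_htr hiso_orth A)
 moreover have "\<psi> x = k x" if "x\<in>W" for x
 proof -
  have "htr (- w) x\<in>W'" unfolding W'_def using that by simp
  from A(2)[OF this] show ?thesis unfolding k_def \<psi>'_def comp_def
   by (metis htr_minus_right)
 qed
 ultimately show ?thesis by blast
qed

section \<open>Infinitesimal isometries\<close>

text \<open>On the left is the square of the derivative of \<open>hB p\<close> at \<open>c\<close>
  in direction \<open>v\<close>, so the claim is that cosh of the distance has a gradient of norm at
  most sinh of the distance. A boost that takes \<open>c\<close> to the origin reduces it to the
  Euclidean Cauchy-Schwarz inequality.\<close>

lemma lorentz_Cauchy_Schwarz:
 "(hz p*hzd c v - p \<bullet> v)\<^sup>2\<le>((hB p c)\<^sup>2 - 1)*gH c v v"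
proof -
 define p' v' where "p' = htr (- c) p" and "v' = dhtr (- c) c v"
 have c0: "htr (- c) c = 0" using htr_minus_left[of c 0] by simp
 have hz: "hz p' = hB p c" unfolding p'_def hz_htr hB_def by simp
 have "hzd (htr (-c) c) v' = hzd c v * hz c + v \<bullet> (- c)"
  unfolding v'_def hzd_dhtr by simp
 then have "hz p*hzd c v - p \<bullet> v = - (p' \<bullet> v')"
  using boost_form[of "hz p" "- c" p "hzd c v" v]
  unfolding c0 p'_def v'_def htr_def[symmetric] dhtr_def[symmetric]
  by (simp add: hzd_def)
 then have "(hz p*hzd c v - p \<bullet> v)\<^sup>2 = (p' \<bullet> v')\<^sup>2" by simp
 also have "\<dots>\<le>(p' \<bullet> p')*(v' \<bullet> v')" by (rule Cauchy_Schwarz_ineq)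
 also have "v' \<bullet> v' = gH c v v"
  using gH_dhtr[of "- c" c v v] unfolding c0 v'_def by simp
 also have "p' \<bullet> p' = (hB p c)\<^sup>2 - 1" using hz_power2[of p'] unfolding hz by simp
 finally show ?thesis .
qed

text \<open>The distance \<open>arcosh (\<beta> t)\<close> grows at speed at most 1, but arcosh is
  not differentiable at 1. Hence the mean value theorem is applied after the last time
  \<open>s\<close> with \<open>\<beta> s = 1\<close>.\<close>

lemma cosh_comparison:
 fixes \<beta> \<beta>' :: "real => real"
 assumes T: "0\<le>T" and b0: "\<beta> 0 = 1" and ge: "\<And>t. t\<in>{0..T} ==> 1\<le>\<beta> t"
  and der: "\<And>t. t\<in>{0..T} ==> (\<beta> has_real_derivative \<beta>' t) (at t within {0..T})"
  and le: "\<And>t. t\<in>{0..T} ==> (\<beta>' t)\<^sup>2\<le>(\<beta> t)\<^sup>2 - 1"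
 shows "\<beta> T\<le>cosh T"
proof (cases "\<beta> T = 1")
 case True then show ?thesis using cosh_real_ge_1[of T] by simp
next
 case False
 have cont: "continuous_on {0..T} \<beta>" using der by (rule DERIV_continuous_on)
 define Z where "Z = {t\<in>{0..T}. \<beta> t = 1}"
 have "closed Z" unfolding Z_def by (rule continuous_closed_preimage_constant[OF cont]) auto
 moreover have "bounded Z" unfolding Z_def by (rule bounded_subset[OF bounded_closed_interval[of 0 T]]) auto
 ultimately have cZ: "compact Z" by (simp add: compact_eq_bounded_closed)
 have "0\<in>Z" unfolding Z_def using T b0 by auto
 then obtain s where s: "s\<in>Z" "\<And>t. t\<in>Z ==> t\<le>s"
  using compact_attains_sup[OF cZ] by auto
 have s0: "0\<le>s" "s\<le>T" "\<beta> s = 1" using s(1) unfolding Z_def by auto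
 have sT: "s < T" using False s0 by (metis order_le_less)
 have gt: "1 < \<beta> t" if "s < t" "t\<le>T" for t
  using s(2)[of t] that ge[of t] s0 unfolding Z_def by fastforce
 have cont': "continuous_on {s..T} (\<lambda>t. arcosh (\<beta> t))"
  by (intro continuous_on_arcosh' continuous_on_subset[OF cont]) (use s0 ge in auto)
 have "arcosh (\<beta> T) - arcosh (\<beta> s)\<le>T - s"
 proof -
  have der': "((\<lambda>t. arcosh (\<beta> t)) has_derivative (\<lambda>h. \<beta>' x/sqrt ((\<beta> x)\<^sup>2 - 1)*h)) (at x)"
   if "s < x" "x < T" for x
  proof -
   have "x\<in>interior {0..T}" using that s0 by (auto simp: interior_atLeastAtMost_real)
   then have "(\<beta> has_real_derivative \<beta>' x) (at x)"
    using der[of x] at_within_interior[of x "{0..T}"] that s0 by auto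
   then have "((\<lambda>t. arcosh (\<beta> t)) has_real_derivative (1/sqrt ((\<beta> x)\<^sup>2 - 1)) * \<beta>' x) (at x)"
    using DERIV_chain2[where f = arcosh and g = \<beta> and x = x, OF arcosh_real_has_field_derivative] gt that
    by auto
   then show ?thesis unfolding has_field_derivative_def
    by (rule has_derivative_eq_rhs) (simp add: fun_eq_iff)
  qed
  obtain z where z: "s < z" "z < T"
   "arcosh (\<beta> T) - arcosh (\<beta> s) = \<beta>' z/sqrt ((\<beta> z)\<^sup>2 - 1)*(T - s)"
   using mvt[OF sT cont' der'] by blast
  have p: "0 < (\<beta> z)\<^sup>2 - 1" using gt[of z] z by simp
  have "\<beta>' z\<le>sqrt ((\<beta> z)\<^sup>2 - 1)"
   using le[of z] z s0 by (intro real_le_rsqrt) auto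
  then have "\<beta>' z/sqrt ((\<beta> z)\<^sup>2 - 1)\<le>1" using p by simp
  then show ?thesis unfolding z(3) using sT by (simp add: mult_left_le_one_le mult_right_le_one_le
    mult_right_mono[of "\<beta>' z/sqrt ((\<beta> z)\<^sup>2 - 1)" 1 "T - s", simplified])
 qed
 then have "arcosh (\<beta> T)\<le>T" using s0 by simp
 moreover have "1\<le>\<beta> T" using ge T by auto
 ultimately have "cosh (arcosh (\<beta> T))\<le>cosh T"
  using T by (subst cosh_real_nonneg_le_iff) auto
 then show ?thesis using \<open>1\<le>\<beta> T\<close> by simp
qed

text \<open>The last clause is the convexity of hyperbolic balls, which keeps geodesics inside the
  domain of a locally defined map.\<close>

lemma geodesic_between:
 fixes x y :: "'a::real_inner"
 assumes "x\<noteq>y"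
 obtains T w where "0 < T" "cosh T = hB x y" "gH x w w = 1" "y = cosh T *\<^sub>R x + sinh T *\<^sub>R w"
  "\<And>z t. t\<in>{0..T} ==> hB z (cosh t *\<^sub>R x + sinh t *\<^sub>R w)\<le>max (hB z x) (hB z y)"
proof -
 define T where "T = arcosh (hB x y)"
 have T: "0 < T" "cosh T = hB x y"
  using hB_ge_1[of x y] hB_eq_1_iff[of x y] assms unfolding T_def by auto
 have sT: "0 < sinh T" using T by simp
 define w where "w = (1/sinh T) *\<^sub>R (y - cosh T *\<^sub>R x)"
 have y: "y = cosh T *\<^sub>R x + sinh T *\<^sub>R w" unfolding w_def using sT by simp
 have xy: "x \<bullet> y = hz x*hz y - cosh T" unfolding T(2) hB_def by simp
 have "x \<bullet> w = (x \<bullet> y - cosh T*(x \<bullet> x))/sinh T"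
  unfolding w_def by (simp add: inner_diff_right)
 also have "x \<bullet> y - cosh T*(x \<bullet> x) = hz x*(hz y - cosh T*hz x)"
 proof -
  have "cosh T*(x \<bullet> x) = hz x*hz x*cosh T - cosh T" unfolding hz_square by (simp add: algebra_simps)
  then show ?thesis unfolding xy by (simp add: algebra_simps)
 qed
 finally have hzd: "hzd x w = (hz y - cosh T*hz x)/sinh T" unfolding hzd_def by simp
 have "gH x w w*(sinh T)\<^sup>2 = (y - cosh T *\<^sub>R x) \<bullet> (y - cosh T *\<^sub>R x) - (hz y - cosh T*hz x)\<^sup>2"
 proof -
  have "w \<bullet> w*(sinh T)\<^sup>2 = (sinh T *\<^sub>R w) \<bullet> (sinh T *\<^sub>R w)" by (simp add: power2_eq_square)
  also have "sinh T *\<^sub>R w = y - cosh T *\<^sub>R x" unfolding w_def using sT by simp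
  finally have "w \<bullet> w*(sinh T)\<^sup>2 = (y - cosh T *\<^sub>R x) \<bullet> (y - cosh T *\<^sub>R x)" .
  then show ?thesis unfolding gH_def hzd using sT
   by (simp add: left_diff_distrib power_divide flip: power2_eq_square)
 qed
 also have "\<dots> = y \<bullet> y - 2*cosh T*(x \<bullet> y) + (cosh T)\<^sup>2*(x \<bullet> x) - (hz y)\<^sup>2 + 2*cosh T*(hz x*hz y) - (cosh T)\<^sup>2*(hz x)\<^sup>2"
  by (simp add: inner_diff inner_commute power2_eq_square algebra_simps)
 also have "\<dots> = (sinh T)\<^sup>2" unfolding xy hz_power2
  using cosh_square_eq[of T] by (simp add: algebra_simps power2_eq_square)
 finally have gw: "gH x w w = 1" using sT by simp
 have bound: "hB z (cosh t *\<^sub>R x + sinh t *\<^sub>R w)\<le>max (hB z x) (hB z y)" if t: "t\<in>{0..T}" for z t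
 proof -
  \<comment> \<open>In Minkowski space the point at time \<open>t\<close> is \<open>a\<close> times
    the point over \<open>x\<close> plus \<open>b\<close> times the point over \<open>y\<close>, by
    the addition theorem of sinh. The product with \<open>z\<close> is linear in it, and
    \<open>a + b \<le> 1\<close>.\<close>
  define a b where "a = sinh (T - t)/sinh T" and "b = sinh t/sinh T"
  have ab: "0\<le>a" "0\<le>b" unfolding a_def b_def using t sT by auto
  have "sinh (T - t) + sinh t\<le>sinh T"
  proof -
   have "sinh T = sinh ((T - t) + t)" by simp
   also have "\<dots> = sinh (T - t) * cosh t + cosh (T - t) * sinh t" by (rule sinh_add)
   also have "\<dots> \<ge> sinh (T - t) * 1 + 1 * sinh t"
    using t by (intro add_mono mult_left_mono mult_right_mono cosh_real_ge_1) auto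
   finally show ?thesis by simp
  qed
  then have ab1: "a + b\<le>1" unfolding a_def b_def using sT by (simp add: field_simps)
  have ca: "cosh t = a + b*cosh T"
   unfolding a_def b_def using sT by (simp add: field_simps sinh_diff)
  have sb: "sinh t = b * sinh T" unfolding b_def using sT by simp
  have "cosh t *\<^sub>R x + sinh t *\<^sub>R w = a *\<^sub>R x + b *\<^sub>R y"
   unfolding ca sb y by (simp add: algebra_simps)
  moreover have "hz (cosh t *\<^sub>R x + sinh t *\<^sub>R w) = a*hz x + b*hz y"
  proof -
   have "cosh t*hz x + sinh t*hzd x w = a*hz x + b*hz y"
    unfolding hzd ca sb using sT by (simp add: field_simps)
   then show ?thesis unfolding geodesic_hz[OF gw] .
  qed
  ultimately have "hB z (cosh t *\<^sub>R x + sinh t *\<^sub>R w) = a*hB z x + b*hB z y"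
   unfolding hB_def by (simp add: inner_add algebra_simps)
  also have "\<dots>\<le>a*max (hB z x) (hB z y) + b*max (hB z x) (hB z y)"
   using ab by (intro add_mono mult_left_mono) auto
  also have "\<dots> = (a + b) * max (hB z x) (hB z y)" by (simp add: algebra_simps)
  also have "\<dots>\<le>1*max (hB z x) (hB z y)"
   using ab1 hB_ge_1[of z x] by (intro mult_right_mono) auto
  finally show ?thesis by simp
 qed
 show ?thesis by (rule that[OF T gw y bound])
qed

lemma gH_geodesic_velocity:
 assumes "gH h w w = 1"
 shows "gH (cosh t *\<^sub>R h + sinh t *\<^sub>R w) (sinh t *\<^sub>R h + cosh t *\<^sub>R w) (sinh t *\<^sub>R h + cosh t *\<^sub>R w) = 1"
  and "hzd (cosh t *\<^sub>R h + sinh t *\<^sub>R w) (sinh t *\<^sub>R h + cosh t *\<^sub>R w) = sinh t*hz h + cosh t*hzd h w"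
proof -
 define d where "d = hzd h w"
 have ww: "w \<bullet> w = 1 + d*d" using assms unfolding gH_def d_def by simp
 have hw: "h \<bullet> w = hz h*d" unfolding d_def hzd_mult ..
 have hh: "h \<bullet> h = hz h*hz h - 1" by (simp add: hz_square)
 have cs: "cosh t*cosh t = sinh t * sinh t + 1" using cosh_square_eq[of t] by (simp add: power2_eq_square)
 have "(cosh t *\<^sub>R h + sinh t *\<^sub>R w) \<bullet> (sinh t *\<^sub>R h + cosh t *\<^sub>R w)
   = cosh t * sinh t*(h \<bullet> h) + (cosh t*cosh t + sinh t * sinh t) * (h \<bullet> w) + sinh t*cosh t*(w \<bullet> w)"
  by (simp add: inner_add inner_commute algebra_simps)
 also have "\<dots> = (cosh t*hz h + sinh t*d) * (sinh t*hz h + cosh t*d)"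
  unfolding ww hw hh by (simp add: algebra_simps)
 finally show hzd: "hzd (cosh t *\<^sub>R h + sinh t *\<^sub>R w) (sinh t *\<^sub>R h + cosh t *\<^sub>R w) = sinh t*hz h + cosh t*hzd h w"
  unfolding hzd_def[of "cosh t *\<^sub>R h + sinh t *\<^sub>R w"] geodesic_hz[OF assms] d_def[symmetric]
  using hz_pos[of "cosh t *\<^sub>R h + sinh t *\<^sub>R w"] unfolding geodesic_hz[OF assms] d_def[symmetric] by simp
 have "(sinh t *\<^sub>R h + cosh t *\<^sub>R w) \<bullet> (sinh t *\<^sub>R h + cosh t *\<^sub>R w)
   = sinh t * sinh t*(h \<bullet> h) + 2*(cosh t * sinh t) * (h \<bullet> w) + cosh t*cosh t*(w \<bullet> w)"
  by (simp add: inner_add inner_commute algebra_simps)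
 also have "\<dots> = 1 + (sinh t*hz h + cosh t*d) * (sinh t*hz h + cosh t*d)"
  unfolding ww hw hh using cs by (simp add: algebra_simps)
 finally show "gH (cosh t *\<^sub>R h + sinh t *\<^sub>R w) (sinh t *\<^sub>R h + cosh t *\<^sub>R w) (sinh t *\<^sub>R h + cosh t *\<^sub>R w) = 1"
  unfolding gH_def hzd d_def[symmetric] by simp
qed

lemma geodesic_has_vector_derivative:
 "((\<lambda>t. cosh t *\<^sub>R h + sinh t *\<^sub>R w) has_vector_derivative (sinh t *\<^sub>R h + cosh t *\<^sub>R w)) (at t within S)"
 by (auto intro!: derivative_eq_intros simp: has_vector_derivative_def scaleR_add_right mult.commute)

text \<open>The image of the unit-speed geodesic from \<open>x\<close> to \<open>y\<close> again has
  unit speed, so its end is at most as far from its beginning as \<open>y\<close> is from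
  \<open>x\<close>.\<close>

lemma hB_contraction:
 fixes \<psi> :: "'a::real_inner => 'a"
 assumes der: "\<And>z. hB w z < C ==> (\<psi> has_derivative D z) (at z)"
  and iso: "\<And>z v. hB w z < C ==> gH (\<psi> z) (D z v) (D z v) = gH z v v"
  and x: "hB w x < C" and y: "hB w y < C"
 shows "hB (\<psi> x) (\<psi> y)\<le>hB x y"
proof (cases "x = y")
 case False
 obtain T u where T: "0 < T" "cosh T = hB x y" "gH x u u = 1" "y = cosh T *\<^sub>R x + sinh T *\<^sub>R u"
  "\<And>z t. t\<in>{0..T} ==> hB z (cosh t *\<^sub>R x + sinh t *\<^sub>R u)\<le>max (hB z x) (hB z y)"
  using geodesic_between[OF False] by metis
 define \<sigma> \<sigma>' where "\<sigma> t = cosh t *\<^sub>R x + sinh t *\<^sub>R u" and "\<sigma>' t = sinh t *\<^sub>R x + cosh t *\<^sub>R u" for t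
 have N: "hB w (\<sigma> t) < C" if "t\<in>{0..T}" for t
  using T(5)[OF that, of w] x y unfolding \<sigma>_def by simp
 define c c' where "c t = \<psi> (\<sigma> t)" and "c' t = D (\<sigma> t) (\<sigma>' t)" for t
 have dc: "(c has_derivative (\<lambda>h. h *\<^sub>R c' t)) (at t within {0..T})" if t: "t\<in>{0..T}" for t
 proof -
  have "((\<lambda>t. \<psi> (\<sigma> t)) has_derivative (\<lambda>h. D (\<sigma> t) (h *\<^sub>R \<sigma>' t))) (at t within {0..T})"
   using geodesic_has_vector_derivative[of x u t "{0..T}"]
   unfolding has_vector_derivative_def \<sigma>_def[symmetric] \<sigma>'_def[symmetric]
   by (rule has_derivative_compose[where f = \<sigma> and g = \<psi>, OF _ der[OF N[OF t]]])
  then show ?thesis unfolding c_def c'_def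
   using linear_scale[OF has_derivative_linear[OF der[OF N[OF t]]]] by simp
 qed
 define \<beta> \<beta>' where "\<beta> t = hB (\<psi> x) (c t)" and "\<beta>' t = hz (\<psi> x) * hzd (c t) (c' t) - \<psi> x \<bullet> c' t" for t
 have "\<beta> T\<le>cosh T"
 proof (rule cosh_comparison)
  show "\<beta> 0 = 1" unfolding \<beta>_def c_def \<sigma>_def by simp
  fix t assume t: "t\<in>{0..T}"
  show "1\<le>\<beta> t" unfolding \<beta>_def by (rule hB_ge_1)
  have hzdh: "hzd z (r *\<^sub>R v) = r*hzd z v" for z v :: 'a and r unfolding hzd_def by simp
  have "((\<lambda>t. hz (\<psi> x) * hz (c t) - \<psi> x \<bullet> c t) has_derivative
    (\<lambda>h. hz (\<psi> x) * hzd (c t) (h *\<^sub>R c' t) - \<psi> x \<bullet> (h *\<^sub>R c' t))) (at t within {0..T})"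
   by (intro derivative_intros has_derivative_compose[OF dc[OF t] hz_has_derivative] dc[OF t])
  then show "(\<beta> has_real_derivative \<beta>' t) (at t within {0..T})"
   unfolding \<beta>_def hB_def[abs_def] \<beta>'_def has_field_derivative_def
   by (rule has_derivative_eq_rhs) (auto simp: hzdh algebra_simps)
  show "(\<beta>' t)\<^sup>2\<le>(\<beta> t)\<^sup>2 - 1"
   using lorentz_Cauchy_Schwarz[of "\<psi> x" "c t" "c' t"] gH_geodesic_velocity(1)[OF T(3), of t]
    iso[OF N[OF t], of "\<sigma>' t"]
   unfolding \<beta>_def \<beta>'_def c_def c'_def \<sigma>_def \<sigma>'_def by simp
 qed (use T in auto)
 moreover have "\<beta> T = hB (\<psi> x) (\<psi> y)" by (simp add: \<beta>_def c_def \<sigma>_def T(4)[symmetric])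
 ultimately show ?thesis unfolding T(2) by simp
qed simp

lemma hB_small:
 fixes z :: "'a::euclidean_space"
 assumes "0 < e"
 obtains C where "1 < C" "\<And>y. hB z y < C ==> y\<in>ball z e"
proof -
 have "isCont (htr z) 0" using htr_has_derivative has_derivative_continuous by blast
 then obtain d where d: "d > 0" "\<And>x. norm x < d ==> dist (htr z x) z < e"
  using assms unfolding continuous_at_eps_delta by (metis dist_0_norm dist_commute htr_at_0)
 define C where "C = sqrt (1 + d\<^sup>2)"
 have "y\<in>ball z e" if "hB z y < C" for y
 proof -
  have "hz (htr (- z) y) < C"
   using that hB_htr[of "- z" z y] htr_minus_left[of z 0] by simp
  then have "norm (htr (- z) y) < d"
   unfolding C_def hz_norm using d by (simp add: abs_less_iff power2_less_imp_less less_imp_le)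
  from d(2)[OF this] show ?thesis by (simp add: dist_commute)
 qed
 moreover have "1 < C" unfolding C_def using d by simp
 ultimately show ?thesis using that by blast
qed

text \<open>The triangle inequality in the form cosh (a + b) \<le> 2 cosh a cosh b.\<close>

lemma hB_mult_bound: "hB x z\<le>2*hB x y*hB y z"
proof -
 define x' z' where "x' = htr (- y) x" and "z' = htr (- y) z"
 have "hB x z = hB x' z'" unfolding x'_def z'_def hB_htr ..
 also have "\<dots>\<le>2*hz x' * hz z'"
 proof -
  have "\<bar>x' \<bullet> z'\<bar>\<le>norm x' * norm z'" by (rule Cauchy_Schwarz_ineq2)
  also have "\<dots>\<le>hz x' * hz z'" using norm_less_hz[of x'] norm_less_hz[of z'] by (intro mult_mono) (auto intro: less_imp_le)
  finally show ?thesis unfolding hB_def by linarith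
 qed
 also have "hz x' = hB x y" unfolding x'_def using hB_htr[of "- y" x y] htr_minus_left[of y 0] by simp
 also have "hz z' = hB y z" unfolding z'_def using hB_htr[of "- y" y z] htr_minus_left[of y 0] by simp
 finally show ?thesis .
qed

section \<open>Flat linear connections\<close>

lemma continuous_on_linear_family:
 fixes a :: "real => 'b::euclidean_space => 'b"
 assumes lin: "\<And>t. t\<in>S ==> linear (a t)" and cont: "\<And>v. continuous_on S (\<lambda>t. a t v)"
  and f: "continuous_on S f"
 shows "continuous_on S (\<lambda>t. a t (f t))"
proof -
 have "continuous_on S (\<lambda>t. \<Sum>i\<in>Basis. (f t \<bullet> i) *\<^sub>R a t i)"
  by (intro continuous_intros f cont)
 moreover have "(\<Sum>i\<in>Basis. (f t \<bullet> i) *\<^sub>R a t i) = a t (f t)" if "t\<in>S" for t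
 proof -
  have "a t (f t) = a t (\<Sum>i\<in>Basis. (f t \<bullet> i) *\<^sub>R i)" by (simp add: euclidean_representation)
  then show ?thesis unfolding linear_sum[OF lin[OF that]] linear_scale[OF lin[OF that]] by simp
 qed
 ultimately show ?thesis by (simp cong: continuous_on_cong)
qed

text \<open>The Picard iteration. The bound \<open>norm v/2\<close> makes it a contraction on the
  whole unit interval, so that no subdivision is necessary.\<close>

lemma linear_ode_exists:
 fixes a :: "real => 'b::euclidean_space => 'b"
 assumes lin: "\<And>t. t\<in>{0..1} ==> linear (a t)" and cont: "\<And>v. continuous_on {0..1} (\<lambda>t. a t v)"
  and bd: "\<And>t v. t\<in>{0..1} ==> norm (a t v)\<le>norm v/2"
 shows "\<exists>\<psi>. \<psi> 0 = w0 \<and> (\<forall>t\<in>{0..1}. (\<psi> has_vector_derivative a t (\<psi> t)) (at t within {0..1}))"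
proof -
 \<comment> \<open>Clamping to the unit interval turns a continuous function there into a bounded
   continuous function on the line; these form a complete space to which Banach's theorem
   applies.\<close>
 define cl :: "real => real" where "cl t = max 0 (min 1 t)" for t
 have cl: "cl t\<in>{0..1}" for t unfolding cl_def by auto
 have cl_id: "cl t = t" if "t\<in>{0..1}" for t using that unfolding cl_def by auto
 have cca: "continuous_on {0..1} (\<lambda>s. a s (apply_bcontfun \<phi> s))" for \<phi>
  by (rule continuous_on_linear_family[OF lin cont]) (auto intro: continuous_intros)
 define I where "I \<phi> t = w0 + integral {0..t} (\<lambda>s. a s (apply_bcontfun \<phi> s))" for \<phi> t
 have cI: "continuous_on {0..1} (I \<phi>)" for \<phi>
  unfolding I_def by (intro continuous_intros indefinite_integral_continuous_1 integrable_continuous_interval cca)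
 have bI: "(\<lambda>t. I \<phi> (cl t))\<in>bcontfun" for \<phi>
 proof -
  have "continuous_on UNIV (\<lambda>t. I \<phi> (cl t))"
   by (rule continuous_on_compose2[OF cI]) (use cl in \<open>auto simp: cl_def intro!: continuous_intros\<close>)
  moreover have "bounded (range (\<lambda>t. I \<phi> (cl t)))"
   by (rule bounded_subset[OF compact_imp_bounded[OF compact_continuous_image[OF cI compact_Icc]]])
    (use cl in auto)
  ultimately show ?thesis unfolding bcontfun_def by simp
 qed
 define T where "T \<phi> = Bcontfun (\<lambda>t. I \<phi> (cl t))" for \<phi>
 have T: "apply_bcontfun (T \<phi>) t = I \<phi> (cl t)" for \<phi> t
  unfolding T_def by (simp add: Bcontfun_inverse[OF bI])
 have contr: "dist (T \<phi>) (T \<theta>)\<le>(1/2)*dist \<phi> \<theta>" for \<phi> \<theta>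
 proof (rule dist_bound)
  fix t
  have i: "(\<lambda>s. a s (apply_bcontfun \<phi> s)) integrable_on {0..cl t}" for \<phi>
   by (rule integrable_continuous_interval[OF continuous_on_subset[OF cca]]) (use cl in auto)
  have "dist (apply_bcontfun (T \<phi>) t) (apply_bcontfun (T \<theta>) t)
   = norm (integral {0..cl t} (\<lambda>s. a s (apply_bcontfun \<phi> s)) - integral {0..cl t} (\<lambda>s. a s (apply_bcontfun \<theta> s)))"
   unfolding T I_def dist_norm by simp
  also have "\<dots> = norm (integral {0..cl t} (\<lambda>s. a s (apply_bcontfun \<phi> s) - a s (apply_bcontfun \<theta> s)))"
   by (simp add: integral_diff i)
  also have "\<dots>\<le>(dist \<phi> \<theta>/2)*(cl t - 0)"
  proof (rule integral_bound)
   show "continuous_on {0..cl t} (\<lambda>s. a s (apply_bcontfun \<phi> s) - a s (apply_bcontfun \<theta> s))"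
    by (intro continuous_intros continuous_on_subset[OF cca]) (use cl in auto)
   fix s assume "s\<in>{0..cl t}"
   then have s: "s\<in>{0..1}" using cl[of t] by auto
   have "norm (a s (apply_bcontfun \<phi> s) - a s (apply_bcontfun \<theta> s)) = norm (a s (apply_bcontfun \<phi> s - apply_bcontfun \<theta> s))"
    by (simp add: linear_diff[OF lin[OF s]])
   also have "\<dots>\<le>dist (apply_bcontfun \<phi> s) (apply_bcontfun \<theta> s)/2"
    using bd[OF s] by (simp add: dist_norm)
   also have "\<dots>\<le>dist \<phi> \<theta>/2" using dist_bounded[of \<phi> s \<theta>] by simp
   finally show "norm (a s (apply_bcontfun \<phi> s) - a s (apply_bcontfun \<theta> s))\<le>dist \<phi> \<theta>/2" .
  qed (use cl[of t] in auto)
  also have "\<dots>\<le>(dist \<phi> \<theta>/2)*1" using cl[of t] by (intro mult_left_mono) auto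
  finally show "dist (apply_bcontfun (T \<phi>) t) (apply_bcontfun (T \<theta>) t)\<le>(1/2)*dist \<phi> \<theta>" by simp
 qed
 obtain \<phi> where \<phi>: "T \<phi> = \<phi>"
  using banach_fix_type[of "1/2" T] contr by auto
 define \<psi> where "\<psi> = apply_bcontfun \<phi>"
 have \<psi>I: "\<psi> t = I \<phi> t" if "t\<in>{0..1}" for t
  using T[of \<phi> t] unfolding \<phi> \<psi>_def cl_id[OF that] .
 have "\<psi> 0 = w0" using \<psi>I[of 0] unfolding I_def by simp
 moreover have "(\<psi> has_vector_derivative a t (\<psi> t)) (at t within {0..1})" if t: "t\<in>{0..1}" for t
 proof (rule has_vector_derivative_transform[OF t])
  show "(I \<phi> has_vector_derivative a t (\<psi> t)) (at t within {0..1})"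
   unfolding I_def \<psi>_def
   using has_vector_derivative_add[OF has_vector_derivative_const integral_has_vector_derivative[OF cca t]]
   by simp
 qed (use \<psi>I in auto)
 ultimately show ?thesis by blast
qed

lemma small_gronwall:
 fixes E :: "real => 'b::real_normed_vector"
 assumes E0: "E 0 = 0" and der: "\<And>t. t\<in>{0..1} ==> (E has_vector_derivative E' t) (at t within {0..1})"
  and bd: "\<And>t. t\<in>{0..1} ==> norm (E' t)\<le>norm (E t)/2 + \<rho>" and t: "t\<in>{0..1}"
 shows "norm (E t)\<le>2 * \<rho>"
proof -
 have "continuous_on {0..1} E" using der by (rule continuous_on_vector_derivative)
 then have "continuous_on {0..1} (\<lambda>t. norm (E t))" by (intro continuous_intros)
 then obtain m where m: "m\<in>{0..1}" "\<And>t. t\<in>{0..1} ==> norm (E t)\<le>norm (E m)"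
  using continuous_attains_sup[of "{0..1::real}" "\<lambda>t. norm (E t)"] by auto
 have "norm (E m - E 0)\<le>(norm (E m)/2 + \<rho>)*norm (m - 0)"
 proof (rule differentiable_bound)
  fix x :: real assume x: "x\<in>{0..1}"
  show "(E has_derivative (\<lambda>h. h *\<^sub>R E' x)) (at x within {0..1})"
   using der[OF x] unfolding has_vector_derivative_def .
  have "norm (E' x)\<le>norm (E m)/2 + \<rho>" using bd[OF x] m(2)[OF x] by simp
  then show "onorm (\<lambda>h. h *\<^sub>R E' x)\<le>norm (E m)/2 + \<rho>"
   by (intro onorm_le) (simp add: mult.commute mult_left_mono)
 qed (use m in auto)
 also have "\<dots>\<le>(norm (E m)/2 + \<rho>)*1"
  using m(1) bd[OF m(1)] norm_ge_zero[of "E' m"] by (intro mult_left_mono) (auto simp del: norm_ge_zero)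
 finally have "norm (E m)\<le>2 * \<rho>" using E0 by simp
 then show ?thesis using m(2)[OF t] by simp
qed

lemma linear_norm_le:
 fixes f :: "'a::euclidean_space => 'd::real_normed_vector"
 assumes "linear f"
 shows "norm (f h)\<le>norm h*(\<Sum>i\<in>Basis. norm (f i))"
proof -
 have "norm (f h) = norm (f (\<Sum>i\<in>Basis. (h \<bullet> i) *\<^sub>R i))" by (simp add: euclidean_representation)
 also have "\<dots> = norm (\<Sum>i\<in>Basis. (h \<bullet> i) *\<^sub>R f i)" unfolding linear_sum[OF assms] linear_scale[OF assms] ..
 also have "\<dots>\<le>(\<Sum>i\<in>Basis. norm h*norm (f i))" by (intro sum_norm_le) (simp add: Basis_le_norm mult_right_mono)
 finally show ?thesis by (simp add: sum_distrib_left)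
qed

lemma trilinear_norm_le:
 fixes f :: "'a::euclidean_space => 'b::euclidean_space => 'c::euclidean_space => 'd::real_normed_vector"
 assumes l1: "\<And>y w. linear (\<lambda>h. f h y w)" and l2: "\<And>h w. linear (\<lambda>y. f h y w)" and l3: "\<And>h y. linear (f h y)"
 shows "norm (f h y w)\<le>norm h*norm y*norm w*(\<Sum>l\<in>Basis. \<Sum>i\<in>Basis. \<Sum>j\<in>Basis. norm (f l i j))"
proof -
 have "norm (f h y w)\<le>norm h*(\<Sum>l\<in>Basis. norm (f l y w))" by (rule linear_norm_le[OF l1])
 also have "\<dots>\<le>norm h*(\<Sum>l\<in>Basis. norm y*(\<Sum>i\<in>Basis. norm (f l i w)))"
  by (intro mult_left_mono sum_mono linear_norm_le[OF l2] norm_ge_zero)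
 also have "\<dots>\<le>norm h*(\<Sum>l\<in>Basis. norm y*(\<Sum>i\<in>Basis. norm w*(\<Sum>j\<in>Basis. norm (f l i j))))"
  by (intro mult_left_mono sum_mono linear_norm_le[OF l3] norm_ge_zero)
 finally show ?thesis by (simp add: sum_distrib_left mult_ac)
qed

lemma trilinear_family_uniform:
 fixes T :: "'p::metric_space => 'a::euclidean_space => 'b::euclidean_space => 'c::euclidean_space => 'd::real_normed_vector"
 assumes K: "compact K"
  and l1: "\<And>x y w. x\<in>K ==> linear (\<lambda>h. T x h y w)"
  and l2: "\<And>x h w. x\<in>K ==> linear (\<lambda>y. T x h y w)" and l3: "\<And>x h y. x\<in>K ==> linear (T x h y)"
  and cont: "\<And>h y w. continuous_on K (\<lambda>x. T x h y w)"
 shows "\<exists>C>0. \<forall>x\<in>K. \<forall>h y w. norm (T x h y w)\<le>C*norm h*norm y*norm w"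
  and "0 < \<epsilon> ==> \<exists>\<delta>>0. \<forall>x\<in>K. \<forall>z\<in>K. dist x z < \<delta> -->
   (\<forall>h y w. norm (T z h y w - T x h y w)\<le>\<epsilon> * norm h*norm y*norm w)"
proof -
 define N where "N x = (\<Sum>l\<in>Basis. \<Sum>i\<in>Basis. \<Sum>j\<in>Basis. norm (T x l i j))" for x
 have "continuous_on K N" unfolding N_def by (intro continuous_intros cont)
 then have "bounded (N ` K)" using K by (intro compact_imp_bounded compact_continuous_image)
 then obtain B where B: "0 < B" "\<And>x. x\<in>K ==> norm (N x)\<le>B" unfolding bounded_pos by auto
 have "norm (T x h y w)\<le>B*norm h*norm y*norm w" if x: "x\<in>K" for x h y w
 proof -
  have "norm (T x h y w)\<le>norm h*norm y*norm w*N x"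
   unfolding N_def by (rule trilinear_norm_le[OF l1[OF x] l2[OF x] l3[OF x]])
  also have "\<dots>\<le>norm h*norm y*norm w*B" using B(2)[OF x] by (intro mult_left_mono) auto
  finally show ?thesis by (simp add: mult_ac)
 qed
 then show "\<exists>C>0. \<forall>x\<in>K. \<forall>h y w. norm (T x h y w)\<le>C*norm h*norm y*norm w" using B(1) by blast
 assume \<epsilon>: "0 < \<epsilon>"
 define D where "D p = (\<Sum>l\<in>Basis. \<Sum>i\<in>Basis. \<Sum>j\<in>Basis. norm (T (snd p) l i j - T (fst p) l i j))" for p
 have "continuous_on (K\<times>K) D" unfolding D_def
  by (intro continuous_intros continuous_on_compose2[OF cont]) auto
 then have "uniformly_continuous_on (K\<times>K) D" using K by (intro compact_uniformly_continuous compact_Times)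
 then obtain \<delta> where \<delta>: "\<delta> > 0" "\<And>p q. p\<in>K\<times>K ==> q\<in>K\<times>K ==> dist q p < \<delta> ==> dist (D q) (D p) < \<epsilon>"
  unfolding uniformly_continuous_on_def using \<epsilon> by metis
 have "norm (T z h y w - T x h y w)\<le>\<epsilon> * norm h*norm y*norm w"
  if x: "x\<in>K" and z: "z\<in>K" and d: "dist x z < \<delta>" for x z h y w
 proof -
  have "dist (D (x, z)) (D (x, x)) < \<epsilon>"
   by (rule \<delta>(2)) (use x z d in \<open>auto simp: dist_Pair_Pair dist_commute\<close>)
  moreover have "D (x, x) = 0" unfolding D_def by simp
  ultimately have D: "D (x, z)\<le>\<epsilon>" by simp
  have "norm (T z h y w - T x h y w)\<le>norm h*norm y*norm w*D (x, z)"
   unfolding D_def fst_conv snd_conv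
   by (rule trilinear_norm_le[of "\<lambda>h y w. T z h y w - T x h y w"])
    (intro linear_compose_sub l1 l2 l3 x z)+
  also have "\<dots>\<le>norm h*norm y*norm w * \<epsilon>" using D by (intro mult_left_mono) auto
  finally show ?thesis by (simp add: mult_ac)
 qed
 then show "\<exists>\<delta>>0. \<forall>x\<in>K. \<forall>z\<in>K. dist x z < \<delta> -->
   (\<forall>h y w. norm (T z h y w - T x h y w)\<le>\<epsilon> * norm h*norm y*norm w)" using \<delta>(1) by blast
qed


lemma bilinear_family_bound:
 fixes L :: "'c::metric_space => 'a::euclidean_space => 'b::euclidean_space => 'd::real_normed_vector"
 assumes K: "compact K" and bil: "\<And>x. x\<in>K ==> bilinear (L x)" and cont: "\<And>y w. continuous_on K (\<lambda>x. L x y w)"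
 shows "\<exists>C>0. \<forall>x\<in>K. \<forall>y w. norm (L x y w)\<le>C*norm y*norm w"
proof -
 have l: "linear (\<lambda>y. L x y w)" "linear (L x y)" if "x\<in>K" for x y w using bil[OF that] unfolding bilinear_def by auto
 \<comment> \<open>A real dummy argument turns the bilinear family into a trilinear one.\<close>
 have 1: "linear (\<lambda>h::real. h *\<^sub>R L x y w)" for x y w by (intro linearI) (auto simp: scaleR_add_left)
 obtain C where C: "0 < C" "\<forall>x\<in>K. \<forall>h::real. \<forall>y w. norm (h *\<^sub>R L x y w)\<le>C*norm h*norm y*norm w"
  using trilinear_family_uniform(1)[of K "\<lambda>x h y w. h *\<^sub>R L x y w", OF K 1 linear_compose_scale_right[OF l(1)] linear_compose_scale_right[OF l(2)]
   continuous_on_scaleR[OF continuous_on_const cont]] by blast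
 have "norm (L x y w)\<le>C*norm y*norm w" if "x\<in>K" for x y w using C(2)[rule_format, OF that, of 1 y w] by simp
 then show ?thesis using C(1) by blast
qed

lemma bilinear_family_taylor:
 fixes L :: "'a::euclidean_space => 'b::euclidean_space => 'c::euclidean_space => 'd::real_normed_vector"
 assumes K: "compact K" "convex K" and bdL: "\<And>x h. x\<in>K ==> bilinear (dL x h)"
  and der: "\<And>x y w. x\<in>K ==> ((\<lambda>x. L x y w) has_derivative (\<lambda>h. dL x h y w)) (at x within K)"
  and cont: "\<And>h y w. continuous_on K (\<lambda>x. dL x h y w)"
 shows "\<exists>C>0. (\<forall>x\<in>K. \<forall>h y w. norm (dL x h y w)\<le>C*norm h*norm y*norm w) \<and>
  (\<forall>x h y w. x\<in>K --> x + h\<in>K --> norm (L (x + h) y w - L x y w)\<le>C*norm h*norm y*norm w) \<and>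
  (\<forall>\<epsilon>>0. \<exists>\<delta>>0. \<forall>x h y w. x\<in>K --> x + h\<in>K --> norm h < \<delta> -->
    norm (L (x + h) y w - L x y w - dL x h y w)\<le>\<epsilon> * norm h*norm y*norm w)"
proof -
 have l1: "linear (\<lambda>h. dL x h y w)" if "x\<in>K" for x y w
  using der[OF that] by (rule has_derivative_linear)
 have l2: "linear (\<lambda>y. dL x h y w)" and l3: "linear (dL x h y)" if "x\<in>K" for x h y w
  using bdL[OF that] unfolding bilinear_def by auto
 obtain C where C: "0 < C" "\<And>x h y w. x\<in>K ==> norm (dL x h y w)\<le>C*norm h*norm y*norm w"
  using trilinear_family_uniform(1)[of K dL, OF K(1) l1 l2 l3 cont] by metis
 have lip: "norm (L (x + h) y w - L x y w)\<le>C*norm h*norm y*norm w" if "x\<in>K" "x + h\<in>K" for x h y w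
 proof -
  have "norm (L (x + h) y w - L x y w)\<le>(C*norm y*norm w) * norm (x + h - x)"
  proof (rule differentiable_bound[OF K(2) der])
   fix z assume "z\<in>K"
   then show "onorm (\<lambda>h. dL z h y w)\<le>C*norm y*norm w"
    by (intro onorm_le) (use C(2) in \<open>simp add: mult_ac\<close>)
  qed (use that in auto)
  then show ?thesis by (simp add: mult_ac)
 qed
 have taylor: "\<exists>\<delta>>0. \<forall>x h y w. x\<in>K --> x + h\<in>K --> norm h < \<delta> -->
    norm (L (x + h) y w - L x y w - dL x h y w)\<le>\<epsilon> * norm h*norm y*norm w" if \<epsilon>: "0 < \<epsilon>" for \<epsilon>
 proof -
  obtain \<delta> where \<delta>: "\<delta> > 0" "\<And>x z h y w. x\<in>K ==> z\<in>K ==> dist x z < \<delta> ==>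
   norm (dL z h y w - dL x h y w)\<le>\<epsilon> * norm h*norm y*norm w"
   using trilinear_family_uniform(2)[of K dL, OF K(1) l1 l2 l3 cont \<epsilon>] by metis
  have "norm (L (x + h) y w - L x y w - dL x h y w)\<le>\<epsilon> * norm h*norm y*norm w"
   if x: "x\<in>K" "x + h\<in>K" and h: "norm h < \<delta>" for x h y w
  proof -
   define S where "S = K\<inter>ball x \<delta>"
   have "norm (L (x + h) y w - L x y w - dL x (x + h - x) y w)\<le>norm (x + h - x) * (\<epsilon> * norm y*norm w)"
   proof (rule differentiable_bound_linearization[where S = S])
    show "x + t *\<^sub>R (x + h - x)\<in>S" if "t\<in>{0..1}" for t
    proof -
     have "(1 - t) *\<^sub>R x + t *\<^sub>R (x + h)\<in>K"
      using K(2) x that unfolding convex_alt by auto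
     moreover have "(1 - t) *\<^sub>R x + t *\<^sub>R (x + h) = x + t *\<^sub>R (x + h - x)" by (simp add: algebra_simps)
     moreover have "dist x (x + t *\<^sub>R (x + h - x)) < \<delta>"
      using that h mult_left_le_one_le[of "norm h" t] by (simp add: dist_norm)
     ultimately show ?thesis unfolding S_def by simp
    qed
    show "((\<lambda>x. L x y w) has_derivative (\<lambda>h. dL z h y w)) (at z within S)" if "z\<in>S" for z
     using der[of z] that unfolding S_def by (auto intro: has_derivative_subset)
    show "onorm ((\<lambda>h. dL z h y w) - (\<lambda>h. dL x h y w))\<le>\<epsilon> * norm y*norm w" if "z\<in>S" for z
     by (rule onorm_le) (use \<delta>(2)[of x z] that x in \<open>simp add: S_def mult_ac\<close>)
    show "x\<in>S" unfolding S_def using x \<delta>(1) by simp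
   qed
   then show ?thesis by (simp add: mult_ac)
  qed
  then show ?thesis using \<delta>(1) by blast
 qed
 show ?thesis
 proof (intro exI[of _ C] conjI)
  show "\<forall>x\<in>K. \<forall>h y w. norm (dL x h y w)\<le>C*norm h*norm y*norm w" using C(2) by blast
  show "\<forall>x h y w. x\<in>K --> x + h\<in>K --> norm (L (x + h) y w - L x y w)\<le>C*norm h*norm y*norm w"
   using lip by blast
 qed (use C(1) taylor in simp_all)
qed

text \<open>A section is built by parallel transport along the radii from \<open>x0\<close>; this
  uses the connection in radial directions only. Flatness, stated as the symmetry in
  \<open>h\<close> and \<open>y\<close> of the second derivative that a parallel section must have,
  shows that the section is parallel in the other directions too.\<close>

theorem flat_connection_parallel:
 fixes L :: "'a::euclidean_space => 'a => 'b::euclidean_space => 'b"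
 assumes S: "open S" "x0\<in>S" and bL: "\<And>x. x\<in>S ==> bilinear (L x)"
  and bdL: "\<And>x h. x\<in>S ==> bilinear (dL x h)"
  and der: "\<And>x y w. x\<in>S ==> ((\<lambda>x. L x y w) has_derivative (\<lambda>h. dL x h y w)) (at x)"
  and cont: "\<And>h y w. continuous_on S (\<lambda>x. dL x h y w)"
  and flat: "\<And>x h y w. x\<in>S ==> dL x h y w + L x y (L x h w) = dL x y h w + L x h (L x y w)"
 shows "\<exists>r>0. ball x0 r\<subseteq>S \<and> (\<forall>w0. \<exists>w. w x0 = w0 \<and>
   (\<forall>x\<in>ball x0 r. (w has_derivative (\<lambda>h. L x h (w x))) (at x)))"
proof -
 obtain R where R: "0 < R" "cball x0 R\<subseteq>S" using S open_contains_cball by blast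
 define K where "K = cball x0 R"
 have K: "compact K" "convex K" "K\<subseteq>S" unfolding K_def using R by auto
 have cL: "continuous_on S (\<lambda>x. L x y w)" for y w
  by (rule has_derivative_continuous_on[OF has_derivative_at_withinI[OF der]])
 obtain C where C0: "0 < C" and C1: "\<forall>x\<in>K. \<forall>y w. norm (L x y w)\<le>C*norm y*norm w"
  using bilinear_family_bound[of K L, OF K(1) bL[OF subsetD[OF K(3)]] continuous_on_subset[OF cL K(3)]] by auto
 have C: "0 < C" "\<And>x y w. x\<in>K ==> norm (L x y w)\<le>C*norm y*norm w"
  using C0 C1 by auto
 obtain C' where Cc: "0 < C'" "\<forall>x\<in>K. \<forall>h y w. norm (dL x h y w)\<le>C' * norm h*norm y*norm w"
  and lip': "\<forall>x h y w. x\<in>K --> x + h\<in>K --> norm (L (x + h) y w - L x y w)\<le>C' * norm h*norm y*norm w"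
  and taylor': "\<forall>\<epsilon>>0. \<exists>\<delta>>0. \<forall>x h y w. x\<in>K --> x + h\<in>K --> norm h < \<delta> -->
    norm (L (x + h) y w - L x y w - dL x h y w)\<le>\<epsilon> * norm h*norm y*norm w"
  using bilinear_family_taylor[of K dL L, OF K(1,2) bdL[OF subsetD[OF K(3)]]
     has_derivative_at_withinI[OF der[OF subsetD[OF K(3)]]] continuous_on_subset[OF cont K(3)]] by auto
 have C': "0 < C'" "\<And>x h y w. x\<in>K ==> norm (dL x h y w)\<le>C' * norm h*norm y*norm w"
  and lip: "\<And>x h y w. x\<in>K ==> x + h\<in>K ==> norm (L (x + h) y w - L x y w)\<le>C' * norm h*norm y*norm w"
  and taylor: "\<And>\<epsilon>. 0 < \<epsilon> ==> \<exists>\<delta>>0. \<forall>x h y w. x\<in>K --> x + h\<in>K --> norm h < \<delta> -->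
    norm (L (x + h) y w - L x y w - dL x h y w)\<le>\<epsilon> * norm h*norm y*norm w"
  using Cc lip' taylor' by auto
 \<comment> \<open>On this radius the transport equation has coefficient at most 1/2, as
   \<open>linear_ode_exists\<close> and \<open>small_gronwall\<close> require.\<close>
 define r where "r = min R (1/(2*C))"
 have r: "0 < r" "r\<le>R" "C*r\<le>1/2"
  unfolding r_def using R C by (auto simp: min_def field_simps)
 have lin2: "linear (L x y)" and lin1: "linear (\<lambda>y. L x y w)" if "x\<in>K" for x y w
  using bL that K(3) unfolding bilinear_def by auto
 have dlin1: "linear (\<lambda>h. dL x h y w)" and dlin2: "linear (\<lambda>y. dL x h y w)" and dlin3: "linear (dL x h y)" if "x\<in>K" for x h y w
  using bdL has_derivative_linear[OF der] that K(3) unfolding bilinear_def by auto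
 have inK: "x0 + t *\<^sub>R k\<in>K" if "t\<in>{0..1}" "norm k < r" for t k
 proof -
  have "\<bar>t\<bar> * norm k\<le>1*r" using that by (intro mult_mono) auto
  then show ?thesis unfolding K_def using r by (simp add: dist_norm)
 qed
 have Lk: "norm (L (x0 + t *\<^sub>R k) k v)\<le>norm v/2" if "t\<in>{0..1}" "norm k < r" for t k v
 proof -
  have "C*norm k\<le>C*r" using that C by (intro mult_left_mono) auto
  then have "C*norm k*norm v\<le>1/2*norm v" using r by (intro mult_right_mono) auto
  then show ?thesis using C(2)[OF inK[OF that], of k v] by simp
 qed
 have "\<exists>w. w x0 = w0 \<and> (\<forall>x\<in>ball x0 r. (w has_derivative (\<lambda>h. L x h (w x))) (at x))" for w0
 proof -
  have "\<exists>\<psi>. norm k < r --> \<psi> 0 = w0 \<and> (\<forall>t\<in>{0..1}. (\<psi> has_vector_derivative L (x0 + t *\<^sub>R k) k (\<psi> t)) (at t within {0..1}))" for k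
  proof (cases "norm k < r")
   case True
   have "\<exists>\<psi>. \<psi> 0 = w0 \<and> (\<forall>t\<in>{0..1}. (\<psi> has_vector_derivative L (x0 + t *\<^sub>R k) k (\<psi> t)) (at t within {0..1}))"
   proof (rule linear_ode_exists)
    show "continuous_on {0..1} (\<lambda>t. L (x0 + t *\<^sub>R k) k v)" for v
     by (rule continuous_on_compose2[OF cL]) (use inK[OF _ True] K(3) in \<open>auto intro!: continuous_intros\<close>)
   qed (use lin2 inK Lk True in auto)
   then show ?thesis by blast
  qed auto
  then obtain \<Psi> where \<Psi>0: "\<And>k. norm k < r ==> \<Psi> k 0 = w0"
   and \<Psi>: "\<And>k t. norm k < r ==> t\<in>{0..1} ==> (\<Psi> k has_vector_derivative L (x0 + t *\<^sub>R k) k (\<Psi> k t)) (at t within {0..1})"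
   by metis
  define B where "B = 2*norm w0"
  have \<Psi>B: "norm (\<Psi> k t)\<le>B" if k: "norm k < r" and t: "t\<in>{0..1}" for k t
  proof -
   have "norm (\<Psi> k t - w0)\<le>2*(norm w0/2)"
   proof (rule small_gronwall[where E' = "\<lambda>t. L (x0 + t *\<^sub>R k) k (\<Psi> k t)"])
    fix s :: real assume s: "s\<in>{0..1}"
    show "((\<lambda>t. \<Psi> k t - w0) has_vector_derivative L (x0 + s *\<^sub>R k) k (\<Psi> k s)) (at s within {0..1})"
     using has_vector_derivative_diff[OF \<Psi>[OF k s] has_vector_derivative_const[of w0]] by simp
    have "norm (L (x0 + s *\<^sub>R k) k (\<Psi> k s))\<le>norm (\<Psi> k s)/2" by (rule Lk[OF s k])
    also have "\<dots>\<le>norm (\<Psi> k s - w0)/2 + norm w0/2"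
     using norm_triangle_sub[of "\<Psi> k s" w0] by simp
    finally show "norm (L (x0 + s *\<^sub>R k) k (\<Psi> k s))\<le>norm (\<Psi> k s - w0)/2 + norm w0/2" .
   qed (use \<Psi>0[OF k] t in auto)
   then show ?thesis unfolding B_def using norm_triangle_sub[of "\<Psi> k t" w0] by simp
  qed
  have B0: "0\<le>B" unfolding B_def by simp
  \<comment> \<open>The transport of \<open>w0\<close> along the segment from \<open>x0\<close> to
    \<open>x\<close>, run in unit time.\<close>
  define w where "w x = \<Psi> (x - x0) 1" for x
  have "w x0 = w0"
  proof -
   have "norm (\<Psi> 0 1 - w0)\<le>2*0"
   proof (rule small_gronwall[where E' = "\<lambda>t. 0"])
    fix s :: real assume s: "s\<in>{0..1}"
    have "L x0 0 v = 0" for v using linear_0[OF lin1[of x0]] unfolding K_def using R by simp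
    then show "((\<lambda>t. \<Psi> 0 t - w0) has_vector_derivative 0) (at s within {0..1})"
     using has_vector_derivative_diff[OF \<Psi>[of 0, OF _ s] has_vector_derivative_const[of w0]] r by simp
   qed (use \<Psi>0[of 0] r in auto)
   then show ?thesis unfolding w_def by simp
  qed
  moreover have "(w has_derivative (\<lambda>h. L x h (w x))) (at x)" if x: "x\<in>ball x0 r" for x
  proof -
   define k where "k = x - x0"
   have k: "norm k < r" using x unfolding k_def by (simp add: dist_norm norm_minus_commute)
   have xk: "x = x0 + 1 *\<^sub>R k" unfolding k_def by simp
   have xK: "x\<in>K" using inK[OF _ k, of 1] xk by simp
   \<comment> \<open>\<open>D\<close> is a Lipschitz constant of the transported vector in the end
     point, by \<open>small_gronwall\<close>; \<open>M\<close> collects the coefficients of the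
     terms quadratic in \<open>y\<close> in the estimate of \<open>E'\<close> below.\<close>
   define D where "D = 2*(C' * r + C) * B"
   have D0: "0\<le>D" unfolding D_def using C C' r B0 by simp
   define M where "M = C' * r*D + C' * B + C*D"
   have M0: "0\<le>M" unfolding M_def using C C' r B0 D0 by simp
   have key: "norm (\<Psi> (k + y) 1 - \<Psi> k 1 - L x y (\<Psi> k 1))\<le>2*(\<epsilon> * norm y*r*B + M*(norm y)\<^sup>2)"
    if y: "norm (k + y) < r" and \<epsilon>: "0 < \<epsilon>" and
     tay: "\<And>x h y w. x\<in>K ==> x + h\<in>K ==> norm h\<le>norm y' ==>
    norm (L (x + h) y w - L x y w - dL x h y w)\<le>\<epsilon> * norm h*norm y*norm w" and "y' = y" for y y' \<epsilon>
   proof -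
    define P P' where "P t = \<Psi> k t" and "P' t = \<Psi> (k + y) t" for t
    define xt where "xt t = x0 + t *\<^sub>R k" for t
    have xt: "xt t\<in>K" "xt t + t *\<^sub>R y\<in>K" if "t\<in>{0..1}" for t
     using inK[OF that k] inK[OF that y] unfolding xt_def by (auto simp: algebra_simps)
    have PB: "norm (P t)\<le>B" "norm (P' t)\<le>B" if "t\<in>{0..1}" for t
     using \<Psi>B[OF k that] \<Psi>B[OF y that] unfolding P_def P'_def by auto
    have dP: "(P has_vector_derivative L (xt t) k (P t)) (at t within {0..1})"
     and dP': "(P' has_vector_derivative L (xt t + t *\<^sub>R y) (k + y) (P' t)) (at t within {0..1})"
     if "t\<in>{0..1}" for t
     using \<Psi>[OF k that] \<Psi>[OF y that] unfolding P_def P'_def xt_def by (auto simp: algebra_simps)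
    have ty: "norm (t *\<^sub>R y)\<le>norm y" if "t\<in>{0..1}" for t
     using that mult_left_le_one_le[of "norm y" t] by simp
    have Ladd: "L (xt t + t *\<^sub>R y) (k + y) v = L (xt t + t *\<^sub>R y) k v + L (xt t + t *\<^sub>R y) y v" if "t\<in>{0..1}" for t v
     by (rule linear_add[OF lin1[OF xt(2)[OF that]]])
    have delta: "norm (P' t - P t)\<le>D*norm y" if t: "t\<in>{0..1}" for t
    proof -
     have "norm (P' t - P t)\<le>2*((C' * r + C) * B*norm y)"
     proof (rule small_gronwall[OF _ has_vector_derivative_diff[OF dP' dP] _ t])
      fix s :: real assume s: "s\<in>{0..1}"
      have "L (xt s + s *\<^sub>R y) (k + y) (P' s) - L (xt s) k (P s)
       = L (xt s) k (P' s - P s) + (L (xt s + s *\<^sub>R y) k (P' s) - L (xt s) k (P' s)) + L (xt s + s *\<^sub>R y) y (P' s)"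
       unfolding Ladd[OF s] linear_diff[OF lin2[OF xt(1)[OF s]]] by simp
      also have "norm \<dots>\<le>norm (P' s - P s)/2 + C' * norm y*r*B + C*norm y*B"
      proof (intro norm_triangle_mono)
       show "norm (L (xt s) k (P' s - P s))\<le>norm (P' s - P s)/2" unfolding xt_def by (rule Lk[OF s k])
       have "norm (L (xt s + s *\<^sub>R y) k (P' s) - L (xt s) k (P' s))\<le>C' * norm (s *\<^sub>R y) * norm k*norm (P' s)"
        by (rule lip[OF xt[OF s]])
       also have "\<dots>\<le>C' * norm y*r*B" using C' k ty[OF s] PB[OF s] r by (intro mult_mono) auto
       finally show "norm (L (xt s + s *\<^sub>R y) k (P' s) - L (xt s) k (P' s))\<le>C' * norm y*r*B" .
       have "norm (L (xt s + s *\<^sub>R y) y (P' s))\<le>C*norm y*norm (P' s)" by (rule C(2)[OF xt(2)[OF s]])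
       also have "\<dots>\<le>C*norm y*B" using C PB[OF s] by (intro mult_mono) auto
       finally show "norm (L (xt s + s *\<^sub>R y) y (P' s))\<le>C*norm y*B" .
      qed
      finally show "norm (L (xt s + s *\<^sub>R y) (k + y) (P' s) - L (xt s) k (P s))\<le>norm (P' s - P s)/2 + (C' * r + C) * B*norm y"
       by (simp add: algebra_simps)
     qed (auto simp: P_def P'_def \<Psi>0[OF k] \<Psi>0[OF y])
     then show ?thesis unfolding D_def by (simp add: mult_ac)
    qed
    \<comment> \<open>Moving the end point by \<open>y\<close> moves the radius at time
      \<open>t\<close> by \<open>t *\<^sub>R y\<close>. For a parallel section the vector there
      changes by \<open>t *\<^sub>R L (xt t) y (P t)\<close> to first order; \<open>E\<close> is the
      deviation from this.\<close>
    define E where "E t = P' t - P t - t *\<^sub>R L (xt t) y (P t)" for t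
    define E' where "E' t = L (xt t + t *\<^sub>R y) (k + y) (P' t) - L (xt t) k (P t)
      - (t *\<^sub>R (dL (xt t) k y (P t) + L (xt t) y (L (xt t) k (P t))) + L (xt t) y (P t))" for t
    have dE: "(E has_vector_derivative E' t) (at t within {0..1})" if t: "t\<in>{0..1}" for t
    proof -
     have dLt: "((\<lambda>t. L (xt t) y (P t)) has_vector_derivative (dL (xt t) k y (P t) + L (xt t) y (L (xt t) k (P t)))) (at t within {0..1})"
     proof -
      have a: "((\<lambda>s. L (xt s) y v) has_vector_derivative dL (xt t) k y v) (at t within {0..1})" for v
      proof -
       have "(xt has_derivative (\<lambda>s. s *\<^sub>R k)) (at t within {0..1})"
        unfolding xt_def[abs_def] by (auto intro!: derivative_eq_intros)
       from has_derivative_compose[where f = xt and g = "\<lambda>x. L x y v", OF this der] show ?thesis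
        using xt(1)[OF t] K(3) linear_scale[OF dlin1[OF xt(1)[OF t]]] unfolding has_vector_derivative_def by auto
      qed
      have rep: "L (xt s) y (P s) = (\<Sum>i\<in>Basis. (P s \<bullet> i) *\<^sub>R L (xt s) y i)" if "s\<in>{0..1}" for s
       unfolding linear_scale[OF lin2[OF xt(1)[OF that]], symmetric] linear_sum[OF lin2[OF xt(1)[OF that]], symmetric]
        euclidean_representation ..
      have d1: "((\<lambda>s. \<Sum>i\<in>Basis. (P s \<bullet> i) *\<^sub>R L (xt s) y i) has_vector_derivative
        (\<Sum>i\<in>Basis. (P t \<bullet> i) *\<^sub>R dL (xt t) k y i + (L (xt t) k (P t) \<bullet> i) *\<^sub>R L (xt t) y i)) (at t within {0..1})"
      proof (rule has_vector_derivative_sum)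
       fix i :: 'b
       have "((\<lambda>s. P s \<bullet> i) has_vector_derivative (L (xt t) k (P t) \<bullet> i)) (at t within {0..1})"
        using bounded_linear.has_vector_derivative[OF bounded_linear_inner_left dP[OF t]] .
       then have "((\<lambda>s. P s \<bullet> i) has_real_derivative (L (xt t) k (P t) \<bullet> i)) (at t within {0..1})"
        by (simp add: has_real_derivative_iff_has_vector_derivative)
       from has_vector_derivative_scaleR[OF this a]
       show "((\<lambda>s. (P s \<bullet> i) *\<^sub>R L (xt s) y i) has_vector_derivative
         (P t \<bullet> i) *\<^sub>R dL (xt t) k y i + (L (xt t) k (P t) \<bullet> i) *\<^sub>R L (xt t) y i) (at t within {0..1})" .
      qed
      have d2: "(\<Sum>i\<in>Basis. (P t \<bullet> i) *\<^sub>R dL (xt t) k y i + (L (xt t) k (P t) \<bullet> i) *\<^sub>R L (xt t) y i)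
        = dL (xt t) k y (P t) + L (xt t) y (L (xt t) k (P t))"
       unfolding sum.distrib
       unfolding linear_scale[OF lin2[OF xt(1)[OF t]], symmetric] linear_sum[OF lin2[OF xt(1)[OF t]], symmetric]
        linear_scale[OF dlin3[OF xt(1)[OF t]], symmetric] linear_sum[OF dlin3[OF xt(1)[OF t]], symmetric]
        euclidean_representation ..
      show ?thesis by (rule has_vector_derivative_transform[OF t rep d1[unfolded d2]])
     qed
     have "((\<lambda>t. t *\<^sub>R L (xt t) y (P t)) has_vector_derivative
       t *\<^sub>R (dL (xt t) k y (P t) + L (xt t) y (L (xt t) k (P t))) + 1 *\<^sub>R L (xt t) y (P t)) (at t within {0..1})"
      by (rule has_vector_derivative_scaleR[OF _ dLt]) (auto intro!: derivative_eq_intros)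
     then show ?thesis unfolding E_def[abs_def] E'_def
      by (intro has_vector_derivative_diff dP[OF t] dP'[OF t]) simp
    qed
    have bE: "norm (E' t)\<le>norm (E t)/2 + (\<epsilon> * norm y*r*B + M*(norm y)\<^sup>2)" if t: "t\<in>{0..1}" for t
    proof -
     note xs = xt[OF t]
     define X where "X = xt t"
     have fl: "dL X k y (P t) + L X y (L X k (P t)) = dL X y k (P t) + L X k (L X y (P t))"
      unfolding X_def using flat[of "xt t"] xs K(3) by auto
     \<comment> \<open>Flatness in the form \<open>fl\<close> exchanges \<open>k\<close> and
       \<open>y\<close>. What remains is \<open>L X k (E t)\<close>, to which the Gronwall estimate
       applies, a Taylor remainder, and terms quadratic in \<open>y\<close>.\<close>
     have "E' t = L X k (E t) + (L (X + t *\<^sub>R y) k (P' t) - L X k (P' t) - dL X (t *\<^sub>R y) k (P' t))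
       + t *\<^sub>R dL X y k (P' t - P t) + (L (X + t *\<^sub>R y) y (P' t) - L X y (P' t)) + L X y (P' t - P t)"
     proof -
      have e1: "L X k (E t) = L X k (P' t) - L X k (P t) - t *\<^sub>R L X k (L X y (P t))"
       unfolding E_def X_def linear_diff[OF lin2[OF xs(1)]] linear_scale[OF lin2[OF xs(1)]] ..
      have e2: "dL X (t *\<^sub>R y) k (P' t) = t *\<^sub>R dL X y k (P' t)"
       unfolding X_def by (rule linear_scale[OF dlin1[OF xs(1)]])
      have e3: "dL X y k (P' t - P t) = dL X y k (P' t) - dL X y k (P t)"
       unfolding X_def by (rule linear_diff[OF dlin3[OF xs(1)]])
      have e4: "L X y (P' t - P t) = L X y (P' t) - L X y (P t)"
       unfolding X_def by (rule linear_diff[OF lin2[OF xs(1)]])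
      have e5: "L (X + t *\<^sub>R y) (k + y) (P' t) = L (X + t *\<^sub>R y) k (P' t) + L (X + t *\<^sub>R y) y (P' t)"
       unfolding X_def by (rule Ladd[OF t])
      show ?thesis unfolding E'_def X_def[symmetric] e1 e2 e3 e4 e5 fl
       by (simp add: algebra_simps)
     qed
     also have "norm \<dots>\<le>norm (E t)/2 + \<epsilon> * norm y*r*B + C' * norm y*r*(D*norm y)
       + C' * norm y*norm y*B + C*norm y*(D*norm y)"
     proof (intro norm_triangle_mono)
      show "norm (L X k (E t))\<le>norm (E t)/2" unfolding X_def xt_def by (rule Lk[OF t k])
      have "norm (L (X + t *\<^sub>R y) k (P' t) - L X k (P' t) - dL X (t *\<^sub>R y) k (P' t))\<le>\<epsilon> * norm (t *\<^sub>R y) * norm k*norm (P' t)"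
       unfolding X_def by (rule tay[OF xs]) (use ty[OF t] \<open>y' = y\<close> in simp)
      also have "\<dots>\<le>\<epsilon> * norm y*r*B" using \<epsilon> k ty[OF t] PB[OF t] r by (intro mult_mono) auto
      finally show "norm (L (X + t *\<^sub>R y) k (P' t) - L X k (P' t) - dL X (t *\<^sub>R y) k (P' t))\<le>\<epsilon> * norm y*r*B" .
      have "norm (t *\<^sub>R dL X y k (P' t - P t))\<le>1*norm (dL X y k (P' t - P t))"
       unfolding norm_scaleR using t by (intro mult_right_mono) auto
      also have "\<dots>\<le>C' * norm y*norm k*norm (P' t - P t)" using C'(2)[OF xs(1)] unfolding X_def by simp
      also have "\<dots>\<le>C' * norm y*r*(D*norm y)" using C' k delta[OF t] r by (intro mult_mono) auto
      finally show "norm (t *\<^sub>R dL X y k (P' t - P t))\<le>C' * norm y*r*(D*norm y)" .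
      have "norm (L (X + t *\<^sub>R y) y (P' t) - L X y (P' t))\<le>C' * norm (t *\<^sub>R y) * norm y*norm (P' t)"
       unfolding X_def by (rule lip[OF xs])
      also have "\<dots>\<le>C' * norm y*norm y*B" using C' ty[OF t] PB[OF t] by (intro mult_mono) auto
      finally show "norm (L (X + t *\<^sub>R y) y (P' t) - L X y (P' t))\<le>C' * norm y*norm y*B" .
      have "norm (L X y (P' t - P t))\<le>C*norm y*norm (P' t - P t)" unfolding X_def by (rule C(2)[OF xs(1)])
      also have "\<dots>\<le>C*norm y*(D*norm y)" using C delta[OF t] by (intro mult_left_mono) auto
      finally show "norm (L X y (P' t - P t))\<le>C*norm y*(D*norm y)" .
     qed
     finally show ?thesis unfolding M_def by (simp add: algebra_simps power2_eq_square)
    qed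
    have "norm (E 1)\<le>2*(\<epsilon> * norm y*r*B + M*(norm y)\<^sup>2)"
     by (rule small_gronwall[OF _ dE bE]) (auto simp: E_def P_def P'_def \<Psi>0[OF k] \<Psi>0[OF y])
    moreover have "xt 1 = x" unfolding xt_def using xk by simp
    ultimately show ?thesis unfolding E_def P_def P'_def by simp
   qed
   show ?thesis unfolding has_derivative_at_alt
   proof (intro conjI allI impI)
    show "bounded_linear (\<lambda>h. L x h (w x))" using lin1[OF xK] by (simp add: linear_conv_bounded_linear)
    fix e :: real assume e: "0 < e"
    \<comment> \<open>The Taylor part and the quadratic part of \<open>key\<close> receive half of
      \<open>e\<close> each; the summand 1 only avoids division by 0.\<close>
    define \<epsilon> where "\<epsilon> = e/(4*(r*B + 1))"
    have rB: "0 < r*B + 1" using r B0 by (simp add: add_nonneg_pos)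
    have \<epsilon>: "0 < \<epsilon>" unfolding \<epsilon>_def using e rB by simp
    obtain \<delta> where \<delta>: "\<delta> > 0" "\<And>x h y w. x\<in>K ==> x + h\<in>K ==> norm h < \<delta> ==>
      norm (L (x + h) y w - L x y w - dL x h y w)\<le>\<epsilon> * norm h*norm y*norm w"
     using taylor[OF \<epsilon>] by metis
    define d where "d = min \<delta> (min (r - norm k) (e/(4*(M + 1))))"
    have d0: "0 < d" unfolding d_def using \<delta> k e M0 by simp
    have "norm (w x' - w x - L x (x' - x) (w x))\<le>e*norm (x' - x)" if x': "norm (x' - x) < d" for x'
    proof -
     define y where "y = x' - x"
     have y: "norm y < \<delta>" "norm y < r - norm k" "norm y < e/(4*(M + 1))"
      using x' unfolding y_def d_def by auto
     have ky: "norm (k + y) < r" using y(2) norm_triangle_ineq[of k y] by simp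
     have "norm (\<Psi> (k + y) 1 - \<Psi> k 1 - L x y (\<Psi> k 1))\<le>2*(\<epsilon> * norm y*r*B + M*(norm y)\<^sup>2)"
      by (rule key[OF ky \<epsilon> \<delta>(2) refl]) (use y(1) in auto)
     also have "\<dots> = norm y*(2 * \<epsilon> * (r*B)) + norm y*(2*(M*norm y))" by (simp add: power2_eq_square algebra_simps)
     also have "\<dots>\<le>norm y*(e/2) + norm y*(e/2)"
     proof (intro add_mono mult_left_mono)
      have "2 * \<epsilon> * (r*B)\<le>2 * \<epsilon> * (r*B + 1)" using \<epsilon> by simp
      also have "\<dots> = e/2" unfolding \<epsilon>_def using rB by (simp add: field_simps)
      finally show "2 * \<epsilon> * (r*B)\<le>e/2" .
      have "M*norm y\<le>(M + 1)*(e/(4*(M + 1)))" using y(3) M0 by (intro mult_mono) auto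
      also have "\<dots> = e/4" using M0 by (simp add: divide_simps add_eq_0_iff) (simp add: algebra_simps)?
      finally show "2*(M*norm y)\<le>e/2" by simp
     qed auto
     also have "\<dots> = e*norm y" by simp
     finally show ?thesis unfolding w_def y_def k_def by (simp add: algebra_simps)
    qed
    then show "\<exists>d>0. \<forall>y. norm (y - x) < d --> norm (w y - w x - L x (y - x) (w x))\<le>e*norm (y - x)"
     using d0 by blast
   qed
  qed
  ultimately show ?thesis by blast
 qed
 moreover have "ball x0 r\<subseteq>S" using r R(2) by (meson ball_subset_cball subset_ball subset_trans)
 ultimately show ?thesis using r(1) by blast
qed

section \<open>Continuously differentiable functions\<close>

definition C1_on :: "('a::real_normed_vector => 'b::real_normed_vector) => 'a set => bool" where
 "C1_on f S \<longleftrightarrow> (\<exists>f'. (\<forall>x\<in>S. (f has_derivative f' x) (at x)) \<and> (\<forall>v. continuous_on S (\<lambda>x. f' x v)))"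

lemma C1_onI:
 assumes "\<And>x. x\<in>S ==> (f has_derivative f' x) (at x)" "\<And>v. continuous_on S (\<lambda>x. f' x v)"
 shows "C1_on f S"
 unfolding C1_on_def using assms by blast

lemma C1_on_frechet:
 assumes "C1_on f S"
 shows "\<And>x. x\<in>S ==> (f has_derivative frechet_derivative f (at x)) (at x)"
  and "continuous_on S (\<lambda>x. frechet_derivative f (at x) v)"
proof -
 obtain f' where f': "\<And>x. x\<in>S ==> (f has_derivative f' x) (at x)" "\<And>v. continuous_on S (\<lambda>x. f' x v)"
  using assms unfolding C1_on_def by blast
 have eq: "frechet_derivative f (at x) = f' x" if "x\<in>S" for x
  using frechet_derivative_at[OF f'(1)[OF that]] by simp
 show "\<And>x. x\<in>S ==> (f has_derivative frechet_derivative f (at x)) (at x)" using f'(1) eq by simp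
 show "continuous_on S (\<lambda>x. frechet_derivative f (at x) v)"
  using f'(2)[of v] by (rule continuous_on_eq) (simp add: eq)
qed

lemma C1_on_iff_Ck_on: "C1_on f S \<longleftrightarrow> Ck_on 1 f S"
proof
 assume "C1_on f S"
 then show "Ck_on 1 f S"
  using C1_on_frechet[of f S] unfolding One_nat_def Ck_on.simps differentiable_def by blast
next
 assume "Ck_on 1 f S"
 then show "C1_on f S" unfolding One_nat_def Ck_on.simps
  by (intro C1_onI[where f' = "\<lambda>x. frechet_derivative f (at x)"]) (auto simp: frechet_derivative_works)
qed

lemma C1_on_continuous: "C1_on f S ==> continuous_on S f"
 unfolding C1_on_def by (meson has_derivative_at_withinI has_derivative_continuous_on)

lemma C1_on_subset: "C1_on f S ==> T\<subseteq>S ==> C1_on f T"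
 unfolding C1_on_def by (meson continuous_on_subset subsetD)

lemma C1_on_cong:
 assumes "open S" "C1_on f S" "\<And>x. x\<in>S ==> f x = g x"
 shows "C1_on g S"
 using assms unfolding C1_on_def by (meson has_derivative_transform_within_open)

lemma C1_on_const: "C1_on (\<lambda>x. c) S"
 by (rule C1_onI[where f' = "\<lambda>x v. 0"]) auto

lemma C1_on_bounded_linear:
 assumes "bounded_linear T" "C1_on f S"
 shows "C1_on (\<lambda>x. T (f x)) S"
proof (rule C1_onI[where f' = "\<lambda>x v. T (frechet_derivative f (at x) v)"])
 show "((\<lambda>x. T (f x)) has_derivative (\<lambda>v. T (frechet_derivative f (at x) v))) (at x)" if "x\<in>S" for x
  by (rule bounded_linear.has_derivative[OF assms(1) C1_on_frechet(1)[OF assms(2) that]])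
 show "continuous_on S (\<lambda>x. T (frechet_derivative f (at x) v))" for v
  by (rule bounded_linear.continuous_on[OF assms(1) C1_on_frechet(2)[OF assms(2)]])
qed

lemma C1_on_add:
 assumes "C1_on f S" "C1_on g S"
 shows "C1_on (\<lambda>x. f x + g x) S"
 by (rule C1_onI[where f' = "\<lambda>x v. frechet_derivative f (at x) v + frechet_derivative g (at x) v"])
  (auto intro!: derivative_intros continuous_intros C1_on_frechet[OF assms(1)] C1_on_frechet[OF assms(2)])

lemma C1_on_diff:
 assumes "C1_on f S" "C1_on g S"
 shows "C1_on (\<lambda>x. f x - g x) S"
 by (rule C1_onI[where f' = "\<lambda>x v. frechet_derivative f (at x) v - frechet_derivative g (at x) v"])
  (auto intro!: derivative_intros continuous_intros C1_on_frechet[OF assms(1)] C1_on_frechet[OF assms(2)])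

lemma C1_on_mult:
 fixes f g :: "'a::real_normed_vector => real"
 assumes "C1_on f S" "C1_on g S"
 shows "C1_on (\<lambda>x. f x*g x) S"
 by (rule C1_onI[where f' = "\<lambda>x v. f x*frechet_derivative g (at x) v + frechet_derivative f (at x) v * g x"])
  (auto intro!: derivative_intros continuous_intros C1_on_frechet[OF assms(1)] C1_on_frechet[OF assms(2)]
   C1_on_continuous[OF assms(1)] C1_on_continuous[OF assms(2)])

lemma C1_on_inverse:
 fixes f :: "'a::real_normed_vector => real"
 assumes "C1_on f S" "\<And>x. x\<in>S ==> f x\<noteq>0"
 shows "C1_on (\<lambda>x. inverse (f x)) S"
 by (rule C1_onI[where f' = "\<lambda>x v. - (inverse (f x) * frechet_derivative f (at x) v * inverse (f x))"])
  (auto intro!: Deriv.has_derivative_inverse continuous_intros C1_on_frechet[OF assms(1)]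
   C1_on_continuous[OF assms(1)] dest: assms(2))

lemma C1_on_divide:
 fixes f g :: "'a::real_normed_vector => real"
 assumes "C1_on f S" "C1_on g S" "\<And>x. x\<in>S ==> g x\<noteq>0"
 shows "C1_on (\<lambda>x. f x/g x) S"
 unfolding divide_inverse by (intro C1_on_mult C1_on_inverse assms)

lemma C1_on_sum:
 assumes "\<And>i. i\<in>I ==> C1_on (f i) S"
 shows "C1_on (\<lambda>x. \<Sum>i\<in>I. f i x) S"
 using assms by (induction I rule: infinite_finite_induct) (auto intro: C1_on_const C1_on_add)

lemma C1_on_prod:
 fixes f :: "'i => 'a::real_normed_vector => real"
 assumes "\<And>i. i\<in>I ==> C1_on (f i) S"
 shows "C1_on (\<lambda>x. \<Prod>i\<in>I. f i x) S"
 using assms by (induction I rule: infinite_finite_induct) (auto intro: C1_on_const C1_on_mult)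

lemma C1_on_det:
 fixes A :: "'a::real_normed_vector => real^'n^'n"
 assumes "\<And>i j. C1_on (\<lambda>x. A x$i$j) S"
 shows "C1_on (\<lambda>x. det (A x)) S"
 unfolding det_def by (intro C1_on_sum C1_on_mult C1_on_prod C1_on_const assms)

lemma matrix_inv_right:
 fixes A :: "real^'n^'n"
 assumes "det A\<noteq>0"
 shows "A ** matrix_inv A = mat 1"
proof -
 have "\<exists>B. A ** B = mat 1 \<and> B ** A = mat 1" using assms by (simp add: invertible_det_nz[symmetric] invertible_def)
 then have "A ** matrix_inv A = mat 1 \<and> matrix_inv A ** A = mat 1" unfolding matrix_inv_def by (rule someI_ex)
 then show ?thesis ..
qed

text \<open>By Cramer's rule each entry of the inverse is a quotient of two determinants.\<close>

lemma C1_on_matrix_inv: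
 fixes A :: "'a::real_normed_vector => real^'n^'n"
 assumes S: "open S" and A: "\<And>i j. C1_on (\<lambda>x. A x$i$j) S" and nz: "\<And>x. x\<in>S ==> det (A x)\<noteq>0"
 shows "C1_on (\<lambda>x. matrix_inv (A x)$k$l) S"
proof (rule C1_on_cong[OF S])
 define B where "B x = (\<chi> i j. if j = k then (axis l 1 :: real^'n)$i else A x$i$j)" for x
 show "C1_on (\<lambda>x. det (B x)/det (A x)) S"
 proof (intro C1_on_divide C1_on_det A nz)
  show "C1_on (\<lambda>x. B x$i$j) S" for i j
   unfolding B_def by (cases "j = k") (auto intro: C1_on_const A)
 qed
 fix x assume x: "x\<in>S"
 have "A x *v (matrix_inv (A x) *v axis l 1) = axis l 1"
  by (simp add: matrix_vector_mul_assoc matrix_inv_right[OF nz[OF x]])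
 then have "matrix_inv (A x) *v axis l 1 = (\<chi> k. det (\<chi> i j. if j = k then (axis l 1 :: real^'n)$i else A x$i$j)/det (A x))"
  using cramer[OF nz[OF x]] by blast
 then have "(matrix_inv (A x) *v axis l 1)$k = det (B x)/det (A x)" unfolding B_def by simp
 moreover have "(matrix_inv (A x) *v axis l 1)$k = matrix_inv (A x)$k$l"
  by (simp add: matrix_vector_mult_basis column_def)
 ultimately show "det (B x)/det (A x) = matrix_inv (A x)$k$l" by simp
qed

text \<open>The second difference of \<open>f\<close> over the parallelogram spanned by
  \<open>t u\<close> and \<open>t v\<close> is symmetric in \<open>u\<close> and \<open>v\<close>.
  Two applications of the mean value theorem express it by \<open>f''\<close> at a nearby point in
  one order of the arguments, and exchanging the roles of \<open>u\<close> and \<open>v\<close>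
  gives the other order.\<close>

lemma mixed_derivatives_commute:
 fixes f :: "'a::real_normed_vector => real"
 assumes S: "open S" "x\<in>S" and f1: "\<And>z. z\<in>S ==> (f has_derivative f' z) (at z)"
  and f2: "\<And>z v. z\<in>S ==> ((\<lambda>z. f' z v) has_derivative (\<lambda>h. f'' z h v)) (at z)"
  and cont: "\<And>h v. continuous_on S (\<lambda>z. f'' z h v)"
 shows "f'' x u v = f'' x v u"
proof -
 have main: "\<exists>p\<in>ball x e. (f (x + t *\<^sub>R u + t *\<^sub>R v) - f (x + t *\<^sub>R u)) - (f (x + t *\<^sub>R v) - f x) = t*t*f'' p v u"
  if e: "0 < e" "ball x e\<subseteq>S" and t: "0 < t" "t*(norm u + norm v) < e" for u v e t
 proof -
  have inb: "x + s *\<^sub>R u + r *\<^sub>R v\<in>ball x e" if "0\<le>s" "s\<le>t" "0\<le>r" "r\<le>t" for s r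
  proof -
   have "norm (s *\<^sub>R u + r *\<^sub>R v)\<le>s*norm u + r*norm v"
    using norm_triangle_ineq[of "s *\<^sub>R u" "r *\<^sub>R v"] that by simp
   also have "\<dots>\<le>t*norm u + t*norm v" using that by (intro add_mono mult_right_mono) auto
   also have "\<dots> < e" using t by (simp add: algebra_simps)
   finally have n: "norm (s *\<^sub>R u + r *\<^sub>R v) < e" .
   have "dist x (x + w) = norm w" for w :: 'a by (simp add: dist_norm)
   then show ?thesis using n by (simp add: add.assoc)
  qed
  define \<phi> where "\<phi> s = f (x + s *\<^sub>R u + t *\<^sub>R v) - f (x + s *\<^sub>R u + 0 *\<^sub>R v)" for s
  have l1: "((\<lambda>s. f (x + s *\<^sub>R u + r *\<^sub>R v)) has_derivative (\<lambda>h. f' (x + s *\<^sub>R u + r *\<^sub>R v) (h *\<^sub>R u))) (at s within T)"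
   if "0\<le>s" "s\<le>t" "0\<le>r" "r\<le>t" for s r T
   by (rule has_derivative_compose[where f = "\<lambda>s. x + s *\<^sub>R u + r *\<^sub>R v" and g = f])
    (use inb[OF that] e f1 in \<open>auto intro!: derivative_eq_intros\<close>)
  have "\<exists>\<xi>\<in>{0<..<t}. \<phi> t - \<phi> 0 = (f' (x + \<xi> *\<^sub>R u + t *\<^sub>R v) ((t - 0) *\<^sub>R u) - f' (x + \<xi> *\<^sub>R u + 0 *\<^sub>R v) ((t - 0) *\<^sub>R u))"
   unfolding \<phi>_def by (rule mvt_simple[OF t(1)]) (intro has_derivative_diff l1; use t in simp)
  then obtain \<xi> where \<xi>: "0 < \<xi>" "\<xi> < t"
   "\<phi> t - \<phi> 0 = f' (x + \<xi> *\<^sub>R u + t *\<^sub>R v) (t *\<^sub>R u) - f' (x + \<xi> *\<^sub>R u + 0 *\<^sub>R v) (t *\<^sub>R u)" by auto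
  have l2: "((\<lambda>r. f' (x + \<xi> *\<^sub>R u + r *\<^sub>R v) (t *\<^sub>R u)) has_derivative (\<lambda>h. f'' (x + \<xi> *\<^sub>R u + r *\<^sub>R v) (h *\<^sub>R v) (t *\<^sub>R u))) (at r within T)"
   if "0\<le>r" "r\<le>t" for r T
   by (rule has_derivative_compose[where f = "\<lambda>r. x + \<xi> *\<^sub>R u + r *\<^sub>R v" and g = "\<lambda>z. f' z (t *\<^sub>R u)"])
    (use inb[of \<xi> r] that \<xi> e f2 in \<open>auto intro!: derivative_eq_intros\<close>)
  have "\<exists>\<eta>\<in>{0<..<t}. f' (x + \<xi> *\<^sub>R u + t *\<^sub>R v) (t *\<^sub>R u) - f' (x + \<xi> *\<^sub>R u + 0 *\<^sub>R v) (t *\<^sub>R u)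
    = f'' (x + \<xi> *\<^sub>R u + \<eta> *\<^sub>R v) ((t - 0) *\<^sub>R v) (t *\<^sub>R u)"
   by (rule mvt_simple[OF t(1)]) (intro l2; use t in simp)
  then obtain \<eta> where \<eta>: "0 < \<eta>" "\<eta> < t"
   "f' (x + \<xi> *\<^sub>R u + t *\<^sub>R v) (t *\<^sub>R u) - f' (x + \<xi> *\<^sub>R u + 0 *\<^sub>R v) (t *\<^sub>R u) = f'' (x + \<xi> *\<^sub>R u + \<eta> *\<^sub>R v) (t *\<^sub>R v) (t *\<^sub>R u)" by auto
  define p where "p = x + \<xi> *\<^sub>R u + \<eta> *\<^sub>R v"
  have p: "p\<in>ball x e" unfolding p_def using inb[of \<xi> \<eta>] \<xi> \<eta> by simp
  then have pS: "p\<in>S" using e by auto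
  have "(\<lambda>h. f'' p h (t *\<^sub>R u)) = (\<lambda>h. t*f'' p h u)"
  proof (rule has_derivative_unique)
   show "((\<lambda>z. f' z (t *\<^sub>R u)) has_derivative (\<lambda>h. f'' p h (t *\<^sub>R u))) (at p)" by (rule f2[OF pS])
   have "((\<lambda>z. t*f' z u) has_derivative (\<lambda>h. t*f'' p h u)) (at p)" by (intro derivative_intros f2[OF pS])
   then show "((\<lambda>z. f' z (t *\<^sub>R u)) has_derivative (\<lambda>h. t*f'' p h u)) (at p)"
    by (rule has_derivative_transform_within_open[OF _ S(1) pS])
     (use linear_scale[OF has_derivative_linear[OF f1]] in auto)
  qed
  then have "f'' p (t *\<^sub>R v) (t *\<^sub>R u) = t*(t*f'' p v u)"
   using linear_scale[OF has_derivative_linear[OF f2[OF pS]]] by (metis real_scaleR_def)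
  then show ?thesis using p \<xi>(3) \<eta>(3) unfolding p_def[symmetric] \<phi>_def by (auto simp: mult.assoc)
 qed
 have "\<bar>f'' x u v - f'' x v u\<bar>\<le>2 * \<epsilon>" if \<epsilon>: "0 < \<epsilon>" for \<epsilon>
 proof -
  have c: "\<exists>e>0. ball x e\<subseteq>S \<and> (\<forall>p\<in>ball x e. \<bar>f'' p h w - f'' x h w\<bar> < \<epsilon>)" for h w
  proof -
   have "isCont (\<lambda>z. f'' z h w) x" using cont S by (simp add: continuous_on_eq_continuous_at)
   then obtain d where d: "d > 0" "\<And>p. dist p x < d ==> dist (f'' p h w) (f'' x h w) < \<epsilon>"
    using \<epsilon> unfolding continuous_at_eps_delta by metis
   obtain d' where d': "d' > 0" "ball x d'\<subseteq>S" using S open_contains_ball by blast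
   show ?thesis using d d' by (intro exI[of _ "min d d'"]) (auto simp: dist_commute dist_real_def)
  qed
  obtain e1 where e1: "0 < e1" "ball x e1\<subseteq>S" "\<And>p. p\<in>ball x e1 ==> \<bar>f'' p v u - f'' x v u\<bar> < \<epsilon>"
   using c[of v u] by blast
  obtain e2 where e2: "0 < e2" "ball x e2\<subseteq>S" "\<And>p. p\<in>ball x e2 ==> \<bar>f'' p u v - f'' x u v\<bar> < \<epsilon>"
   using c[of u v] by blast
  define N where "N = norm u + norm v"
  define t where "t = min e1 e2/(2*(N + 1))"
  have N: "0\<le>N" unfolding N_def by simp
  have t: "0 < t" unfolding t_def using e1 e2 N by simp
  have "t*N\<le>t*(N + 1)" using t by simp
  also have "\<dots> = min e1 e2/2" unfolding t_def using N by (simp add: field_simps)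
  also have "\<dots> < min e1 e2"
  proof -
   have "0 < min e1 e2" using e1(1) e2(1) by simp
   then show ?thesis by linarith
  qed
  finally have tN: "t*N < e1" "t*N < e2" by auto
  obtain p where p: "p\<in>ball x e1" "(f (x + t *\<^sub>R u + t *\<^sub>R v) - f (x + t *\<^sub>R u)) - (f (x + t *\<^sub>R v) - f x) = t*t*f'' p v u"
   using main[OF e1(1,2) t, of u v] tN unfolding N_def by auto
  obtain q where q: "q\<in>ball x e2" "(f (x + t *\<^sub>R v + t *\<^sub>R u) - f (x + t *\<^sub>R v)) - (f (x + t *\<^sub>R u) - f x) = t*t*f'' q u v"
   using main[OF e2(1,2) t, of v u] tN unfolding N_def by (auto simp: add.commute)
  have eq: "x + t *\<^sub>R v + t *\<^sub>R u = x + t *\<^sub>R u + t *\<^sub>R v" by simp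
  have "t*t*f'' p v u = t*t*f'' q u v" using p(2) q(2)[unfolded eq] by linarith
  then have "f'' p v u = f'' q u v" using t by simp
  then show ?thesis using e1(3)[OF p(1)] e2(3)[OF q(1)] by linarith
 qed
 then have "\<bar>f'' x u v - f'' x v u\<bar>\<le>0 + e" if "0 < e" for e using that half_gt_zero[OF that] by fastforce
 then have "\<bar>f'' x u v - f'' x v u\<bar>\<le>0" by (rule field_le_epsilon)
 then show ?thesis by simp
qed


section \<open>The Levi-Civita connection in a chart\<close>

lemma vec_expand: "(x :: real^'n) = (\<Sum>i\<in>UNIV. (x$i) *\<^sub>R axis i 1)"
 using basis_expansion[of x] by (simp add: scalar_mult_eq_scaleR)

locale hyp_chart =
 fixes M :: "('a, 'n::finite) riem" and c :: "('a, 'n) chart"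
 assumes riem: "riemannian_manifold M" and curv: "constant_curvature M (-1)" and c: "c\<in>man_atlas M"
begin

definition S :: "(real^'n) set" where "S = chart_img c"
definition g :: "real^'n => real^'n => real^'n => real" where "g = inner_at M c"
definition G :: "real^'n => real^'n^'n" where "G = man_metric M c"
definition dG :: "real^'n => real^'n => real^'n^'n" where "dG x = frechet_derivative G (at x)"
definition dg :: "real^'n => real^'n => real^'n => real^'n => real" where "dg x h y z = y \<bullet> (dG x h *v z)"

lemma g_eq: "g x y z = y \<bullet> (G x *v z)"
 unfolding g_def G_def inner_at_def ..

lemma open_S: "open S"
 using riem c unfolding riemannian_manifold_def smooth_atlas_def S_def by blast

lemma Ck_G: "Ck_on k G S"
 using riem c unfolding riemannian_manifold_def smooth_on_def S_def G_def by blast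

lemma transpose_G: "x\<in>S ==> transpose (G x) = G x"
 and pos_G: "x\<in>S ==> y\<noteq>0 ==> 0 < y \<bullet> (G x *v y)"
 using riem c unfolding riemannian_manifold_def S_def G_def by blast+

lemma g_pos: "x\<in>S ==> y\<noteq>0 ==> 0 < g x y y"
 unfolding g_eq by (rule pos_G)

lemma G_sym: "x\<in>S ==> G x$i$j = G x$j$i"
 using transpose_G[of x] unfolding transpose_def by (metis vec_lambda_beta)

lemma g_sym: "x\<in>S ==> g x y z = g x z y"
 unfolding g_eq using transpose_G[of x]
 by (metis dot_lmul_matrix inner_commute vector_transpose_matrix)

lemma bilinear_g: "bilinear (g x)"
 unfolding bilinear_def g_eq
 by (auto intro!: linearI simp: inner_add_left inner_add_right matrix_vector_right_distrib matrix_vector_mult_scaleR)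

lemma bilinear_dg: "bilinear (dg x h)"
 unfolding bilinear_def dg_def
 by (auto intro!: linearI simp: inner_add_left inner_add_right matrix_vector_right_distrib matrix_vector_mult_scaleR)

lemma G_derivative: "x\<in>S ==> (G has_derivative dG x) (at x)"
 and C1_dG: "C1_on (\<lambda>x. dG x h) S"
proof -
 have "Ck_on 1 G S" by (rule Ck_G)
 then show "x\<in>S ==> (G has_derivative dG x) (at x)"
  unfolding C1_on_iff_Ck_on[symmetric] dG_def by (rule C1_on_frechet)
 have "Ck_on (Suc 1) G S" by (rule Ck_G)
 then show "C1_on (\<lambda>x. dG x h) S" unfolding C1_on_iff_Ck_on dG_def by simp
qed

lemma C1_G: "C1_on G S"
 using Ck_G[of 1] unfolding C1_on_iff_Ck_on .

lemma C1_G_entry: "C1_on (\<lambda>x. G x$i$j) S"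
 using C1_on_bounded_linear[OF bounded_linear_vec_nth C1_on_bounded_linear[OF bounded_linear_vec_nth C1_G]] .

lemma C1_dG_entry: "C1_on (\<lambda>x. dG x h$i$j) S"
 using C1_on_bounded_linear[OF bounded_linear_vec_nth C1_on_bounded_linear[OF bounded_linear_vec_nth C1_dG]] .

lemma G_entry_derivative: "x\<in>S ==> ((\<lambda>x. G x$i$j) has_derivative (\<lambda>h. dG x h$i$j)) (at x)"
 by (intro bounded_linear.has_derivative[OF bounded_linear_vec_nth] G_derivative)

lemma pderiv_G: "x\<in>S ==> pderiv_at k (\<lambda>z. G z$i$j) x = dG x (axis k 1)$i$j"
 unfolding pderiv_at_def using frechet_derivative_at[OF G_entry_derivative] by metis

lemma dG_sym: "x\<in>S ==> dG x h$i$j = dG x h$j$i"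
proof -
 assume x: "x\<in>S"
 have "((\<lambda>x. G x$i$j) has_derivative (\<lambda>h. dG x h$j$i)) (at x)"
  by (rule has_derivative_transform_within_open[OF G_entry_derivative[OF x] open_S x]) (rule G_sym)
 then have "(\<lambda>h. dG x h$j$i) = (\<lambda>h. dG x h$i$j)"
  by (rule has_derivative_unique) (rule G_entry_derivative[OF x])
 then show ?thesis by metis
qed

lemma det_G: "x\<in>S ==> det (G x)\<noteq>0"
proof -
 assume x: "x\<in>S"
 have "\<And>y. G x *v y = 0 ==> y = 0" using pos_G[OF x] by (metis inner_zero_right less_irrefl)
 then show ?thesis by (metis invertible_det_nz invertible_left_inverse matrix_left_invertible_ker)
qed

lemma christoffel_eq: "x\<in>S ==> christoffel M c x k i j =
   (\<Sum>l\<in>UNIV. matrix_inv (G x)$k$l*(dG x (axis i 1)$j$l + dG x (axis j 1)$i$l - dG x (axis l 1)$i$j))/2"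
 unfolding christoffel_def G_def[symmetric] by (simp add: pderiv_G)

lemma christoffel_sym: "x\<in>S ==> christoffel M c x k i j = christoffel M c x k j i"
 by (simp add: christoffel_eq dG_sym[of x _ j i] add.commute)

lemma C1_christoffel: "C1_on (\<lambda>x. christoffel M c x k i j) S"
proof (rule C1_on_cong[OF open_S])
 show "C1_on (\<lambda>x. (\<Sum>l\<in>UNIV. matrix_inv (G x)$k$l*(dG x (axis i 1)$j$l + dG x (axis j 1)$i$l - dG x (axis l 1)$i$j))*(1/2)) S"
  by (intro C1_on_mult C1_on_sum C1_on_add C1_on_diff C1_on_const C1_dG_entry C1_on_matrix_inv open_S C1_G_entry det_G)
qed (simp add: christoffel_eq)

text \<open>The Christoffel symbols as a bilinear map. The sum over basis vectors lets derivatives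
  and continuity be treated coefficient by coefficient.\<close>

definition \<Gamma> :: "real^'n => real^'n => real^'n => real^'n" where
 "\<Gamma> x y z = (\<Sum>k\<in>UNIV. (\<Sum>i\<in>UNIV. \<Sum>j\<in>UNIV. christoffel M c x k i j*y$i*z$j) *\<^sub>R axis k 1)"

definition dchr where "dchr x k i j = frechet_derivative (\<lambda>x. christoffel M c x k i j) (at x)"

definition d\<Gamma> :: "real^'n => real^'n => real^'n => real^'n => real^'n" where
 "d\<Gamma> x h y z = (\<Sum>k\<in>UNIV. (\<Sum>i\<in>UNIV. \<Sum>j\<in>UNIV. dchr x k i j h*y$i*z$j) *\<^sub>R axis k 1)"

lemma sum_axis_nth: "(\<Sum>k\<in>UNIV. f k *\<^sub>R axis k (1::real))$l = f l"
 by (simp add: axis_def if_distrib cong: if_cong)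

lemma \<Gamma>_nth: "\<Gamma> x y z$k = (\<Sum>i\<in>UNIV. \<Sum>j\<in>UNIV. christoffel M c x k i j*y$i*z$j)"
 unfolding \<Gamma>_def sum_axis_nth ..

lemma d\<Gamma>_nth: "d\<Gamma> x h y z$k = (\<Sum>i\<in>UNIV. \<Sum>j\<in>UNIV. dchr x k i j h*y$i*z$j)"
 unfolding d\<Gamma>_def sum_axis_nth ..

lemma bilinear_\<Gamma>: "bilinear (\<Gamma> x)"
 unfolding bilinear_def
 by (auto intro!: linearI simp: vec_eq_iff \<Gamma>_nth algebra_simps sum.distrib sum_distrib_left)

lemma bilinear_d\<Gamma>: "bilinear (d\<Gamma> x h)"
 unfolding bilinear_def
 by (auto intro!: linearI simp: vec_eq_iff d\<Gamma>_nth algebra_simps sum.distrib sum_distrib_left)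

lemma \<Gamma>_sym: "x\<in>S ==> \<Gamma> x y z = \<Gamma> x z y"
 unfolding vec_eq_iff \<Gamma>_nth
 by (subst sum.swap) (simp add: christoffel_sym[of x] mult_ac)

lemma chr_derivative: "x\<in>S ==> ((\<lambda>x. christoffel M c x k i j) has_derivative dchr x k i j) (at x)"
 unfolding dchr_def by (rule C1_on_frechet(1)[OF C1_christoffel])

lemma continuous_dchr: "continuous_on S (\<lambda>x. dchr x k i j h)"
 unfolding dchr_def by (rule C1_on_frechet(2)[OF C1_christoffel])

lemma \<Gamma>_derivative: "x\<in>S ==> ((\<lambda>x. \<Gamma> x y z) has_derivative (\<lambda>h. d\<Gamma> x h y z)) (at x)"
 unfolding \<Gamma>_def d\<Gamma>_def
 by (intro has_derivative_sum has_derivative_scaleR_left has_derivative_mult_left chr_derivative)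

lemma continuous_d\<Gamma>: "continuous_on S (\<lambda>x. d\<Gamma> x h y z)"
 unfolding d\<Gamma>_def by (intro continuous_intros continuous_dchr)

lemma d\<Gamma>_sym: "x\<in>S ==> d\<Gamma> x h y z = d\<Gamma> x h z y"
proof -
 assume x: "x\<in>S"
 have "((\<lambda>x. \<Gamma> x y z) has_derivative (\<lambda>h. d\<Gamma> x h z y)) (at x)"
  by (rule has_derivative_transform_within_open[OF \<Gamma>_derivative[OF x] open_S x]) (rule \<Gamma>_sym)
 then have "(\<lambda>h. d\<Gamma> x h z y) = (\<lambda>h. d\<Gamma> x h y z)"
  by (rule has_derivative_unique) (rule \<Gamma>_derivative[OF x])
 then show ?thesis by metis
qed

lemma g_derivative: "x\<in>S ==> ((\<lambda>x. g x y z) has_derivative (\<lambda>h. dg x h y z)) (at x)"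
proof -
 assume x: "x\<in>S"
 have "linear (\<lambda>A::real^'n^'n. y \<bullet> (A *v z))"
  by (intro linearI) (simp_all add: matrix_vector_mult_add_rdistrib inner_add_right scaleR_matrix_vector_assoc[symmetric])
 then have "bounded_linear (\<lambda>A::real^'n^'n. y \<bullet> (A *v z))" by (simp add: linear_conv_bounded_linear)
 from bounded_linear.has_derivative[OF this G_derivative[OF x]]
 show ?thesis unfolding g_eq dg_def .
qed

lemma dG_linear: "x\<in>S ==> dG x h = (\<Sum>i\<in>UNIV. h$i *\<^sub>R dG x (axis i 1))"
proof -
 assume x: "x\<in>S"
 have l: "linear (dG x)" using G_derivative[OF x] by (rule has_derivative_linear)
 have "dG x h = dG x (\<Sum>i\<in>UNIV. h$i *\<^sub>R axis i 1)" using vec_expand[of h] by simp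
 then show ?thesis unfolding linear_sum[OF l] linear_scale[OF l] .
qed

lemma dg_expand: "x\<in>S ==> dg x h y z = (\<Sum>i\<in>UNIV. \<Sum>j\<in>UNIV. \<Sum>l\<in>UNIV. h$l*y$i*z$j*dG x (axis l 1)$i$j)"
proof -
 assume x: "x\<in>S"
 have e: "dG x h$i$j = (\<Sum>l\<in>UNIV. h$l*dG x (axis l 1)$i$j)" for i j
  by (subst dG_linear[OF x]) simp
 show ?thesis unfolding dg_def inner_vec_def matrix_vector_mult_def
  by (simp add: e sum_distrib_left sum_distrib_right mult_ac)
qed

lemma dg_sym: "x\<in>S ==> dg x h y z = dg x h z y"
 unfolding dg_expand by (subst sum.swap) (simp add: dG_sym[of x] mult_ac)

text \<open>The Koszul formula for constant coordinate fields.\<close>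

lemma g_\<Gamma>: "x\<in>S ==> g x w (\<Gamma> x y z) = (dg x y z w + dg x z y w - dg x w y z)/2"
proof -
 assume x: "x\<in>S"
 \<comment> \<open>\<open>T\<close> is the vector \<open>\<Gamma> x y z\<close> with its index
   lowered: \<open>G x\<close> cancels the inverse matrix in the Christoffel symbols.\<close>
 define T where "T = (\<chi> l. (\<Sum>i\<in>UNIV. \<Sum>j\<in>UNIV. y$i*z$j *
   (dG x (axis i 1)$j$l + dG x (axis j 1)$i$l - dG x (axis l 1)$i$j))/2)"
 have "\<Gamma> x y z = matrix_inv (G x) *v T"
 proof (rule vec_eq_iff[THEN iffD2, rule_format])
  fix k
  have "\<Gamma> x y z$k = (\<Sum>i\<in>UNIV. \<Sum>j\<in>UNIV. \<Sum>l\<in>UNIV. matrix_inv (G x)$k$l*(y$i*z$j *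
   (dG x (axis i 1)$j$l + dG x (axis j 1)$i$l - dG x (axis l 1)$i$j)/2))"
   unfolding \<Gamma>_nth christoffel_eq[OF x] by (simp add: sum_distrib_left sum_distrib_right sum_divide_distrib mult_ac)
  also have "\<dots> = (\<Sum>i\<in>UNIV. \<Sum>l\<in>UNIV. \<Sum>j\<in>UNIV. matrix_inv (G x)$k$l*(y$i*z$j *
   (dG x (axis i 1)$j$l + dG x (axis j 1)$i$l - dG x (axis l 1)$i$j)/2))"
   by (intro sum.cong refl sum.swap)
  also have "\<dots> = (\<Sum>l\<in>UNIV. \<Sum>i\<in>UNIV. \<Sum>j\<in>UNIV. matrix_inv (G x)$k$l*(y$i*z$j *
   (dG x (axis i 1)$j$l + dG x (axis j 1)$i$l - dG x (axis l 1)$i$j)/2))"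
   by (rule sum.swap)
  also have "\<dots> = (matrix_inv (G x) *v T)$k"
   unfolding matrix_vector_mult_def T_def by (simp add: sum_distrib_left sum_divide_distrib)
  finally show "\<Gamma> x y z$k = (matrix_inv (G x) *v T)$k" .
 qed
 then have "G x *v \<Gamma> x y z = T"
  by (simp add: matrix_vector_mul_assoc matrix_inv_right[OF det_G[OF x]])
 then have "g x w (\<Gamma> x y z) = (\<Sum>l\<in>UNIV. w$l*T$l)" unfolding g_eq inner_vec_def by simp
 also have "\<dots> = (\<Sum>l\<in>UNIV. \<Sum>i\<in>UNIV. \<Sum>j\<in>UNIV. (y$i*z$j*w$l*dG x (axis i 1)$j$l
   + z$j*y$i*w$l*dG x (axis j 1)$i$l - w$l*y$i*z$j*dG x (axis l 1)$i$j)/2)"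
  unfolding T_def by (simp add: sum_distrib_left sum_divide_distrib algebra_simps)
 also have "\<dots> = ((\<Sum>l\<in>UNIV. \<Sum>i\<in>UNIV. \<Sum>j\<in>UNIV. y$i*z$j*w$l*dG x (axis i 1)$j$l)
   + (\<Sum>l\<in>UNIV. \<Sum>i\<in>UNIV. \<Sum>j\<in>UNIV. z$j*y$i*w$l*dG x (axis j 1)$i$l)
   - (\<Sum>l\<in>UNIV. \<Sum>i\<in>UNIV. \<Sum>j\<in>UNIV. w$l*y$i*z$j*dG x (axis l 1)$i$j))/2"
  by (simp only: sum.distrib sum_subtractf sum_divide_distrib[symmetric])
 also have "(\<Sum>l\<in>UNIV. \<Sum>i\<in>UNIV. \<Sum>j\<in>UNIV. y$i*z$j*w$l*dG x (axis i 1)$j$l) = dg x y z w"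
 proof -
  have "dg x y z w = (\<Sum>j\<in>UNIV. \<Sum>l\<in>UNIV. \<Sum>i\<in>UNIV. y$i*z$j*w$l*dG x (axis i 1)$j$l)"
   by (rule dg_expand[OF x])
  also have "\<dots> = (\<Sum>l\<in>UNIV. \<Sum>j\<in>UNIV. \<Sum>i\<in>UNIV. y$i*z$j*w$l*dG x (axis i 1)$j$l)"
   by (rule sum.swap)
  also have "\<dots> = (\<Sum>l\<in>UNIV. \<Sum>i\<in>UNIV. \<Sum>j\<in>UNIV. y$i*z$j*w$l*dG x (axis i 1)$j$l)"
   by (intro sum.cong refl sum.swap)
  finally show ?thesis by simp
 qed
 also have "(\<Sum>l\<in>UNIV. \<Sum>i\<in>UNIV. \<Sum>j\<in>UNIV. z$j*y$i*w$l*dG x (axis j 1)$i$l) = dg x z y w"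
 proof -
  have "dg x z y w = (\<Sum>i\<in>UNIV. \<Sum>l\<in>UNIV. \<Sum>j\<in>UNIV. z$j*y$i*w$l*dG x (axis j 1)$i$l)"
   by (rule dg_expand[OF x])
  also have "\<dots> = (\<Sum>l\<in>UNIV. \<Sum>i\<in>UNIV. \<Sum>j\<in>UNIV. z$j*y$i*w$l*dG x (axis j 1)$i$l)"
   by (rule sum.swap)
  finally show ?thesis by simp
 qed
 also have "(\<Sum>l\<in>UNIV. \<Sum>i\<in>UNIV. \<Sum>j\<in>UNIV. w$l*y$i*z$j*dG x (axis l 1)$i$j) = dg x w y z"
 proof -
  have "dg x w y z = (\<Sum>i\<in>UNIV. \<Sum>j\<in>UNIV. \<Sum>l\<in>UNIV. w$l*y$i*z$j*dG x (axis l 1)$i$j)"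
   by (rule dg_expand[OF x])
  also have "\<dots> = (\<Sum>i\<in>UNIV. \<Sum>l\<in>UNIV. \<Sum>j\<in>UNIV. w$l*y$i*z$j*dG x (axis l 1)$i$j)"
   by (intro sum.cong refl sum.swap)
  also have "\<dots> = (\<Sum>l\<in>UNIV. \<Sum>i\<in>UNIV. \<Sum>j\<in>UNIV. w$l*y$i*z$j*dG x (axis l 1)$i$j)"
   by (rule sum.swap)
  finally show ?thesis by simp
 qed
 finally show ?thesis .
qed

lemma metric_compatible: "x\<in>S ==> dg x h y z = g x (\<Gamma> x h y) z + g x y (\<Gamma> x h z)"
 unfolding g_sym[of x "\<Gamma> x h y" z] by (simp add: g_\<Gamma> dg_sym[of x] add_divide_distrib diff_divide_distrib)


lemma g_lin [simp]:
 "g x (y + z) w = g x y w + g x z w" "g x (y - z) w = g x y w - g x z w" "g x (- y) w = - g x y w"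
 "g x (a *\<^sub>R y) w = a*g x y w" "g x 0 w = 0"
 "g x w (y + z) = g x w y + g x w z" "g x w (y - z) = g x w y - g x w z" "g x w (- y) = - g x w y"
 "g x w (a *\<^sub>R y) = a*g x w y" "g x w 0 = 0"
 using bilinear_g[of x]
 by (simp_all add: bilinear_ladd bilinear_radd bilinear_lsub bilinear_rsub bilinear_lmul bilinear_rmul
   bilinear_lneg bilinear_rneg bilinear_lzero bilinear_rzero)

lemma \<Gamma>_lin [simp]:
 "\<Gamma> x (y + z) w = \<Gamma> x y w + \<Gamma> x z w" "\<Gamma> x (y - z) w = \<Gamma> x y w - \<Gamma> x z w" "\<Gamma> x (- y) w = - \<Gamma> x y w"
 "\<Gamma> x (a *\<^sub>R y) w = a *\<^sub>R \<Gamma> x y w" "\<Gamma> x 0 w = 0"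
 "\<Gamma> x w (y + z) = \<Gamma> x w y + \<Gamma> x w z" "\<Gamma> x w (y - z) = \<Gamma> x w y - \<Gamma> x w z" "\<Gamma> x w (- y) = - \<Gamma> x w y"
 "\<Gamma> x w (a *\<^sub>R y) = a *\<^sub>R \<Gamma> x w y" "\<Gamma> x w 0 = 0"
 using bilinear_\<Gamma>[of x]
 by (simp_all add: bilinear_ladd bilinear_radd bilinear_lsub bilinear_rsub bilinear_lmul bilinear_rmul
   bilinear_lneg bilinear_rneg bilinear_lzero bilinear_rzero)

lemma d\<Gamma>_lin [simp]:
 "d\<Gamma> x h (y + z) w = d\<Gamma> x h y w + d\<Gamma> x h z w" "d\<Gamma> x h (y - z) w = d\<Gamma> x h y w - d\<Gamma> x h z w"
 "d\<Gamma> x h (a *\<^sub>R y) w = a *\<^sub>R d\<Gamma> x h y w"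
 "d\<Gamma> x h w (y + z) = d\<Gamma> x h w y + d\<Gamma> x h w z" "d\<Gamma> x h w (y - z) = d\<Gamma> x h w y - d\<Gamma> x h w z"
 "d\<Gamma> x h w (a *\<^sub>R y) = a *\<^sub>R d\<Gamma> x h w y"
 using bilinear_d\<Gamma>[of x h]
 by (simp_all add: bilinear_ladd bilinear_radd bilinear_lsub bilinear_rsub bilinear_lmul bilinear_rmul)

lemma d\<Gamma>_lin1:
 assumes "x\<in>S"
 shows "d\<Gamma> x (y + z) v w = d\<Gamma> x y v w + d\<Gamma> x z v w" "d\<Gamma> x (a *\<^sub>R y) v w = a *\<^sub>R d\<Gamma> x y v w"
proof -
 have l: "linear (\<lambda>h. d\<Gamma> x h v w)" by (rule has_derivative_linear[OF \<Gamma>_derivative[OF assms]])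
 show "d\<Gamma> x (y + z) v w = d\<Gamma> x y v w + d\<Gamma> x z v w" by (rule linear_add[OF l])
 show "d\<Gamma> x (a *\<^sub>R y) v w = a *\<^sub>R d\<Gamma> x y v w" by (rule linear_scale[OF l])
qed

lemma g_expand_left: "g x y b = (\<Sum>i\<in>UNIV. y$i*g x (axis i 1) b)"
proof -
 have l: "linear (\<lambda>y. g x y b)" using bilinear_g unfolding bilinear_def by blast
 have "g x y b = g x (\<Sum>i\<in>UNIV. (y$i) *\<^sub>R axis i 1) b" using vec_expand[of y] by simp
 then show ?thesis unfolding linear_sum[OF l] linear_scale[OF l] by simp
qed

lemma dg_expand_left: "dg x h y b = (\<Sum>i\<in>UNIV. y$i*dg x h (axis i 1) b)"
proof -
 have l: "linear (\<lambda>y. dg x h y b)" using bilinear_dg unfolding bilinear_def by blast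
 have "dg x h y b = dg x h (\<Sum>i\<in>UNIV. (y$i) *\<^sub>R axis i 1) b" using vec_expand[of y] by simp
 then show ?thesis unfolding linear_sum[OF l] linear_scale[OF l] by simp
qed

section \<open>Curvature\<close>

text \<open>R(u,v)w for constant coordinate fields; their bracket vanishes, so the third term of the
  convention is absent.\<close>

definition Rm :: "real^'n => real^'n => real^'n => real^'n => real^'n" where
 "Rm x u v w = d\<Gamma> x u v w - d\<Gamma> x v u w + \<Gamma> x u (\<Gamma> x v w) - \<Gamma> x v (\<Gamma> x u w)"

lemma Rm_lin:
 assumes "x\<in>S"
 shows "Rm x (u + u') v w = Rm x u v w + Rm x u' v w" "Rm x (a *\<^sub>R u) v w = a *\<^sub>R Rm x u v w"
  "Rm x u (v + v') w = Rm x u v w + Rm x u v' w" "Rm x u (a *\<^sub>R v) w = a *\<^sub>R Rm x u v w"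
  "Rm x u v (w + w') = Rm x u v w + Rm x u v w'" "Rm x u v (a *\<^sub>R w) = a *\<^sub>R Rm x u v w"
 unfolding Rm_def by (simp_all add: d\<Gamma>_lin1[OF assms] algebra_simps)

lemma Rm_antisym: "Rm x u v w = - Rm x v u w"
 unfolding Rm_def by simp

lemma Rm_bianchi: "x\<in>S ==> Rm x u v w + Rm x v w u + Rm x w u v = 0"
 unfolding Rm_def
 by (simp add: d\<Gamma>_sym[of x _ u v] d\<Gamma>_sym[of x _ u w] d\<Gamma>_sym[of x _ v w] \<Gamma>_sym[of x u v] \<Gamma>_sym[of x u w] \<Gamma>_sym[of x v w])

text \<open>Metric compatibility expresses the first and second derivatives of
  \<open>g x w z\<close> by \<open>\<Gamma>\<close> and \<open>d\<Gamma>\<close>. The symmetry of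
  the second derivative in \<open>u\<close> and \<open>v\<close> is then the claim.\<close>

lemma Rm_skew: "x\<in>S ==> g x (Rm x u v w) z = - g x w (Rm x u v z)"
proof -
 assume x: "x\<in>S"
 define f' where "f' z v a b = g z (\<Gamma> z v a) b + g z a (\<Gamma> z v b)" for z v a b
 define f'' where "f'' x h v a b = (g x (\<Gamma> x h (\<Gamma> x v a)) b + g x (\<Gamma> x v a) (\<Gamma> x h b) + g x (d\<Gamma> x h v a) b)
   + (g x (\<Gamma> x h (\<Gamma> x v b)) a + g x (\<Gamma> x v b) (\<Gamma> x h a) + g x (d\<Gamma> x h v b) a)" for x h v a b
 have df: "((\<lambda>x. g x a b) has_derivative (\<lambda>v. f' z v a b)) (at z)" if "z\<in>S" for z a b
  using g_derivative[OF that, of a b] unfolding metric_compatible[OF that] f'_def .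
 have dgv: "((\<lambda>z. g z (\<Gamma> z v a) b) has_derivative
   (\<lambda>h. g z (\<Gamma> z h (\<Gamma> z v a)) b + g z (\<Gamma> z v a) (\<Gamma> z h b) + g z (d\<Gamma> z h v a) b)) (at z)" if z: "z\<in>S" for z v a b
 proof -
  have rep: "g z' (\<Gamma> z' v a) b = (\<Sum>i\<in>UNIV. \<Gamma> z' v a$i*g z' (axis i 1) b)" for z'
   by (rule g_expand_left)
  have "((\<lambda>z. \<Sum>i\<in>UNIV. \<Gamma> z v a$i*g z (axis i 1) b) has_derivative
    (\<lambda>h. \<Sum>i\<in>UNIV. \<Gamma> z v a$i*dg z h (axis i 1) b + d\<Gamma> z h v a$i*g z (axis i 1) b)) (at z)"
   by (intro has_derivative_sum has_derivative_mult g_derivative[OF z]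
     bounded_linear.has_derivative[OF bounded_linear_vec_nth] \<Gamma>_derivative[OF z])
  moreover have "(\<Sum>i\<in>UNIV. \<Gamma> z v a$i*dg z h (axis i 1) b + d\<Gamma> z h v a$i*g z (axis i 1) b)
    = dg z h (\<Gamma> z v a) b + g z (d\<Gamma> z h v a) b" for h
  proof -
   show ?thesis unfolding sum.distrib dg_expand_left[symmetric] g_expand_left[symmetric] ..
  qed
  ultimately show ?thesis unfolding rep[symmetric] by (simp add: metric_compatible[OF z])
 qed
 have ddf: "((\<lambda>z. f' z v a b) has_derivative (\<lambda>h. f'' z h v a b)) (at z)" if z: "z\<in>S" for z v a b
 proof -
  have "((\<lambda>z. g z (\<Gamma> z v a) b + g z (\<Gamma> z v b) a) has_derivative (\<lambda>h. f'' z h v a b)) (at z)"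
   unfolding f''_def by (intro has_derivative_add dgv[OF z])
  then show ?thesis unfolding f'_def
   by (rule has_derivative_transform_within_open[OF _ open_S z]) (simp add: g_sym)
 qed
 have cg: "continuous_on S (\<lambda>z. g z (p z) (q z))" if "continuous_on S p" "continuous_on S q" for p q :: "real^'n => real^'n"
 proof -
  have "g z (p z) (q z) = (\<Sum>i\<in>UNIV. \<Sum>j\<in>UNIV. p z$i*G z$i$j*q z$j)" for z
   unfolding g_eq inner_vec_def matrix_vector_mult_def by (simp add: sum_distrib_left mult_ac)
  then show ?thesis by (simp only:) (intro continuous_intros that C1_on_continuous[OF C1_G_entry])
 qed
 have cGam: "continuous_on S (\<lambda>z. \<Gamma> z (p z) (q z))" if "continuous_on S p" "continuous_on S q" for p q :: "real^'n => real^'n"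
  unfolding \<Gamma>_def by (intro continuous_intros that C1_on_continuous[OF C1_christoffel])
 have "f'' x u v w z = f'' x v u w z"
  by (rule mixed_derivatives_commute[OF open_S x df ddf])
   (auto simp: f''_def intro!: continuous_intros cg cGam continuous_d\<Gamma>)
 then have "g x (\<Gamma> x u (\<Gamma> x v w)) z + g x (d\<Gamma> x u v w) z + (g x (\<Gamma> x u (\<Gamma> x v z)) w + g x (d\<Gamma> x u v z) w)
  = g x (\<Gamma> x v (\<Gamma> x u w)) z + g x (d\<Gamma> x v u w) z + (g x (\<Gamma> x v (\<Gamma> x u z)) w + g x (d\<Gamma> x v u z) w)"
  unfolding f''_def by (simp add: g_sym[OF x, of "\<Gamma> x v w"] g_sym[OF x, of "\<Gamma> x v z"])
 then show ?thesis unfolding Rm_def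
  by (simp add: g_sym[OF x, of w])
qed

lemma curvature_op_eq: "x\<in>S ==> curvature_op M c x u v w = Rm x u v w"
proof -
 assume x: "x\<in>S"
 have coeff: "curvature_coeff M c x l i j k = dchr x l j k (axis i 1) - dchr x l i k (axis j 1)
   + (\<Sum>m\<in>UNIV. christoffel M c x m j k*christoffel M c x l i m - christoffel M c x m i k*christoffel M c x l j m)" for l i j k
  unfolding curvature_coeff_def pderiv_at_def dchr_def ..
 have dexp: "dchr x l j k h = (\<Sum>i\<in>UNIV. h$i*dchr x l j k (axis i 1))" for l j k h
 proof -
  have l: "linear (dchr x l j k)" by (rule has_derivative_linear[OF chr_derivative[OF x]])
  have "dchr x l j k h = dchr x l j k (\<Sum>i\<in>UNIV. h$i *\<^sub>R axis i 1)" using vec_expand[of h] by simp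
  then show ?thesis unfolding linear_sum[OF l] linear_scale[OF l] by simp
 qed
 show ?thesis
 proof (rule vec_eq_iff[THEN iffD2, rule_format])
  fix l
  have 1: "d\<Gamma> x u v w$l = (\<Sum>i\<in>UNIV. \<Sum>j\<in>UNIV. \<Sum>k\<in>UNIV. dchr x l j k (axis i 1)*u$i * v$j*w$k)"
  proof -
   have "d\<Gamma> x u v w$l = (\<Sum>j\<in>UNIV. \<Sum>k\<in>UNIV. \<Sum>i\<in>UNIV. dchr x l j k (axis i 1)*u$i * v$j*w$k)"
    unfolding d\<Gamma>_nth by (subst dexp) (simp add: sum_distrib_right sum_distrib_left mult_ac)
   also have "\<dots> = (\<Sum>j\<in>UNIV. \<Sum>i\<in>UNIV. \<Sum>k\<in>UNIV. dchr x l j k (axis i 1)*u$i * v$j*w$k)"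
    by (intro sum.cong refl sum.swap)
   also have "\<dots> = (\<Sum>i\<in>UNIV. \<Sum>j\<in>UNIV. \<Sum>k\<in>UNIV. dchr x l j k (axis i 1)*u$i * v$j*w$k)"
    by (rule sum.swap)
   finally show ?thesis .
  qed
  have 2: "d\<Gamma> x v u w$l = (\<Sum>i\<in>UNIV. \<Sum>j\<in>UNIV. \<Sum>k\<in>UNIV. dchr x l i k (axis j 1)*u$i * v$j*w$k)"
  proof -
   have "d\<Gamma> x v u w$l = (\<Sum>i\<in>UNIV. \<Sum>k\<in>UNIV. \<Sum>j\<in>UNIV. dchr x l i k (axis j 1)*u$i * v$j*w$k)"
    unfolding d\<Gamma>_nth by (subst dexp) (simp add: sum_distrib_right sum_distrib_left mult_ac)
   also have "\<dots> = (\<Sum>i\<in>UNIV. \<Sum>j\<in>UNIV. \<Sum>k\<in>UNIV. dchr x l i k (axis j 1)*u$i * v$j*w$k)"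
    by (intro sum.cong refl sum.swap)
   finally show ?thesis .
  qed
  have 3: "\<Gamma> x u (\<Gamma> x v w)$l = (\<Sum>i\<in>UNIV. \<Sum>j\<in>UNIV. \<Sum>k\<in>UNIV. (\<Sum>m\<in>UNIV. christoffel M c x m j k*christoffel M c x l i m) * u$i * v$j*w$k)" for u v
  proof -
   have "\<Gamma> x u (\<Gamma> x v w)$l = (\<Sum>i\<in>UNIV. \<Sum>m\<in>UNIV. \<Sum>j\<in>UNIV. \<Sum>k\<in>UNIV. christoffel M c x m j k*christoffel M c x l i m*u$i * v$j*w$k)"
    unfolding \<Gamma>_nth by (simp add: sum_distrib_left sum_distrib_right mult_ac)
   also have "\<dots> = (\<Sum>i\<in>UNIV. \<Sum>j\<in>UNIV. \<Sum>m\<in>UNIV. \<Sum>k\<in>UNIV. christoffel M c x m j k*christoffel M c x l i m*u$i * v$j*w$k)"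
    by (intro sum.cong refl sum.swap)
   also have "\<dots> = (\<Sum>i\<in>UNIV. \<Sum>j\<in>UNIV. \<Sum>k\<in>UNIV. \<Sum>m\<in>UNIV. christoffel M c x m j k*christoffel M c x l i m*u$i * v$j*w$k)"
    by (intro sum.cong refl sum.swap)
   finally show ?thesis by (simp add: sum_distrib_right)
  qed
  have 4: "\<Gamma> x v (\<Gamma> x u w)$l = (\<Sum>i\<in>UNIV. \<Sum>j\<in>UNIV. \<Sum>k\<in>UNIV. (\<Sum>m\<in>UNIV. christoffel M c x m i k*christoffel M c x l j m) * u$i * v$j*w$k)"
   unfolding 3[of v u] by (subst sum.swap) (simp add: mult_ac)
  show "curvature_op M c x u v w$l = Rm x u v w$l"
   unfolding Rm_def vector_minus_component vector_add_component 1 2 3[of u v] 4 curvature_op_def coeff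
   by (simp add: sum.distrib sum_subtractf ring_distribs)
 qed
qed

text \<open>The curvature hypothesis speaks of independent pairs; for dependent ones both sides
  vanish.\<close>

lemma Rm_sectional: "x\<in>S ==> g x (Rm x u v v) u = - (g x u u*g x v v - (g x u v)\<^sup>2)"
proof -
 assume x: "x\<in>S"
 show ?thesis
 proof (cases "u\<noteq>v \<and> independent {u, v}")
  case True
  have "sectional_curvature M c x u v = -1"
   using curv c x True unfolding constant_curvature_def S_def by blast
  then have "g x (Rm x u v v) u/(g x u u*g x v v - (g x u v)\<^sup>2) = -1"
   unfolding sectional_curvature_def g_def[symmetric] curvature_op_eq[OF x] .
  \<comment> \<open>Division by 0 gives 0, so a quotient equal to -1 excludes a zero
    denominator.\<close>
  moreover have "N = - D" if "N/D = -1" for N D :: real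
   using that by (cases "D = 0") (auto simp: divide_eq_eq)
  ultimately show ?thesis by blast
 next
  case False
  have "\<exists>a. u = a *\<^sub>R v \<or> v = a *\<^sub>R u"
  proof (cases "u = v")
   case True then show ?thesis by (intro exI[of _ 1]) simp
  next
   case neq: False
   then have "\<not> independent {u, v}" using False by simp
   then have "\<not> independent {v} \<or> u\<in>span {v}" using neq by (simp add: independent_insert)
   then show ?thesis
   proof
    assume "\<not> independent {v}" then have "v = 0" by (simp add: dependent_single)
    then show ?thesis by (intro exI[of _ 0]) simp
   qed (auto simp: span_singleton)
  qed
  then obtain a where "u = a *\<^sub>R v \<or> v = a *\<^sub>R u" by blast
  moreover have "Rm x u u w = 0" for u w unfolding Rm_def by simp
  ultimately show ?thesis by (auto simp: Rm_lin[OF x] power2_eq_square)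
 qed
qed

text \<open>The difference \<open>T\<close> between the curvature tensor and that of constant
  curvature -1 has all the symmetries of a curvature tensor and vanishing sectional curvatures.
  Polarisation shows that it is 0.\<close>

lemma curvature_constant: "x\<in>S ==> Rm x u v w = g x u w *\<^sub>R v - g x v w *\<^sub>R u"
proof -
 assume x: "x\<in>S"
 note gs = g_sym[OF x]
 define T where "T u v w z = g x (Rm x u v w) z + (g x v w*g x u z - g x u w*g x v z)" for u v w z
 have a12: "T u v w z = - T v u w z" for u v w z
  unfolding T_def by (subst Rm_antisym) simp
 have a34: "T u v w z = - T u v z w" for u v w z
 by (smt (verit) Rm_skew T_def gs mult.commute x)
 have bi: "T u v w z + T v w u z + T w u v z = 0" for u v w z
 proof -
  have "g x (Rm x u v w + Rm x v w u + Rm x w u v) z = 0" unfolding Rm_bianchi[OF x] by simp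
  then have "g x (Rm x u v w) z + g x (Rm x v w u) z + g x (Rm x w u v) z = 0" by (simp only: g_lin)
  moreover have "g x w v = g x v w" "g x w u = g x u w" "g x v u = g x u v" by (rule gs)+
  ultimately show ?thesis unfolding T_def by (simp add: algebra_simps)
 qed
 \<comment> \<open>Pair symmetry is a linear consequence of four Bianchi identities and the two
   antisymmetries.\<close>
 have pair: "T u v w z = T w z u v" for u v w z
  using bi[of u v w z] bi[of v w z u] bi[of w z u v] bi[of z u v w]
   a12[of u v w z] a12[of v w u z] a12[of w u v z] a34[of v w z u] a34[of w z v u] a34[of z v w u]
   a34[of w z u v] a34[of z u w v] a34[of u w z v] a34[of z u v w] a34[of u v z w] a34[of v z u w]
   a12[of z v w u] a12[of v z u w] a12[of u w z v] a12[of w u z v] a12[of v z w u]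
  by linarith
 have sec: "T u v v u = 0" for u v
  unfolding T_def using Rm_sectional[OF x, of u v] by (simp add: power2_eq_square gs[of v u] algebra_simps)
 have lin1: "T (u + u') v w z = T u v w z + T u' v w z" and lin2: "T u (v + v') w z = T u v w z + T u v' w z"
  and lin3: "T u v (w + w') z = T u v w z + T u v w' z" and lin4: "T u v w (z + z') = T u v w z + T u v w z'" for u u' v v' w w' z z'
  unfolding T_def by (simp_all add: Rm_lin[OF x] algebra_simps)
 have p1: "T u v v u' = 0" for u v u'
 proof -
  have "T (u + u') v v (u + u') = T u v v u + T u v v u' + (T u' v v u + T u' v v u')"
   by (simp add: lin1 lin4)
  then have "T u v v u' + T u' v v u = 0" using sec by simp
  moreover have "T u' v v u = T u v v u'" using pair[of u' v v u] a12[of v u u' v] a34[of u v u' v] by simp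
  ultimately show ?thesis by simp
 qed
 have p2: "T u v w z = - T u w v z" for u v w z
 proof -
  have "T u (v + w) (v + w) z = T u v v z + T u v w z + (T u w v z + T u w w z)"
   by (simp add: lin2 lin3)
  then show ?thesis using p1 by simp
 qed
 \<comment> \<open>By \<open>p2\<close> and \<open>a12\<close> the three terms of the Bianchi
   identity are equal, hence each is 0.\<close>
 have T0: "T u v w z = 0" for z
  using bi[of u v w z] p2[of v w u z] a12[of v u w z] p2[of w u v z] a12[of w v u z] p2[of v w u z] by linarith
 have "g x (Rm x u v w - (g x u w *\<^sub>R v - g x v w *\<^sub>R u)) z = 0" for z
  using T0[of z] unfolding T_def by (simp add: algebra_simps)
 then have "Rm x u v w - (g x u w *\<^sub>R v - g x v w *\<^sub>R u) = 0"
  using g_pos[OF x, of "Rm x u v w - (g x u w *\<^sub>R v - g x v w *\<^sub>R u)"] by (metis less_irrefl)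
 then show ?thesis by simp
qed

end

context hyp_chart begin

section \<open>Tractor frames\<close>

lemma bounded_bilinear_matrix_vector: "bounded_bilinear (\<lambda>(A::real^'n^'n) (v::real^'n). A *v v)"
 unfolding bilinear_conv_bounded_bilinear[symmetric] bilinear_def
 by (auto intro!: linearI simp: matrix_vector_right_distrib matrix_vector_mult_add_rdistrib
   matrix_vector_mult_scaleR scaleR_matrix_vector_assoc[symmetric])

lemma g_derivative_compose:
 assumes x: "x\<in>S" and p: "(p has_derivative dp) (at x)" and q: "(q has_derivative dq) (at x)"
 shows "((\<lambda>x. g x (p x) (q x)) has_derivative (\<lambda>h. dg x h (p x) (q x) + g x (dp h) (q x) + g x (p x) (dq h))) (at x)"
proof -
 have "((\<lambda>x. p x \<bullet> (G x *v q x)) has_derivative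
   (\<lambda>h. p x \<bullet> (G x *v dq h + dG x h *v q x) + dp h \<bullet> (G x *v q x))) (at x)"
  by (rule has_derivative_inner[OF p bounded_bilinear.FDERIV[OF bounded_bilinear_matrix_vector G_derivative[OF x] q]])
 then show ?thesis unfolding g_eq[symmetric]
  by (rule has_derivative_eq_rhs) (simp add: g_eq dg_def inner_add_right fun_eq_iff)
qed

text \<open>In the model the linear functions of Minkowski space, restricted to the hyperboloid,
  satisfy these equations with \<open>\<xi>\<close> the gradient of \<open>u\<close>. So the
  solutions on a chart are its future coordinates in the model.\<close>

lemma tractor_solutions:
 assumes x0: "x0\<in>S"
 shows "\<exists>r>0. ball x0 r\<subseteq>S \<and> (\<forall>u0 \<xi>0. \<exists>u \<xi>. u x0 = u0 \<and> \<xi> x0 = \<xi>0 \<and>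
  (\<forall>x\<in>ball x0 r. (u has_derivative (\<lambda>h. g x (\<xi> x) h)) (at x) \<and>
    (\<xi> has_derivative (\<lambda>h. u x *\<^sub>R h - \<Gamma> x h (\<xi> x))) (at x)))"
proof -
 define L where "L x y w = (g x (snd w) y, fst w *\<^sub>R y - \<Gamma> x y (snd w))" for x y :: "real^'n" and w :: "real\<times>(real^'n)"
 define dL where "dL x h y w = (dg x h (snd w) y, - d\<Gamma> x h y (snd w))" for x h y :: "real^'n" and w :: "real\<times>(real^'n)"
 have "\<exists>r>0. ball x0 r\<subseteq>S \<and> (\<forall>w0. \<exists>w. w x0 = w0 \<and>
   (\<forall>x\<in>ball x0 r. (w has_derivative (\<lambda>h. L x h (w x))) (at x)))"
 proof (rule flat_connection_parallel[OF open_S x0])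
  show "bilinear (L x)" for x
   unfolding bilinear_def L_def by (auto intro!: linearI simp: algebra_simps)
  show "bilinear (dL x h)" for x h
   unfolding bilinear_def dL_def using bilinear_dg[of x h]
   by (auto intro!: linearI simp: algebra_simps bilinear_ladd bilinear_radd bilinear_lmul bilinear_rmul)
  show "((\<lambda>x. L x y w) has_derivative (\<lambda>h. dL x h y w)) (at x)" if "x\<in>S" for x y w
  proof -
   have "((\<lambda>x. (g x (snd w) y, fst w *\<^sub>R y - \<Gamma> x y (snd w))) has_derivative
     (\<lambda>h. (dg x h (snd w) y, 0 - d\<Gamma> x h y (snd w)))) (at x)"
    by (intro has_derivative_Pair has_derivative_diff has_derivative_const g_derivative \<Gamma>_derivative that)
   then show ?thesis unfolding L_def dL_def by simp
  qed
  have "continuous_on S (\<lambda>x. dg x h y z)" for h y z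
   unfolding dg_def matrix_vector_mult_def inner_vec_def
   by simp (intro continuous_intros C1_on_continuous[OF C1_dG_entry])
  then show "continuous_on S (\<lambda>x. dL x h y w)" for h y w
   unfolding dL_def by (intro continuous_intros continuous_d\<Gamma>)
  show "dL x h y w + L x y (L x h w) = dL x y h w + L x h (L x y w)" if x: "x\<in>S" for x h y w
  proof -
   obtain u \<xi> where w: "w = (u, \<xi>)" by (cases w)
   have 1: "dg x h \<xi> y + g x (u *\<^sub>R h - \<Gamma> x h \<xi>) y = dg x y \<xi> h + g x (u *\<^sub>R y - \<Gamma> x y \<xi>) h"
    unfolding metric_compatible[OF x] by (simp add: \<Gamma>_sym[OF x, of h y] g_sym[OF x, of h y])
   \<comment> \<open>This is where curvature -1 enters: \<open>Rm\<close> cancels the terms that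
     come from the derivative of the scalar part.\<close>
   have "Rm x h y \<xi> = g x h \<xi> *\<^sub>R y - g x y \<xi> *\<^sub>R h" by (rule curvature_constant[OF x])
   then have 2: "- d\<Gamma> x h y \<xi> + (g x \<xi> h *\<^sub>R y - \<Gamma> x y (u *\<^sub>R h - \<Gamma> x h \<xi>))
     = - d\<Gamma> x y h \<xi> + (g x \<xi> y *\<^sub>R h - \<Gamma> x h (u *\<^sub>R y - \<Gamma> x y \<xi>))"
    unfolding Rm_def by (simp add: \<Gamma>_sym[OF x, of h y] g_sym[OF x, of \<xi>] algebra_simps)
   show ?thesis unfolding w L_def dL_def using 1 2 by simp
  qed
 qed
 then obtain r where r: "r > 0" "ball x0 r\<subseteq>S" and ex: "\<forall>w0. \<exists>w. w x0 = w0 \<and>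
   (\<forall>x\<in>ball x0 r. (w has_derivative (\<lambda>h. L x h (w x))) (at x))" by blast
 show ?thesis
 proof (intro exI[of _ r] conjI allI r)
  fix u0 \<xi>0
  obtain w where w: "w x0 = (u0, \<xi>0)" "\<And>x. x\<in>ball x0 r ==> (w has_derivative (\<lambda>h. L x h (w x))) (at x)"
   using ex by blast
  show "\<exists>u \<xi>. u x0 = u0 \<and> \<xi> x0 = \<xi>0 \<and>
  (\<forall>x\<in>ball x0 r. (u has_derivative (\<lambda>h. g x (\<xi> x) h)) (at x) \<and>
    (\<xi> has_derivative (\<lambda>h. u x *\<^sub>R h - \<Gamma> x h (\<xi> x))) (at x))"
   using has_derivative_fst[OF w(2)] has_derivative_snd[OF w(2)] w(1)
   by (intro exI[of _ "\<lambda>x. fst (w x)"] exI[of _ "\<lambda>x. snd (w x)"]) (simp add: L_def)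
 qed
qed

lemma orthonormal_frame:
 assumes x: "x\<in>S"
 shows "\<exists>e :: 'n => real^'n. \<forall>i j. g x (e i) (e j) = (if i = j then 1 else 0)"
proof -
 have "\<exists>e :: 'n => real^'n. \<forall>i\<in>I. \<forall>j\<in>I. g x (e i) (e j) = (if i = j then 1 else 0)" for I :: "'n set"
 proof (induction I rule: finite_induct[OF finite])
  case 1 then show ?case by simp
 next
  case (2 k I)
  then obtain e where e: "\<forall>i\<in>I. \<forall>j\<in>I. g x (e i) (e j) = (if i = j then 1 else 0)" by blast
  have "card I < card (UNIV :: 'n set)"
   using 2 by (intro psubset_card_mono) auto
  then have "dim ((\<lambda>i. G x *v e i) ` I) < DIM(real^'n)"
   using dim_le_card'[of "(\<lambda>i. G x *v e i) ` I"] card_image_le[of I "\<lambda>i. G x *v e i"] by simp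
  then obtain y where y: "y\<noteq>0" "\<And>z. z\<in>span ((\<lambda>i. G x *v e i) ` I) ==> orthogonal y z"
   using orthogonal_to_subspace_exists[of "(\<lambda>i. G x *v e i) ` I"] by auto
  have ye: "g x y (e i) = 0" if "i\<in>I" for i
   using y(2)[of "G x *v e i"] that unfolding g_eq orthogonal_def by (auto intro: span_base)
  define a where "a = sqrt (g x y y)"
  have a: "a > 0" "a*a = g x y y" unfolding a_def using g_pos[OF x y(1)] by auto
  define e' where "e' = e (k := (1/a) *\<^sub>R y)"
  have "g x (e' k) (e' k) = 1" unfolding e'_def using a(1) by (simp add: a(2)[symmetric])
  moreover have "g x (e' k) (e' i) = 0" "g x (e' i) (e' k) = 0" if "i\<in>I" for i
   using ye[OF that] g_sym[OF x] that 2 unfolding e'_def by auto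
  moreover have "g x (e' i) (e' j) = (if i = j then 1 else 0)" if "i\<in>I" "j\<in>I" for i j
   using e that 2 unfolding e'_def by auto
  ultimately show ?case using 2 by (intro exI[of _ e']) auto
 qed
 from this[of UNIV] show ?thesis by simp
qed

text \<open>The Minkowski form on the pairs is parallel: metric compatibility cancels the
  Christoffel terms, and the remaining terms cancel against the derivative of
  \<open>u x * v x\<close>.\<close>

lemma tractor_pairing_constant:
 assumes B: "B\<subseteq>S" "convex B" "x0\<in>B" "x\<in>B"
  and u: "\<And>x. x\<in>B ==> (u has_derivative (\<lambda>h. g x (\<xi> x) h)) (at x)"
  and \<xi>: "\<And>x. x\<in>B ==> (\<xi> has_derivative (\<lambda>h. u x *\<^sub>R h - \<Gamma> x h (\<xi> x))) (at x)"
  and v: "\<And>x. x\<in>B ==> (v has_derivative (\<lambda>h. g x (\<zeta> x) h)) (at x)"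
  and \<zeta>: "\<And>x. x\<in>B ==> (\<zeta> has_derivative (\<lambda>h. v x *\<^sub>R h - \<Gamma> x h (\<zeta> x))) (at x)"
 shows "g x (\<xi> x) (\<zeta> x) - u x * v x = g x0 (\<xi> x0) (\<zeta> x0) - u x0 * v x0"
proof -
 have "((\<lambda>x. g x (\<xi> x) (\<zeta> x) - u x * v x) has_derivative (\<lambda>h. 0)) (at x within B)" if x: "x\<in>B" for x
 proof -
  have xS: "x\<in>S" using x B by auto
  have "((\<lambda>x. g x (\<xi> x) (\<zeta> x) - u x * v x) has_derivative
   (\<lambda>h. (dg x h (\<xi> x) (\<zeta> x) + g x (u x *\<^sub>R h - \<Gamma> x h (\<xi> x)) (\<zeta> x) + g x (\<xi> x) (v x *\<^sub>R h - \<Gamma> x h (\<zeta> x)))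
    - (u x*g x (\<zeta> x) h + g x (\<xi> x) h * v x))) (at x)"
   by (intro has_derivative_diff has_derivative_mult g_derivative_compose[OF xS] u \<xi> v \<zeta> x)
  then have "((\<lambda>x. g x (\<xi> x) (\<zeta> x) - u x * v x) has_derivative (\<lambda>h. 0)) (at x)"
   by (rule has_derivative_eq_rhs)
    (simp add: metric_compatible[OF xS] g_sym[OF xS, of _ "\<zeta> x"] fun_eq_iff)
  then show ?thesis by (rule has_derivative_at_withinI)
 qed
 from has_derivative_zero_constant[OF B(2) this] obtain k where "\<forall>x\<in>B. g x (\<xi> x) (\<zeta> x) - u x * v x = k" by blast
 then show ?thesis using B by simp
qed

text \<open>
 The components \<open>\<phi> x$i\<close> and \<open>hz (\<phi> x)\<close> are the coordinates of a point of the hyperboloid,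
 and \<open>\<xi> i\<close>, \<open>\<eta>\<close> are their gradients.
\<close>

definition tractor_frame ::
  "(real^'n) set => (real^'n => real^'n) => ('n => real^'n => real^'n) => (real^'n => real^'n) => bool" where
 "tractor_frame B \<phi> \<xi> \<eta> \<longleftrightarrow> open B \<and> B\<subseteq>S \<and> (\<forall>x\<in>B.
   (\<forall>i. ((\<lambda>x. \<phi> x$i) has_derivative (\<lambda>h. g x (\<xi> i x) h)) (at x)) \<and>
   (\<forall>i. (\<xi> i has_derivative (\<lambda>h. \<phi> x$i *\<^sub>R h - \<Gamma> x h (\<xi> i x))) (at x)) \<and>
   ((\<lambda>x. hz (\<phi> x)) has_derivative (\<lambda>h. g x (\<eta> x) h)) (at x) \<and>
   (\<eta> has_derivative (\<lambda>h. hz (\<phi> x) *\<^sub>R h - \<Gamma> x h (\<eta> x))) (at x) \<and>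
   (\<forall>y. y = (\<Sum>i\<in>UNIV. g x y (\<xi> i x) *\<^sub>R \<xi> i x) - g x y (\<eta> x) *\<^sub>R \<eta> x) \<and>
   (\<Sum>i\<in>UNIV. \<phi> x$i *\<^sub>R \<xi> i x) = hz (\<phi> x) *\<^sub>R \<eta> x)"

text \<open>At \<open>x0\<close> the pairs (1, 0) and (0, \<open>e i\<close>) are a
  Lorentz-orthonormal basis, and by \<open>tractor_pairing_constant\<close> their parallel
  extensions remain one. Expanding (0, \<open>y\<close>) and (1, 0) in this basis gives the
  algebraic conditions of \<open>tractor_frame\<close>, and the equation of the hyperboloid.\<close>

lemma tractor_frame_exists:
 assumes x0: "x0\<in>S"
 shows "\<exists>r>0. \<exists>\<phi> \<xi> \<eta>. tractor_frame (ball x0 r) \<phi> \<xi> \<eta> \<and> \<phi> x0 = 0"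
proof -
 obtain r where r: "r > 0" "ball x0 r\<subseteq>S" and ex: "\<And>u0 \<xi>0. \<exists>u \<xi>. u x0 = u0 \<and> \<xi> x0 = \<xi>0 \<and>
  (\<forall>x\<in>ball x0 r. (u has_derivative (\<lambda>h. g x (\<xi> x) h)) (at x) \<and>
    (\<xi> has_derivative (\<lambda>h. u x *\<^sub>R h - \<Gamma> x h (\<xi> x))) (at x))"
  using tractor_solutions[OF x0] by blast
 obtain e :: "'n => real^'n" where e: "\<And>i j. g x0 (e i) (e j) = (if i = j then 1 else 0)"
  using orthonormal_frame[OF x0] by blast
 obtain u0 \<eta> where u0: "u0 x0 = 1" "\<eta> x0 = 0" "\<And>x. x\<in>ball x0 r ==> (u0 has_derivative (\<lambda>h. g x (\<eta> x) h)) (at x)"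
  "\<And>x. x\<in>ball x0 r ==> (\<eta> has_derivative (\<lambda>h. u0 x *\<^sub>R h - \<Gamma> x h (\<eta> x))) (at x)"
  using ex[of 1 0] by blast
 have "\<forall>i. \<exists>u \<xi>. u x0 = 0 \<and> \<xi> x0 = e i \<and>
  (\<forall>x\<in>ball x0 r. (u has_derivative (\<lambda>h. g x (\<xi> x) h)) (at x) \<and>
    (\<xi> has_derivative (\<lambda>h. u x *\<^sub>R h - \<Gamma> x h (\<xi> x))) (at x))" using ex by blast
 from choice[OF this] obtain u where "\<forall>i. \<exists>\<xi>. u i x0 = 0 \<and> \<xi> x0 = e i \<and>
  (\<forall>x\<in>ball x0 r. (u i has_derivative (\<lambda>h. g x (\<xi> x) h)) (at x) \<and>
    (\<xi> has_derivative (\<lambda>h. u i x *\<^sub>R h - \<Gamma> x h (\<xi> x))) (at x))" by blast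
 from choice[OF this] obtain \<xi> where u\<xi>: "\<forall>i. u i x0 = 0 \<and> \<xi> i x0 = e i \<and>
  (\<forall>x\<in>ball x0 r. (u i has_derivative (\<lambda>h. g x (\<xi> i x) h)) (at x) \<and>
    (\<xi> i has_derivative (\<lambda>h. u i x *\<^sub>R h - \<Gamma> x h (\<xi> i x))) (at x))" by blast
 then have u: "\<And>i. u i x0 = 0" "\<And>i. \<xi> i x0 = e i"
  "\<And>i x. x\<in>ball x0 r ==> (u i has_derivative (\<lambda>h. g x (\<xi> i x) h)) (at x)"
  "\<And>i x. x\<in>ball x0 r ==> (\<xi> i has_derivative (\<lambda>h. u i x *\<^sub>R h - \<Gamma> x h (\<xi> i x))) (at x)"
  by blast+
 have x0b: "x0\<in>ball x0 r" using r by simp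
 note pc = tractor_pairing_constant[OF r(2) convex_ball x0b]
 have N: "g x (\<xi> i x) (\<xi> j x) = u i x*u j x + (if i = j then 1 else 0)"
  "g x (\<xi> i x) (\<eta> x) = u i x*u0 x" "g x (\<eta> x) (\<eta> x) = u0 x*u0 x - 1" if x: "x\<in>ball x0 r" for i j x
  using pc[OF x u(3) u(4) u(3) u(4), of i j] pc[OF x u(3) u(4) u0(3) u0(4), of i] pc[OF x u0(3) u0(4) u0(3) u0(4)]
  by (auto simp: u(1,2) u0(1,2) e split: if_splits)
 \<comment> \<open>\<open>P\<close> assigns a pair to its coordinates in the frame. Orthonormality
   recovers the coordinates, so \<open>P\<close> is injective, hence surjective for reasons of
   dimension, and every pair has the expansion.\<close>
 have rep: "s = (- g x y (\<eta> x) + s*u0 x) * u0 x + (\<Sum>j\<in>UNIV. (g x y (\<xi> j x) - s*u j x) * u j x)"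
  "y = (- g x y (\<eta> x) + s*u0 x) *\<^sub>R \<eta> x + (\<Sum>j\<in>UNIV. (g x y (\<xi> j x) - s*u j x) *\<^sub>R \<xi> j x)"
  if x: "x\<in>ball x0 r" for s y x
 proof -
  define P where "P \<alpha> = (fst \<alpha> * u0 x + (\<Sum>j\<in>UNIV. snd \<alpha>$j*u j x), fst \<alpha> *\<^sub>R \<eta> x + (\<Sum>j\<in>UNIV. snd \<alpha>$j *\<^sub>R \<xi> j x))"
   for \<alpha> :: "real\<times>(real^'n)"
  have linP: "linear P"
   unfolding P_def by (intro linearI) (auto simp: algebra_simps sum.distrib sum_distrib_left scaleR_sum_right)
  have gsum: "g x (\<Sum>j\<in>UNIV. f j) z = (\<Sum>j\<in>UNIV. g x (f j) z)" for f :: "'n => real^'n" and z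
   by (rule linear_sum) (use bilinear_g in \<open>auto simp: bilinear_def\<close>)
  have xS: "x\<in>S" using x r by auto
  have \<alpha>: "snd \<alpha>$j = g x (snd (P \<alpha>)) (\<xi> j x) - fst (P \<alpha>)*u j x"
   "fst \<alpha> = - g x (snd (P \<alpha>)) (\<eta> x) + fst (P \<alpha>)*u0 x" for \<alpha> j
  proof -
   have "g x (snd (P \<alpha>)) (\<xi> j x) = fst \<alpha> * (u j x*u0 x) + (\<Sum>i\<in>UNIV. snd \<alpha>$i*(u i x*u j x + (if i = j then 1 else 0)))"
    unfolding P_def by (simp add: gsum N[OF x] g_sym[OF xS, of "\<eta> x"])
   also have "\<dots> = fst \<alpha> * (u j x*u0 x) + (\<Sum>i\<in>UNIV. snd \<alpha>$i*u i x) * u j x + snd \<alpha>$j"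
   proof -
    have "(\<Sum>i\<in>UNIV. snd \<alpha>$i*(u i x*u j x + (if i = j then 1 else 0)))
     = (\<Sum>i\<in>UNIV. snd \<alpha>$i*u i x*u j x) + (\<Sum>i\<in>UNIV. if i = j then snd \<alpha>$i else 0)"
     unfolding sum.distrib[symmetric] by (intro sum.cong refl) (simp add: algebra_simps)
    then show ?thesis by (simp add: sum_distrib_right)
   qed
   finally show "snd \<alpha>$j = g x (snd (P \<alpha>)) (\<xi> j x) - fst (P \<alpha>)*u j x"
    unfolding P_def by (simp add: algebra_simps)
   have "g x (snd (P \<alpha>)) (\<eta> x) = fst \<alpha> * (u0 x*u0 x - 1) + (\<Sum>i\<in>UNIV. snd \<alpha>$i*(u i x*u0 x))"
    unfolding P_def by (simp add: gsum N[OF x])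
   then show "fst \<alpha> = - g x (snd (P \<alpha>)) (\<eta> x) + fst (P \<alpha>)*u0 x"
    unfolding P_def by (simp add: algebra_simps sum_distrib_left sum_distrib_right)
  qed
  have "inj P"
  proof (rule linear_injective_0[OF linP, THEN iffD2], intro allI impI)
   fix \<alpha> assume "P \<alpha> = 0"
   then have "fst \<alpha> = 0" "\<And>j. snd \<alpha>$j = 0" using \<alpha>[of \<alpha>] by auto
   then show "\<alpha> = 0" by (simp add: prod_eq_iff vec_eq_iff)
  qed
  then have "surj P" by (rule linear_inj_imp_surj[OF linP])
  then obtain \<alpha> where P: "P \<alpha> = (s, y)" by (metis surjD)
  have f: "fst \<alpha> = - g x y (\<eta> x) + s*u0 x" "\<And>j. snd \<alpha>$j = g x y (\<xi> j x) - s*u j x"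
   using \<alpha>[of \<alpha>] unfolding P by auto
  show "s = (- g x y (\<eta> x) + s*u0 x) * u0 x + (\<Sum>j\<in>UNIV. (g x y (\<xi> j x) - s*u j x) * u j x)"
   using P unfolding P_def f by simp
  show "y = (- g x y (\<eta> x) + s*u0 x) *\<^sub>R \<eta> x + (\<Sum>j\<in>UNIV. (g x y (\<xi> j x) - s*u j x) *\<^sub>R \<xi> j x)"
   using P unfolding P_def f by simp
 qed
 define \<phi> where "\<phi> x = (\<chi> i. u i x)" for x
 have hz2: "u0 x*u0 x = 1 + \<phi> x \<bullet> \<phi> x" if "x\<in>ball x0 r" for x
  using rep(1)[OF that, of 1 0] unfolding \<phi>_def inner_vec_def by (simp add: sum_negf)
 \<comment> \<open>\<open>u0\<close> is 1 at the centre and its square is at least 1, so on a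
   connected ball it cannot change sign.\<close>
 have "0 < u0 x" if x: "x\<in>ball x0 r" for x
 proof (rule ccontr)
  assume neg: "\<not> 0 < u0 x"
  have "continuous_on (ball x0 r) u0"
   by (rule has_derivative_continuous_on[OF has_derivative_at_withinI[OF u0(3)]])
  then have "connected (u0 ` ball x0 r)" by (rule connected_continuous_image) (rule connected_ball)
  then have "{u0 x .. u0 x0}\<subseteq>u0 ` ball x0 r" by (rule connected_contains_Icc) (use x x0b in auto)
  moreover have "0\<in>{u0 x .. u0 x0}" using neg u0(1) by simp
  ultimately obtain z where z: "z\<in>ball x0 r" "u0 z = 0" by auto
  then show False using hz2[OF z(1)] inner_ge_zero[of "\<phi> z"] by simp
 qed
 then have hz: "hz (\<phi> x) = u0 x" if "x\<in>ball x0 r" for x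
  unfolding hz_def hz2[OF that, symmetric] using \<open>\<And>x. x\<in>ball x0 r ==> 0 < u0 x\<close>[OF that] by simp
 have ob: "open (ball x0 r)" by simp
 have "tractor_frame (ball x0 r) \<phi> \<xi> \<eta>"
  unfolding tractor_frame_def
 proof (intro conjI ballI allI ob r(2))
  fix x assume x: "x\<in>ball x0 r"
  show "((\<lambda>x. \<phi> x$i) has_derivative (\<lambda>h. g x (\<xi> i x) h)) (at x)" for i
   unfolding \<phi>_def using u(3)[OF x] by simp
  show "(\<xi> i has_derivative (\<lambda>h. \<phi> x$i *\<^sub>R h - \<Gamma> x h (\<xi> i x))) (at x)" for i
   unfolding \<phi>_def using u(4)[OF x] by simp
  show "((\<lambda>x. hz (\<phi> x)) has_derivative (\<lambda>h. g x (\<eta> x) h)) (at x)"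
   by (rule has_derivative_transform_within_open[OF u0(3)[OF x] ob x]) (simp add: hz)
  show "(\<eta> has_derivative (\<lambda>h. hz (\<phi> x) *\<^sub>R h - \<Gamma> x h (\<eta> x))) (at x)"
   unfolding hz[OF x] by (rule u0(4)[OF x])
  show "y = (\<Sum>i\<in>UNIV. g x y (\<xi> i x) *\<^sub>R \<xi> i x) - g x y (\<eta> x) *\<^sub>R \<eta> x" for y
   using rep(2)[OF x, of y 0] by simp
  show "(\<Sum>i\<in>UNIV. \<phi> x$i *\<^sub>R \<xi> i x) = hz (\<phi> x) *\<^sub>R \<eta> x"
  proof -
   have "\<phi> x$i = u i x" for i unfolding \<phi>_def by simp
   then show ?thesis unfolding hz[OF x] using rep(2)[OF x, of 0 1] by (simp add: sum_negf)
  qed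
 qed
 moreover have "\<phi> x0 = 0" unfolding \<phi>_def by (simp add: u(1) vec_eq_iff)
 ultimately show ?thesis using r(1) by blast
qed

definition dframe :: "('n => real^'n => real^'n) => real^'n => real^'n => real^'n" where
 "dframe \<xi> x h = (\<Sum>i\<in>UNIV. g x (\<xi> i x) h *\<^sub>R axis i 1)"

lemma dframe_nth: "dframe \<xi> x h$i = g x (\<xi> i x) h"
 unfolding dframe_def sum_axis_nth ..

text \<open>The derivative of \<open>\<phi>\<close> pairs a vector with the gradients
  \<open>\<xi> i\<close>. That the frame reproduces every \<open>y\<close> says exactly that the
  Minkowski form pulls back to \<open>g\<close>.\<close>

lemma tractor_frame_isometry:
 assumes F: "tractor_frame B \<phi> \<xi> \<eta>" and x: "x\<in>B"
 shows "(\<phi> has_derivative dframe \<xi> x) (at x)"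
  and "hzd (\<phi> x) (dframe \<xi> x y) = g x (\<eta> x) y"
  and "gH (\<phi> x) (dframe \<xi> x y) (dframe \<xi> x z) = g x y z"
proof -
 have xS: "x\<in>S" using F x unfolding tractor_frame_def by auto
 have \<phi>: "((\<lambda>x. \<phi> x$i) has_derivative (\<lambda>h. g x (\<xi> i x) h)) (at x)" for i
  using F x unfolding tractor_frame_def by blast
 have "((\<lambda>x. \<Sum>i\<in>UNIV. (\<phi> x$i) *\<^sub>R axis i 1) has_derivative dframe \<xi> x) (at x)"
  unfolding dframe_def by (intro has_derivative_sum has_derivative_scaleR_left \<phi>)
 then show "(\<phi> has_derivative dframe \<xi> x) (at x)" unfolding vec_expand[symmetric] .
 have e: "(\<Sum>i\<in>UNIV. \<phi> x$i *\<^sub>R \<xi> i x) = hz (\<phi> x) *\<^sub>R \<eta> x"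
  and rep: "y = (\<Sum>i\<in>UNIV. g x y (\<xi> i x) *\<^sub>R \<xi> i x) - g x y (\<eta> x) *\<^sub>R \<eta> x" for y
  using F x unfolding tractor_frame_def by blast+
 have lin: "linear (\<lambda>w. g x w z)" for z using bilinear_g unfolding bilinear_def by blast
 have hzd: "hzd (\<phi> x) (dframe \<xi> x y) = g x (\<eta> x) y" for y
 proof -
  have "\<phi> x \<bullet> dframe \<xi> x y = g x (\<Sum>i\<in>UNIV. \<phi> x$i *\<^sub>R \<xi> i x) y"
   unfolding linear_sum[OF lin] by (simp add: inner_vec_def dframe_nth)
  also have "\<dots> = hz (\<phi> x) * g x (\<eta> x) y" unfolding e by simp
  finally show ?thesis unfolding hzd_def by simp
 qed
 then show "hzd (\<phi> x) (dframe \<xi> x y) = g x (\<eta> x) y" .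
 have "g x y z = g x ((\<Sum>i\<in>UNIV. g x y (\<xi> i x) *\<^sub>R \<xi> i x) - g x y (\<eta> x) *\<^sub>R \<eta> x) z" using rep[of y] by simp
 also have "\<dots> = (\<Sum>i\<in>UNIV. g x y (\<xi> i x) * g x (\<xi> i x) z) - g x y (\<eta> x) * g x (\<eta> x) z"
  by (simp add: linear_sum[OF lin])
 also have "\<dots> = gH (\<phi> x) (dframe \<xi> x y) (dframe \<xi> x z)"
  unfolding gH_def hzd by (simp add: inner_vec_def dframe_nth g_sym[OF xS, of y])
 finally show "gH (\<phi> x) (dframe \<xi> x y) (dframe \<xi> x z) = g x y z" by simp
qed

lemma tractor_frame_curve:
 assumes F: "tractor_frame B \<phi> \<xi> \<eta>" and x: "x t\<in>B" and dx: "(x has_vector_derivative v) (at t)"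
 shows "((\<lambda>s. \<phi> (x s)) has_vector_derivative dframe \<xi> (x t) v) (at t)"
  and "((\<lambda>s. \<xi> i (x s)) has_vector_derivative \<phi> (x t)$i *\<^sub>R v - \<Gamma> (x t) v (\<xi> i (x t))) (at t)"
  and "((\<lambda>s. \<eta> (x s)) has_vector_derivative hz (\<phi> (x t)) *\<^sub>R v - \<Gamma> (x t) v (\<eta> (x t))) (at t)"
proof -
 have *: "((\<lambda>s. f (x s)) has_vector_derivative f' v) (at t)" if "(f has_derivative f') (at (x t))" for f f' :: "real^'n => real^'n"
  using has_derivative_compose[OF dx[unfolded has_vector_derivative_def] that] linear_scale[OF has_derivative_linear[OF that]]
  unfolding has_vector_derivative_def by simp
 have "(\<xi> i has_derivative (\<lambda>h. \<phi> (x t)$i *\<^sub>R h - \<Gamma> (x t) h (\<xi> i (x t)))) (at (x t))"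
  and "(\<eta> has_derivative (\<lambda>h. hz (\<phi> (x t)) *\<^sub>R h - \<Gamma> (x t) h (\<eta> (x t)))) (at (x t))"
  using F x unfolding tractor_frame_def by blast+
 from *[OF tractor_frame_isometry(1)[OF F x]] *[OF this(1)] *[OF this(2)]
 show "((\<lambda>s. \<phi> (x s)) has_vector_derivative dframe \<xi> (x t) v) (at t)"
  and "((\<lambda>s. \<xi> i (x s)) has_vector_derivative \<phi> (x t)$i *\<^sub>R v - \<Gamma> (x t) v (\<xi> i (x t))) (at t)"
  and "((\<lambda>s. \<eta> (x s)) has_vector_derivative hz (\<phi> (x t)) *\<^sub>R v - \<Gamma> (x t) v (\<eta> (x t))) (at t)" .
qed

lemma continuous_dframe:
 assumes F: "tractor_frame B \<phi> \<xi> \<eta>"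
 shows "continuous_on B (\<lambda>x. dframe \<xi> x y)"
proof -
 have "continuous_on B (\<lambda>x. g x (\<xi> i x) y)" for i
 proof (rule has_derivative_continuous_on[OF has_derivative_at_withinI])
  fix x assume x: "x\<in>B"
  then have xS: "x\<in>S" and \<xi>: "(\<xi> i has_derivative (\<lambda>h. \<phi> x$i *\<^sub>R h - \<Gamma> x h (\<xi> i x))) (at x)"
   using F unfolding tractor_frame_def by auto
  show "((\<lambda>x. g x (\<xi> i x) y) has_derivative (\<lambda>h. dg x h (\<xi> i x) y + g x (\<phi> x$i *\<^sub>R h - \<Gamma> x h (\<xi> i x)) y + g x (\<xi> i x) 0)) (at x)"
   by (rule g_derivative_compose[OF xS \<xi> has_derivative_const])
 qed
 then show ?thesis unfolding dframe_def by (intro continuous_intros)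
qed

end

section \<open>Local isometries from hyperbolic space\<close>

lemma C1_on_local:
 assumes "\<And>x. x\<in>S ==> \<exists>N. open N \<and> x\<in>N \<and> C1_on f N"
 shows "C1_on f S"
proof -
 have d: "(f has_derivative frechet_derivative f (at x)) (at x)"
  and c: "isCont (\<lambda>x. frechet_derivative f (at x) v) x" if "x\<in>S" for x v
 proof -
  obtain N where N: "open N" "x\<in>N" "C1_on f N" using assms \<open>x\<in>S\<close> by blast
  show "(f has_derivative frechet_derivative f (at x)) (at x)" by (rule C1_on_frechet(1)[OF N(3,2)])
  show "isCont (\<lambda>x. frechet_derivative f (at x) v) x"
   using C1_on_frechet(2)[OF N(3), of v] N by (simp add: continuous_on_eq_continuous_at)
 qed
 show ?thesis
  by (rule C1_onI[where f' = "\<lambda>x. frechet_derivative f (at x)"])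
   (auto intro: d continuous_at_imp_continuous_on c)
qed

lemma C1_on_compose:
 fixes f :: "'a::real_normed_vector => 'b::euclidean_space"
 assumes f: "C1_on f S" and h: "C1_on h T" and sub: "f ` S\<subseteq>T"
 shows "C1_on (h \<circ> f) S"
proof (rule C1_onI[where f' = "\<lambda>x v. frechet_derivative h (at (f x)) (frechet_derivative f (at x) v)"])
 fix x assume x: "x\<in>S"
 then have fx: "f x\<in>T" using sub by auto
 show "(h \<circ> f has_derivative (\<lambda>v. frechet_derivative h (at (f x)) (frechet_derivative f (at x) v))) (at x)"
  unfolding comp_def
  by (rule has_derivative_compose[OF C1_on_frechet(1)[OF f x] C1_on_frechet(1)[OF h fx]])
next
 fix v
 have eq: "frechet_derivative h (at (f x)) (frechet_derivative f (at x) v)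
  = (\<Sum>i\<in>Basis. (frechet_derivative f (at x) v \<bullet> i) *\<^sub>R frechet_derivative h (at (f x)) i)" if "x\<in>S" for x
 proof -
  have l: "linear (frechet_derivative h (at (f x)))"
   using C1_on_frechet(1)[OF h, of "f x"] sub that by (auto intro: has_derivative_linear)
  show ?thesis
   unfolding linear_scale[OF l, symmetric] linear_sum[OF l, symmetric] euclidean_representation ..
 qed
 have "continuous_on S (\<lambda>x. \<Sum>i\<in>Basis. (frechet_derivative f (at x) v \<bullet> i) *\<^sub>R frechet_derivative h (at (f x)) i)"
  by (intro continuous_intros C1_on_frechet(2)[OF f] continuous_on_compose2[OF C1_on_frechet(2)[OF h] C1_on_continuous[OF f] sub])
 then show "continuous_on S (\<lambda>x. frechet_derivative h (at (f x)) (frechet_derivative f (at x) v))"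
  by (rule continuous_on_eq) (simp add: eq)
qed

lemma frechet_derivative_compose':
 assumes "C1_on f S" "x\<in>S" "C1_on h T" "f x\<in>T"
 shows "frechet_derivative (h \<circ> f) (at x) v = frechet_derivative h (at (f x)) (frechet_derivative f (at x) v)"
by (metis C1_on_frechet(1) assms(1,2,3,4) comp_apply frechet_derivative_compose frechet_derivative_works)

lemma frechet_derivative_cong:
 assumes "open S" "x\<in>S" "\<And>z. z\<in>S ==> f z = g z"
 shows "frechet_derivative f (at x) = frechet_derivative g (at x)"
proof -
 have "(f has_derivative D) (at x) \<longleftrightarrow> (g has_derivative D) (at x)" for D
  using has_derivative_transform_within_open[OF _ assms(1,2)] assms(3) by metis
 then show ?thesis unfolding frechet_derivative_def by simp
qed

lemma C1_inverse_function:
 fixes f :: "'a::euclidean_space => 'a"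
 assumes S: "open S" "x0\<in>S" and f: "C1_on f S" and inj: "inj (frechet_derivative f (at x0))"
 shows "\<exists>U V g. open U \<and> U\<subseteq>S \<and> x0\<in>U \<and> open V \<and> f x0\<in>V \<and> homeomorphism U V f g \<and>
  (\<forall>y\<in>V. \<exists>g'. (g has_derivative g') (at y) \<and> (\<forall>v. frechet_derivative f (at (g y)) (g' v) = v))"
proof -
 define D where "D x = frechet_derivative f (at x)" for x
 have dD: "(f has_derivative D x) (at x)" if "x\<in>S" for x unfolding D_def by (rule C1_on_frechet(1)[OF f that])
 define F where "F x = Blinfun (D x)" for x
 have F: "blinfun_apply (F x) = D x" if "x\<in>S" for x
  unfolding F_def using dD[OF that] by (intro bounded_linear_Blinfun_apply) (rule has_derivative_bounded_linear)
 have cF: "continuous_on S F"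
 proof (rule continuous_on_blinfun_componentwise)
  fix i :: 'a assume "i\<in>Basis"
  have "continuous_on S (\<lambda>x. D x i)" unfolding D_def by (rule C1_on_frechet(2)[OF f])
  then show "continuous_on S (\<lambda>x. blinfun_apply (F x) i)" by (rule continuous_on_eq) (simp add: F)
 qed
 have linD: "linear (D x0)" using dD[OF S(2)] by (rule has_derivative_linear)
 have "bij (D x0)" using inj linear_inj_imp_surj[OF linD] unfolding bij_def D_def by auto
 have invlin: "bounded_linear (inv (D x0))"
  using linear_inj_imp_surj[OF linD] inj unfolding D_def[symmetric]
  by (metis \<open>bij (D x0)\<close> bij_betw_def inj_linear_imp_inv_linear linD linear_conv_bounded_linear)
 have "Blinfun (inv (D x0)) o\<^sub>L F x0 = id_blinfun"
  by (rule blinfun_eqI) (simp add: bounded_linear_Blinfun_apply[OF invlin] F[OF S(2)] inv_f_f[OF inj[folded D_def]])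
 from inverse_function_theorem[OF S(1) _ cF S(2) this, of f]
 obtain U V g g' where U: "open U" "U\<subseteq>S" "x0\<in>U" "open V" "f x0\<in>V" "homeomorphism U V f g"
  and g': "\<And>y. y\<in>V ==> (g has_derivative g' y) (at y)"
  "\<And>y. y\<in>V ==> g' y = inv (blinfun_apply (F (g y)))"
  "\<And>y. y\<in>V ==> bij (blinfun_apply (F (g y)))"
  using dD F by metis
 have "\<exists>h. (g has_derivative h) (at y) \<and> (\<forall>v. frechet_derivative f (at (g y)) (h v) = v)" if y: "y\<in>V" for y
 proof (intro exI conjI allI)
  show "(g has_derivative g' y) (at y)" by (rule g'(1)[OF y])
  have "g y\<in>S" using U(2,6) y unfolding homeomorphism_def by auto
  then have "frechet_derivative f (at (g y)) = blinfun_apply (F (g y))" by (simp add: F D_def)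
  then show "frechet_derivative f (at (g y)) (g' y v) = v" for v
   unfolding g'(2)[OF y] using g'(3)[OF y] by (simp add: bij_is_surj surj_f_inv_f)
 qed
 then show ?thesis using U by blast
qed

locale hyp_manifold =
 fixes M :: "('a, 'n::finite) riem"
 assumes riem: "riemannian_manifold M" and curv: "constant_curvature M (-1)"
begin

abbreviation X where "X \<equiv> man_top M"

lemma chart_locale: "c\<in>man_atlas M ==> hyp_chart M c"
 by unfold_locales (auto intro: riem curv)

lemma Hausdorff: "Hausdorff_space X"
 using riem unfolding riemannian_manifold_def by blast

lemma atlas_cover: "p\<in>topspace X ==> \<exists>c\<in>man_atlas M. p\<in>chart_dom c"
 using riem unfolding riemannian_manifold_def smooth_atlas_def by blast

lemma chart_dom_open: "c\<in>man_atlas M ==> openin X (chart_dom c)"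
 and chart_img_open: "c\<in>man_atlas M ==> open (chart_img c)"
 and chart_homeo: "c\<in>man_atlas M ==> homeomorphic_map (subtopology X (chart_dom c)) (top_of_set (chart_img c)) (chart_map c)"
 using riem unfolding riemannian_manifold_def smooth_atlas_def by blast+

lemma chart_dom_sub: "c\<in>man_atlas M ==> chart_dom c\<subseteq>topspace X"
 using chart_dom_open openin_subset by blast

lemma chart_topspace: "c\<in>man_atlas M ==> topspace (subtopology X (chart_dom c)) = chart_dom c"
 using chart_dom_sub[of c] by auto

lemma chart_inj: "c\<in>man_atlas M ==> inj_on (chart_map c) (chart_dom c)"
 using chart_homeo[of c] chart_topspace[of c] unfolding homeomorphic_eq_everything_map by auto

lemma chart_inv_map: "c\<in>man_atlas M ==> p\<in>chart_dom c ==> chart_inv c (chart_map c p) = p"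
 unfolding chart_inv_def by (simp add: chart_inj inv_into_f_f)

lemma chart_map_inv: "x\<in>chart_img c ==> chart_map c (chart_inv c x) = x"
 and chart_inv_dom: "x\<in>chart_img c ==> chart_inv c x\<in>chart_dom c"
 unfolding chart_inv_def chart_img_def by (simp_all add: f_inv_into_f inv_into_into)

lemma chart_map_img: "p\<in>chart_dom c ==> chart_map c p\<in>chart_img c"
 unfolding chart_img_def by simp

lemma chart_open_image:
 assumes "c\<in>man_atlas M" "openin X U" "U\<subseteq>chart_dom c"
 shows "open (chart_map c ` U)"
by (smt (verit, best) assms(1,2,3) chart_dom_open chart_homeo chart_img_open chart_topspace homeomorphic_map_openness openin_open_eq openin_open_subtopology)

lemma chart_open_preimage:
 assumes "c\<in>man_atlas M" "open W"
 shows "openin X {p\<in>chart_dom c. chart_map c p\<in>W}"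
proof -
 have "continuous_map (subtopology X (chart_dom c)) (top_of_set (chart_img c)) (chart_map c)"
  using chart_homeo[OF assms(1)] unfolding homeomorphic_eq_everything_map by blast
 moreover have "openin (top_of_set (chart_img c)) (chart_img c\<inter>W)" using assms(2) by auto
 ultimately have "openin (subtopology X (chart_dom c)) {p\<in>topspace (subtopology X (chart_dom c)). chart_map c p\<in>chart_img c\<inter>W}"
  by (rule openin_continuous_map_preimage)
 moreover have "{p\<in>topspace (subtopology X (chart_dom c)). chart_map c p\<in>chart_img c\<inter>W} = {p\<in>chart_dom c. chart_map c p\<in>W}"
  unfolding chart_topspace[OF assms(1)] by (auto intro: chart_map_img)
 ultimately show ?thesis using chart_dom_open[OF assms(1)] by (metis openin_open_subtopology)
qed

definition dcf where "dcf c f w = frechet_derivative (chart_map c \<circ> f) (at w)"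

text \<open>Local isometries from open sets of the model. The target is an abstract topological
  space, so continuity is stated by preimages; the metric condition is demanded in every chart,
  which avoids any choice.\<close>

definition liso :: "(real^'n) set => (real^'n => 'a) => bool" where
 "liso W f \<longleftrightarrow> open W \<and> f ` W\<subseteq>topspace X \<and> (\<forall>U. openin X U --> open {w\<in>W. f w\<in>U}) \<and>
  (\<forall>c\<in>man_atlas M. C1_on (chart_map c \<circ> f) {w\<in>W. f w\<in>chart_dom c} \<and>
   (\<forall>w\<in>W. f w\<in>chart_dom c -->
    (\<forall>v v'. inner_at M c (chart_map c (f w)) (dcf c f w v) (dcf c f w v') = gH w v v')))"

lemma liso_open: "liso W f ==> open W"
 and liso_topspace: "liso W f ==> w\<in>W ==> f w\<in>topspace X"
 and liso_preimage: "liso W f ==> openin X U ==> open {w\<in>W. f w\<in>U}"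
 and liso_C1: "liso W f ==> c\<in>man_atlas M ==> C1_on (chart_map c \<circ> f) {w\<in>W. f w\<in>chart_dom c}"
 and liso_isometry: "liso W f ==> c\<in>man_atlas M ==> w\<in>W ==> f w\<in>chart_dom c ==>
   inner_at M c (chart_map c (f w)) (dcf c f w v) (dcf c f w v') = gH w v v'"
 unfolding liso_def by blast+

lemma liso_subset:
 assumes f: "liso W f" and V: "open V" "V\<subseteq>W"
 shows "liso V f"
 unfolding liso_def
proof (intro conjI allI impI ballI V(1))
 show "f ` V\<subseteq>topspace X" using V liso_topspace[OF f] by auto
 fix U assume "openin X U"
 moreover have "{w\<in>V. f w\<in>U} = V\<inter>{w\<in>W. f w\<in>U}" using V by auto
 ultimately show "open {w\<in>V. f w\<in>U}" using liso_preimage[OF f] V by auto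
next
 fix c assume c: "c\<in>man_atlas M"
 show "C1_on (chart_map c \<circ> f) {w\<in>V. f w\<in>chart_dom c}"
  by (rule C1_on_subset[OF liso_C1[OF f c]]) (use V in auto)
 fix w v v' assume "w\<in>V" "f w\<in>chart_dom c"
 then show "inner_at M c (chart_map c (f w)) (dcf c f w v) (dcf c f w v') = gH w v v'"
  using liso_isometry[OF f c] V(2) by blast
qed

lemma liso_has_derivative:
 assumes "liso W f" "c\<in>man_atlas M" "w\<in>W" "f w\<in>chart_dom c"
 shows "((\<lambda>w. chart_map c (f w)) has_derivative dcf c f w) (at w)"
 using C1_on_frechet(1)[OF liso_C1[OF assms(1,2)]] assms(3,4) unfolding dcf_def comp_def by blast

lemma dcf_inj:
 assumes "liso W f" "c\<in>man_atlas M" "w\<in>W" "f w\<in>chart_dom c"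
 shows "inj (dcf c f w)"
proof (rule linear_injective_0[THEN iffD2], rule has_derivative_linear[OF liso_has_derivative[OF assms]], intro allI impI)
 fix v assume "dcf c f w v = 0"
 then have "gH w v v = 0" using liso_isometry[OF assms, of v v] unfolding inner_at_def by simp
 then show "v = 0" by (simp add: gH_eq_0_iff)
qed

lemma transition_eq: "c\<in>man_atlas M ==> p\<in>chart_dom c ==> transition c c' (chart_map c p) = chart_map c' p"
 unfolding transition_def by (simp add: chart_inv_map)

lemma overlap_open:
 assumes "c\<in>man_atlas M" "c'\<in>man_atlas M"
 shows "open (chart_map c ` (chart_dom c\<inter>chart_dom c'))"
 by (rule chart_open_image[OF assms(1)]) (auto intro: openin_Int chart_dom_open assms)

lemma transition_C1:
 assumes "c\<in>man_atlas M" "c'\<in>man_atlas M"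
 shows "C1_on (transition c c') (chart_map c ` (chart_dom c\<inter>chart_dom c'))"
proof -
 have "smooth_on (transition c c') (chart_map c ` (chart_dom c\<inter>chart_dom c'))"
  using riem assms unfolding riemannian_manifold_def smooth_atlas_def by blast
 then show ?thesis unfolding smooth_on_def C1_on_iff_Ck_on by blast
qed

lemma transition_isometry:
 assumes "c\<in>man_atlas M" "c'\<in>man_atlas M" "p\<in>chart_dom c" "p\<in>chart_dom c'"
 shows "inner_at M c' (chart_map c' p) (frechet_derivative (transition c c') (at (chart_map c p)) y)
   (frechet_derivative (transition c c') (at (chart_map c p)) z) = inner_at M c (chart_map c p) y z"
proof -
 have "\<forall>c\<in>man_atlas M. \<forall>c'\<in>man_atlas M. \<forall>x\<in>chart_map c ` (chart_dom c\<inter>chart_dom c').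
    let D = frechet_derivative (transition c c') (at x) in
     \<forall>y z. y \<bullet> (man_metric M c x *v z) = D y \<bullet> (man_metric M c' (transition c c' x) *v D z)"
  using riem unfolding riemannian_manifold_def by blast
 then have "let D = frechet_derivative (transition c c') (at (chart_map c p)) in
     \<forall>y z. y \<bullet> (man_metric M c (chart_map c p) *v z) = D y \<bullet> (man_metric M c' (transition c c' (chart_map c p)) *v D z)"
  using assms by blast
 then show ?thesis unfolding inner_at_def Let_def transition_eq[OF assms(1,3)] by simp
qed

text \<open>Checking one chart around each point suffices, because transition maps are C1 and
  isometric.\<close>

lemma lisoI:
 assumes W: "open W" and loc: "\<And>w. w\<in>W ==> \<exists>c\<in>man_atlas M. \<exists>N. open N \<and> w\<in>N \<and> N\<subseteq>W \<and> f ` N\<subseteq>chart_dom c \<and>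
   C1_on (chart_map c \<circ> f) N \<and>
   (\<forall>z\<in>N. \<forall>v v'. inner_at M c (chart_map c (f z)) (dcf c f z v) (dcf c f z v') = gH z v v')"
 shows "liso W f"
 unfolding liso_def
proof (intro conjI allI impI ballI W)
 show "f ` W\<subseteq>topspace X"
 by (smt (verit, del_insts) hyp_manifold.chart_dom_sub hyp_manifold_axioms image_subset_iff loc subsetD)
 fix U assume U: "openin X U"
 show "open {w\<in>W. f w\<in>U}"
 proof (subst open_subopen, intro ballI)
  fix w assume w: "w\<in>{w\<in>W. f w\<in>U}"
  obtain c N where c: "c\<in>man_atlas M" and N: "open N" "w\<in>N" "N\<subseteq>W" "f ` N\<subseteq>chart_dom c" "C1_on (chart_map c \<circ> f) N"
   using loc[of w] w by blast
  have o: "open (chart_map c ` (U\<inter>chart_dom c))"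
   by (rule chart_open_image[OF c]) (auto intro: openin_Int chart_dom_open c U)
  have "open (N\<inter>(chart_map c \<circ> f) -` (chart_map c ` (U\<inter>chart_dom c)))"
   using continuous_open_preimage[OF C1_on_continuous[OF N(5)] N(1) o] .
  moreover have "w\<in>N\<inter>(chart_map c \<circ> f) -` (chart_map c ` (U\<inter>chart_dom c))" using w N by auto
  moreover have "N\<inter>(chart_map c \<circ> f) -` (chart_map c ` (U\<inter>chart_dom c))\<subseteq>{w\<in>W. f w\<in>U}"
  proof
   fix z assume z: "z\<in>N\<inter>(chart_map c \<circ> f) -` (chart_map c ` (U\<inter>chart_dom c))"
   then obtain q where q: "q\<in>U" "q\<in>chart_dom c" "chart_map c (f z) = chart_map c q" by auto
   have "f z = q" using inj_onD[OF chart_inj[OF c] q(3)] q(2) z N by auto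
   then show "z\<in>{w\<in>W. f w\<in>U}" using q z N by auto
  qed
  ultimately show "\<exists>T. open T \<and> w\<in>T \<and> T\<subseteq>{w\<in>W. f w\<in>U}" by blast
 qed
next
 fix c' assume c': "c'\<in>man_atlas M"
 have main: "\<exists>N. open N \<and> w\<in>N \<and> C1_on (chart_map c' \<circ> f) N \<and>
   (\<forall>v v'. inner_at M c' (chart_map c' (f w)) (dcf c' f w v) (dcf c' f w v') = gH w v v')"
  if w: "w\<in>W" "f w\<in>chart_dom c'" for w
 proof -
  obtain c N where c: "c\<in>man_atlas M" and N: "open N" "w\<in>N" "N\<subseteq>W" "f ` N\<subseteq>chart_dom c" "C1_on (chart_map c \<circ> f) N"
   and iso: "\<And>z v v'. z\<in>N ==> inner_at M c (chart_map c (f z)) (dcf c f z v) (dcf c f z v') = gH z v v'"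
   using loc[of w] w by blast
  define T where "T = chart_map c ` (chart_dom c\<inter>chart_dom c')"
  have oT: "open T" unfolding T_def by (rule overlap_open[OF c c'])
  define N' where "N' = N\<inter>(chart_map c \<circ> f) -` T"
  have N': "open N'" unfolding N'_def
   using continuous_open_preimage[OF C1_on_continuous[OF N(5)] N(1) oT] .
  have wN': "w\<in>N'" unfolding N'_def T_def using w N by auto
  have C1N': "C1_on (chart_map c \<circ> f) N'" by (rule C1_on_subset[OF N(5)]) (auto simp: N'_def)
  have eq: "(transition c c' \<circ> (chart_map c \<circ> f)) z = (chart_map c' \<circ> f) z" if "z\<in>N'" for z
   using transition_eq[OF c, of "f z" c'] N(4) that unfolding N'_def by auto
  have C1t: "C1_on (transition c c') T" unfolding T_def by (rule transition_C1[OF c c'])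
  have "C1_on (transition c c' \<circ> (chart_map c \<circ> f)) N'"
   by (rule C1_on_compose[OF C1N' C1t]) (auto simp: N'_def)
  then have C1: "C1_on (chart_map c' \<circ> f) N'" by (rule C1_on_cong[OF N']) (rule eq)
  have wT: "(chart_map c \<circ> f) w\<in>T" using wN' unfolding N'_def by auto
  have d: "dcf c' f w v = frechet_derivative (transition c c') (at (chart_map c (f w))) (dcf c f w v)" for v
  proof -
   have e: "frechet_derivative (transition c c' \<circ> (chart_map c \<circ> f)) (at w) = frechet_derivative (chart_map c' \<circ> f) (at w)"
    by (rule frechet_derivative_cong[OF N' wN']) (rule eq)
   show ?thesis unfolding dcf_def e[symmetric] frechet_derivative_compose'[OF C1N' wN' C1t wT] by simp
  qed
  have fw: "f w\<in>chart_dom c" using N by auto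
  have "inner_at M c' (chart_map c' (f w)) (dcf c' f w v) (dcf c' f w v') = gH w v v'" for v v'
   unfolding d transition_isometry[OF c c' fw w(2)] by (rule iso[OF N(2)])
  then show ?thesis using N' wN' C1 by blast
 qed
 show "C1_on (chart_map c' \<circ> f) {w\<in>W. f w\<in>chart_dom c'}"
  by (rule C1_on_local) (use main in blast)
 fix w v v' assume "w\<in>W" "f w\<in>chart_dom c'"
 then show "inner_at M c' (chart_map c' (f w)) (dcf c' f w v) (dcf c' f w v') = gH w v v'"
  using main by blast
qed

lemma liso_glue:
 assumes "open W" and "\<And>w. w\<in>W ==> \<exists>V h. open V \<and> w\<in>V \<and> V\<subseteq>W \<and> liso V h \<and> (\<forall>z\<in>V. h z = f z)"
 shows "liso W f"
proof (rule lisoI[OF assms(1)])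
 fix w assume "w\<in>W"
 from assms(2)[OF this] obtain V h where "open V \<and> w\<in>V \<and> V\<subseteq>W \<and> liso V h \<and> (\<forall>z\<in>V. h z = f z)" by (elim exE)
 then have V: "open V" "w\<in>V" "V\<subseteq>W" "liso V h" "\<And>z. z\<in>V ==> h z = f z" by auto
 obtain c where c: "c\<in>man_atlas M" "h w\<in>chart_dom c" using atlas_cover[OF liso_topspace[OF V(4,2)]] by blast
 define N where "N = {z\<in>V. h z\<in>chart_dom c}"
 have oN: "open N" unfolding N_def by (rule liso_preimage[OF V(4) chart_dom_open[OF c(1)]])
 have C1: "C1_on (chart_map c \<circ> h) N" unfolding N_def by (rule liso_C1[OF V(4) c(1)])
 have eq: "(chart_map c \<circ> h) z = (chart_map c \<circ> f) z" if "z\<in>N" for z using V(5) that unfolding N_def by simp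
 have d: "dcf c f z = dcf c h z" if "z\<in>N" for z
  unfolding dcf_def by (rule frechet_derivative_cong[OF oN that, symmetric]) (rule eq)
 show "\<exists>c\<in>man_atlas M. \<exists>N. open N \<and> w\<in>N \<and> N\<subseteq>W \<and> f ` N\<subseteq>chart_dom c \<and>
   C1_on (chart_map c \<circ> f) N \<and>
   (\<forall>z\<in>N. \<forall>v v'. inner_at M c (chart_map c (f z)) (dcf c f z v) (dcf c f z v') = gH z v v')"
 proof (intro bexI[OF _ c(1)] exI[of _ N] conjI oN ballI allI)
  show "w\<in>N" "N\<subseteq>W" "f ` N\<subseteq>chart_dom c" using V c unfolding N_def by auto
  show "C1_on (chart_map c \<circ> f) N" by (rule C1_on_cong[OF oN C1]) (rule eq)
  fix z v v' assume z: "z\<in>N"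
  have "f z = h z" using V(5) z unfolding N_def by simp
  then show "inner_at M c (chart_map c (f z)) (dcf c f z v) (dcf c f z v') = gH z v v'"
   unfolding d[OF z] using liso_isometry[OF V(4) c(1)] z unfolding N_def by simp
 qed
qed

lemma liso_hiso:
 assumes f: "liso W f" and k: "hiso k"
 shows "liso (k -` W) (f \<circ> k)"
proof -
 obtain k' where k': "\<And>x S. (k has_derivative k' x) (at x within S)" "\<And>v. continuous_on UNIV (\<lambda>x. k' x v)"
  "\<And>x v w. gH (k x) (k' x v) (k' x w) = gH x v w" using hiso_deriv[OF k] by metis
 have C1k: "C1_on k UNIV" by (rule C1_onI[OF k'(1,2)])
 have fk: "frechet_derivative k (at x) = k' x" for x using frechet_derivative_at[OF k'(1)] by simp
 have op: "open (k -` W)" if "open W" for W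
  using hiso_continuous_on[OF k, of UNIV] that by (simp add: open_vimage)
 show ?thesis
 proof (rule lisoI)
  show "open (k -` W)" by (rule op[OF liso_open[OF f]])
  fix w assume w: "w\<in>k -` W"
  then obtain c where c: "c\<in>man_atlas M" "f (k w)\<in>chart_dom c" using atlas_cover liso_topspace[OF f] by blast
  define N where "N = {z\<in>W. f z\<in>chart_dom c}"
  have oN: "open N" unfolding N_def by (rule liso_preimage[OF f chart_dom_open[OF c(1)]])
  have C1: "C1_on (chart_map c \<circ> f) N" unfolding N_def by (rule liso_C1[OF f c(1)])
  have C1k': "C1_on k (k -` N)" by (rule C1_on_subset[OF C1k]) auto
  show "\<exists>c\<in>man_atlas M. \<exists>N. open N \<and> w\<in>N \<and> N\<subseteq>k -` W \<and> (f \<circ> k) ` N\<subseteq>chart_dom c \<and>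
   C1_on (chart_map c \<circ> (f \<circ> k)) N \<and>
   (\<forall>z\<in>N. \<forall>v v'. inner_at M c (chart_map c ((f \<circ> k) z)) (dcf c (f \<circ> k) z v) (dcf c (f \<circ> k) z v') = gH z v v')"
  proof (intro bexI[OF _ c(1)] exI[of _ "k -` N"] conjI ballI allI)
   show "open (k -` N)" by (rule op[OF oN])
   show "w\<in>k -` N" "k -` N\<subseteq>k -` W" "(f \<circ> k) ` (k -` N)\<subseteq>chart_dom c" using w c unfolding N_def by auto
   show "C1_on (chart_map c \<circ> (f \<circ> k)) (k -` N)"
    unfolding comp_assoc[symmetric] by (rule C1_on_compose[OF C1k' C1]) auto
   fix z v v' assume z: "z\<in>k -` N"
   have d: "dcf c (f \<circ> k) z v = dcf c f (k z) (k' z v)" for v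
    unfolding dcf_def comp_assoc[symmetric]
    using frechet_derivative_compose'[OF C1k' z C1, of v] z by (simp add: fk)
   show "inner_at M c (chart_map c ((f \<circ> k) z)) (dcf c (f \<circ> k) z v) (dcf c (f \<circ> k) z v') = gH z v v'"
    unfolding d comp_apply using liso_isometry[OF f c(1), of "k z"] z k'(3) unfolding N_def by simp
  qed
 qed
qed

end

context hyp_manifold begin

lemma liso_local_inverse:
 assumes f: "liso W f" and c: "c\<in>man_atlas M" and w: "w\<in>W" "f w\<in>chart_dom c"
 shows "\<exists>U V b. open U \<and> U\<subseteq>W \<and> f ` U\<subseteq>chart_dom c \<and> w\<in>U \<and> open V \<and> chart_map c (f w)\<in>V \<and>
  homeomorphism U V (\<lambda>z. chart_map c (f z)) b \<and>
  (\<forall>y\<in>V. \<exists>b'. (b has_derivative b') (at y) \<and> (\<forall>v. dcf c f (b y) (b' v) = v))"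
proof -
 define N where "N = {z\<in>W. f z\<in>chart_dom c}"
 have oN: "open N" unfolding N_def by (rule liso_preimage[OF f chart_dom_open[OF c]])
 have C1: "C1_on (chart_map c \<circ> f) N" unfolding N_def by (rule liso_C1[OF f c])
 have wN: "w\<in>N" unfolding N_def using w by simp
 have "inj (frechet_derivative (chart_map c \<circ> f) (at w))" using dcf_inj[OF f c w] unfolding dcf_def .
 from C1_inverse_function[OF oN wN C1 this] obtain U V b where "open U" "U\<subseteq>N" "w\<in>U" "open V"
  "chart_map c (f w)\<in>V" "homeomorphism U V (chart_map c \<circ> f) b"
  "\<forall>y\<in>V. \<exists>b'. (b has_derivative b') (at y) \<and> (\<forall>v. frechet_derivative (chart_map c \<circ> f) (at (b y)) (b' v) = v)"
  by auto
 then show ?thesis unfolding dcf_def comp_def[of "chart_map c" f] N_def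
  by (intro exI[of _ U] exI[of _ V] exI[of _ b]) auto
qed

text \<open>Near the common value \<open>f\<close> and \<open>f'\<close> can be inverted in a chart,
  so \<open>f\<close> differs from \<open>f'\<close> by an infinitesimal isometry of the model whose
  inverse is one as well. Both are contractions by \<open>hB_contraction\<close>; hence distances
  are preserved, and the map extends to the whole model.\<close>

theorem liso_rigid:
 assumes f: "liso W f" and f': "liso W' f'" and w: "w\<in>W" "w'\<in>W'" and eq: "f w = f' w'"
 shows "\<exists>k N. hiso k \<and> k w = w' \<and> open N \<and> w\<in>N \<and> N\<subseteq>W \<and> k ` N\<subseteq>W' \<and> (\<forall>z\<in>N. f z = f' (k z))"
proof -
 obtain c where c: "c\<in>man_atlas M" "f w\<in>chart_dom c" using atlas_cover[OF liso_topspace[OF f w(1)]] by blast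
 have c': "f' w'\<in>chart_dom c" using c eq by simp
 define a a' where "a z = chart_map c (f z)" and "a' z = chart_map c (f' z)" for z
 obtain U V b where U: "open U" "U\<subseteq>W" "f ` U\<subseteq>chart_dom c" "w\<in>U" "open V" "a w\<in>V" "homeomorphism U V a b"
  and b: "\<And>y. y\<in>V ==> \<exists>b'. (b has_derivative b') (at y) \<and> (\<forall>v. dcf c f (b y) (b' v) = v)"
  using liso_local_inverse[OF f c(1) w(1) c(2)] unfolding a_def by blast
 obtain U' V' b' where U': "open U'" "U'\<subseteq>W'" "f' ` U'\<subseteq>chart_dom c" "w'\<in>U'" "open V'" "a' w'\<in>V'" "homeomorphism U' V' a' b'"
  and b': "\<And>y. y\<in>V' ==> \<exists>d. (b' has_derivative d) (at y) \<and> (\<forall>v. dcf c f' (b' y) (d v) = v)"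
  using liso_local_inverse[OF f' c(1) w(2) c'] unfolding a'_def by blast
 have ae: "a = (\<lambda>z. chart_map c (f z))" and ae': "a' = (\<lambda>z. chart_map c (f' z))"
  unfolding a_def a'_def by (rule refl)+
 have aw: "a w = a' w'" unfolding a_def a'_def eq ..
 have key: "\<exists>D. ((b2 \<circ> a1) has_derivative D) (at z) \<and> (\<forall>v. gH ((b2 \<circ> a1) z) (D v) (D v) = gH z v v)"
  if "liso W1 f1" "liso W2 f2" "z\<in>W1" "f1 z\<in>chart_dom c" and a1: "a1 = (\<lambda>z. chart_map c (f1 z))" and a2: "a2 = (\<lambda>z. chart_map c (f2 z))"
   and h: "homeomorphism U2 V2 a2 b2" "U2\<subseteq>W2" "f2 ` U2\<subseteq>chart_dom c"
   and b2: "\<And>y. y\<in>V2 ==> \<exists>d. (b2 has_derivative d) (at y) \<and> (\<forall>v. dcf c f2 (b2 y) (d v) = v)"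
   and z: "a1 z\<in>V2" for W1 W2 f1 f2 a1 a2 b2 z U2 V2
 proof -
  obtain d where d: "(b2 has_derivative d) (at (a1 z))" "\<And>v. dcf c f2 (b2 (a1 z)) (d v) = v" using b2[OF z] by blast
  have "(a1 has_derivative dcf c f1 z) (at z)" unfolding a1 by (rule liso_has_derivative[OF that(1) c(1) that(3,4)])
  from has_derivative_compose[OF this d(1)] have D: "((b2 \<circ> a1) has_derivative (\<lambda>v. d (dcf c f1 z v))) (at z)" unfolding comp_def .
  have b2z: "b2 (a1 z)\<in>U2" and a2b2: "a2 (b2 (a1 z)) = a1 z" using h(1) z unfolding homeomorphism_def by auto
  have "gH ((b2 \<circ> a1) z) (d (dcf c f1 z v)) (d (dcf c f1 z v)) = gH z v v" for v
  proof -
   have "gH (b2 (a1 z)) (d (dcf c f1 z v)) (d (dcf c f1 z v)) = inner_at M c (a2 (b2 (a1 z))) (dcf c f1 z v) (dcf c f1 z v)"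
   proof -
    have "b2 (a1 z)\<in>W2" "f2 (b2 (a1 z))\<in>chart_dom c" using b2z h(2,3) by auto
    from liso_isometry[OF that(2) c(1) this, of "d (dcf c f1 z v)" "d (dcf c f1 z v)"]
    show ?thesis unfolding a2 d(2) by simp
   qed
   also have "\<dots> = gH z v v" unfolding a2b2 unfolding a1 by (rule liso_isometry[OF that(1) c(1) that(3,4)])
   finally show ?thesis by simp
  qed
  then show ?thesis using D by blast
 qed
 \<comment> \<open>\<open>\<psi>\<close> is a local inverse of \<open>f'\<close> after
   \<open>f\<close>, and \<open>\<theta>\<close> the same with the roles exchanged.\<close>
 define \<psi> \<theta> where "\<psi> = b' \<circ> a" and "\<theta> = b \<circ> a'"
 define O1 where "O1 = U\<inter>a -` V'"
 define O2 where "O2 = U'\<inter>a' -` V"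
 have o1: "open O1" unfolding O1_def using U(7) U(1) U'(5) unfolding homeomorphism_def by (auto intro: continuous_open_preimage)
 have o2: "open O2" unfolding O2_def using U'(7) U'(1) U(5) unfolding homeomorphism_def by (auto intro: continuous_open_preimage)
 have w1: "w\<in>O1" unfolding O1_def using U U' aw by simp
 have w2: "w'\<in>O2" unfolding O2_def using U U' aw by simp
 have \<psi>w: "\<psi> w = w'" unfolding \<psi>_def comp_apply aw using U'(4,7) unfolding homeomorphism_def by auto
 have d\<psi>: "\<exists>D. (\<psi> has_derivative D) (at z) \<and> (\<forall>v. gH (\<psi> z) (D v) (D v) = gH z v v)" if "z\<in>O1" for z
  unfolding \<psi>_def
  by (rule key[OF f f' _ _ ae ae' U'(7) U'(2,3) b']) (use that U in \<open>auto simp: O1_def\<close>)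
 have d\<theta>: "\<exists>D. (\<theta> has_derivative D) (at z) \<and> (\<forall>v. gH (\<theta> z) (D v) (D v) = gH z v v)" if "z\<in>O2" for z
  unfolding \<theta>_def
  by (rule key[OF f' f _ _ ae' ae U(7) U(2,3) b]) (use that U' in \<open>auto simp: O2_def\<close>)
 have \<theta>\<psi>: "\<theta> (\<psi> z) = z" if "z\<in>O1" for z
  using that U(7) U'(7) unfolding O1_def \<theta>_def \<psi>_def homeomorphism_def by auto
 obtain e1 where e1: "e1 > 0" "ball w e1\<subseteq>O1" using o1 w1 open_contains_ball by blast
 obtain e2 where e2: "e2 > 0" "ball w' e2\<subseteq>O2" using o2 w2 open_contains_ball by blast
 obtain C1 where C1: "1 < C1" "\<And>y. hB w y < C1 ==> y\<in>ball w e1" using hB_small[OF e1(1)] by metis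
 obtain C2 where C2: "1 < C2" "\<And>y. hB w' y < C2 ==> y\<in>ball w' e2" using hB_small[OF e2(1)] by metis
 define C where "C = min C1 C2"
 have C: "1 < C" "\<And>y. hB w y < C ==> y\<in>O1" "\<And>y. hB w' y < C ==> y\<in>O2"
  using C1 C2 e1 e2 unfolding C_def by auto
 obtain D where D: "\<And>z. z\<in>O1 ==> (\<psi> has_derivative D z) (at z)" "\<And>z v. z\<in>O1 ==> gH (\<psi> z) (D z v) (D z v) = gH z v v"
  using d\<psi> by metis
 obtain E where E: "\<And>z. z\<in>O2 ==> (\<theta> has_derivative E z) (at z)" "\<And>z v. z\<in>O2 ==> gH (\<theta> z) (E z v) (E z v) = gH z v v"
  using d\<theta> by metis
 define N where "N = {y. hB w y < C}"
 have oN: "open N" unfolding N_def by (intro open_Collect_less continuous_intros)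
 have wN: "w\<in>N" unfolding N_def using C(1) by simp
 have le1: "hB (\<psi> x) (\<psi> y)\<le>hB x y" if "x\<in>N" "y\<in>N" for x y
  by (rule hB_contraction[where w = w and C = C and D = D]) (use that C D in \<open>auto simp: N_def\<close>)
 have N2: "hB w' (\<psi> x) < C" if "x\<in>N" for x
  using le1[OF wN that] that unfolding \<psi>w N_def by simp
 have le2: "hB x y\<le>hB (\<psi> x) (\<psi> y)" if "x\<in>N" "y\<in>N" for x y
 proof -
  have "hB (\<theta> (\<psi> x)) (\<theta> (\<psi> y))\<le>hB (\<psi> x) (\<psi> y)"
   by (rule hB_contraction[where w = w' and C = C and D = E]) (use that C E N2 in auto)
  then show ?thesis using that C(2) by (simp add: \<theta>\<psi> N_def)
 qed
 obtain k where k: "hiso k" "\<And>x. x\<in>N ==> \<psi> x = k x"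
  using hB_local_isometry_extends[OF oN, of \<psi>] wN le1 le2 by (metis antisym empty_iff)
 have NO: "N\<subseteq>O1" unfolding N_def using C by auto
 have "k w = w'" using k(2)[OF wN] \<psi>w by simp
 moreover have "k ` N\<subseteq>W'"
 proof
  fix y assume "y\<in>k ` N"
  then obtain x where x: "x\<in>N" "y = \<psi> x" using k(2) by auto
  then have "a x\<in>V'" using NO unfolding O1_def by auto
  then have "\<psi> x\<in>U'" unfolding \<psi>_def using U'(7) unfolding homeomorphism_def by auto
  then show "y\<in>W'" using x U'(2) by auto
 qed
 moreover have "f z = f' (k z)" if z: "z\<in>N" for z
 proof -
  have zz: "z\<in>U" "a z\<in>V'" using z NO unfolding O1_def by auto
  then have "\<psi> z\<in>U'" "a' (\<psi> z) = a z" unfolding \<psi>_def using U'(7) unfolding homeomorphism_def by auto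
  then have "chart_map c (f z) = chart_map c (f' (\<psi> z))" "f z\<in>chart_dom c" "f' (\<psi> z)\<in>chart_dom c"
   using zz U(3) U'(3) unfolding a_def a'_def by auto
  then show ?thesis using inj_onD[OF chart_inj[OF c(1)]] k(2)[OF z] by metis
 qed
 moreover have "N\<subseteq>W" using NO U(2) unfolding O1_def by auto
 ultimately show ?thesis using k(1) oN wN by blast
qed

end

section \<open>Existence and unique continuation of local isometries\<close>

context hyp_manifold begin

text \<open>The parametrisation inverts the tractor coordinates \<open>\<phi>\<close>. The frame is
  kept in the statement, since the analysis of geodesics and of lengths of curves is carried out in
  it.\<close>

lemma liso_exists:
 assumes c: "c\<in>man_atlas M" and p: "p\<in>chart_dom c"
 shows "\<exists>\<rho>>0. \<exists>J B \<phi> \<xi> \<eta>. liso (ball 0 \<rho>) J \<and> J 0 = p \<and> inj_on J (ball 0 \<rho>) \<and>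
  (\<forall>W. open W --> W\<subseteq>ball 0 \<rho> --> openin X (J ` W)) \<and> J ` ball 0 \<rho>\<subseteq>chart_dom c \<and>
  hyp_chart.tractor_frame M c B \<phi> \<xi> \<eta> \<and> (\<forall>z\<in>ball 0 \<rho>. chart_map c (J z)\<in>B \<and> \<phi> (chart_map c (J z)) = z)"
proof -
 interpret C: hyp_chart M c by (rule chart_locale[OF c])
 define x0 where "x0 = chart_map c p"
 have x0: "x0\<in>C.S" unfolding x0_def C.S_def by (rule chart_map_img[OF p])
 obtain r \<phi> \<xi> \<eta> where r: "r > 0" "C.tractor_frame (ball x0 r) \<phi> \<xi> \<eta>" "\<phi> x0 = 0"
  using C.tractor_frame_exists[OF x0] by blast
 define B where "B = ball x0 r"
 have F: "C.tractor_frame B \<phi> \<xi> \<eta>" unfolding B_def by (rule r(2))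
 have BS: "B\<subseteq>C.S" and oB: "open B" using F unfolding C.tractor_frame_def by auto
 have d\<phi>: "(\<phi> has_derivative C.dframe \<xi> x) (at x)" if "x\<in>B" for x
  by (rule C.tractor_frame_isometry(1)[OF F that])
 have C1: "C1_on \<phi> B" by (rule C1_onI[OF d\<phi> C.continuous_dframe[OF F]])
 have fr: "frechet_derivative \<phi> (at x) = C.dframe \<xi> x" if "x\<in>B" for x
  using frechet_derivative_at[OF d\<phi>[OF that]] by simp
 have x0B: "x0\<in>B" unfolding B_def using r by simp
 have "inj (C.dframe \<xi> x0)"
 proof (rule linear_injective_0[THEN iffD2], rule has_derivative_linear[OF d\<phi>[OF x0B]], intro allI impI)
  fix v assume "C.dframe \<xi> x0 v = 0"
  then have "C.g x0 v v = 0" using C.tractor_frame_isometry(3)[OF F x0B, of v v] by (simp add: gH_def hzd_def)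
  then show "v = 0" using C.g_pos[OF x0] by fastforce
 qed
 then have "inj (frechet_derivative \<phi> (at x0))" by (simp add: fr[OF x0B])
 from C1_inverse_function[OF oB x0B C1 this] obtain U V \<psi> where
  U: "open U" "U\<subseteq>B" "x0\<in>U" "open V" "\<phi> x0\<in>V" "homeomorphism U V \<phi> \<psi>"
  and \<psi>': "\<forall>y\<in>V. \<exists>g'. (\<psi> has_derivative g') (at y) \<and> (\<forall>v. frechet_derivative \<phi> (at (\<psi> y)) (g' v) = v)" by auto
 obtain \<rho> where \<rho>: "\<rho> > 0" "ball 0 \<rho>\<subseteq>V" using U(4,5) r(3) open_contains_ball by metis
 have \<psi>U: "\<psi> y\<in>U" "\<phi> (\<psi> y) = y" if "y\<in>V" for y using U(6) that unfolding homeomorphism_def by auto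
 have \<psi>\<phi>: "\<psi> (\<phi> x) = x" "\<phi> x\<in>V" if "x\<in>U" for x using U(6) that unfolding homeomorphism_def by auto
 define J where "J = chart_inv c \<circ> \<psi>"
 have US: "U\<subseteq>chart_img c" using U(2) BS unfolding C.S_def by auto
 have Jc: "chart_map c (J z) = \<psi> z" "J z\<in>chart_dom c" if "z\<in>ball 0 \<rho>" for z
 proof -
  have "\<psi> z\<in>chart_img c" using \<psi>U(1)[of z] US \<rho>(2) that by blast
  then show "chart_map c (J z) = \<psi> z" "J z\<in>chart_dom c"
   unfolding J_def comp_apply by (rule chart_map_inv, rule chart_inv_dom)
 qed
 \<comment> \<open>The inverse function theorem yields a derivative at each point only. This formula
   for it, the frame expansion of the vector that \<open>\<phi>\<close> maps to \<open>v\<close>,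
   shows that it varies continuously.\<close>
 define \<psi>d where "\<psi>d y v = (\<Sum>i\<in>UNIV. (v$i) *\<^sub>R \<xi> i (\<psi> y)) - hzd y v *\<^sub>R \<eta> (\<psi> y)" for y v
 have rep: "y = (\<Sum>i\<in>UNIV. C.g x y (\<xi> i x) *\<^sub>R \<xi> i x) - C.g x y (\<eta> x) *\<^sub>R \<eta> x" if "x\<in>B" for x y
  using F that unfolding C.tractor_frame_def by blast
 have d\<psi>: "(\<psi> has_derivative \<psi>d y) (at y)" and id: "C.dframe \<xi> (\<psi> y) (\<psi>d y v) = v" if y: "y\<in>V" for y v
 proof -
  obtain g' where g': "(\<psi> has_derivative g') (at y)" "\<And>v. frechet_derivative \<phi> (at (\<psi> y)) (g' v) = v"
   using \<psi>' y by blast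
  have yB: "\<psi> y\<in>B" using \<psi>U(1)[OF y] U(2) by auto
  then have yS: "\<psi> y\<in>C.S" using BS by auto
  have g2: "C.dframe \<xi> (\<psi> y) (g' v) = v" for v using g'(2) fr[OF yB] by simp
  have "g' v = \<psi>d y v" for v
  proof -
   have "C.g (\<psi> y) (g' v) (\<xi> i (\<psi> y)) = v$i" for i
    using C.dframe_nth[of \<xi> "\<psi> y" "g' v" i] C.g_sym[OF yS] unfolding g2 by simp
   moreover have "C.g (\<psi> y) (g' v) (\<eta> (\<psi> y)) = hzd y v"
    using C.tractor_frame_isometry(2)[OF F yB, of "g' v"] C.g_sym[OF yS] unfolding g2 \<psi>U(2)[OF y] by simp
   ultimately show ?thesis using rep[OF yB, of "g' v"] unfolding \<psi>d_def by simp
  qed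
  then have "g' = \<psi>d y" by (rule ext)
  then show "(\<psi> has_derivative \<psi>d y) (at y)" "C.dframe \<xi> (\<psi> y) (\<psi>d y v) = v" using g'(1) g2 by auto
 qed
 have cont: "continuous_on V (\<lambda>y. f (\<psi> y))" if "\<And>x. x\<in>B ==> (f has_derivative f' x) (at x)" for f :: "real^'n => real^'n" and f'
 proof -
  have "continuous_on B f" by (rule has_derivative_continuous_on[OF has_derivative_at_withinI[OF that]])
  moreover have "continuous_on V \<psi>" using U(6) unfolding homeomorphism_def by auto
  ultimately show ?thesis by (rule continuous_on_compose2) (use \<psi>U(1) U(2) in auto)
 qed
 have c\<xi>: "continuous_on V (\<lambda>y. \<xi> i (\<psi> y))" for i
  by (rule cont[of _ "\<lambda>x h. \<phi> x$i *\<^sub>R h - C.\<Gamma> x h (\<xi> i x)"]) (use F in \<open>auto simp: C.tractor_frame_def\<close>)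
 have c\<eta>: "continuous_on V (\<lambda>y. \<eta> (\<psi> y))"
  by (rule cont[of _ "\<lambda>x h. hz (\<phi> x) *\<^sub>R h - C.\<Gamma> x h (\<eta> x)"]) (use F in \<open>auto simp: C.tractor_frame_def\<close>)
 have c\<psi>: "continuous_on V (\<lambda>y. \<psi>d y v)" for v
  unfolding \<psi>d_def by (intro continuous_intros c\<xi> c\<eta> continuous_on_hzd)
 have C1\<psi>: "C1_on \<psi> (ball 0 \<rho>)" by (rule C1_on_subset[OF C1_onI[OF d\<psi> c\<psi>] \<rho>(2)])
 have ob: "open (ball 0 \<rho>)" by simp
 have lJ: "liso (ball 0 \<rho>) J"
 proof (rule lisoI)
  fix w :: "real^'n" assume w: "w\<in>ball 0 \<rho>"
  show "\<exists>c\<in>man_atlas M. \<exists>N. open N \<and> w\<in>N \<and> N\<subseteq>ball 0 \<rho> \<and> J ` N\<subseteq>chart_dom c \<and> C1_on (chart_map c \<circ> J) N \<and>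
    (\<forall>z\<in>N. \<forall>v v'. inner_at M c (chart_map c (J z)) (dcf c J z v) (dcf c J z v') = gH z v v')"
  proof (intro bexI[OF _ c] exI[of _ "ball 0 \<rho>"] conjI ballI allI w ob order_refl)
   show "J ` ball 0 \<rho>\<subseteq>chart_dom c" using Jc(2) by auto
   show "C1_on (chart_map c \<circ> J) (ball 0 \<rho>)"
    by (rule C1_on_cong[OF _ C1\<psi>]) (auto simp: Jc(1))
   fix z v v' assume z: "z\<in>ball (0::real^'n) \<rho>"
   have zV: "z\<in>V" using z \<rho> by auto
   have yB: "\<psi> z\<in>B" using \<psi>U(1)[OF zV] U(2) by auto
   have "frechet_derivative (chart_map c \<circ> J) (at z) = frechet_derivative \<psi> (at z)"
    by (rule frechet_derivative_cong[OF ob z]) (simp add: Jc(1))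
   also have "\<dots> = \<psi>d z" using frechet_derivative_at[OF d\<psi>[OF zV]] by simp
   finally have d: "dcf c J z = \<psi>d z" unfolding dcf_def .
   show "inner_at M c (chart_map c (J z)) (dcf c J z v) (dcf c J z v') = gH z v v'"
    unfolding Jc(1)[OF z] d
    using C.tractor_frame_isometry(3)[OF F yB, of "\<psi>d z v" "\<psi>d z v'"] unfolding id[OF zV] \<psi>U(2)[OF zV] C.g_def by simp
  qed
 qed simp
 have J0: "J 0 = p"
 by (metis J_def U(3,6) c chart_inv_map comp_apply homeomorphism_def p r(3) x0_def)
 have injJ: "inj_on J (ball 0 \<rho>)"
  by (rule inj_onI) (metis Jc(1) \<psi>U(2) \<rho>(2) subsetD)
 have opJ: "openin X (J ` W)" if W: "open W" "W\<subseteq>ball 0 \<rho>" for W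
 proof -
  have eq: "J ` W = {q\<in>chart_dom c. chart_map c q\<in>U\<inter>\<phi> -` W}"
  proof (intro equalityI subsetI)
   fix q assume "q\<in>J ` W"
   then obtain z where z: "z\<in>W" "q = J z" by auto
   then have "z\<in>ball 0 \<rho>" "z\<in>V" using W \<rho> by auto
   then show "q\<in>{q\<in>chart_dom c. chart_map c q\<in>U\<inter>\<phi> -` W}" using z Jc \<psi>U by auto
  next
   fix q assume q: "q\<in>{q\<in>chart_dom c. chart_map c q\<in>U\<inter>\<phi> -` W}"
   then have "J (\<phi> (chart_map c q)) = q" unfolding J_def using \<psi>\<phi>(1) chart_inv_map[OF c] by auto
   then show "q\<in>J ` W" using q by force
  qed
  have "continuous_on U \<phi>" using U(6) unfolding homeomorphism_def by auto
  then have "open (U\<inter>\<phi> -` W)" using U(1) W(1) by (simp add: continuous_open_preimage)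
  then show ?thesis unfolding eq by (rule chart_open_preimage[OF c])
 qed
 have fin: "chart_map c (J z)\<in>B \<and> \<phi> (chart_map c (J z)) = z" if "z\<in>ball 0 \<rho>" for z
  using \<psi>U[OF subsetD[OF \<rho>(2) that]] U(2) unfolding Jc(1)[OF that] by auto
 show ?thesis
  using \<rho>(1) lJ J0 injJ opJ Jc(2) F fin
  by (intro exI[of _ \<rho>] exI[of _ J] exI[of _ B] exI[of _ \<phi>] exI[of _ \<xi>] exI[of _ \<eta>] conjI allI impI ballI) auto
qed

text \<open>The set \<open>A\<close> of points near which the maps agree is open, and so is its
  complement. The critical case is a point \<open>a\<close> where only the values agree: there
  \<open>f = f' \<circ> k\<close> with \<open>k a = a\<close>. If \<open>A\<close> came close to
  \<open>a\<close>, injectivity of \<open>f'\<close> near \<open>a\<close> would make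
  \<open>k\<close> the identity on an open set, hence everywhere, and \<open>a\<close> would lie in
  \<open>A\<close>.\<close>

theorem liso_unique:
 assumes f: "liso W f" and f': "liso W f'" and W: "connected W" and V: "open V" "V\<noteq>{}" "V\<subseteq>W"
  and eq: "\<And>z. z\<in>V ==> f z = f' z" and w: "w\<in>W"
 shows "f w = f' w"
proof -
 define A where "A = {w\<in>W. \<exists>N. open N \<and> w\<in>N \<and> N\<subseteq>W \<and> (\<forall>z\<in>N. f z = f' z)}"
 have oA: "open A"
 proof (subst open_subopen, intro ballI)
  fix a assume "a\<in>A"
  then obtain N where N: "open N" "a\<in>N" "N\<subseteq>W" "\<forall>z\<in>N. f z = f' z" unfolding A_def by blast
  then have "N\<subseteq>A" unfolding A_def by blast
  then show "\<exists>T. open T \<and> a\<in>T \<and> T\<subseteq>A" using N by blast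
 qed
 have oC: "open (W - A)"
 proof (subst open_subopen, intro ballI)
  fix a assume a: "a\<in>W - A"
  show "\<exists>T. open T \<and> a\<in>T \<and> T\<subseteq>W - A"
  proof (cases "f a = f' a")
   case False
   then obtain U1 U2 where U: "openin X U1" "openin X U2" "f a\<in>U1" "f' a\<in>U2" "disjnt U1 U2"
    using Hausdorff liso_topspace[OF f] liso_topspace[OF f'] a unfolding Hausdorff_space_def by (metis DiffD1)
   define T where "T = {w\<in>W. f w\<in>U1}\<inter>{w\<in>W. f' w\<in>U2}"
   have "open T" unfolding T_def using liso_preimage[OF f U(1)] liso_preimage[OF f' U(2)] by auto
   moreover have "a\<in>T" unfolding T_def using a U by auto
   moreover have "T\<subseteq>W - A"
   proof
    fix t assume t: "t\<in>T"
    then have "f t\<noteq>f' t" using U(5) unfolding T_def disjnt_def by auto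
    then show "t\<in>W - A" using t unfolding T_def A_def by auto
   qed
   ultimately show ?thesis by blast
  next
   case True
   have aW: "a\<in>W" using a by auto
   obtain k N where k: "hiso k" "k a = a" "open N" "a\<in>N" "N\<subseteq>W" "k ` N\<subseteq>W" "\<forall>z\<in>N. f z = f' (k z)"
    using liso_rigid[OF f f' aW aW True] by blast
   obtain c where c: "c\<in>man_atlas M" "f' a\<in>chart_dom c" using atlas_cover[OF liso_topspace[OF f' aW]] by blast
   obtain N1 V1 b where N1: "open N1" "a\<in>N1" "homeomorphism N1 V1 (\<lambda>z. chart_map c (f' z)) b"
    using liso_local_inverse[OF f' c(1) aW c(2)] by blast
   have inj: "z = z'" if "z\<in>N1" "z'\<in>N1" "f' z = f' z'" for z z'
    using that N1(3) unfolding homeomorphism_def by metis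
   define T where "T = N\<inter>(N1\<inter>k -` N1)"
   have "open (k -` N1)" using hiso_continuous_on[OF k(1), of UNIV] N1(1) by (simp add: open_vimage)
   then have oT: "open T" unfolding T_def using k(3) N1(1) by auto
   have aT: "a\<in>T" unfolding T_def using k(2,4) N1(2) by auto
   have "T\<inter>A = {}"
   proof (rule ccontr)
    assume "T\<inter>A\<noteq>{}"
    then obtain t where t: "t\<in>T" "t\<in>A" by auto
    then obtain N2 where N2: "open N2" "t\<in>N2" "\<forall>z\<in>N2. f z = f' z" unfolding A_def by blast
    have "k z = z" if "z\<in>N2\<inter>T" for z
     using that N2(3) k(7) inj[of "k z" z] unfolding T_def by auto
    moreover have "open (N2\<inter>T)" "N2\<inter>T\<noteq>{}" using N2 oT t by auto
    ultimately have "k = (\<lambda>x. x)" using hiso_eqI[OF k(1) hiso_id] by blast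
    then have "a\<in>A" using k(3-7) aW unfolding A_def by auto
    then show False using a by auto
   qed
   moreover have "T\<subseteq>W" unfolding T_def using k(5) by auto
   ultimately show ?thesis using oT aT by blast
  qed
 qed
 have "A\<noteq>{}" using V eq unfolding A_def by blast
 moreover have "A\<subseteq>W" unfolding A_def by auto
 ultimately have "W - A = {}" using W oA oC unfolding connected_def by blast
 then show ?thesis using w unfolding A_def by blast
qed

end

section \<open>Monodromy\<close>

text \<open>Continuation in a vector space, separated from the geometry: \<open>L U f\<close> says
  that \<open>f\<close> is a branch on \<open>U\<close>. The essential axiom is \<open>ext\<close>,
  with the same radius \<open>e\<close> for all branches and all points.\<close>

locale continuation =
 fixes L :: "'b::real_normed_vector set => ('b => 'c) => bool" and e :: real
 assumes restr: "\<And>U V f. L U f ==> open V ==> V\<subseteq>U ==> L V f"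
  and glue: "\<And>U f. open U ==> (\<And>u. u\<in>U ==> \<exists>V h. open V \<and> u\<in>V \<and> V\<subseteq>U \<and> L V h \<and> (\<forall>z\<in>V. h z = f z)) ==> L U f"
  and uniq: "\<And>U V f f' u. L U f ==> L U f' ==> connected U ==> open V ==> V\<noteq>{} ==> V\<subseteq>U ==>
    (\<And>z. z\<in>V ==> f z = f' z) ==> u\<in>U ==> f u = f' u"
  and ext: "\<And>U f u. L U f ==> u\<in>U ==> \<exists>f' V. L (ball u e) f' \<and> open V \<and> u\<in>V \<and> V\<subseteq>U\<inter>ball u e \<and> (\<forall>z\<in>V. f z = f' z)"
  and e: "e > 0"
begin

text \<open>Every point of the larger ball is served by the branch centred at its image under a
  contracting homothety. A fixed gain of \<open>e/2\<close> per step exhausts the space.\<close>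

lemma extend_ball:
 assumes R: "R > 0" and f: "L (ball 0 R) f"
 shows "\<exists>f'. L (ball 0 (R + e/2)) f' \<and> (\<forall>z\<in>ball 0 R. f' z = f z)"
proof -
 \<comment> \<open>The homothety from the larger ball onto the given one moves points by less than
   \<open>e/2\<close>; the other half of \<open>e\<close> is left for comparing neighbouring
   centres.\<close>
 define h where "h x = (R/(R + e/2)) *\<^sub>R x" for x :: 'b
 have hR: "h x\<in>ball 0 R" and hx: "norm (x - h x) < e/2" if "x\<in>ball 0 (R + e/2)" for x
 proof -
  have x: "norm x < R + e/2" using that by simp
  have "norm (h x) = R*(norm x/(R + e/2))" unfolding h_def using R e by simp
  also have "\<dots> < R*1" using x R e by (intro mult_strict_left_mono) auto
  finally show "h x\<in>ball 0 R" by simp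
  have "x - h x = ((e/2)/(R + e/2)) *\<^sub>R x"
  proof -
   have "1 - R/(R + e/2) = (e/2)/(R + e/2)" using R e by (simp add: field_simps)
   then show ?thesis unfolding h_def by (metis scaleR_left_diff_distrib scaleR_one)
  qed
  then have "norm (x - h x) = (e/2)*(norm x/(R + e/2))" using R e by simp
  also have "\<dots> < (e/2)*1" using x R e by (intro mult_strict_left_mono) auto
  finally show "norm (x - h x) < e/2" by simp
 qed
 have "\<forall>u\<in>ball 0 R. \<exists>f'. L (ball u e) f' \<and> (\<exists>V. open V \<and> u\<in>V \<and> V\<subseteq>ball 0 R\<inter>ball u e \<and> (\<forall>z\<in>V. f z = f' z))"
  using ext[OF f] by blast
 from bchoice[OF this] obtain J where "\<forall>u\<in>ball 0 R. L (ball u e) (J u) \<and>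
   (\<exists>V. open V \<and> u\<in>V \<and> V\<subseteq>ball 0 R\<inter>ball u e \<and> (\<forall>z\<in>V. f z = J u z))" by (elim exE)
 then have J: "\<And>u. u\<in>ball 0 R ==> L (ball u e) (J u)"
  "\<And>u. u\<in>ball 0 R ==> \<exists>V. open V \<and> u\<in>V \<and> V\<subseteq>ball 0 R\<inter>ball u e \<and> (\<forall>z\<in>V. f z = J u z)" by blast+
 have Jf: "f z = J u z" if u: "u\<in>ball 0 R" and z: "z\<in>ball 0 R" "z\<in>ball u e" for u z
 proof -
  obtain V where V: "open V" "u\<in>V" "V\<subseteq>ball 0 R\<inter>ball u e" "\<forall>z\<in>V. f z = J u z" using J(2)[OF u] by blast
  show ?thesis
  proof (rule uniq[of "ball 0 R\<inter>ball u e" f "J u" V])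
   show "L (ball 0 R\<inter>ball u e) f" by (rule restr[OF f]) auto
   show "L (ball 0 R\<inter>ball u e) (J u)" by (rule restr[OF J(1)[OF u]]) auto
   show "connected (ball 0 R\<inter>ball u e)" by (intro convex_connected convex_Int convex_ball)
  qed (use V z in auto)
 qed
 \<comment> \<open>The intersection of two balls is convex, hence connected, and meets
   \<open>ball 0 R\<close> because the centres are close.\<close>
 have JJ: "J u z = J u' z" if u: "u\<in>ball 0 R" "u'\<in>ball 0 R" and z: "z\<in>ball u e" "z\<in>ball u' e" and d: "dist u u' < e" for u u' z
 proof (rule uniq[of "ball u e\<inter>ball u' e" "J u" "J u'" "ball 0 R\<inter>(ball u e\<inter>ball u' e)"])
  show "L (ball u e\<inter>ball u' e) (J u)" by (rule restr[OF J(1)[OF u(1)]]) auto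
  show "L (ball u e\<inter>ball u' e) (J u')" by (rule restr[OF J(1)[OF u(2)]]) auto
  show "connected (ball u e\<inter>ball u' e)" by (intro convex_connected convex_Int convex_ball)
  show "ball 0 R\<inter>(ball u e\<inter>ball u' e)\<noteq>{}" using u d e by (auto simp: dist_commute)
  show "J u x = J u' x" if "x\<in>ball 0 R\<inter>(ball u e\<inter>ball u' e)" for x
   using Jf[OF u(1), of x] Jf[OF u(2), of x] that by auto
 qed (use z in auto)
 define f' where "f' x = J (h x) x" for x
 have "L (ball 0 (R + e/2)) f'"
 proof (rule glue)
  fix x :: 'b assume x: "x\<in>ball 0 (R + e/2)"
  define V where "V = ball x (e/2)\<inter>ball 0 (R + e/2)"
  have "V\<subseteq>ball (h x) e"
  proof
   fix z assume "z\<in>V"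
   then have "norm (x - z) < e/2" unfolding V_def by (simp add: dist_norm)
   then show "z\<in>ball (h x) e" using hx[OF x] norm_triangle_ineq[of "h x - x" "x - z"]
    by (simp add: dist_norm norm_minus_commute)
  qed
  then have "L V (J (h x))" by (intro restr[OF J(1)[OF hR[OF x]]]) (auto simp: V_def)
  moreover have "J (h x) z = f' z" if z: "z\<in>V" for z
  proof -
   have z2: "z\<in>ball 0 (R + e/2)" "norm (x - z) < e/2" using z unfolding V_def by (auto simp: dist_norm)
   have "h x - h z = (R/(R + e/2)) *\<^sub>R (x - z)" unfolding h_def by (simp add: scaleR_diff_right)
   then have "norm (h x - h z) = (R/(R + e/2))*norm (x - z)" using R e by simp
   also have "\<dots>\<le>1*norm (x - z)" using R e by (intro mult_right_mono) auto
   finally have "dist (h x) (h z) < e" using z2 e by (simp add: dist_norm)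
   moreover have "z\<in>ball (h z) e" using hx[OF z2(1)] e by (simp add: dist_norm norm_minus_commute)
   ultimately show ?thesis unfolding f'_def
    using JJ[OF hR[OF x] hR[OF z2(1)]] z \<open>V\<subseteq>ball (h x) e\<close> by blast
  qed
  ultimately show "\<exists>V h. open V \<and> x\<in>V \<and> V\<subseteq>ball 0 (R + e/2) \<and> L V h \<and> (\<forall>z\<in>V. h z = f' z)"
   using x e by (intro exI[of _ V] exI[of _ "J (h x)"]) (auto simp: V_def)
 qed simp
 moreover have "f' z = f z" if z: "z\<in>ball 0 R" for z
 proof -
  have z2: "z\<in>ball 0 (R + e/2)" using z e by simp
  have "z\<in>ball (h z) e" using hx[OF z2] e by (simp add: dist_norm norm_minus_commute)
  then show ?thesis unfolding f'_def using Jf[OF hR[OF z2] z] by simp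
 qed
 ultimately show ?thesis by blast
qed

theorem monodromy:
 assumes R: "R > 0" and f: "L (ball 0 R) f"
 shows "\<exists>F. L UNIV F \<and> (\<forall>z\<in>ball 0 R. F z = f z)"
proof -
 define r where "r n = R + real n*(e/2)" for n :: nat
 have r0: "r n > 0" for n unfolding r_def using R e by (simp add: add_pos_nonneg)
 have "\<exists>g. \<forall>n. (L (ball 0 (r n)) (g n) \<and> (n = 0 --> g n = f)) \<and> (\<forall>z\<in>ball 0 (r n). g (Suc n) z = g n z)"
 proof (rule dependent_nat_choice)
  show "\<exists>g. L (ball 0 (r 0)) g \<and> ((0::nat) = 0 --> g = f)" using f unfolding r_def by auto
  fix g and n :: nat assume g: "L (ball 0 (r n)) g \<and> (n = 0 --> g = f)"
  have "\<exists>f'. L (ball 0 (r n + e/2)) f' \<and> (\<forall>z\<in>ball 0 (r n). f' z = g z)"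
   using extend_ball[OF r0] g by blast
  moreover have "r n + e/2 = r (Suc n)" unfolding r_def by (simp add: algebra_simps)
  ultimately show "\<exists>g'. (L (ball 0 (r (Suc n))) g' \<and> (Suc n = 0 --> g' = f)) \<and> (\<forall>z\<in>ball 0 (r n). g' z = g z)" by auto
 qed
 then obtain g where g0: "\<forall>n. (L (ball 0 (r n)) (g n) \<and> (n = 0 --> g n = f)) \<and> (\<forall>z\<in>ball (0::'b) (r n). g (Suc n) z = g n z)"
  by (elim exE)
 have g: "L (ball 0 (r n)) (g n)" and g00: "g 0 = f" and gS: "z\<in>ball 0 (r n) ==> g (Suc n) z = g n z" for n and z :: 'b
  using g0 by blast+
 have rmono: "r n\<le>r m" if "n\<le>m" for n m unfolding r_def using that e by (simp add: mult_right_mono)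
 have gm: "g m z = g n z" if "n\<le>m" "z\<in>ball 0 (r n)" for n m z
  using that(1)
 proof (induction m rule: dec_induct)
  case (step m)
  have "z\<in>ball 0 (r m)" using that(2) rmono[OF step(1)] by auto
  then show ?case using gS step by simp
 qed simp
 have ex: "\<exists>n. z\<in>ball 0 (r n)" for z :: 'b
 proof -
  obtain n :: nat where "norm z/(e/2) < real n" using reals_Archimedean2 by blast
  then have "norm z < real n*(e/2)" using e by (simp add: pos_divide_less_eq)
  then show ?thesis unfolding r_def using R by (intro exI[of _ n]) auto
 qed
 define F where "F z = g (LEAST n. z\<in>ball 0 (r n)) z" for z
 have F: "F z = g n z" if "z\<in>ball 0 (r n)" for z n
  unfolding F_def using gm[OF Least_le[of "\<lambda>n. z\<in>ball 0 (r n)", OF that]] LeastI[of "\<lambda>n. z\<in>ball 0 (r n)", OF that] by simp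
 have "L UNIV F"
 proof (rule glue)
  fix u :: 'b
  obtain n where "u\<in>ball 0 (r n)" using ex by blast
  then show "\<exists>V h. open V \<and> u\<in>V \<and> V\<subseteq>UNIV \<and> L V h \<and> (\<forall>z\<in>V. h z = F z)"
   using g[of n] F by (intro exI[of _ "ball 0 (r n)"] exI[of _ "g n"]) auto
 qed simp
 moreover have "F z = f z" if "z\<in>ball 0 R" for z
  using F[of z 0] that g00 unfolding r_def by simp
 ultimately show ?thesis by blast
qed

end

text \<open>\<open>arsinh (norm y)\<close> is the distance of \<open>y\<close> from the origin, so
  points of norm at least \<open>\<rho>\<close> and less than \<open>\<rho>/2\<close> are separated
  by \<open>d\<close>. The choice of e^2 = cosh \<open>d\<close> - 1 leaves half of that excess as a
  margin.\<close>

lemma hB_norm_gap: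
 assumes "\<rho> > 0"
 shows "\<exists>e>0. \<forall>y z :: 'b::euclidean_space. norm z < \<rho>/2 --> hB y z\<le>1 + e\<^sup>2/2 --> norm y < \<rho>"
proof -
 define d where "d = arsinh \<rho> - arsinh (\<rho>/2)"
 have d: "d > 0" unfolding d_def using assms by simp
 define \<kappa> where "\<kappa> = cosh d - 1"
 have \<kappa>: "\<kappa> > 0" unfolding \<kappa>_def using d cosh_real_ge_1[of d] cosh_real_one_iff[of d] by linarith
 have "norm y < \<rho>" if z: "norm z < \<rho>/2" and h: "hB y z\<le>1 + (sqrt \<kappa>)\<^sup>2/2" for y z :: 'b
 proof (rule ccontr)
  assume "\<not> norm y < \<rho>"
  define a b where "a = arsinh (norm y)" and "b = arsinh (norm z)"
  have ab: "d\<le>a - b"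
  proof -
   have "arsinh \<rho>\<le>a" unfolding a_def using \<open>\<not> norm y < \<rho>\<close> by (metis arsinh_less_iff_real not_less)
   moreover have "b < arsinh (\<rho>/2)" unfolding b_def using z by simp
   ultimately show ?thesis unfolding d_def by simp
  qed
  have "hz y = cosh a" "hz z = cosh b" unfolding hz_norm a_def b_def cosh_arsinh_real by (simp_all add: add.commute)
  moreover have "y \<bullet> z\<le>sinh a * sinh b" unfolding a_def b_def using norm_cauchy_schwarz[of y z] by simp
  ultimately have "cosh (a - b)\<le>hB y z" unfolding hB_def cosh_diff by simp
  moreover have "cosh d\<le>cosh (a - b)" using ab d by (subst cosh_real_nonneg_le_iff) auto
  ultimately have "cosh d\<le>1 + \<kappa>/2" using h \<kappa> by simp
  then show False using \<kappa> unfolding \<kappa>_def by (simp add: field_simps)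
 qed
 then show ?thesis using \<kappa> by (intro exI[of _ "sqrt \<kappa>"]) auto
qed

section \<open>Development of the compact manifold\<close>

context hyp_manifold begin

definition param :: "real => (real^'n => 'a) => bool" where
 "param \<rho> J \<longleftrightarrow> 0 < \<rho> \<and> liso (ball 0 \<rho>) J \<and> inj_on J (ball 0 \<rho>) \<and>
   (\<forall>W. open W --> W\<subseteq>ball 0 \<rho> --> openin X (J ` W))"

lemma param_half_open: "param \<rho> J ==> openin X (J ` ball 0 (\<rho>/2))"
by (simp add: ball_divide_subset param_def)

lemma param_exists:
 assumes "p\<in>topspace X"
 shows "\<exists>\<rho> J. param \<rho> J \<and> J 0 = p"
by (smt (verit, ccfv_threshold) assms atlas_cover liso_exists param_def)

lemma liso_connected_rigid:
 assumes F: "liso W F" and J: "liso W' J" and h: "h\<in>W" "z\<in>W'" "F h = J z"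
 obtains k where "hiso k" "k h = z"
  "\<And>U y. connected U ==> open U ==> h\<in>U ==> U\<subseteq>W ==> k ` U\<subseteq>W' ==> y\<in>U ==> F y = J (k y)"
proof -
 obtain k N where k: "hiso k" "k h = z" "open N" "h\<in>N" "\<forall>y\<in>N. F y = J (k y)"
  using liso_rigid[OF F J h] by blast
 have "F y = J (k y)" if U: "connected U" "open U" "h\<in>U" "U\<subseteq>W" "k ` U\<subseteq>W'" "y\<in>U" for U y
 proof -
  have 1: "liso U F" by (rule liso_subset[OF F U(2,4)])
  have 2: "liso U (J \<circ> k)" by (rule liso_subset[OF liso_hiso[OF J k(1)] U(2)]) (use U(5) in auto)
  have "F y = (J \<circ> k) y"
   by (rule liso_unique[OF 1 2 U(1), of "N\<inter>U"]) (use k U in auto)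
  then show ?thesis by simp
 qed
 then show ?thesis using that k(1,2) by blast
qed

text \<open>Near \<open>h\<close> the map \<open>F\<close> is \<open>J\<close> after an isometry
  \<open>k\<close>. By unique continuation this holds on the whole preimage of the ball, so
  \<open>inv k\<close> lifts the parametrised ball to a neighbourhood of \<open>h\<close>. This is
  the covering property in the form used below.\<close>

lemma liso_continue:
 assumes F: "liso UNIV F" and J: "liso (ball 0 \<rho>) J" and z: "z\<in>ball 0 \<rho>" "F h = J z"
 obtains k where "hiso k" "k h = z" "\<And>y. y\<in>ball 0 \<rho> ==> F (inv k y) = J y"
proof -
 obtain k where k: "hiso k" "k h = z"
  "\<And>U y. connected U ==> open U ==> h\<in>U ==> U\<subseteq>UNIV ==> k ` U\<subseteq>ball 0 \<rho> ==> y\<in>U ==> F y = J (k y)"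
  using liso_connected_rigid[OF F J UNIV_I z] by blast
 have ki: "k (inv k y) = y" for y using k(1) unfolding hiso_def by (simp add: surj_f_inv_f)
 have "F (inv k y) = J y" if y: "y\<in>ball 0 \<rho>" for y
 proof -
  have "F (inv k y) = J (k (inv k y))"
  proof (rule k(3)[of "inv k ` ball 0 \<rho>"])
   show "connected (inv k ` ball 0 \<rho>)"
    by (intro connected_continuous_image hiso_continuous_on hiso_inv k(1) connected_ball)
   show "open (inv k ` ball 0 \<rho>)" by (intro hiso_open_image hiso_inv k(1) open_ball)
   show "h\<in>inv k ` ball 0 \<rho>" using z(1) k(2) hiso_inj[OF k(1)] by (metis image_eqI inv_f_f)
   show "k ` inv k ` ball 0 \<rho>\<subseteq>ball 0 \<rho>" using ki by auto
  qed (use y in auto)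
  then show ?thesis by (simp add: ki)
 qed
 then show ?thesis using that k(1,2) by blast
qed

end

locale compact_hyp_manifold = hyp_manifold M for M :: "('a, 'n::finite) riem" +
 fixes x0 :: 'a
 assumes compact: "compact_space X" and connected: "connected_space X" and x0: "x0\<in>topspace X"
  and card: "CARD('n) \<ge> 2"
begin

text \<open>Covering by the balls of half radius leaves a margin around every point, which
  \<open>uniform_extension\<close> turns into a common radius.\<close>

lemma finite_param_cover:
 "\<exists>A. finite A \<and> (\<forall>(\<rho>, J)\<in>A. param \<rho> J) \<and> topspace X = (\<Union>(\<rho>, J)\<in>A. J ` ball 0 (\<rho>/2))"
proof -
 have "\<forall>p\<in>topspace X. \<exists>a. param (fst a) (snd a) \<and> snd a 0 = p" using param_exists by auto
 from bchoice[OF this] obtain a where a: "\<forall>p\<in>topspace X. param (fst (a p)) (snd (a p)) \<and> snd (a p) 0 = p" by (elim exE)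
 define V where "V p = snd (a p) ` ball 0 (fst (a p)/2)" for p
 have par: "param (fst (a p)) (snd (a p))" and pV: "p\<in>V p" if "p\<in>topspace X" for p
 proof -
  show 1: "param (fst (a p)) (snd (a p))" using a that by blast
  have "snd (a p) 0 = p" using a that by blast
  then show "p\<in>V p" unfolding V_def using 1 unfolding param_def by (intro image_eqI[of _ _ 0]) auto
 qed
 have oV: "openin X (V p)" if "p\<in>topspace X" for p
  unfolding V_def by (rule param_half_open[OF par[OF that]])
 have "compactin X (topspace X)" using compact unfolding compact_space_def .
 then have "\<exists>\<F>. finite \<F> \<and> \<F>\<subseteq>V ` topspace X \<and> topspace X\<subseteq>\<Union>\<F>"
 proof -
  assume "compactin X (topspace X)"
  then have "\<forall>\<U>. (\<forall>U\<in>\<U>. openin X U) \<and> topspace X\<subseteq>\<Union>\<U> --> (\<exists>\<F>. finite \<F> \<and> \<F>\<subseteq>\<U> \<and> topspace X\<subseteq>\<Union>\<F>)"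
   unfolding compactin_def by (rule conjunct2)
  from spec[OF this, of "V ` topspace X"] show ?thesis using oV pV by blast
 qed
 then obtain \<F> where \<F>: "finite \<F>" "\<F>\<subseteq>V ` topspace X" "topspace X\<subseteq>\<Union>\<F>" by blast
 obtain P where P: "P\<subseteq>topspace X" "finite P" "\<F> = V ` P" using finite_subset_image[OF \<F>(1,2)] by blast
 have "V p\<subseteq>topspace X" if "p\<in>P" for p using oV P that openin_subset by blast
 then have "topspace X = (\<Union>p\<in>P. V p)" using \<F>(3) P(3) by blast
 then have "topspace X = (\<Union>(\<rho>, J)\<in>a ` P. J ` ball 0 (\<rho>/2))" unfolding V_def by (simp add: case_prod_beta)
 moreover have "\<forall>(\<rho>, J)\<in>a ` P. param \<rho> J"
 proof
  fix b assume "b\<in>a ` P"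
  then obtain p where "b = a p" "p\<in>topspace X" using P(1) by blast
  then show "case b of (\<rho>, J) => param \<rho> J" using par by (simp add: case_prod_beta)
 qed
 ultimately show ?thesis using P(2) by (intro exI[of _ "a ` P"]) simp
qed

text \<open>A Lebesgue number argument in the model: \<open>f\<close> agrees near \<open>w\<close>
  with \<open>J \<circ> k\<close> for a \<open>J\<close> of the finite cover, and this map is
  defined on a ball about \<open>w\<close> whose radius is the least gap from
  \<open>hB_norm_gap\<close>.\<close>

lemma uniform_extension:
 "\<exists>e>0. \<forall>W f w. liso W f --> w\<in>W -->
   (\<exists>f' V. liso (ball w e) f' \<and> open V \<and> w\<in>V \<and> V\<subseteq>W\<inter>ball w e \<and> (\<forall>z\<in>V. f z = f' z))"
proof -
 obtain A where A: "finite A" "\<forall>(\<rho>, J)\<in>A. param \<rho> J" "topspace X = (\<Union>(\<rho>, J)\<in>A. J ` ball 0 (\<rho>/2))"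
  using finite_param_cover by blast
 have "\<forall>a\<in>A. \<exists>e>0. \<forall>y z :: real^'n. norm z < fst a/2 --> hB y z\<le>1 + e\<^sup>2/2 --> norm y < fst a"
 proof
  fix a assume "a\<in>A"
  then have "0 < fst a" using A(2) unfolding param_def by auto
  from hB_norm_gap[OF this] show "\<exists>e>0. \<forall>y z :: real^'n. norm z < fst a/2 --> hB y z\<le>1 + e\<^sup>2/2 --> norm y < fst a" .
 qed
 from bchoice[OF this] obtain \<epsilon> where "\<forall>a\<in>A. \<epsilon> a > 0 \<and> (\<forall>y z :: real^'n. norm z < fst a/2 --> hB y z\<le>1 + (\<epsilon> a)\<^sup>2/2 --> norm y < fst a)"
  by (elim exE)
 then have \<epsilon>: "\<And>a. a\<in>A ==> \<epsilon> a > 0" "\<And>a (y :: real^'n) z. a\<in>A ==> norm z < fst a/2 ==> hB y z\<le>1 + (\<epsilon> a)\<^sup>2/2 ==> norm y < fst a"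
  by blast+
 define e where "e = Min (insert 1 (\<epsilon> ` A))"
 have e: "e > 0" "\<And>a. a\<in>A ==> e\<le>\<epsilon> a" unfolding e_def using A(1) \<epsilon>(1) by auto
 show ?thesis
 proof (intro exI[of _ e] conjI allI impI e(1))
  fix W f w assume f: "liso W f" and w: "w\<in>W"
  obtain \<rho> J z where J: "(\<rho>, J)\<in>A" "norm z < \<rho>/2" "f w = J z"
   using liso_topspace[OF f w] A(3) by auto
  have pJ: "param \<rho> J" using A(2) J(1) by auto
  then have \<rho>: "0 < \<rho>" and lJ: "liso (ball 0 \<rho>) J" unfolding param_def by auto
  have z: "z\<in>ball 0 \<rho>" using J(2) \<rho> by simp
  obtain k N where k: "hiso k" "k w = z" "open N" "w\<in>N" "N\<subseteq>W" "\<forall>y\<in>N. f y = J (k y)"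
   using liso_rigid[OF f lJ w z J(3)] by blast
  have sub: "ball w e\<subseteq>k -` ball 0 \<rho>"
  proof
   fix y assume "y\<in>ball w e"
   then have n: "norm (w - y) < e" by (simp add: dist_norm)
   have "hB (k y) z = hB y w" using hiso_hB[OF k(1), of y w] k(2) by simp
   also have "\<dots>\<le>1 + (norm (y - w))\<^sup>2/2" by (rule hB_le)
   also have "\<dots>\<le>1 + (\<epsilon> (\<rho>, J))\<^sup>2/2"
    using n e(2)[OF J(1)] by (simp add: norm_minus_commute power_mono)
   finally have "norm (k y) < \<rho>" using \<epsilon>(2)[OF J(1), of z "k y"] J(2) by simp
   then show "y\<in>k -` ball 0 \<rho>" by simp
  qed
  have "liso (ball w e) (J \<circ> k)" by (rule liso_subset[OF liso_hiso[OF lJ k(1)] open_ball sub])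
  then show "\<exists>f' V. liso (ball w e) f' \<and> open V \<and> w\<in>V \<and> V\<subseteq>W\<inter>ball w e \<and> (\<forall>z\<in>V. f z = f' z)"
   using k e(1) by (intro exI[of _ "J \<circ> k"] exI[of _ "N\<inter>ball w e"]) auto
 qed
qed

lemma global_extension:
 assumes J: "liso (ball 0 \<rho>) J" "\<rho> > 0"
 shows "\<exists>F. liso UNIV F \<and> (\<forall>z\<in>ball 0 \<rho>. F z = J z)"
proof -
 obtain e where e: "e > 0" "\<And>W f w. liso W f ==> w\<in>W ==>
   \<exists>f' V. liso (ball w e) f' \<and> open V \<and> w\<in>V \<and> V\<subseteq>W\<inter>ball w e \<and> (\<forall>z\<in>V. f z = f' z)"
  using uniform_extension by blast
 interpret continuation liso e
 proof
  show "liso V f" if "liso U f" "open V" "V\<subseteq>U" for U V f using liso_subset that by blast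
  show "liso U f" if "open U" "\<And>u. u\<in>U ==> \<exists>V h. open V \<and> u\<in>V \<and> V\<subseteq>U \<and> liso V h \<and> (\<forall>z\<in>V. h z = f z)" for U f
   by (rule liso_glue[OF that])
  show "f u = f' u" if "liso U f" "liso U f'" "connected U" "open V" "V\<noteq>{}" "V\<subseteq>U" "\<And>z. z\<in>V ==> f z = f' z" "u\<in>U" for U V f f' u
   by (rule liso_unique[OF that])
 qed (fact e(2), fact e(1))
 show ?thesis by (rule monodromy[OF J(2,1)])
qed

text \<open>Every point of \<open>U\<close> is covered, and every lift of it is close to the fibre
  over \<open>x0\<close>, with one bound for all lifts.\<close>

definition orbit_bounded where
 "orbit_bounded F U D \<longleftrightarrow> (\<forall>p\<in>U. (\<exists>h. F h = p) \<and> (\<forall>h :: real^'n. F h = p --> (\<exists>q. F q = x0 \<and> hB h q\<le>D)))"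

text \<open>The bound passes from one point of a parametrised ball to the whole ball. So the set
  \<open>G\<close> of points having a bound and its complement are both unions of members of the
  finite cover; connectedness gives \<open>G = topspace X\<close>, and finiteness a common
  bound.\<close>

lemma orbit_dense:
 assumes F: "liso UNIV F" "F 0 = x0"
 shows "range F = topspace X" and "\<exists>D. \<forall>h. \<exists>q. F q = x0 \<and> hB h q\<le>D"
proof -
 obtain A where A: "finite A" "\<forall>(\<rho>, J)\<in>A. param \<rho> J" "topspace X = (\<Union>(\<rho>, J)\<in>A. J ` ball 0 (\<rho>/2))"
  using finite_param_cover by blast
 define V where "V a = snd a ` ball 0 (fst a/2)" for a :: "real\<times>(real^'n => 'a)"
 have AV: "topspace X = (\<Union>a\<in>A. V a)" unfolding V_def A(3) by (simp add: case_prod_beta)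
 have par: "param (fst a) (snd a)" if "a\<in>A" for a using A(2) that by auto
 have oV: "openin X (V a)" if "a\<in>A" for a unfolding V_def by (rule param_half_open[OF par[OF that]])
 have step: "\<exists>D'. orbit_bounded F (V a) D'" if a: "a\<in>A" and p: "p\<in>V a" "orbit_bounded F {p} D" for a p D
 proof -
  obtain \<rho> J where aJ: "a = (\<rho>, J)" by (cases a)
  have \<rho>: "\<rho> > 0" and J: "liso (ball 0 \<rho>) J" using par[OF a] unfolding param_def aJ by auto
  obtain z where z: "norm z < \<rho>/2" "p = J z" using p(1) unfolding V_def aJ by auto
  have zb: "z\<in>ball 0 \<rho>" using z \<rho> by simp
  obtain h0 where h0: "F h0 = p" using p(2) unfolding orbit_bounded_def by auto
  \<comment> \<open>By \<open>hB_le\<close> this bounds \<open>hB\<close> between any two points of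
    the ball of radius \<open>\<rho>/2\<close>.\<close>
  define C where "C = 1 + \<rho>\<^sup>2/2"
  have "(\<exists>h. F h = p') \<and> (\<forall>h. F h = p' --> (\<exists>q. F q = x0 \<and> hB h q\<le>2*C*D))" if p': "p'\<in>V a" for p'
  proof -
   obtain z' where z': "norm z' < \<rho>/2" "p' = J z'" using p' unfolding V_def aJ by auto
   have zb': "z'\<in>ball 0 \<rho>" using z' \<rho> by simp
   obtain k where k: "\<And>y. y\<in>ball 0 \<rho> ==> F (inv k y) = J y"
    using liso_continue[OF F(1) J zb] h0 z(2) by metis
   have zz: "hB z' z\<le>C"
   proof -
    have "norm (z' - z)\<le>\<rho>" using norm_triangle_ineq4[of z' z] z z' by simp
    then have "(norm (z' - z))\<^sup>2\<le>\<rho>\<^sup>2" by (intro power_mono) auto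
    then show ?thesis using hB_le[of z' z] unfolding C_def by simp
   qed
   have "\<exists>q. F q = x0 \<and> hB h q\<le>2*C*D" if h: "F h = p'" for h
   proof -
    have "F h = J z'" using h z'(2) by simp
    then obtain l where l: "hiso l" "l h = z'" "\<And>y. y\<in>ball 0 \<rho> ==> F (inv l y) = J y"
     using liso_continue[OF F(1) J zb'] by metis
    have "F (inv l z) = p" using l(3)[OF zb] z(2) by simp
    then obtain q where q: "F q = x0" "hB (inv l z) q\<le>D" using p(2) unfolding orbit_bounded_def by auto
    have "hB h (inv l z) = hB (l h) (l (inv l z))" using hiso_hB[OF l(1)] by simp
    also have "\<dots> = hB z' z" using l(1,2) unfolding hiso_def by (simp add: surj_f_inv_f)
    finally have "hB h q\<le>2*hB z' z*hB (inv l z) q" using hB_mult_bound[of h q "inv l z"] by simp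
    also have "\<dots>\<le>2*C*D" using zz q(2) hB_ge_1[of z' z] hB_ge_1[of "inv l z" q] by (intro mult_mono) auto
    finally show ?thesis using q(1) by blast
   qed
   then show ?thesis using k[OF zb'] z'(2) by blast
  qed
  then show ?thesis unfolding orbit_bounded_def by blast
 qed
 define G where "G = {p\<in>topspace X. \<exists>D. orbit_bounded F {p} D}"
 have sub: "V a\<subseteq>G" if a: "a\<in>A" and p: "p\<in>V a" "p\<in>G" for a p
 proof -
  obtain D where "orbit_bounded F {p} D" using p(2) unfolding G_def by blast
  from step[OF a p(1) this] obtain D' where "orbit_bounded F (V a) D'" by blast
  then have "\<exists>D. orbit_bounded F {p'} D" if "p'\<in>V a" for p'
   using that unfolding orbit_bounded_def by blast
  then show ?thesis unfolding G_def AV using a by blast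
 qed
 have G1: "G = (\<Union>a\<in>{a\<in>A. V a\<inter>G\<noteq>{}}. V a)" using sub unfolding G_def AV by blast
 have G2: "topspace X - G = (\<Union>a\<in>{a\<in>A. \<not> V a\<inter>G\<noteq>{}}. V a)" using sub unfolding AV by blast
 have o: "openin X G" "openin X (topspace X - G)"
  by (subst G1, rule openin_Union, use oV in blast) (subst G2, rule openin_Union, use oV in blast)
 have "orbit_bounded F {x0} 1" unfolding orbit_bounded_def using F(2) by (metis hB_self order_refl singletonD)
 then have "x0\<in>G" unfolding G_def using x0 by auto
 have "G\<subseteq>topspace X" unfolding G_def by auto
 have GX: "G = topspace X"
 proof -
  have "\<not> (openin X G \<and> openin X (topspace X - G) \<and> topspace X\<subseteq>G\<union>(topspace X - G) \<and>
    G\<inter>(topspace X - G) = {} \<and> G\<noteq>{} \<and> topspace X - G\<noteq>{})"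
   using connected unfolding connected_space_def by blast
  then have "topspace X - G = {}" using o \<open>x0\<in>G\<close> by blast
  then show ?thesis using \<open>G\<subseteq>topspace X\<close> by blast
 qed
 have "F h\<in>topspace X" for h using liso_topspace[OF F(1)] by auto
 moreover have "p\<in>range F" if "p\<in>topspace X" for p
 proof -
  have "p\<in>G" using that GX by simp
  then obtain D where "orbit_bounded F {p} D" unfolding G_def by blast
  then show ?thesis unfolding orbit_bounded_def by auto
 qed
 ultimately show "range F = topspace X" by blast
 have "\<forall>a\<in>A. \<exists>D. orbit_bounded F (V a) D"
 proof
  fix a assume a: "a\<in>A"
  have "snd a 0\<in>V a" unfolding V_def using par[OF a] unfolding param_def by auto
  moreover then have "snd a 0\<in>G" unfolding GX AV using a by blast
  ultimately show "\<exists>D. orbit_bounded F (V a) D" using step[OF a] unfolding G_def by blast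
 qed
 from bchoice[OF this] obtain D where D: "\<forall>a\<in>A. orbit_bounded F (V a) (D a)" by (elim exE)
 have "\<exists>q. F q = x0 \<and> hB h q\<le>Max (insert 0 (D ` A))" for h
 proof -
  have "F h\<in>topspace X" using liso_topspace[OF F(1)] by auto
  then obtain a where a: "a\<in>A" "F h\<in>V a" unfolding AV by blast
  then obtain q where q: "F q = x0" "hB h q\<le>D a" using D unfolding orbit_bounded_def by blast
  have "D a\<le>Max (insert 0 (D ` A))" using A(1) a(1) by auto
  then have "hB h q\<le>Max (insert 0 (D ` A))" using q(2) by (rule order_trans[rotated])
  then show ?thesis using q(1) by blast
 qed
 then show "\<exists>D. \<forall>h. \<exists>q. F q = x0 \<and> hB h q\<le>D" by blast
qed

text \<open>\<open>sqrt (1 + r\<^sup>2)\<close> is the value of \<open>hz\<close> at norm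
  \<open>r\<close>, so the right-hand conditions describe balls about points of the fibre. Both
  claims are read off after moving such a point to the origin by
  \<open>liso_continue\<close>.\<close>

lemma orbit_local:
 assumes F: "liso UNIV F" and J: "param \<rho> J" "J 0 = x0"
 shows "F q = x0 ==> F q' = x0 ==> q\<noteq>q' ==> sqrt (1 + \<rho>\<^sup>2)\<le>hB q q'"
  and "0 < r ==> r\<le>\<rho> ==> F h\<in>J ` ball 0 r \<longleftrightarrow> (\<exists>q. F q = x0 \<and> hB h q < sqrt (1 + r\<^sup>2))"
proof -
 have \<rho>: "\<rho> > 0" and lJ: "liso (ball 0 \<rho>) J" and inj: "inj_on J (ball 0 \<rho>)" using J(1) unfolding param_def by auto
 have 0: "(0::real^'n)\<in>ball 0 \<rho>" using \<rho> by simp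
 have less: "hz y < sqrt (1 + r\<^sup>2) \<longleftrightarrow> norm y < r" if "0 < r" for y :: "real^'n" and r
 proof -
  have "(norm y)\<^sup>2 < r\<^sup>2 \<longleftrightarrow> norm y < r"
   using that power2_less_imp_less[of "norm y" r] power_strict_mono[of "norm y" r 2] by auto
  then show ?thesis unfolding hz_norm by simp
 qed
 show "sqrt (1 + \<rho>\<^sup>2)\<le>hB q q'" if q: "F q = x0" "F q' = x0" "q\<noteq>q'"
 proof -
  have "F q = J 0" using q(1) J(2) by simp
  then obtain k where k: "hiso k" "k q = 0" "\<And>y. y\<in>ball 0 \<rho> ==> F (inv k y) = J y"
   using liso_continue[OF F lJ 0] by metis
  have kq': "k q'\<noteq>0" using k(2) q(3) injD[OF hiso_inj[OF k(1)]] by metis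
  have "\<not> norm (k q') < \<rho>"
  proof
   assume "norm (k q') < \<rho>"
   then have b: "k q'\<in>ball 0 \<rho>" by simp
   have "F (inv k (k q')) = F q'" by (simp add: hiso_inj[OF k(1)])
   then have "J (k q') = J 0" using k(3)[OF b] q(2) J(2) by simp
   then show False using inj_onD[OF inj _ b 0] kq' by blast
  qed
  then have "\<not> hz (k q') < sqrt (1 + \<rho>\<^sup>2)" using less[OF \<rho>] by simp
  moreover have "hB q q' = hz (k q')" using hiso_hB[OF k(1), of q q'] k(2) by simp
  ultimately show ?thesis by simp
 qed
 show "F h\<in>J ` ball 0 r \<longleftrightarrow> (\<exists>q. F q = x0 \<and> hB h q < sqrt (1 + r\<^sup>2))" if r: "0 < r" "r\<le>\<rho>"
 proof
  assume "F h\<in>J ` ball 0 r"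
  then obtain z where z: "norm z < r" "F h = J z" by auto
  then have zb: "z\<in>ball 0 \<rho>" using r by simp
  obtain k where k: "hiso k" "k h = z" "\<And>y. y\<in>ball 0 \<rho> ==> F (inv k y) = J y"
   using liso_continue[OF F lJ zb z(2)] by metis
  have "F (inv k 0) = x0" using k(3)[OF 0] J(2) by simp
  moreover have "hB h (inv k 0) = hz z"
   using hiso_hB[OF k(1), of h "inv k 0"] k(1,2) unfolding hiso_def by (simp add: surj_f_inv_f)
  ultimately show "\<exists>q. F q = x0 \<and> hB h q < sqrt (1 + r\<^sup>2)" using less[OF r(1), of z] z(1) by auto
 next
  assume "\<exists>q. F q = x0 \<and> hB h q < sqrt (1 + r\<^sup>2)"
  then obtain q where q: "F q = x0" "hB h q < sqrt (1 + r\<^sup>2)" by blast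
  have "F q = J 0" using q(1) J(2) by simp
  then obtain k where k: "hiso k" "k q = 0" "\<And>y. y\<in>ball 0 \<rho> ==> F (inv k y) = J y"
   using liso_continue[OF F lJ 0] by metis
  have "hz (k h) = hB h q" using hiso_hB[OF k(1), of h q] k(2) by simp
  then have n: "norm (k h) < r" using q(2) less[OF r(1), of "k h"] by simp
  have "F h = F (inv k (k h))" by (simp add: hiso_inj[OF k(1)])
  also have "\<dots> = J (k h)" by (rule k(3)) (use n r in simp)
  finally show "F h\<in>J ` ball 0 r" using n by auto
 qed
qed

end

section \<open>Geodesics\<close>

definition geo :: "'a::real_vector => 'a => real => 'a" where
 "geo h w t = cosh t *\<^sub>R h + sinh t *\<^sub>R w"

definition dgeo :: "'a::real_vector => 'a => real => 'a" where
 "dgeo h w t = sinh t *\<^sub>R h + cosh t *\<^sub>R w"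

lemma geo_derivative: "(geo h w has_vector_derivative dgeo h w t) (at t within T)"
 unfolding geo_def[abs_def] dgeo_def by (rule geodesic_has_vector_derivative)

lemma dgeo_derivative: "(dgeo h w has_vector_derivative geo h w t) (at t within T)"
 unfolding geo_def dgeo_def[abs_def] using geodesic_has_vector_derivative[of w h t T] by (simp add: add.commute)

lemma geo_0 [simp]: "geo h w 0 = h" and dgeo_0 [simp]: "dgeo h w 0 = w"
 unfolding geo_def dgeo_def by simp_all

lemma geo_unit: "gH h w w = 1 ==> gH (geo h w t) (dgeo h w t) (dgeo h w t) = 1"
 unfolding geo_def dgeo_def by (rule gH_geodesic_velocity(1))

lemma continuous_geo:
 fixes h w :: "'a::real_inner"
 shows "continuous_on T (geo h w)"
 by (rule continuous_on_vector_derivative[OF geo_derivative])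

text \<open>The equation z'' = z factors: z' + z and then z solve first-order equations with initial
  value 0, which an integrating factor settles.\<close>

lemma second_order_unique:
 fixes z z' :: "real => 'b::real_normed_vector"
 assumes z: "\<And>t. t\<in>{s-e<..<s+e} ==> (z has_vector_derivative z' t) (at t)"
  and z': "\<And>t. t\<in>{s-e<..<s+e} ==> (z' has_vector_derivative z t) (at t)"
  and 0: "z s = 0" "z' s = 0" and t: "t\<in>{s-e<..<s+e}"
 shows "z t = 0"
proof -
 have s: "s\<in>{s-e<..<s+e}" using t by auto
 have zero: "f t = 0" if f: "\<And>t. t\<in>{s-e<..<s+e} ==> (f has_vector_derivative a *\<^sub>R f t) (at t)" and f0: "f s = 0"
  and t: "t\<in>{s-e<..<s+e}" for f :: "real => 'b" and a t
 proof -
  have "((\<lambda>t. exp (- a*t) *\<^sub>R f t) has_derivative (\<lambda>h. 0)) (at t within {s-e<..<s+e})" if t: "t\<in>{s-e<..<s+e}" for t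
  proof -
   have "((\<lambda>t. exp (- a*t)) has_real_derivative (exp (- a*t) * (- a))) (at t)"
    by (auto intro!: derivative_eq_intros)
   from has_vector_derivative_scaleR[OF this f[OF t]]
   have "((\<lambda>t. exp (- a*t) *\<^sub>R f t) has_vector_derivative 0) (at t)" by (simp add: algebra_simps)
   then have "((\<lambda>t. exp (- a*t) *\<^sub>R f t) has_derivative (\<lambda>h. 0)) (at t)" unfolding has_vector_derivative_def by simp
   then show ?thesis by (rule has_derivative_at_withinI)
  qed
  from has_derivative_zero_constant[OF _ this] obtain k where "\<forall>t\<in>{s-e<..<s+e}. exp (- a*t) *\<^sub>R f t = k" by auto
  then have "exp (- a*t) *\<^sub>R f t = exp (- a * s) *\<^sub>R f s" using t s by simp
  then show ?thesis using f0 by simp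
 qed
 have u: "z' t + z t = 0" if "t\<in>{s-e<..<s+e}" for t
 proof (rule zero[of "\<lambda>t. z' t + z t" 1, OF _ _ that])
  fix t assume "t\<in>{s-e<..<s+e}"
  from has_vector_derivative_add[OF z'[OF this] z[OF this]]
  show "((\<lambda>t. z' t + z t) has_vector_derivative 1 *\<^sub>R (z' t + z t)) (at t)" by (simp add: add.commute)
 qed (simp add: 0)
 have "z' t = (-1) *\<^sub>R z t" if "t\<in>{s-e<..<s+e}" for t using u[OF that] by (simp add: eq_neg_iff_add_eq_0)
 then have "(z has_vector_derivative (-1) *\<^sub>R z t) (at t)" if "t\<in>{s-e<..<s+e}" for t using z[OF that] that by simp
 from zero[OF this 0(1) t] show ?thesis .
qed

context hyp_manifold begin

definition adapted where
 "adapted c p \<rho> J B \<phi> \<xi> \<eta> \<longleftrightarrow> \<rho> > 0 \<and> liso (ball 0 \<rho>) J \<and> J 0 = p \<and> inj_on J (ball 0 \<rho>) \<and>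
  (\<forall>W. open W --> W\<subseteq>ball 0 \<rho> --> openin X (J ` W)) \<and> J ` ball 0 \<rho>\<subseteq>chart_dom c \<and>
  hyp_chart.tractor_frame M c B \<phi> \<xi> \<eta> \<and> (\<forall>z\<in>ball 0 \<rho>. chart_map c (J z)\<in>B \<and> \<phi> (chart_map c (J z)) = z)"

lemma adapted_exists:
 assumes "c\<in>man_atlas M" "p\<in>chart_dom c"
 obtains \<rho> J B \<phi> \<xi> \<eta> where "adapted c p \<rho> J B \<phi> \<xi> \<eta>"
proof -
 obtain \<rho> where 12: "\<rho> > 0 \<and> (\<exists>J B \<phi> \<xi> \<eta>. liso (ball 0 \<rho>) J \<and> J 0 = p \<and> inj_on J (ball 0 \<rho>) \<and>
  (\<forall>W. open W --> W\<subseteq>ball 0 \<rho> --> openin X (J ` W)) \<and> J ` ball 0 \<rho>\<subseteq>chart_dom c \<and>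
  hyp_chart.tractor_frame M c B \<phi> \<xi> \<eta> \<and> (\<forall>z\<in>ball 0 \<rho>. chart_map c (J z)\<in>B \<and> \<phi> (chart_map c (J z)) = z))"
  using liso_exists[OF assms] by (elim exE)
 from conjunct2[OF 12] obtain J B \<phi> \<xi> \<eta> where "liso (ball 0 \<rho>) J \<and> J 0 = p \<and> inj_on J (ball 0 \<rho>) \<and>
  (\<forall>W. open W --> W\<subseteq>ball 0 \<rho> --> openin X (J ` W)) \<and> J ` ball 0 \<rho>\<subseteq>chart_dom c \<and>
  hyp_chart.tractor_frame M c B \<phi> \<xi> \<eta> \<and> (\<forall>z\<in>ball 0 \<rho>. chart_map c (J z)\<in>B \<and> \<phi> (chart_map c (J z)) = z)"
  by (elim exE)
 then have "adapted c p \<rho> J B \<phi> \<xi> \<eta>" unfolding adapted_def using 12 by simp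
 then show ?thesis by (rule that)
qed

lemma adaptedD:
 assumes "adapted c p \<rho> J B \<phi> \<xi> \<eta>"
 shows "\<rho> > 0" "liso (ball 0 \<rho>) J" "J 0 = p" "J ` ball 0 \<rho>\<subseteq>chart_dom c"
  "hyp_chart.tractor_frame M c B \<phi> \<xi> \<eta>" "param \<rho> J"
  "z\<in>ball 0 \<rho> ==> chart_map c (J z)\<in>B" "z\<in>ball 0 \<rho> ==> \<phi> (chart_map c (J z)) = z"
 using assms unfolding adapted_def param_def by simp_all

lemma dcf_transition:
 assumes f: "liso W f" and c: "c\<in>man_atlas M" "c'\<in>man_atlas M" and w: "w\<in>W" "f w\<in>chart_dom c" "f w\<in>chart_dom c'"
 shows "dcf c' f w v = frechet_derivative (transition c c') (at (chart_map c (f w))) (dcf c f w v)"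
proof -
 define N where "N = {z\<in>W. f z\<in>chart_dom c\<inter>chart_dom c'}"
 have oN: "open N" unfolding N_def by (rule liso_preimage[OF f]) (auto intro: openin_Int chart_dom_open c)
 have wN: "w\<in>N" unfolding N_def using w by simp
 have C1: "C1_on (chart_map c \<circ> f) N" by (rule C1_on_subset[OF liso_C1[OF f c(1)]]) (auto simp: N_def)
 have eq: "(transition c c' \<circ> (chart_map c \<circ> f)) z = (chart_map c' \<circ> f) z" if "z\<in>N" for z
  using transition_eq[OF c(1), of "f z" c'] that unfolding N_def by auto
 have wT: "(chart_map c \<circ> f) w\<in>chart_map c ` (chart_dom c\<inter>chart_dom c')" using w by auto
 have e: "frechet_derivative (transition c c' \<circ> (chart_map c \<circ> f)) (at w) = frechet_derivative (chart_map c' \<circ> f) (at w)"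
  by (rule frechet_derivative_cong[OF oN wN]) (rule eq)
 show ?thesis unfolding dcf_def e[symmetric] frechet_derivative_compose'[OF C1 wN transition_C1[OF c] wT] by simp
qed

text \<open>The tangent map of \<open>F\<close> in the encoding of \<open>tangent_vector\<close>,
  with the same default 0 outside the charts around the base point.\<close>

definition TF :: "(real^'n => 'a) => real^'n => real^'n => ('a, 'n) tvec" where
 "TF F h w = (F h, \<lambda>c. if c\<in>man_atlas M \<and> F h\<in>chart_dom c then dcf c F h w else 0)"

lemma TF_tangent_vector:
 assumes F: "liso UNIV F" and c: "c\<in>man_atlas M" "F h\<in>chart_dom c"
 shows "TF F h w = tangent_vector M c (chart_map c (F h)) (dcf c F h w)"
 unfolding TF_def tangent_vector_def chart_inv_map[OF c]
 using dcf_transition[OF F c(1) _ _ c(2)] by auto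

lemma liso_curve_velocity:
 assumes F: "liso UNIV F" and c: "c\<in>man_atlas M" and \<sigma>: "(\<sigma> has_vector_derivative \<sigma>') (at t)" and t: "F (\<sigma> t)\<in>chart_dom c"
 shows "((\<lambda>s. chart_map c (F (\<sigma> s))) has_vector_derivative dcf c F (\<sigma> t) \<sigma>') (at t)"
  and "coord_velocity c (\<lambda>s. F (\<sigma> s)) t = dcf c F (\<sigma> t) \<sigma>'"
proof -
 have d: "((\<lambda>w. chart_map c (F w)) has_derivative dcf c F (\<sigma> t)) (at (\<sigma> t))"
  by (rule liso_has_derivative[OF F c UNIV_I t])
 from has_derivative_compose[OF \<sigma>[unfolded has_vector_derivative_def] d]
 show "((\<lambda>s. chart_map c (F (\<sigma> s))) has_vector_derivative dcf c F (\<sigma> t) \<sigma>') (at t)"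
  unfolding has_vector_derivative_def using linear_scale[OF has_derivative_linear[OF d]] by simp
 then show "coord_velocity c (\<lambda>s. F (\<sigma> s)) t = dcf c F (\<sigma> t) \<sigma>'"
  unfolding coord_velocity_def by (rule vector_derivative_at)
qed

lemma velocity_geo:
 assumes F: "liso UNIV F"
 shows "velocity M (\<lambda>s. F (geo h w s)) t = TF F (geo h w t) (dgeo h w t)"
 unfolding velocity_def TF_def using liso_curve_velocity(2)[OF F _ geo_derivative] by auto

lemma geo_preimage_open:
 assumes F: "liso UNIV F" and U: "openin X U"
 shows "open {t. F (geo h w t)\<in>U}"
proof -
 have "open {z. F z\<in>U}" using liso_preimage[OF F U] by simp
 from open_vimage[OF this continuous_geo[of UNIV h w]] show ?thesis by (simp add: vimage_def)
qed

text \<open>In a chart the velocity is expanded in a tractor frame; its coefficients are the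
  Minkowski components of \<open>dgeo\<close>, whose derivatives are those of \<open>geo\<close>.
  Differentiating the expansion gives the geodesic equation, since the curve stays on the
  hyperboloid.\<close>

lemma complete_geodesic_geo:
 assumes F: "liso UNIV F" and u: "gH h w w = 1"
 shows "complete_geodesic M (\<lambda>s. F (geo h w s))"
 unfolding complete_geodesic_def
proof (intro conjI ballI allI impI)
 show "continuous_map euclideanreal X (\<lambda>s. F (geo h w s))"
  unfolding continuous_map_def using liso_topspace[OF F] geo_preimage_open[OF F] by auto
 fix c t assume c: "c\<in>man_atlas M" and t: "F (geo h w t)\<in>chart_dom c"
 interpret C: hyp_chart M c by (rule chart_locale[OF c])
 define x where "x s = chart_map c (F (geo h w s))" for s
 define v where "v s = dcf c F (geo h w s) (dgeo h w s)" for s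
 have dx: "(x has_vector_derivative v s) (at s)" and cv: "coord_velocity c (\<lambda>s. F (geo h w s)) s = v s"
  if "F (geo h w s)\<in>chart_dom c" for s
  using liso_curve_velocity[OF F c geo_derivative that] unfolding x_def[abs_def] v_def by auto
 show "(\<lambda>s. chart_map c (F (geo h w s))) differentiable at t"
  using dx[OF t] unfolding x_def[abs_def] has_vector_derivative_def differentiable_def by blast
 obtain \<rho> J B \<phi> \<xi> \<eta> where ad: "adapted c (F (geo h w t)) \<rho> J B \<phi> \<xi> \<eta>" by (rule adapted_exists[OF c t])
 note J = adaptedD(1-4)[OF ad] and Fr = adaptedD(5)[OF ad] and JB = adaptedD(7,8)[OF ad]
 have 0: "(0::real^'n)\<in>ball 0 \<rho>" using J(1) by simp
 obtain k N where k: "hiso k" "open N" "geo h w t\<in>N" "k ` N\<subseteq>ball 0 \<rho>" "\<forall>z\<in>N. F z = J (k z)"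
  using liso_rigid[OF F J(2) UNIV_I 0, of "geo h w t"] J(3) by auto
 obtain k' where k': "\<And>x v w. gH (k x) (k' x v) (k' x w) = gH x v w"
  "\<And>h w t. gH h w w = 1 ==> k (cosh t *\<^sub>R h + sinh t *\<^sub>R w) = cosh t *\<^sub>R k h + sinh t *\<^sub>R k' h w"
  using hiso_deriv[OF k(1)] by metis
 define h' w' where "h' = k h" and "w' = k' h w"
 have u': "gH h' w' w' = 1" unfolding h'_def w'_def k'(1) by (rule u)
 have kg: "k (geo h w s) = geo h' w' s" for s unfolding geo_def h'_def w'_def by (rule k'(2)[OF u])
 define T where "T = geo h w -` N"
 have oT: "open T" unfolding T_def using continuous_geo[of UNIV h w] k(2) by (simp add: open_vimage)
 have tT: "t\<in>T" unfolding T_def using k(3) by simp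
 have T: "F (geo h w s)\<in>chart_dom c" "x s\<in>B" "\<phi> (x s) = geo h' w' s" if "s\<in>T" for s
 proof -
  have s: "F (geo h w s) = J (geo h' w' s)" "geo h' w' s\<in>ball 0 \<rho>"
   using that k(4,5) unfolding T_def kg[symmetric] by auto
  show "F (geo h w s)\<in>chart_dom c" "x s\<in>B" "\<phi> (x s) = geo h' w' s"
   unfolding x_def s(1) using s(2) J(4) JB by auto
 qed
 define \<kappa> where "\<kappa> s = cosh s*hz h' + sinh s*hzd h' w'" for s
 define \<kappa>' where "\<kappa>' s = sinh s*hz h' + cosh s*hzd h' w'" for s
 have \<kappa>: "hz (geo h' w' s) = \<kappa> s" "hzd (geo h' w' s) (dgeo h' w' s) = \<kappa>' s" for s
  unfolding geo_def dgeo_def \<kappa>_def \<kappa>'_def by (rule geodesic_hz[OF u'], rule gH_geodesic_velocity(2)[OF u'])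
 have fv: "C.dframe \<xi> (x s) (v s) = dgeo h' w' s" if s: "s\<in>T" for s
 proof -
  have "((\<lambda>s. \<phi> (x s)) has_vector_derivative C.dframe \<xi> (x s) (v s)) (at s)"
   by (rule C.tractor_frame_curve(1)[OF Fr T(2)[OF s] dx[OF T(1)[OF s]]])
  moreover have "((\<lambda>s. \<phi> (x s)) has_vector_derivative dgeo h' w' s) (at s)"
   by (rule has_vector_derivative_transform_within_open[OF geo_derivative oT s]) (simp add: T(3))
  ultimately show ?thesis by (rule vector_derivative_unique_at)
 qed
 have gx: "C.g (x s) (\<xi> i (x s)) (v s) = dgeo h' w' s$i" "C.g (x s) (\<eta> (x s)) (v s) = \<kappa>' s" if "s\<in>T" for s i
  using C.dframe_nth[of \<xi> "x s" "v s" i] C.tractor_frame_isometry(2)[OF Fr T(2)[OF that], of "v s"]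
  unfolding fv[OF that] T(3)[OF that] \<kappa> by auto
 have BS: "B\<subseteq>C.S" using Fr unfolding C.tractor_frame_def by auto
 \<comment> \<open>The reproducing property of the frame, with the pairings from \<open>gx\<close>.
   The point is that the coefficients are explicit functions of \<open>s\<close>.\<close>
 have vrep: "(\<Sum>i\<in>UNIV. dgeo h' w' s$i *\<^sub>R \<xi> i (x s)) - \<kappa>' s *\<^sub>R \<eta> (x s) = v s" if s: "s\<in>T" for s
 proof -
  have xS: "x s\<in>C.S" using T(2)[OF s] BS by auto
  have "v s = (\<Sum>i\<in>UNIV. C.g (x s) (v s) (\<xi> i (x s)) *\<^sub>R \<xi> i (x s)) - C.g (x s) (v s) (\<eta> (x s)) *\<^sub>R \<eta> (x s)"
   using Fr T(2)[OF s] unfolding C.tractor_frame_def by blast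
  then show ?thesis unfolding C.g_sym[OF xS, of "v s"] gx[OF s] by simp
 qed
 note x\<xi> = C.tractor_frame_curve(2,3)[OF Fr T(2)[OF tT] dx[OF t]]
 have dg: "((\<lambda>s. dgeo h' w' s$i) has_real_derivative geo h' w' t$i) (at t)" for i
  using bounded_linear.has_vector_derivative[OF bounded_linear_vec_nth dgeo_derivative]
  by (simp add: has_real_derivative_iff_has_vector_derivative)
 have d\<kappa>: "(\<kappa>' has_real_derivative \<kappa> t) (at t)"
  unfolding \<kappa>_def \<kappa>'_def[abs_def] by (auto intro!: derivative_eq_intros)
 have "((\<lambda>s. (\<Sum>i\<in>UNIV. dgeo h' w' s$i *\<^sub>R \<xi> i (x s)) - \<kappa>' s *\<^sub>R \<eta> (x s)) has_vector_derivative
   (\<Sum>i\<in>UNIV. dgeo h' w' t$i *\<^sub>R (\<phi> (x t)$i *\<^sub>R v t - C.\<Gamma> (x t) (v t) (\<xi> i (x t))) + geo h' w' t$i *\<^sub>R \<xi> i (x t))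
   - (\<kappa>' t *\<^sub>R (hz (\<phi> (x t)) *\<^sub>R v t - C.\<Gamma> (x t) (v t) (\<eta> (x t))) + \<kappa> t *\<^sub>R \<eta> (x t))) (at t)"
  (is "(_ has_vector_derivative ?S1 - ?S2) _")
  by (intro has_vector_derivative_diff has_vector_derivative_sum has_vector_derivative_scaleR x\<xi> dg d\<kappa>)
 also have "?S1 - ?S2 = - C.\<Gamma> (x t) (v t) (v t)"
 proof -
  have lin: "linear (C.\<Gamma> (x t) (v t))" using C.bilinear_\<Gamma> unfolding bilinear_def by blast
  have e1: "(\<Sum>i\<in>UNIV. geo h' w' t$i *\<^sub>R \<xi> i (x t)) = \<kappa> t *\<^sub>R \<eta> (x t)"
  proof -
   have "(\<Sum>i\<in>UNIV. \<phi> (x t)$i *\<^sub>R \<xi> i (x t)) = hz (\<phi> (x t)) *\<^sub>R \<eta> (x t)"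
    using Fr T(2)[OF tT] unfolding C.tractor_frame_def by blast
   then show ?thesis unfolding T(3)[OF tT] \<kappa> .
  qed
  \<comment> \<open>Position and velocity are Lorentz-orthogonal. With \<open>e1\<close> this
    removes all terms except the Christoffel term.\<close>
  have e2: "(\<Sum>i\<in>UNIV. dgeo h' w' t$i*geo h' w' t$i) = \<kappa>' t * \<kappa> t"
  proof -
   have "(\<Sum>i\<in>UNIV. dgeo h' w' t$i*geo h' w' t$i) = geo h' w' t \<bullet> dgeo h' w' t"
    unfolding inner_vec_def by (simp add: mult.commute)
   also have "\<dots> = hz (geo h' w' t) * hzd (geo h' w' t) (dgeo h' w' t)" unfolding hzd_mult ..
   finally show ?thesis unfolding \<kappa> by simp
  qed
  have "C.\<Gamma> (x t) (v t) (v t) = C.\<Gamma> (x t) (v t) ((\<Sum>i\<in>UNIV. dgeo h' w' t$i *\<^sub>R \<xi> i (x t)) - \<kappa>' t *\<^sub>R \<eta> (x t))"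
   unfolding vrep[OF tT] ..
  also have "\<dots> = (\<Sum>i\<in>UNIV. dgeo h' w' t$i *\<^sub>R C.\<Gamma> (x t) (v t) (\<xi> i (x t))) - \<kappa>' t *\<^sub>R C.\<Gamma> (x t) (v t) (\<eta> (x t))"
   unfolding linear_diff[OF lin] linear_sum[OF lin] linear_scale[OF lin] ..
  finally have e3: "C.\<Gamma> (x t) (v t) (v t) = (\<Sum>i\<in>UNIV. dgeo h' w' t$i *\<^sub>R C.\<Gamma> (x t) (v t) (\<xi> i (x t))) - \<kappa>' t *\<^sub>R C.\<Gamma> (x t) (v t) (\<eta> (x t))" .
  have "?S1 = (\<Sum>i\<in>UNIV. dgeo h' w' t$i*geo h' w' t$i) *\<^sub>R v t - (\<Sum>i\<in>UNIV. dgeo h' w' t$i *\<^sub>R C.\<Gamma> (x t) (v t) (\<xi> i (x t)))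
    + (\<Sum>i\<in>UNIV. geo h' w' t$i *\<^sub>R \<xi> i (x t))"
   unfolding T(3)[OF tT] by (simp add: sum.distrib scaleR_diff_right sum_subtractf scaleR_sum_left)
  then show ?thesis unfolding e1 e2 e3 T(3)[OF tT] \<kappa> by (simp add: algebra_simps)
 qed
 finally have "(v has_vector_derivative - C.\<Gamma> (x t) (v t) (v t)) (at t)"
  by (rule has_vector_derivative_transform_within_open[OF _ oT tT]) (rule vrep)
 then have "(coord_velocity c (\<lambda>s. F (geo h w s)) has_vector_derivative - C.\<Gamma> (x t) (v t) (v t)) (at t)"
  by (rule has_vector_derivative_transform_within_open[OF _ oT tT]) (simp add: cv T(1))
 moreover have "- C.\<Gamma> (x t) (v t) (v t) = (\<chi> k. - (\<Sum>i\<in>UNIV. \<Sum>j\<in>UNIV. christoffel M c (chart_map c (F (geo h w t))) k i j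
           * coord_velocity c (\<lambda>s. F (geo h w s)) t$i*coord_velocity c (\<lambda>s. F (geo h w s)) t$j))"
  unfolding cv[OF t] x_def by (simp add: vec_eq_iff C.\<Gamma>_nth)
 ultimately show "(coord_velocity c (\<lambda>s. F (geo h w s)) has_vector_derivative
   (\<chi> k. - (\<Sum>i\<in>UNIV. \<Sum>j\<in>UNIV. christoffel M c (chart_map c (F (geo h w t))) k i j
           * coord_velocity c (\<lambda>s. F (geo h w s)) t$i*coord_velocity c (\<lambda>s. F (geo h w s)) t$j))) (at t)"
  by simp
qed

end

section \<open>Uniqueness of geodesics and the geodesic flow\<close>

context hyp_chart begin

lemma g_curve_derivative:
 assumes x: "x t\<in>S" and dx: "(x has_vector_derivative x') (at t)"
  and p: "(p has_vector_derivative p') (at t)" and q: "(q has_vector_derivative q') (at t)"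
 shows "((\<lambda>t. g (x t) (p t) (q t)) has_real_derivative (dg (x t) x' (p t) (q t) + g (x t) p' (q t) + g (x t) (p t) q')) (at t)"
proof -
 have lG: "linear (dG (x t))" by (rule has_derivative_linear[OF G_derivative[OF x]])
 have dGx: "((\<lambda>t. G (x t)) has_derivative (\<lambda>h. h *\<^sub>R dG (x t) x')) (at t)"
  using has_derivative_compose[OF dx[unfolded has_vector_derivative_def] G_derivative[OF x]]
  by (simp add: linear_scale[OF lG])
 have "((\<lambda>t. p t \<bullet> (G (x t) *v q t)) has_derivative
   (\<lambda>h. p t \<bullet> (G (x t) *v (h *\<^sub>R q') + (h *\<^sub>R dG (x t) x') *v q t) + (h *\<^sub>R p') \<bullet> (G (x t) *v q t))) (at t)"
  by (rule has_derivative_inner[OF p[unfolded has_vector_derivative_def]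
     bounded_bilinear.FDERIV[OF bounded_bilinear_matrix_vector dGx q[unfolded has_vector_derivative_def]]])
 then show ?thesis unfolding g_eq[symmetric] has_field_derivative_def
  by (rule has_derivative_eq_rhs)
   (simp add: g_eq dg_def inner_add_right fun_eq_iff matrix_vector_mult_scaleR scaleR_matrix_vector_assoc[symmetric] algebra_simps)
qed

end

context hyp_manifold begin

lemma geodesicD:
 assumes "complete_geodesic M \<gamma>" "c\<in>man_atlas M" "\<gamma> t\<in>chart_dom c"
 shows "((\<lambda>s. chart_map c (\<gamma> s)) has_vector_derivative coord_velocity c \<gamma> t) (at t)"
  and "(coord_velocity c \<gamma> has_vector_derivative
    - hyp_chart.\<Gamma> M c (chart_map c (\<gamma> t)) (coord_velocity c \<gamma> t) (coord_velocity c \<gamma> t)) (at t)"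
proof -
 interpret C: hyp_chart M c by (rule chart_locale[OF assms(2)])
 have d: "(\<lambda>s. chart_map c (\<gamma> s)) differentiable (at t)"
  and v: "(coord_velocity c \<gamma> has_vector_derivative
      (\<chi> k. - (\<Sum>i\<in>UNIV. \<Sum>j\<in>UNIV. christoffel M c (chart_map c (\<gamma> t)) k i j
           * coord_velocity c \<gamma> t$i*coord_velocity c \<gamma> t$j))) (at t)"
  using assms unfolding complete_geodesic_def by blast+
 show "((\<lambda>s. chart_map c (\<gamma> s)) has_vector_derivative coord_velocity c \<gamma> t) (at t)"
  using d unfolding coord_velocity_def by (simp add: vector_derivative_works)
 have "(\<chi> k. - (\<Sum>i\<in>UNIV. \<Sum>j\<in>UNIV. christoffel M c (chart_map c (\<gamma> t)) k i j
           * coord_velocity c \<gamma> t$i*coord_velocity c \<gamma> t$j))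
   = - C.\<Gamma> (chart_map c (\<gamma> t)) (coord_velocity c \<gamma> t) (coord_velocity c \<gamma> t)"
  by (simp add: vec_eq_iff C.\<Gamma>_nth)
 then show "(coord_velocity c \<gamma> has_vector_derivative
    - C.\<Gamma> (chart_map c (\<gamma> t)) (coord_velocity c \<gamma> t) (coord_velocity c \<gamma> t)) (at t)" using v by simp
qed

lemma geodesic_preimage_open:
 assumes "complete_geodesic M \<gamma>" "openin X U"
 shows "open {t. \<gamma> t\<in>U}"
proof -
 have "continuous_map euclideanreal X \<gamma>" using assms(1) unfolding complete_geodesic_def by blast
 from openin_continuous_map_preimage[OF this assms(2)] show ?thesis by simp
qed

lemma geodesic_in_topspace: "complete_geodesic M \<gamma> ==> \<gamma> t\<in>topspace X"
 unfolding complete_geodesic_def continuous_map_def by auto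

text \<open>The pairing of the velocity with \<open>\<xi> i\<close> has derivative
  \<open>z t$i\<close> times the squared speed, so for unit speed the nonlinear geodesic equation
  becomes z'' = z in tractor coordinates.\<close>

lemma geodesic_tractor_coordinates:
 assumes \<gamma>: "complete_geodesic M \<gamma>" and c: "c\<in>man_atlas M" and ad: "adapted c (\<gamma> s) \<rho> J B \<phi> \<xi> \<eta>"
  and unit: "inner_at M c (chart_map c (\<gamma> s)) (coord_velocity c \<gamma> s) (coord_velocity c \<gamma> s) = 1"
 defines "z \<equiv> \<lambda>t. \<phi> (chart_map c (\<gamma> t))" and "z' \<equiv> \<lambda>t. hyp_chart.dframe M c \<xi> (chart_map c (\<gamma> t)) (coord_velocity c \<gamma> t)"
 shows "\<exists>e>0. \<forall>t\<in>{s-e<..<s+e}. \<gamma> t = J (z t) \<and> (z has_vector_derivative z' t) (at t) \<and> (z' has_vector_derivative z t) (at t)"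
proof -
 interpret C: hyp_chart M c by (rule chart_locale[OF c])
 note J = adaptedD[OF ad]
 have Fr: "C.tractor_frame B \<phi> \<xi> \<eta>" by (rule J(5))
 have BS: "B\<subseteq>C.S" using Fr unfolding C.tractor_frame_def by auto
 have "openin X (J ` ball 0 \<rho>)" using J(6) unfolding param_def by auto
 then have o: "open {t. \<gamma> t\<in>J ` ball 0 \<rho>}" by (rule geodesic_preimage_open[OF \<gamma>])
 have "s\<in>{t. \<gamma> t\<in>J ` ball 0 \<rho>}" using J(1,3) by (auto intro!: image_eqI[of _ _ 0])
 then obtain e where e: "e > 0" "ball s e\<subseteq>{t. \<gamma> t\<in>J ` ball 0 \<rho>}" using o open_contains_ball by blast
 define I where "I = {s-e<..<s+e}"
 have sI: "s\<in>I" unfolding I_def using e by simp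
 define x where "x t = chart_map c (\<gamma> t)" for t
 define v where "v = coord_velocity c \<gamma>"
 have I: "\<gamma> t = J (z t)" "z t\<in>ball 0 \<rho>" "\<gamma> t\<in>chart_dom c" "x t\<in>B" if "t\<in>I" for t
 proof -
  have "t\<in>ball s e" using that unfolding I_def by (auto simp: dist_real_def)
  then obtain y where y: "y\<in>ball 0 \<rho>" "\<gamma> t = J y" using e(2) by blast
  then have "z t = y" unfolding z_def by (simp add: J(8))
  then show "\<gamma> t = J (z t)" "z t\<in>ball 0 \<rho>" "\<gamma> t\<in>chart_dom c" "x t\<in>B"
   using y J(4,7) unfolding x_def by auto
 qed
 have dx: "(x has_vector_derivative v t) (at t)" and dv: "(v has_vector_derivative - C.\<Gamma> (x t) (v t) (v t)) (at t)" if "t\<in>I" for t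
  using geodesicD[OF \<gamma> c I(3)[OF that]] unfolding x_def[abs_def] v_def by auto
 have xS: "x t\<in>C.S" if "t\<in>I" for t using I(4)[OF that] BS by auto
 \<comment> \<open>The speed is constant by metric compatibility.\<close>
 have N: "C.g (x t) (v t) (v t) = 1" if t: "t\<in>I" for t
 proof -
  have "((\<lambda>t. C.g (x t) (v t) (v t)) has_derivative (\<lambda>h. 0)) (at t within I)" if t: "t\<in>I" for t
  proof -
   have "((\<lambda>t. C.g (x t) (v t) (v t)) has_real_derivative
     (C.dg (x t) (v t) (v t) (v t) + C.g (x t) (- C.\<Gamma> (x t) (v t) (v t)) (v t) + C.g (x t) (v t) (- C.\<Gamma> (x t) (v t) (v t)))) (at t)"
    by (rule C.g_curve_derivative[where x = x, OF xS[OF t] dx[OF t] dv[OF t] dv[OF t]])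
   then have "((\<lambda>t. C.g (x t) (v t) (v t)) has_real_derivative 0) (at t)"
    unfolding C.metric_compatible[OF xS[OF t]] by simp
   then have "((\<lambda>t. C.g (x t) (v t) (v t)) has_derivative (\<lambda>h. 0)) (at t)"
    unfolding has_field_derivative_def by (rule has_derivative_eq_rhs) (simp add: fun_eq_iff)
   then show ?thesis by (rule has_derivative_at_withinI)
  qed
  from has_derivative_zero_constant[OF _ this] obtain k where "\<forall>t\<in>I. C.g (x t) (v t) (v t) = k"
   unfolding I_def by auto
  then have "C.g (x t) (v t) (v t) = C.g (x s) (v s) (v s)" using t sI by simp
  then show ?thesis using unit unfolding C.g_def x_def v_def by simp
 qed
 have main: "(z has_vector_derivative z' t) (at t) \<and> (z' has_vector_derivative z t) (at t)" if t: "t\<in>I" for t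
 proof
  show "(z has_vector_derivative z' t) (at t)"
   using C.tractor_frame_curve(1)[OF Fr I(4)[OF t] dx[OF t]] unfolding z_def z'_def x_def v_def .
  have comp: "((\<lambda>t. C.g (x t) (\<xi> i (x t)) (v t)) has_real_derivative z t$i) (at t)" for i
  proof -
   have "((\<lambda>t. C.g (x t) (\<xi> i (x t)) (v t)) has_real_derivative
     (C.dg (x t) (v t) (\<xi> i (x t)) (v t) + C.g (x t) (\<phi> (x t)$i *\<^sub>R v t - C.\<Gamma> (x t) (v t) (\<xi> i (x t))) (v t)
     + C.g (x t) (\<xi> i (x t)) (- C.\<Gamma> (x t) (v t) (v t)))) (at t)"
    by (rule C.g_curve_derivative[where x = x, OF xS[OF t] dx[OF t] C.tractor_frame_curve(2)[OF Fr I(4)[OF t] dx[OF t]] dv[OF t]])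
   then show ?thesis unfolding C.metric_compatible[OF xS[OF t]] by (simp add: N[OF t]) (simp add: z_def x_def)
  qed
  have "((\<lambda>t. \<Sum>i\<in>UNIV. C.g (x t) (\<xi> i (x t)) (v t) *\<^sub>R (axis i 1 :: real^'n)) has_vector_derivative
    (\<Sum>i\<in>UNIV. C.g (x t) (\<xi> i (x t)) (v t) *\<^sub>R 0 + z t$i *\<^sub>R axis i 1)) (at t)"
   by (intro has_vector_derivative_sum has_vector_derivative_scaleR comp has_vector_derivative_const)
  then show "(z' has_vector_derivative z t) (at t)"
   unfolding z'_def C.dframe_def x_def[symmetric] v_def[symmetric] using vec_expand[of "z t"] by simp
 qed
 show ?thesis using e(1) I(1) main unfolding I_def by blast
qed

lemma geodesic_locally_unique:
 assumes \<gamma>: "complete_geodesic M \<gamma>" "complete_geodesic M \<gamma>'" and eq: "velocity M \<gamma> s = velocity M \<gamma>' s"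
  and c: "c\<in>man_atlas M" "\<gamma> s\<in>chart_dom c"
  and unit: "inner_at M c (chart_map c (\<gamma> s)) (coord_velocity c \<gamma> s) (coord_velocity c \<gamma> s) = 1"
 shows "\<exists>e>0. \<forall>t\<in>{s-e<..<s+e}. \<gamma> t = \<gamma>' t"
proof -
 have p: "\<gamma> s = \<gamma>' s" using eq unfolding velocity_def by simp
 have v: "coord_velocity c \<gamma> s = coord_velocity c \<gamma>' s"
 by (smt (verit) c(1,2) eq p snd_conv velocity_def)
 obtain \<rho> J B \<phi> \<xi> \<eta> where ad: "adapted c (\<gamma> s) \<rho> J B \<phi> \<xi> \<eta>" by (rule adapted_exists[OF c])
 define z where "z \<gamma> t = \<phi> (chart_map c (\<gamma> t))" for \<gamma> :: "real => 'a" and t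
 define z' where "z' \<gamma> t = hyp_chart.dframe M c \<xi> (chart_map c (\<gamma> t)) (coord_velocity c \<gamma> t)" for \<gamma> t
 obtain e1 where e1: "e1 > 0" "\<forall>t\<in>{s-e1<..<s+e1}. \<gamma> t = J (z \<gamma> t) \<and> (z \<gamma> has_vector_derivative z' \<gamma> t) (at t) \<and> (z' \<gamma> has_vector_derivative z \<gamma> t) (at t)"
  using geodesic_tractor_coordinates[OF \<gamma>(1) c(1) ad unit] unfolding z_def[abs_def] z'_def[abs_def] by blast
 have ad': "adapted c (\<gamma>' s) \<rho> J B \<phi> \<xi> \<eta>" using ad p by simp
 have unit': "inner_at M c (chart_map c (\<gamma>' s)) (coord_velocity c \<gamma>' s) (coord_velocity c \<gamma>' s) = 1" using unit p v by simp
 obtain e2 where e2: "e2 > 0" "\<forall>t\<in>{s-e2<..<s+e2}. \<gamma>' t = J (z \<gamma>' t) \<and> (z \<gamma>' has_vector_derivative z' \<gamma>' t) (at t) \<and> (z' \<gamma>' has_vector_derivative z \<gamma>' t) (at t)"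
  using geodesic_tractor_coordinates[OF \<gamma>(2) c(1) ad' unit'] unfolding z_def[abs_def] z'_def[abs_def] by blast
 define e where "e = min e1 e2"
 have "\<gamma> t = \<gamma>' t" if t: "t\<in>{s-e<..<s+e}" for t
 proof -
  have "z \<gamma> t - z \<gamma>' t = 0"
  proof (rule second_order_unique[where s = s and e = e and z = "\<lambda>t. z \<gamma> t - z \<gamma>' t" and z' = "\<lambda>t. z' \<gamma> t - z' \<gamma>' t", OF _ _ _ _ t])
   fix t assume t: "t\<in>{s-e<..<s+e}"
   then have t1: "t\<in>{s-e1<..<s+e1}" and t2: "t\<in>{s-e2<..<s+e2}" unfolding e_def by auto
   show "((\<lambda>t. z \<gamma> t - z \<gamma>' t) has_vector_derivative z' \<gamma> t - z' \<gamma>' t) (at t)"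
    and "((\<lambda>t. z' \<gamma> t - z' \<gamma>' t) has_vector_derivative z \<gamma> t - z \<gamma>' t) (at t)"
    using bspec[OF e1(2) t1] bspec[OF e2(2) t2] by (auto intro: has_vector_derivative_diff)
  qed (simp_all add: z_def z'_def p v)
  moreover have "t\<in>{s-e1<..<s+e1}" "t\<in>{s-e2<..<s+e2}" using t unfolding e_def by auto
  ultimately show ?thesis using e1(2) e2(2) by (metis eq_iff_diff_eq_0)
 qed
 moreover have "e > 0" unfolding e_def using e1 e2 by simp
 ultimately show ?thesis by blast
qed

text \<open>The set of times at which the velocities agree is open by local uniqueness; it is closed
  because the manifold is Hausdorff and coordinate velocities are continuous.\<close>

lemma geodesic_unique:
 assumes F: "liso UNIV F" and u: "gH h w w = 1" and \<gamma>: "complete_geodesic M \<gamma>" and 0: "velocity M \<gamma> 0 = TF F h w"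
 shows "velocity M \<gamma> t = TF F (geo h w t) (dgeo h w t)"
proof -
 define \<sigma> where "\<sigma> t = F (geo h w t)" for t
 have \<sigma>: "complete_geodesic M \<sigma>" unfolding \<sigma>_def by (rule complete_geodesic_geo[OF F u])
 have v\<sigma>: "velocity M \<sigma> t = TF F (geo h w t) (dgeo h w t)" for t
  unfolding \<sigma>_def by (rule velocity_geo[OF F])
 define T where "T = {t. velocity M \<gamma> t = velocity M \<sigma> t}"
 have oT: "open T"
 proof (subst open_subopen, intro ballI)
  fix s assume s: "s\<in>T"
  then have eq: "velocity M \<sigma> s = velocity M \<gamma> s" unfolding T_def by simp
  have "\<sigma> s\<in>topspace X" by (rule geodesic_in_topspace[OF \<sigma>])
  then obtain c where c: "c\<in>man_atlas M" "\<sigma> s\<in>chart_dom c" using atlas_cover by blast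
  have cv: "coord_velocity c \<sigma> s = dcf c F (geo h w s) (dgeo h w s)"
   unfolding \<sigma>_def by (rule liso_curve_velocity(2)[OF F c(1) geo_derivative c(2)[unfolded \<sigma>_def]])
  have "inner_at M c (chart_map c (\<sigma> s)) (coord_velocity c \<sigma> s) (coord_velocity c \<sigma> s) = 1"
   unfolding cv unfolding \<sigma>_def liso_isometry[OF F c(1) UNIV_I c(2)[unfolded \<sigma>_def]] by (rule geo_unit[OF u])
  from geodesic_locally_unique[OF \<sigma> \<gamma> eq c this] obtain e where e: "e > 0" "\<And>t. t\<in>{s-e<..<s+e} ==> \<sigma> t = \<gamma> t" by blast
  have "velocity M \<gamma> t = velocity M \<sigma> t" if t: "t\<in>{s-e<..<s+e}" for t
  proof -
   have "coord_velocity c \<gamma> t = coord_velocity c \<sigma> t" if c: "c\<in>man_atlas M" "\<gamma> t\<in>chart_dom c" for c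
   proof -
    have "((\<lambda>s. chart_map c (\<gamma> s)) has_vector_derivative coord_velocity c \<gamma> t) (at t)" by (rule geodesicD(1)[OF \<gamma> c])
    moreover have "((\<lambda>s. chart_map c (\<sigma> s)) has_vector_derivative coord_velocity c \<sigma> t) (at t)"
     using geodesicD(1)[OF \<sigma> c(1)] c(2) e(2)[OF t] by simp
    then have "((\<lambda>s. chart_map c (\<gamma> s)) has_vector_derivative coord_velocity c \<sigma> t) (at t)"
     by (rule has_vector_derivative_transform_within_open[OF _ _ t]) (auto simp: e(2))
    ultimately show ?thesis by (rule vector_derivative_unique_at)
   qed
   then show ?thesis unfolding velocity_def using e(2)[OF t] by auto
  qed
  then show "\<exists>U. open U \<and> s\<in>U \<and> U\<subseteq>T" using e(1) unfolding T_def
   by (intro exI[of _ "{s-e<..<s+e}"]) auto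
 qed
 have cT: "closed T"
 proof (unfold closed_sequential_limits, intro allI impI)
  fix a s assume as: "(\<forall>n. a n\<in>T) \<and> a \<longlonglongrightarrow> s"
  have eqn: "velocity M \<gamma> (a n) = velocity M \<sigma> (a n)" for n using as unfolding T_def by auto
  have p: "\<gamma> s = \<sigma> s"
  proof (rule ccontr)
   assume "\<gamma> s\<noteq>\<sigma> s"
   then obtain U1 U2 where U: "openin X U1" "openin X U2" "\<gamma> s\<in>U1" "\<sigma> s\<in>U2" "disjnt U1 U2"
    using Hausdorff geodesic_in_topspace[OF \<gamma>, of s] geodesic_in_topspace[OF \<sigma>, of s] unfolding Hausdorff_space_def by blast
   have "open ({t. \<gamma> t\<in>U1}\<inter>{t. \<sigma> t\<in>U2})"
    using geodesic_preimage_open[OF \<gamma> U(1)] geodesic_preimage_open[OF \<sigma> U(2)] by auto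
   then have "eventually (\<lambda>n. a n\<in>{t. \<gamma> t\<in>U1}\<inter>{t. \<sigma> t\<in>U2}) sequentially"
    using as U(3,4) topological_tendstoD by blast
   then obtain n where n: "\<gamma> (a n)\<in>U1" "\<sigma> (a n)\<in>U2" by (auto simp: eventually_sequentially)
   have "\<gamma> (a n) = \<sigma> (a n)" using eqn[of n] unfolding velocity_def by simp
   then show False using n U(5) unfolding disjnt_def by auto
  qed
  have "coord_velocity c \<gamma> s = coord_velocity c \<sigma> s" if c: "c\<in>man_atlas M" "\<gamma> s\<in>chart_dom c" for c
  proof -
   have "isCont (coord_velocity c \<gamma>) s" by (rule has_vector_derivative_continuous[OF geodesicD(2)[OF \<gamma> c]])
   then have l1: "(\<lambda>n. coord_velocity c \<gamma> (a n)) \<longlonglongrightarrow> coord_velocity c \<gamma> s" using as isCont_tendsto_compose by blast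
   have "isCont (coord_velocity c \<sigma>) s"
    by (rule has_vector_derivative_continuous[OF geodesicD(2)[OF \<sigma> c(1)]]) (use c(2) p in simp)
   then have l2: "(\<lambda>n. coord_velocity c \<sigma> (a n)) \<longlonglongrightarrow> coord_velocity c \<sigma> s" using as isCont_tendsto_compose by blast
   have "eventually (\<lambda>n. a n\<in>{t. \<gamma> t\<in>chart_dom c}) sequentially"
    using as c(2) geodesic_preimage_open[OF \<gamma> chart_dom_open[OF c(1)]] topological_tendstoD by blast
   then have "eventually (\<lambda>n. coord_velocity c \<gamma> (a n) = coord_velocity c \<sigma> (a n)) sequentially"
   proof (rule eventually_mono)
    fix n assume n: "a n\<in>{t. \<gamma> t\<in>chart_dom c}"
    have e: "\<gamma> (a n) = \<sigma> (a n)" using eqn[of n] unfolding velocity_def by simp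
    have "coord_velocity c \<gamma> (a n) = snd (velocity M \<gamma> (a n)) c" unfolding velocity_def using n c by simp
    also have "\<dots> = snd (velocity M \<sigma> (a n)) c" unfolding eqn ..
    also have "\<dots> = coord_velocity c \<sigma> (a n)" unfolding velocity_def using n c e by simp
    finally show "coord_velocity c \<gamma> (a n) = coord_velocity c \<sigma> (a n)" .
   qed
   from Lim_transform_eventually[OF l1 this] show ?thesis using l2 LIMSEQ_unique by blast
  qed
  then show "s\<in>T" unfolding T_def velocity_def using p by auto
 qed
 have "0\<in>T" unfolding T_def using 0 v\<sigma>[of 0] by simp
 then have "T = UNIV" using clopen[of T] oT cT by blast
 then have "t\<in>T" by simp
 then show ?thesis unfolding T_def mem_Collect_eq v\<sigma> .
qed

theorem geodesic_flow_TF: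
 assumes F: "liso UNIV F" and u: "gH h w w = 1"
 shows "geodesic_flow M t (TF F h w) = TF F (geo h w t) (dgeo h w t)"
 unfolding geodesic_flow_def
proof (rule the_equality)
 show "\<exists>\<gamma>. complete_geodesic M \<gamma> \<and> velocity M \<gamma> 0 = TF F h w \<and> velocity M \<gamma> t = TF F (geo h w t) (dgeo h w t)"
  by (intro exI[of _ "\<lambda>s. F (geo h w s)"]) (simp add: complete_geodesic_geo[OF F u] velocity_geo[OF F])
qed (use geodesic_unique[OF F u] in blast)

lemma base_point_flow:
 assumes "liso UNIV F" "gH h w w = 1"
 shows "base_point (geodesic_flow M t (TF F h w)) = F (geo h w t)"
 unfolding geodesic_flow_TF[OF assms] by (simp add: TF_def)

lemma dcf_surj:
 assumes "liso W f" "c\<in>man_atlas M" "w\<in>W" "f w\<in>chart_dom c"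
 shows "surj (dcf c f w)"
 by (rule linear_inj_imp_surj[OF has_derivative_linear[OF liso_has_derivative[OF assms]] dcf_inj[OF assms]])

lemma tangent_vector_TF:
 assumes F: "liso UNIV F" "range F = topspace X" and c: "c\<in>man_atlas M" and x: "x\<in>chart_img c"
 shows "\<exists>h w. F h\<in>chart_dom c \<and> x = chart_map c (F h) \<and> y = dcf c F h w \<and> tangent_vector M c x y = TF F h w \<and> inner_at M c x y y = gH h w w"
proof -
 have "chart_inv c x\<in>topspace X" using chart_inv_dom[OF x] chart_dom_sub[OF c] by blast
 then obtain h where h: "F h = chart_inv c x" using F(2) by (metis imageE)
 have d: "F h\<in>chart_dom c" unfolding h by (rule chart_inv_dom[OF x])
 have xe: "x = chart_map c (F h)" unfolding h by (rule chart_map_inv[OF x, symmetric])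
 obtain w where w: "y = dcf c F h w" using dcf_surj[OF F(1) c UNIV_I d] by (metis surjD)
 have "tangent_vector M c x y = TF F h w" unfolding xe w by (rule TF_tangent_vector[OF F(1) c d, symmetric])
 moreover have "inner_at M c x y y = gH h w w" unfolding xe w by (rule liso_isometry[OF F(1) c UNIV_I d])
 ultimately show ?thesis using d xe w by blast
qed

lemma unit_tangent_bundle_TF:
 assumes F: "liso UNIV F" "range F = topspace X"
 shows "unit_tangent_bundle M = {TF F h w | h w. gH h w w = 1}" (is "?A = ?B")
proof
 show "?A\<subseteq>?B"
 proof
  fix v assume "v\<in>?A"
  then obtain c x y where "v = tangent_vector M c x y" "c\<in>man_atlas M" "x\<in>chart_img c" "inner_at M c x y y = 1"
   unfolding unit_tangent_bundle_def by blast
  moreover from tangent_vector_TF[OF F this(2,3)] obtain h w where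
   "tangent_vector M c x y = TF F h w" "inner_at M c x y y = gH h w w" by blast
  ultimately show "v\<in>?B" by auto
 qed
 show "?B\<subseteq>?A"
 proof
  fix v assume "v\<in>?B"
  then obtain h w where v: "v = TF F h w" "gH h w w = 1" by blast
  have "F h\<in>topspace X" using F(2) by blast
  then obtain c where c: "c\<in>man_atlas M" "F h\<in>chart_dom c" using atlas_cover by blast
  have "v = tangent_vector M c (chart_map c (F h)) (dcf c F h w)" unfolding v by (rule TF_tangent_vector[OF F(1) c])
  moreover have "inner_at M c (chart_map c (F h)) (dcf c F h w) (dcf c F h w) = 1"
   unfolding liso_isometry[OF F(1) c(1) UNIV_I c(2)] by (rule v(2))
  ultimately show "v\<in>?A" unfolding unit_tangent_bundle_def mem_Collect_eq using c(1) chart_map_img[OF c(2)]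
   by (intro exI[of _ c] exI[of _ "chart_map c (F h)"] exI[of _ "dcf c F h w"] conjI)
 qed
qed

lemma TF_in_tangent_bundle:
 assumes F: "liso UNIV F"
 shows "TF F h w\<in>tangent_bundle M"
proof -
 have "F h\<in>topspace X" using liso_topspace[OF F] by blast
 then obtain c where c: "c\<in>man_atlas M" "F h\<in>chart_dom c" using atlas_cover by blast
 show ?thesis unfolding tangent_bundle_def mem_Collect_eq TF_tangent_vector[OF F c] using c(1) chart_map_img[OF c(2)]
  by (intro exI[of _ c] exI[of _ "chart_map c (F h)"] exI[of _ "dcf c F h w"] conjI refl)
qed

end

section \<open>Riemannian distance\<close>

text \<open>Outside the finite set \<open>Z\<close> the derivative is continuous but possibly
  unbounded, so its integrability is deduced from finiteness of the right-hand side; if that is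
  infinite, the bound is trivial.\<close>

lemma norm_diff_le_nn_integral:
 fixes f f' :: "real => 'b::euclidean_space"
 assumes ab: "a\<le>b" and Z: "finite Z" and cont: "continuous_on {a..b} f"
  and der: "\<And>t. t\<in>{a<..<b} - Z ==> (f has_vector_derivative f' t) (at t)"
  and cf': "continuous_on ({a<..<b} - Z) f'"
  and le: "\<And>t. t\<in>{a<..<b} - Z ==> norm (f' t)\<le>G t"
 shows "ennreal (norm (f b - f a))\<le>(\<integral>\<^sup>+t\<in>{a<..<b}. ennreal (G t) \<partial>lborel)"
proof (cases "(\<integral>\<^sup>+t\<in>{a<..<b}. ennreal (G t) \<partial>lborel) < \<infinity>")
 case True
 define D where "D = {a<..<b} - Z"
 have oD: "open D" unfolding D_def using Z by (intro open_Diff finite_imp_closed) auto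
 \<comment> \<open>Extending \<open>f'\<close> by 0 from an open set gives a Borel function on the
   line, so that the Lebesgue integral and the gauge integral of the fundamental theorem can be
   compared.\<close>
 define h where "h t = indicator D t *\<^sub>R f' t" for t
 have hm: "h\<in>borel_measurable borel"
  unfolding h_def using cf' oD unfolding D_def[symmetric] by (intro borel_measurable_continuous_on_indicator) auto
 have I1: "(\<integral>\<^sup>+t. ennreal (norm (h t)) \<partial>lborel)\<le>(\<integral>\<^sup>+t\<in>{a<..<b}. ennreal (G t) \<partial>lborel)"
 proof (rule nn_integral_mono)
  fix t show "ennreal (norm (h t))\<le>ennreal (G t) * indicator {a<..<b} t"
   using le[of t] unfolding h_def D_def by (auto simp: indicator_def intro: ennreal_leI)
 qed
 have int: "integrable lborel h"
  by (rule integrableI_bounded) (use hm I1 True in auto)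
 have "(h has_integral (f b - f a)) {a..b}"
 proof (rule has_integral_spike_finite[of "insert a (insert b Z)"])
  show "(f' has_integral (f b - f a)) {a..b}"
   by (rule fundamental_theorem_of_calculus_interior_strong[OF Z ab der cont])
  show "h x = f' x" if "x\<in>{a..b} - insert a (insert b Z)" for x
   using that unfolding h_def D_def by auto
 qed (use Z in auto)
 then have "((\<lambda>t. if t\<in>{a..b} then h t else 0) has_integral (f b - f a)) UNIV"
  by (simp only: has_integral_restrict_UNIV)
 moreover have "(\<lambda>t. if t\<in>{a..b} then h t else 0) = h" unfolding h_def D_def by (auto simp: indicator_def intro!: ext)
 ultimately have "(h has_integral (f b - f a)) UNIV" by simp
 then have "f b - f a = integral\<^sup>L lborel h" using has_integral_integral_lborel[OF int] by (rule has_integral_unique)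
 then have "norm (f b - f a)\<le>integral\<^sup>L lborel (\<lambda>t. norm (h t))" by simp
 then have "ennreal (norm (f b - f a))\<le>ennreal (integral\<^sup>L lborel (\<lambda>t. norm (h t)))" by (rule ennreal_leI)
 also have "\<dots> = (\<integral>\<^sup>+t. ennreal (norm (h t)) \<partial>lborel)"
  by (rule nn_integral_eq_integral[symmetric]) (use int in auto)
 finally show ?thesis using I1 by (rule order_trans)
next
 case False
 then have "(\<integral>\<^sup>+t\<in>{a<..<b}. ennreal (G t) \<partial>lborel) = top" unfolding infinity_ennreal_def not_less top_unique .
 then show ?thesis by (simp only: top_greatest)
qed

context hyp_manifold begin

text \<open>The norm is read in a chart picked by choice. \<open>near\<close> is a hypothesis
  because a curve in the definition of distance is continuous on the unit interval only; it lets the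
  transition map carry the velocity to the chosen chart.\<close>

lemma tangent_norm_eq:
 assumes c: "c\<in>man_atlas M" "\<gamma> t\<in>chart_dom c" and d: "((\<lambda>s. chart_map c (\<gamma> s)) has_vector_derivative y) (at t)"
  and near: "\<And>c'. c'\<in>man_atlas M ==> \<gamma> t\<in>chart_dom c' ==> \<exists>e>0. \<forall>s. \<bar>s - t\<bar> < e --> \<gamma> s\<in>chart_dom c\<inter>chart_dom c'"
 shows "tangent_norm M (velocity M \<gamma> t) = sqrt (inner_at M c (chart_map c (\<gamma> t)) y y)"
proof -
 define c' where "c' = (SOME c. c\<in>man_atlas M \<and> \<gamma> t\<in>chart_dom c)"
 have c': "c'\<in>man_atlas M" "\<gamma> t\<in>chart_dom c'"
  using someI[of "\<lambda>c. c\<in>man_atlas M \<and> \<gamma> t\<in>chart_dom c" c] c unfolding c'_def by auto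
 obtain e where e: "e > 0" "\<forall>s. \<bar>s - t\<bar> < e --> \<gamma> s\<in>chart_dom c\<inter>chart_dom c'" using near[OF c'] by blast
 have xT: "chart_map c (\<gamma> t)\<in>chart_map c ` (chart_dom c\<inter>chart_dom c')" using c c' by auto
 define D where "D = frechet_derivative (transition c c') (at (chart_map c (\<gamma> t)))"
 have dt: "(transition c c' has_derivative D) (at (chart_map c (\<gamma> t)))"
  unfolding D_def by (rule C1_on_frechet(1)[OF transition_C1[OF c(1) c'(1)] xT])
 have "((\<lambda>s. transition c c' (chart_map c (\<gamma> s))) has_vector_derivative D y) (at t)"
  using has_derivative_compose[OF d[unfolded has_vector_derivative_def] dt]
  unfolding has_vector_derivative_def using linear_scale[OF has_derivative_linear[OF dt]] by simp
 then have "((\<lambda>s. chart_map c' (\<gamma> s)) has_vector_derivative D y) (at t)"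
 proof (rule has_vector_derivative_transform_within_open[of _ _ _ "ball t e"])
  fix s assume "s\<in>ball t e"
  then have "\<gamma> s\<in>chart_dom c" using e(2) by (auto simp: dist_real_def abs_minus_commute)
  then show "transition c c' (chart_map c (\<gamma> s)) = chart_map c' (\<gamma> s)" by (rule transition_eq[OF c(1)])
 qed (use e in auto)
 then have cv: "coord_velocity c' \<gamma> t = D y" unfolding coord_velocity_def by (rule vector_derivative_at)
 have "tangent_norm M (velocity M \<gamma> t) = sqrt (inner_at M c' (chart_map c' (\<gamma> t)) (D y) (D y))"
  unfolding tangent_norm_def Let_def velocity_def fst_conv snd_conv c'_def[symmetric] using c' cv by simp
 then show ?thesis unfolding D_def transition_isometry[OF c(1) c'(1) c(2) c'(2)] .
qed

text \<open>The image of a straight segment of the model, in general not a geodesic. As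
  \<open>gH\<close> is at most the Euclidean product, its length is at most the Euclidean one, which
  is enough for an upper bound of the distance.\<close>

lemma line_curve:
 fixes h u :: "real^'n"
 assumes F: "liso UNIV F"
 defines "\<gamma> \<equiv> \<lambda>s. F (h + s *\<^sub>R u)"
 shows "pw_C1_curve M \<gamma>" and "curve_length M \<gamma>\<le>ennreal (norm u)"
proof -
 define \<sigma> where "\<sigma> s = h + s *\<^sub>R u" for s :: real
 have \<sigma>: "(\<sigma> has_vector_derivative u) (at t)" for t
  unfolding \<sigma>_def[abs_def] has_vector_derivative_def by (auto intro!: derivative_eq_intros)
 have c\<sigma>: "continuous_on T \<sigma>" for T unfolding \<sigma>_def by (intro continuous_intros)
 have op: "open {t. \<gamma> t\<in>U}" if "openin X U" for U
 proof -
  have "open {z. F z\<in>U}" using liso_preimage[OF F that] by simp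
  from open_vimage[OF this c\<sigma>[of UNIV]] show ?thesis unfolding \<gamma>_def \<sigma>_def by (simp add: vimage_def)
 qed
 show "pw_C1_curve M \<gamma>"
  unfolding pw_C1_curve_def
 proof (intro conjI ballI allI impI)
  show "continuous_map (top_of_set {0..1}) X \<gamma>"
   unfolding continuous_map_def
  proof (intro conjI ballI allI impI)
   show "\<gamma>\<in>topspace (top_of_set {0..1}) \<rightarrow> topspace X" using liso_topspace[OF F] unfolding \<gamma>_def by auto
   fix U assume "openin X U"
   from op[OF this] show "openin (top_of_set {0..1}) {x\<in>topspace (top_of_set {0..1}). \<gamma> x\<in>U}"
    by (auto simp: openin_open)
  qed
  fix c and a b :: real assume c: "c\<in>man_atlas M" and ab: "{a..b}\<subseteq>{0..1} \<and> \<gamma> ` {a..b}\<subseteq>chart_dom c"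
  have "(\<lambda>s. chart_map c (\<gamma> s)) C1_differentiable_on {a..b}"
   unfolding C1_differentiable_on_def
  proof (intro exI conjI ballI)
   fix t assume "t\<in>{a..b}"
   then have "F (\<sigma> t)\<in>chart_dom c" using ab unfolding \<gamma>_def \<sigma>_def by auto
   from liso_curve_velocity(1)[OF F c \<sigma> this]
   show "((\<lambda>s. chart_map c (\<gamma> s)) has_vector_derivative dcf c F (\<sigma> t) u) (at t)" unfolding \<gamma>_def \<sigma>_def .
  next
   have "continuous_on {w. F w\<in>chart_dom c} (\<lambda>w. dcf c F w u)"
    using C1_on_frechet(2)[OF liso_C1[OF F c], of u] unfolding dcf_def by simp
   then show "continuous_on {a..b} (\<lambda>t. dcf c F (\<sigma> t) u)"
    by (rule continuous_on_compose2[OF _ c\<sigma>]) (use ab in \<open>auto simp: \<gamma>_def \<sigma>_def\<close>)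
  qed
  then show "(\<lambda>s. chart_map c (\<gamma> s)) piecewise_C1_differentiable_on {a..b}"
   by (rule C1_differentiable_imp_piecewise)
 qed
 have tn: "tangent_norm M (velocity M \<gamma> t)\<le>norm u" for t
 proof -
  have "F (\<sigma> t)\<in>topspace X" using liso_topspace[OF F] by blast
  then obtain c where c: "c\<in>man_atlas M" "F (\<sigma> t)\<in>chart_dom c" using atlas_cover by blast
  have ct: "\<gamma> t\<in>chart_dom c" using c(2) unfolding \<gamma>_def \<sigma>_def .
  have "tangent_norm M (velocity M \<gamma> t) = sqrt (inner_at M c (chart_map c (\<gamma> t)) (dcf c F (\<sigma> t) u) (dcf c F (\<sigma> t) u))"
  proof (rule tangent_norm_eq[of c \<gamma> t, OF c(1) ct])
   show "((\<lambda>s. chart_map c (\<gamma> s)) has_vector_derivative dcf c F (\<sigma> t) u) (at t)"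
    using liso_curve_velocity(1)[OF F c(1) \<sigma> c(2)] unfolding \<gamma>_def \<sigma>_def .
   fix c' assume c': "c'\<in>man_atlas M" "\<gamma> t\<in>chart_dom c'"
   have "open {t. \<gamma> t\<in>chart_dom c\<inter>chart_dom c'}" by (rule op) (auto intro: openin_Int chart_dom_open c c')
   moreover have "t\<in>{t. \<gamma> t\<in>chart_dom c\<inter>chart_dom c'}" using c' ct by simp
   ultimately obtain e where "e > 0" "ball t e\<subseteq>{t. \<gamma> t\<in>chart_dom c\<inter>chart_dom c'}"
    using open_contains_ball by blast
   then show "\<exists>e>0. \<forall>s. \<bar>s - t\<bar> < e --> \<gamma> s\<in>chart_dom c\<inter>chart_dom c'"
    by (intro exI[of _ e]) (auto simp: dist_real_def abs_minus_commute subset_iff)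
  qed
  also have "inner_at M c (chart_map c (\<gamma> t)) (dcf c F (\<sigma> t) u) (dcf c F (\<sigma> t) u) = gH (\<sigma> t) u u"
   using liso_isometry[OF F c(1) UNIV_I c(2)] unfolding \<gamma>_def \<sigma>_def .
  also have "sqrt (gH (\<sigma> t) u u)\<le>sqrt (u \<bullet> u)" using gH_le by simp
  finally show ?thesis by (simp add: norm_eq_sqrt_inner)
 qed
 have "curve_length M \<gamma>\<le>(\<integral>\<^sup>+t\<in>{0..1::real}. ennreal (norm u) \<partial>lborel)"
  unfolding curve_length_def by (intro nn_integral_mono mult_right_mono ennreal_leI tn) simp
 also have "\<dots> = ennreal (norm u)" by (simp add: nn_integral_cmult_indicator)
 finally show "curve_length M \<gamma>\<le>ennreal (norm u)" .
qed

lemma riem_dist_upper: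
 assumes F: "liso UNIV F"
 shows "(INF \<gamma>\<in>{\<gamma>. pw_C1_curve M \<gamma> \<and> \<gamma> 0 = F h \<and> \<gamma> 1 = F h'}. curve_length M \<gamma>)\<le>ennreal (norm (h' - h))"
  and "riem_dist M (F h) (F h')\<le>norm (h' - h)"
proof -
 define \<gamma> where "\<gamma> s = F (h + s *\<^sub>R (h' - h))" for s :: real
 have "pw_C1_curve M \<gamma> \<and> \<gamma> 0 = F h \<and> \<gamma> 1 = F h'"
  using line_curve(1)[OF F] unfolding \<gamma>_def[abs_def] by simp
 then have "(INF \<gamma>\<in>{\<gamma>. pw_C1_curve M \<gamma> \<and> \<gamma> 0 = F h \<and> \<gamma> 1 = F h'}. curve_length M \<gamma>)\<le>curve_length M \<gamma>"
  by (intro INF_lower) simp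
 also have "\<dots>\<le>ennreal (norm (h' - h))" unfolding \<gamma>_def[abs_def] by (rule line_curve(2)[OF F])
 finally show 1: "(INF \<gamma>\<in>{\<gamma>. pw_C1_curve M \<gamma> \<and> \<gamma> 0 = F h \<and> \<gamma> 1 = F h'}. curve_length M \<gamma>)\<le>ennreal (norm (h' - h))" .
 show "riem_dist M (F h) (F h')\<le>norm (h' - h)"
  unfolding riem_dist_def using enn2real_mono[OF 1] by simp
qed

text \<open>Only the part of the curve after its last stay outside the ball is measured. There a
  single tractor chart applies, and in it Euclidean speed is at most twice Riemannian speed because
  the coordinates have norm at most 1.\<close>

lemma curve_length_lower:
 assumes c: "c\<in>man_atlas M" and ad: "adapted c p0 \<rho> J B \<phi> \<xi> \<eta>" and r: "0 < r" "r < \<rho>" "r\<le>1"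
  and \<gamma>: "pw_C1_curve M \<gamma>" "\<gamma> 1 = p0" and out: "\<gamma> 0 \<notin> J ` ball 0 r"
 shows "ennreal (r/2)\<le>curve_length M \<gamma>"
proof -
 interpret C: hyp_chart M c by (rule chart_locale[OF c])
 note J = adaptedD[OF ad]
 have Fr: "C.tractor_frame B \<phi> \<xi> \<eta>" by (rule J(5))
 have BS: "B\<subseteq>C.S" using Fr unfolding C.tractor_frame_def by auto
 have cont\<gamma>: "continuous_map (top_of_set {0..1}) X \<gamma>" using \<gamma>(1) unfolding pw_C1_curve_def by blast
 have op: "\<exists>V. open V \<and> {t\<in>{0..1}. \<gamma> t\<in>U} = {0..1}\<inter>V" if "openin X U" for U
  using openin_continuous_map_preimage[OF cont\<gamma> that] by (auto simp: openin_open)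
 have sub: "ball 0 r\<subseteq>ball (0::real^'n) \<rho>" "cball 0 r\<subseteq>ball (0::real^'n) \<rho>" using r by auto
 have oJ: "openin X (J ` ball 0 r)" using J(6) sub(1) unfolding param_def by blast
 have "compactin X (J ` cball 0 r)"
 proof (rule image_compactin)
  show "compactin (top_of_set (ball 0 \<rho>)) (cball (0::real^'n) r)" using sub(2) by (simp add: compactin_subtopology)
  show "continuous_map (top_of_set (ball 0 \<rho>)) X J"
   unfolding continuous_map_def using liso_topspace[OF J(2)] liso_preimage[OF J(2)]
   by (auto simp: openin_open_eq)
 qed
 then have "closedin X (J ` cball 0 r)" by (rule compactin_imp_closedin[OF Hausdorff])
 from closedin_continuous_map_preimage[OF cont\<gamma> this]
 have cl: "closed {t\<in>{0..1}. \<gamma> t\<in>J ` cball 0 r}" by (simp add: closedin_closed_eq)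
 \<comment> \<open>The times outside the open ball form a compact set; its maximum \<open>s\<close>
   is the moment at which the curve enters for good.\<close>
 define K where "K = {t\<in>{0..1}. \<gamma> t \<notin> J ` ball 0 r}"
 obtain V where V: "open V" "{t\<in>{0..1}. \<gamma> t\<in>J ` ball 0 r} = {0..1}\<inter>V" using op[OF oJ] by blast
 have "K = {0..1}\<inter>(- V)" using V(2) unfolding K_def by blast
 then have "compact K" using V(1) by (simp add: compact_Int_closed closed_Compl)
 moreover have "0\<in>K" unfolding K_def using out by simp
 ultimately obtain s where s: "s\<in>K" "\<And>t. t\<in>K ==> t\<le>s" using compact_attains_sup[of K] by blast
 have s01: "0\<le>s" "s\<le>1" "\<gamma> s \<notin> J ` ball 0 r" using s(1) unfolding K_def by auto
 have "\<gamma> 1\<in>J ` ball 0 r" using \<gamma>(2) J(3) r(1) by (auto intro!: image_eqI[of _ _ 0])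
 then have s1: "s < 1" using s01 by (metis order_le_less)
 have inb: "\<gamma> t\<in>J ` ball 0 r" if "s < t" "t\<le>1" for t
  using s(2)[of t] that s01 unfolding K_def by fastforce
 have "s\<in>closure {s<..1}" using s1 by (simp add: closure_greaterThanAtMost)
 moreover have "{s<..1}\<subseteq>{t\<in>{0..1}. \<gamma> t\<in>J ` cball 0 r}"
 proof
  fix t assume t: "t\<in>{s<..1}"
  then have "\<gamma> t\<in>J ` ball 0 r" using inb by auto
  then have "\<gamma> t\<in>J ` cball 0 r" by (meson image_mono ball_subset_cball subsetD)
  then show "t\<in>{t\<in>{0..1}. \<gamma> t\<in>J ` cball 0 r}" using t s01 by auto
 qed
 then have "closure {s<..1}\<subseteq>{t\<in>{0..1}. \<gamma> t\<in>J ` cball 0 r}" using cl by (rule closure_minimal)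
 ultimately have "\<gamma> s\<in>J ` cball 0 r" by blast
 then obtain zs where zs: "zs\<in>cball 0 r" "\<gamma> s = J zs" by blast
 have zsr: "norm zs = r"
 using s01(3) zs(1,2) by auto
 define x where "x t = chart_map c (\<gamma> t)" for t
 define z where "z t = \<phi> (x t)" for t
 have inc: "\<gamma> t\<in>J ` cball 0 r" if "t\<in>{s..1}" for t
 proof (cases "t = s")
  case True then show ?thesis using zs by auto
 next
  case False then have "\<gamma> t\<in>J ` ball 0 r" using inb[of t] that by auto
  then show ?thesis by (meson image_mono ball_subset_cball subsetD)
 qed
 have Jz: "\<gamma> t = J (z t)" "z t\<in>cball 0 r" "\<gamma> t\<in>chart_dom c" "x t\<in>B" if t: "t\<in>{s..1}" for t
 proof -
  obtain y where y: "y\<in>cball 0 r" "\<gamma> t = J y" using inc[OF t] by blast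
  have yb: "y\<in>ball 0 \<rho>" using y(1) sub(2) by blast
  then have "z t = y" unfolding z_def x_def y(2) by (rule J(8))
  then show "\<gamma> t = J (z t)" "z t\<in>cball 0 r" using y by auto
  show "\<gamma> t\<in>chart_dom c" using y(2) yb J(4) by auto
  show "x t\<in>B" unfolding x_def y(2) by (rule J(7)[OF yb])
 qed
 have "zs\<in>ball 0 \<rho>" using zs(1) sub(2) by blast
 then have zs': "z s = zs" unfolding z_def x_def zs(2) by (rule J(8))
 have z1: "z 1 = 0" unfolding z_def x_def \<gamma>(2) J(3)[symmetric] by (rule J(8)) (use J(1) in simp)
 have "\<gamma> ` {s..1}\<subseteq>chart_dom c" using Jz(3) by blast
 then have "(\<lambda>t. chart_map c (\<gamma> t)) piecewise_C1_differentiable_on {s..1}"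
  using \<gamma>(1) c s01 unfolding pw_C1_curve_def by (meson atLeastatMost_subset_iff order_refl)
 then obtain Z where cx: "continuous_on {s..1} x" and Z: "finite Z" "x C1_differentiable_on ({s..1} - Z)"
  unfolding piecewise_C1_differentiable_on_def x_def[abs_def] by blast
 obtain D where D: "\<And>t. t\<in>{s..1} - Z ==> (x has_vector_derivative D t) (at t)" "continuous_on ({s..1} - Z) D"
  using Z(2) unfolding C1_differentiable_on_def by blast
 have d\<phi>: "(\<phi> has_derivative C.dframe \<xi> y) (at y)" if "y\<in>B" for y by (rule C.tractor_frame_isometry(1)[OF Fr that])
 define z' where "z' t = C.dframe \<xi> (x t) (D t)" for t
 \<comment> \<open>The coordinate passes from norm \<open>r\<close> at time \<open>s\<close> to 0 at
   time 1. The factor 1/2 absorbs the comparison of the two metrics.\<close>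
 have "ennreal (norm ((1/2) *\<^sub>R z 1 - (1/2) *\<^sub>R z s))\<le>(\<integral>\<^sup>+t\<in>{s<..<1}. ennreal (tangent_norm M (velocity M \<gamma> t)) \<partial>lborel)"
 proof (rule norm_diff_le_nn_integral[where f' = "\<lambda>t. (1/2) *\<^sub>R z' t" and Z = Z])
  have "continuous_on {s..1} z"
   unfolding z_def
   by (rule continuous_on_compose2[OF has_derivative_continuous_on[OF has_derivative_at_withinI[OF d\<phi>]] cx]) (use Jz(4) in auto)
  then show "continuous_on {s..1} (\<lambda>t. (1/2) *\<^sub>R z t)" by (intro continuous_intros)
  show "((\<lambda>t. (1/2) *\<^sub>R z t) has_vector_derivative (1/2) *\<^sub>R z' t) (at t)" if "t\<in>{s<..<1} - Z" for t
  proof -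
   have "(z has_vector_derivative z' t) (at t)"
    unfolding z_def[abs_def] z'_def by (rule C.tractor_frame_curve(1)[OF Fr Jz(4) D(1)]) (use that in auto)
   then show ?thesis using bounded_linear.has_vector_derivative[OF bounded_linear_scaleR_right] by blast
  qed
  have "continuous_on ({s<..<1} - Z) z'"
  proof -
   have "z' t = (\<Sum>i\<in>UNIV. (D t$i) *\<^sub>R C.dframe \<xi> (x t) (axis i 1))" if "t\<in>{s<..<1} - Z" for t
   proof -
    have l: "linear (C.dframe \<xi> (x t))" using d\<phi>[OF Jz(4)[of t]] that by (auto intro: has_derivative_linear)
    show ?thesis unfolding z'_def by (subst vec_expand[of "D t"]) (simp only: linear_sum[OF l] linear_scale[OF l])
   qed
   moreover have "continuous_on ({s<..<1} - Z) (\<lambda>t. \<Sum>i\<in>UNIV. (D t$i) *\<^sub>R C.dframe \<xi> (x t) (axis i 1))"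
   proof (intro continuous_intros)
    show "continuous_on ({s<..<1} - Z) D" by (rule continuous_on_subset[OF D(2)]) auto
    have "continuous_on ({s<..<1} - Z) x" by (rule continuous_on_subset[OF cx]) auto
    then show "continuous_on ({s<..<1} - Z) (\<lambda>t. C.dframe \<xi> (x t) (axis i 1))" for i
     by (rule continuous_on_compose2[OF C.continuous_dframe[OF Fr]]) (use Jz(4) in auto)
   qed
   ultimately show ?thesis by (subst continuous_on_cong[OF refl])
  qed
  then show "continuous_on ({s<..<1} - Z) (\<lambda>t. (1/2) *\<^sub>R z' t)" by (intro continuous_intros)
  fix t assume t: "t\<in>{s<..<1} - Z"
  then have t': "t\<in>{s..1}" "t\<in>{s..1} - Z" by auto
  have "tangent_norm M (velocity M \<gamma> t) = sqrt (inner_at M c (chart_map c (\<gamma> t)) (D t) (D t))"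
  proof (rule tangent_norm_eq[of c \<gamma> t, OF c Jz(3)[OF t'(1)]])
   show "((\<lambda>s. chart_map c (\<gamma> s)) has_vector_derivative D t) (at t)"
    using D(1)[OF t'(2)] unfolding x_def[abs_def] .
   fix c' assume c': "c'\<in>man_atlas M" "\<gamma> t\<in>chart_dom c'"
   have "openin X (chart_dom c\<inter>chart_dom c')" by (intro openin_Int chart_dom_open c c')
   then obtain V where V: "open V" "{t\<in>{0..1}. \<gamma> t\<in>chart_dom c\<inter>chart_dom c'} = {0..1}\<inter>V" using op by blast
   have "t\<in>{t\<in>{0..1}. \<gamma> t\<in>chart_dom c\<inter>chart_dom c'}" using t s01 Jz(3)[OF t'(1)] c' by auto
   then have "t\<in>V\<inter>{0<..<1}" using V(2) t s01 by auto
   moreover have "open (V\<inter>{0<..<1})" using V(1) by auto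
   ultimately obtain e where e: "e > 0" "ball t e\<subseteq>V\<inter>{0<..<1}" using open_contains_ball by blast
   show "\<exists>e>0. \<forall>s. \<bar>s - t\<bar> < e --> \<gamma> s\<in>chart_dom c\<inter>chart_dom c'"
   proof (intro exI[of _ e] conjI allI impI e(1))
    fix q assume "\<bar>q - t\<bar> < e"
    then have "q\<in>ball t e" by (simp add: dist_real_def abs_minus_commute)
    then have "q\<in>{0..1}\<inter>V" using e(2) by auto
    then show "\<gamma> q\<in>chart_dom c\<inter>chart_dom c'" using V(2) by blast
   qed
  qed
  also have "inner_at M c (chart_map c (\<gamma> t)) (D t) (D t) = gH (z t) (z' t) (z' t)"
   using C.tractor_frame_isometry(3)[OF Fr Jz(4)[OF t'(1)], of "D t" "D t"] unfolding z_def z'_def x_def C.g_def by simp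
  finally have tn: "tangent_norm M (velocity M \<gamma> t) = sqrt (gH (z t) (z' t) (z' t))" .
  have "z t \<bullet> z t\<le>1"
  proof -
   have "norm (z t)\<le>1" using Jz(2)[OF t'(1)] r(3) by simp
   then have "(norm (z t))\<^sup>2\<le>1" by (simp add: power_le_one)
   then show ?thesis by (simp add: dot_square_norm)
  qed
  then have "(1 + z t \<bullet> z t) * gH (z t) (z' t) (z' t)\<le>2*gH (z t) (z' t) (z' t)"
   by (intro mult_right_mono gH_nonneg) simp
  then have "z' t \<bullet> z' t\<le>2*gH (z t) (z' t) (z' t)" using gH_ge[of "z' t" "z t"] by linarith
  also have "\<dots>\<le>4*gH (z t) (z' t) (z' t)" using gH_nonneg[of "z t" "z' t"] by simp
  finally have "sqrt (z' t \<bullet> z' t)\<le>sqrt (4*gH (z t) (z' t) (z' t))" by (simp only: real_sqrt_le_iff)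
  then show "norm ((1/2) *\<^sub>R z' t)\<le>tangent_norm M (velocity M \<gamma> t)"
   unfolding tn real_sqrt_mult norm_scaleR by (simp add: norm_eq_sqrt_inner)
 qed (use s1 Z in auto)
 also have "\<dots>\<le>curve_length M \<gamma>"
  unfolding curve_length_def
 proof (rule nn_integral_mono)
  fix t show "ennreal (tangent_norm M (velocity M \<gamma> t))*indicator {s<..<1} t
  \<le>ennreal (tangent_norm M (velocity M \<gamma> t))*indicator {0..1} t"
   using s01 by (intro mult_left_mono) (auto simp: indicator_def)
 qed
 finally show ?thesis unfolding z1 zs' using zsr by simp
qed

lemma riem_dist_lower:
 assumes F: "liso UNIV F" and c: "c\<in>man_atlas M" and ad: "adapted c (F q) \<rho> J B \<phi> \<xi> \<eta>"
  and r: "0 < r" "r < \<rho>" "r\<le>1" and out: "F h \<notin> J ` ball 0 r"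
 shows "r/2\<le>riem_dist M (F h) (F q)"
proof -
 define I where "I = (INF \<gamma>\<in>{\<gamma>. pw_C1_curve M \<gamma> \<and> \<gamma> 0 = F h \<and> \<gamma> 1 = F q}. curve_length M \<gamma>)"
 have "ennreal (r/2)\<le>I"
  unfolding I_def
 proof (rule INF_greatest)
  fix \<gamma> assume "\<gamma>\<in>{\<gamma>. pw_C1_curve M \<gamma> \<and> \<gamma> 0 = F h \<and> \<gamma> 1 = F q}"
  then show "ennreal (r/2)\<le>curve_length M \<gamma>"
   using out by (intro curve_length_lower[OF c ad r]) auto
 qed
 moreover have "I < top" using riem_dist_upper(1)[OF F, of h q] unfolding I_def by (simp add: le_less_trans)
 ultimately have "enn2real (ennreal (r/2))\<le>enn2real I" by (intro enn2real_mono)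
 then show ?thesis using r unfolding I_def riem_dist_def by simp
qed

end

section \<open>Directions of rays passing close to a separated net\<close>

lemma hz_ray: "norm \<theta> = 1 ==> hz (sinh t *\<^sub>R \<theta>) = cosh t"
 unfolding hz_norm using cosh_square_eq[of t] by (simp add: add.commute[of 1] flip: cosh_square_eq)

lemma perp_norm:
 fixes \<theta> q :: "'b::real_inner"
 assumes "norm \<theta> = 1"
 shows "(norm (q - (q \<bullet> \<theta>) *\<^sub>R \<theta>))\<^sup>2 = q \<bullet> q - (q \<bullet> \<theta>)\<^sup>2"
proof -
 have "\<theta> \<bullet> \<theta> = 1" using assms by (simp add: norm_eq_1)
 then show ?thesis
  unfolding power2_norm_eq_inner by (simp add: inner_diff inner_commute power2_eq_square)
qed

text \<open>The ray \<open>sinh t \<theta>\<close> is closest to \<open>q\<close> when the last square vanishes.\<close>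

lemma hB_ray:
 fixes \<theta> q :: "'b::real_inner"
 assumes "norm \<theta> = 1"
 shows "(hB (sinh t *\<^sub>R \<theta>) q)\<^sup>2 = 1 + (norm (q - (q \<bullet> \<theta>) *\<^sub>R \<theta>))\<^sup>2 + (sinh t*hz q - cosh t*(q \<bullet> \<theta>))\<^sup>2"
proof -
 define a where "a = q \<bullet> \<theta>"
 have "hB (sinh t *\<^sub>R \<theta>) q = cosh t*hz q - sinh t*a"
  unfolding hB_def hz_ray[OF assms] a_def by (simp add: inner_commute)
 moreover have "(cosh t*X - sinh t*a)\<^sup>2 = X\<^sup>2 - a\<^sup>2 + (sinh t*X - cosh t*a)\<^sup>2" for X
  using cosh_square_eq[of t] by algebra
 ultimately show ?thesis using perp_norm[OF assms, of q] unfolding a_def[symmetric] by (simp add: hz_power2)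
qed

lemma hB_scale: "1\<le>\<mu> ==> hB x (\<mu> *\<^sub>R y)\<le>\<mu> * hB x y"
proof -
 assume l: "1\<le>\<mu>"
 have "hz (\<mu> *\<^sub>R y)\<le>\<mu> * hz y"
 proof -
  have "hz (\<mu> *\<^sub>R y)\<le>sqrt (\<mu>\<^sup>2*(1 + y \<bullet> y))"
   unfolding hz_def using mult_mono[OF l l] l by (intro real_sqrt_le_mono) (simp add: algebra_simps power2_eq_square)
  also have "\<dots> = \<mu> * hz y" using l by (simp add: hz_def real_sqrt_mult)
  finally show ?thesis .
 qed
 then have "hz x*hz (\<mu> *\<^sub>R y)\<le>hz x*(\<mu> * hz y)" by (intro mult_left_mono) (auto intro: less_imp_le)
 then show ?thesis unfolding hB_def by (simp add: algebra_simps)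
qed

text \<open>Directions with positive component \<open>i\<close>, in the central projection to the
  plane where that component is 1. Component \<open>i\<close> of \<open>z\<close> is a dummy, so
  that measures can be taken in \<open>real^'n\<close>.\<close>

definition gno :: "'n => real^'n => real^'n::finite" where
 "gno i z = (\<chi> j. if j = i then 1 else z$j)"

lemma gno_nth: "gno i z$j = (if j = i then 1 else z$j)"
 unfolding gno_def by simp

lemma norm_gno_ge: "1\<le>norm (gno i z)"
 using component_le_norm_cart[of "gno i z" i] by (simp add: gno_nth)

lemma gno_nonzero: "gno i z\<noteq>0"
 using norm_gno_ge[of i z] by auto

lemma norm_gno_le:
 fixes z :: "real^'n::finite"
 assumes "\<And>j. \<bar>z$j\<bar>\<le>2"
 shows "norm (gno i z)\<le>2*CARD('n)"
proof -
 have "norm (gno i z)\<le>(\<Sum>j\<in>UNIV. \<bar>gno i z$j\<bar>)" by (rule norm_le_l1_cart)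
 also have "\<dots>\<le>(\<Sum>j\<in>(UNIV::'n set). 2)" using assms by (intro sum_mono) (simp add: gno_nth)
 finally show ?thesis by simp
qed

lemma norm_sgn_gno [simp]: "norm (sgn (gno i z)) = 1"
 using gno_nonzero by (simp add: norm_sgn)

text \<open>For a point on the ray the difference on the left vanishes, so it depends only on the
  part of \<open>q\<close> orthogonal to the ray; 3 is 1 plus the bound 2 for a component of
  \<open>gno i z\<close>.\<close>

lemma gno_perp_lower:
 fixes z q :: "real^'n::finite"
 assumes "\<And>j. \<bar>z$j\<bar>\<le>2"
 shows "\<bar>q$j - gno i z$j*q$i\<bar>\<le>3*norm (q - (q \<bullet> sgn (gno i z)) *\<^sub>R sgn (gno i z))"
proof -
 define \<theta> p where "\<theta> = sgn (gno i z)" and "p = q - (q \<bullet> \<theta>) *\<^sub>R \<theta>"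
 have \<theta>: "\<theta>$j = gno i z$j * \<theta>$i"
  unfolding \<theta>_def sgn_div_norm by (simp add: gno_nth)
 have "q$j - gno i z$j*q$i = p$j - gno i z$j*p$i"
  unfolding p_def using \<theta> by (simp add: algebra_simps)
 also have "\<bar>\<dots>\<bar>\<le>\<bar>p$j\<bar> + \<bar>gno i z$j\<bar> * \<bar>p$i\<bar>" using abs_triangle_ineq4 by (simp add: abs_mult[symmetric])
 also have "\<dots>\<le>norm p + 2*norm p"
  using assms[of j] by (intro add_mono mult_mono component_le_norm_cart) (auto simp: gno_nth)
 finally show ?thesis unfolding p_def \<theta>_def by simp
qed

text \<open>The orthogonal projection is the nearest point of the line through
  \<open>f\<close>.\<close>

lemma gno_perp_upper:
 "norm (q - (q \<bullet> sgn f) *\<^sub>R sgn f)\<le>norm (q - \<mu> *\<^sub>R f)" if "f\<noteq>0" for f q :: "'b::real_inner"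
proof -
 define \<theta> where "\<theta> = sgn f"
 have n: "norm \<theta> = 1" unfolding \<theta>_def using that by (simp add: norm_sgn)
 have f: "f = norm f *\<^sub>R \<theta>" unfolding \<theta>_def by (simp add: sgn_div_norm that)
 have "(norm (q - \<mu> *\<^sub>R f))\<^sup>2 = (norm (q - (\<mu> * norm f) *\<^sub>R \<theta>))\<^sup>2" by (subst f) simp
 also have "\<dots> = q \<bullet> q - 2*(\<mu> * norm f) * (q \<bullet> \<theta>) + (\<mu> * norm f)\<^sup>2"
  using n unfolding power2_norm_eq_inner by (simp add: inner_diff inner_commute norm_eq_1 power2_eq_square)
 also have "\<dots> = q \<bullet> q - (q \<bullet> \<theta>)\<^sup>2 + (\<mu> * norm f - q \<bullet> \<theta>)\<^sup>2" by (simp add: power2_diff)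
 finally have "(norm (q - (q \<bullet> \<theta>) *\<^sub>R \<theta>))\<^sup>2\<le>(norm (q - \<mu> *\<^sub>R f))\<^sup>2"
  unfolding perp_norm[OF n] by simp
 then show ?thesis unfolding \<theta>_def by (rule power2_le_imp_le) simp
qed

text \<open>The time is chosen so that the last square in \<open>hB_ray\<close> vanishes, that is
  with tanh t = (q \<bullet> \<theta>)/hz q.\<close>

lemma ray_passes:
 fixes \<theta> q :: "'b::real_inner"
 assumes \<theta>: "norm \<theta> = 1" and p: "norm (q - (q \<bullet> \<theta>) *\<^sub>R \<theta>)\<le>\<delta>" "\<delta>\<le>1" and T: "sinh T\<le>(q \<bullet> \<theta>)/2"
  and a: "0 < q \<bullet> \<theta>"
 obtains t where "T\<le>t" "sinh t\<le>norm q" "hB (sinh t *\<^sub>R \<theta>) q\<le>sqrt (1 + \<delta>\<^sup>2)"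
proof -
 define a b where "a = q \<bullet> \<theta>" and "b = norm (q - (q \<bullet> \<theta>) *\<^sub>R \<theta>)"
 define t where "t = arsinh (a/sqrt (1 + b\<^sup>2))"
 have st: "sinh t = a/sqrt (1 + b\<^sup>2)" unfolding t_def by simp
 have X: "(hz q)\<^sup>2 = 1 + b\<^sup>2 + a\<^sup>2" unfolding b_def perp_norm[OF \<theta>] a_def by (simp add: hz_power2)
 have pos: "0 < 1 + b\<^sup>2" by (simp add: add_pos_nonneg)
 have b1: "b\<^sup>2\<le>1"
 proof -
  have "b\<^sup>2\<le>1\<^sup>2" by (rule power_mono) (use p in \<open>auto simp: b_def\<close>)
  then show ?thesis by simp
 qed
 have "(cosh t)\<^sup>2 = (hz q/sqrt (1 + b\<^sup>2))\<^sup>2"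
  unfolding cosh_square_eq st power_divide X real_sqrt_pow2[OF less_imp_le[OF pos]] using pos by (simp add: field_simps)
 then have ct: "cosh t = hz q/sqrt (1 + b\<^sup>2)"
  by (rule power2_eq_imp_eq) (simp_all add: less_imp_le)
 have "(hB (sinh t *\<^sub>R \<theta>) q)\<^sup>2 = 1 + b\<^sup>2"
  using hB_ray[OF \<theta>, of t q] unfolding b_def[symmetric] unfolding a_def[symmetric] by (simp add: st ct)
 then have "(hB (sinh t *\<^sub>R \<theta>) q)\<^sup>2\<le>1 + \<delta>\<^sup>2"
  using p power_mono[of b \<delta> 2] unfolding b_def by simp
 then have 1: "hB (sinh t *\<^sub>R \<theta>) q\<le>sqrt (1 + \<delta>\<^sup>2)" by (rule real_le_rsqrt)
 have s2: "1\<le>sqrt (1 + b\<^sup>2)" "sqrt (1 + b\<^sup>2)\<le>2"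
  using b1 by (auto intro: real_le_lsqrt)
 have "a/2\<le>sinh t" unfolding st using s2 a pos by (intro divide_left_mono) (auto simp: a_def)
 then have "sinh T\<le>sinh t" using T unfolding a_def by linarith
 then have 2: "T\<le>t" unfolding sinh_real_le_iff .
 have "sinh t\<le>a" unfolding st using divide_left_mono[OF s2(1), of a] s2(1) a pos unfolding a_def[symmetric] by simp
 also have "a\<le>norm q" unfolding a_def using norm_cauchy_schwarz[of q \<theta>] \<theta> by simp
 finally show ?thesis using that 1 2 by blast
qed

text \<open>The two middle bounds are triangle inequalities: the time of the encounter and the
  distance of \<open>q\<close> from the origin differ by a bounded amount.\<close>

lemma hB_ray_bounds:
 fixes \<theta> q :: "'b::real_inner"
 assumes \<theta>: "norm \<theta> = 1" and le: "hB (sinh t *\<^sub>R \<theta>) q\<le>sqrt (1 + \<delta>\<^sup>2)" and \<delta>: "0\<le>\<delta>"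
 shows "norm (q - (q \<bullet> \<theta>) *\<^sub>R \<theta>)\<le>\<delta>"
  and "hz q\<le>2*(1 + \<delta>)*cosh t" and "cosh t\<le>2*(1 + \<delta>)*hz q"
  and "1\<le>sinh t ==> hz q/2 - \<delta>\<le>q \<bullet> \<theta>"
proof -
 define H where "H = hB (sinh t *\<^sub>R \<theta>) q"
 have H0: "0\<le>H" using hB_ge_1[of "sinh t *\<^sub>R \<theta>" q] unfolding H_def by simp
 have "H\<^sup>2\<le>1 + \<delta>\<^sup>2"
  using power_mono[OF le[folded H_def] H0, of 2] by (simp add: add_nonneg_nonneg)
 then have *: "(norm (q - (q \<bullet> \<theta>) *\<^sub>R \<theta>))\<^sup>2 + (sinh t*hz q - cosh t*(q \<bullet> \<theta>))\<^sup>2\<le>\<delta>\<^sup>2"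
  unfolding H_def hB_ray[OF \<theta>] by simp
 then have "(norm (q - (q \<bullet> \<theta>) *\<^sub>R \<theta>))\<^sup>2\<le>\<delta>\<^sup>2"
  using zero_le_power2[of "sinh t*hz q - cosh t*(q \<bullet> \<theta>)"] by linarith
 then show "norm (q - (q \<bullet> \<theta>) *\<^sub>R \<theta>)\<le>\<delta>" using \<delta> by (rule power2_le_imp_le)
 have "sqrt (1 + \<delta>\<^sup>2)\<le>1 + \<delta>"
  using \<delta> by (intro real_le_lsqrt) (auto simp: power2_sum)
 then have H1: "H\<le>1 + \<delta>" using le unfolding H_def by simp
 have "hz q\<le>2*hz (sinh t *\<^sub>R \<theta>)*H" using hB_mult_bound[of 0 q "sinh t *\<^sub>R \<theta>"] unfolding H_def by simp
 also have "\<dots>\<le>2*cosh t*(1 + \<delta>)" unfolding hz_ray[OF \<theta>] using H1 by (intro mult_left_mono) auto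
 finally show "hz q\<le>2*(1 + \<delta>)*cosh t" by (simp add: mult_ac)
 have "cosh t\<le>2*hz q*H" using hB_mult_bound[of 0 "sinh t *\<^sub>R \<theta>" q] unfolding H_def hz_ray[OF \<theta>, symmetric] by (simp add: hB_sym)
 also have "\<dots>\<le>2*hz q*(1 + \<delta>)" using H1 by (intro mult_left_mono) (auto intro: less_imp_le)
 finally show "cosh t\<le>2*(1 + \<delta>)*hz q" by (simp add: mult_ac)
 assume s1: "1\<le>sinh t"
 have "(sinh t*hz q - cosh t*(q \<bullet> \<theta>))\<^sup>2\<le>\<delta>\<^sup>2"
  using * zero_le_power2[of "norm (q - (q \<bullet> \<theta>) *\<^sub>R \<theta>)"] by linarith
 then have "sinh t*hz q - cosh t*(q \<bullet> \<theta>)\<le>\<delta>" using \<delta> by (rule power2_le_imp_le)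
 moreover have "cosh t\<le>2 * sinh t"
 proof (rule power2_le_imp_le)
  have "1\<^sup>2\<le>(sinh t)\<^sup>2" by (rule power_mono) (use s1 in auto)
  then show "(cosh t)\<^sup>2\<le>(2 * sinh t)\<^sup>2" unfolding cosh_square_eq by (simp add: power_mult_distrib)
 next
  show "0\<le>2 * sinh t" using s1 by linarith
 qed
 then have "cosh t*(hz q/2)\<le>sinh t*hz q" by (simp add: mult_right_mono less_imp_le)
 moreover have "\<delta>\<le>cosh t * \<delta>" using \<delta> cosh_real_ge_1[of t] by (simp add: mult_le_cancel_right1)
 ultimately have "cosh t*(hz q/2)\<le>cosh t*(q \<bullet> \<theta>) + cosh t * \<delta>" by linarith
 then have "cosh t*(hz q/2)\<le>cosh t*(q \<bullet> \<theta> + \<delta>)" by (simp only: distrib_left)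
 then have "hz q/2\<le>q \<bullet> \<theta> + \<delta>" by (simp add: mult_le_cancel_left_pos cosh_real_pos)
 then show "hz q/2 - \<delta>\<le>q \<bullet> \<theta>" by simp
qed

text \<open>A ray that meets \<open>q\<close> at distance of order \<open>\<delta>\<close> has
  almost the gnomonic coordinates of \<open>q\<close>. The error is \<open>\<delta>\<close> divided
  by \<open>q$i\<close>, and the first bound makes \<open>q$i\<close> comparable to
  \<open>hz q\<close>.\<close>

lemma ray_components:
 fixes z q :: "real^'n::finite" and i :: 'n
 defines "\<theta> \<equiv> sgn (gno i z)"
 assumes z: "\<And>j. \<bar>z$j\<bar>\<le>2" and le: "hB (sinh t *\<^sub>R \<theta>) q\<le>sqrt (1 + \<delta>\<^sup>2)" and \<delta>: "0\<le>\<delta>" and t: "1\<le>sinh t"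
 shows "hz q/(4*real CARD('n))\<le>q$i + 2 * \<delta>"
  and "j\<noteq>i ==> 0 < q$i ==> \<bar>z$j - q$j/q$i\<bar>\<le>3 * \<delta>/q$i"
proof -
 have n: "norm \<theta> = 1" unfolding \<theta>_def by simp
 note b = hB_ray_bounds(1)[OF n le \<delta>] and a = hB_ray_bounds(4)[OF n le \<delta> t]
 define f where "f = gno i z"
 have fn: "1\<le>norm f" "norm f\<le>2*real CARD('n)" unfolding f_def using norm_gno_ge norm_gno_le[OF z] by auto
 have \<theta>i: "\<theta>$i = 1/norm f" unfolding \<theta>_def f_def by (simp add: sgn_div_norm gno_nth divide_inverse)
 have "\<bar>(q - (q \<bullet> \<theta>) *\<^sub>R \<theta>)$i\<bar>\<le>\<delta>" using component_le_norm_cart[of "q - (q \<bullet> \<theta>) *\<^sub>R \<theta>" i] b by linarith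
 then have "(q \<bullet> \<theta>)/norm f - \<delta>\<le>q$i" using \<theta>i by simp
 moreover have "hz q/2/(2*real CARD('n))\<le>(q \<bullet> \<theta>)/norm f + \<delta>"
 proof -
  have "hz q/2/(2*real CARD('n))\<le>hz q/2/norm f"
   by (intro divide_left_mono mult_pos_pos) (use fn in \<open>auto intro: less_imp_le\<close>)
  also have "\<dots>\<le>(q \<bullet> \<theta> + \<delta>)/norm f" using a fn by (intro divide_right_mono) auto
  also have "\<dots>\<le>(q \<bullet> \<theta>)/norm f + \<delta>" using fn \<delta> by (simp add: add_divide_distrib divide_le_eq mult_le_cancel_left1)
  finally show ?thesis .
 qed
 ultimately show "hz q/(4*real CARD('n))\<le>q$i + 2 * \<delta>" by simp
 assume j: "j\<noteq>i" and qp: "0 < q$i"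
 have "\<bar>q$j - z$j*q$i\<bar>\<le>3 * \<delta>"
  using gno_perp_lower[OF z, of q j i] j b unfolding \<theta>_def by (simp add: gno_nth)
 moreover have "z$j - q$j/q$i = - (q$j - z$j*q$i)/q$i" using qp by (simp add: field_simps)
 ultimately show "\<bar>z$j - q$j/q$i\<bar>\<le>3 * \<delta>/q$i" using qp by (simp add: abs_divide divide_right_mono)
qed

lemma prod_single:
 fixes i :: "'n::finite" and A B :: "'b::comm_monoid_mult"
 shows "(\<Prod>j\<in>UNIV. if j = i then A else B) = A*B^(CARD('n) - 1)"
proof -
 have "(\<Prod>j\<in>UNIV. if j = i then A else B) = A*(\<Prod>j\<in>UNIV - {i}. if j = i then A else B)"
  by (subst prod.remove[of _ i]) auto
 also have "(\<Prod>j\<in>UNIV - {i}. if j = i then A else B) = (\<Prod>j\<in>UNIV - {i}. B)" by (rule prod.cong) auto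
 finally show ?thesis by (simp add: card_Diff_singleton)
qed

text \<open>Rescaling \<open>q'\<close> to the same component \<open>i\<close> as \<open>q\<close>
  makes the gnomonic difference a Euclidean one, treated by \<open>hB_le\<close>; undoing the
  rescaling costs a factor by \<open>hB_scale\<close>.\<close>

lemma hB_same_cell:
 fixes q q' :: "real^'n::finite" and d e r :: real
 assumes r: "0 < r" "r\<le>q$i" "q$i\<le>q'$i" "q'$i - q$i\<le>r*e"
  and d: "\<And>j. \<bar>q'$j/q'$i - q$j/q$i\<bar> * q$i\<le>d"
 shows "hB q q'\<le>(1 + e) * (1 + (CARD('n) * d)\<^sup>2/2)"
proof -
 define \<mu> y where "\<mu> = q'$i/q$i" and "y = (1/\<mu>) *\<^sub>R q'"
 have p: "0 < q$i" "0 < q'$i" using r by auto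
 have e: "0\<le>e" using r by (smt (verit) mult_pos_neg)
 have \<mu>: "1\<le>\<mu>" "0 < \<mu>" using p r(3) unfolding \<mu>_def by auto
 have "r*e\<le>q$i*e" using r(2) e by (rule mult_right_mono)
 then have "q'$i\<le>(1 + e) * q$i" using r(4) by (simp add: algebra_simps)
 then have \<mu>e: "\<mu>\<le>1 + e" unfolding \<mu>_def using p by (simp add: divide_le_eq)
 have "norm (q - y)\<le>(\<Sum>j\<in>UNIV. \<bar>(q - y)$j\<bar>)" by (rule norm_le_l1_cart)
 also have "\<dots>\<le>(\<Sum>j\<in>(UNIV::'n set). d)"
 proof (rule sum_mono)
  fix j
  have "q$j - y$j = - (q'$j/q'$i - q$j/q$i) * q$i"
   unfolding y_def \<mu>_def using p by (simp add: field_simps)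
  then have "\<bar>(q - y)$j\<bar> = \<bar>q'$j/q'$i - q$j/q$i\<bar> * q$i" using p by (simp add: abs_mult)
  then show "\<bar>(q - y)$j\<bar>\<le>d" using d[of j] by simp
 qed
 finally have "norm (q - y)\<le>CARD('n) * d" by simp
 then have n: "(norm (q - y))\<^sup>2\<le>(CARD('n) * d)\<^sup>2" by (rule power_mono) simp
 have "hB q q' = hB q (\<mu> *\<^sub>R y)" unfolding y_def using \<mu> by simp
 also have "\<dots>\<le>\<mu> * hB q y" by (rule hB_scale[OF \<mu>(1)])
 also have "\<dots>\<le>(1 + e) * (1 + (CARD('n) * d)\<^sup>2/2)"
  using hB_le[of q y] n \<mu>e \<mu>(2) hB_ge_1[of q y] by (intro mult_mono) auto
 finally show ?thesis .
qed

text \<open>A dyadic shell inside a cone around the axis \<open>i\<close>: the points at distance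
  \<open>k\<close> log 2 + O(1) whose directions have gnomonic coordinates at most 2.\<close>

definition sector :: "'n::finite => nat => (real^'n) set" where
 "sector i k = {q. 2^k\<le>q$i \<and> q$i < 2^(k + 1) \<and> (\<forall>j. \<bar>q$j/q$i\<bar>\<le>2)}"

lemma floor_eq_diff: "\<lfloor>x::real\<rfloor> = \<lfloor>y\<rfloor> ==> \<bar>x - y\<bar>\<le>1"
 by linarith

text \<open>Pigeonhole. The shell is cut into boundedly many layers, and the gnomonic coordinates
  into intervals of length 1/(M 2^k), so that two points in one box would be closer than the
  separation permits.\<close>

lemma count_sector:
 fixes Q :: "(real^'n::finite) set"
 assumes sep: "\<And>q q'. q\<in>Q ==> q'\<in>Q ==> q\<noteq>q' ==> C0\<le>hB q q'" and C0: "1 < C0"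
 shows "\<exists>C::real. \<forall>k. finite (Q\<inter>sector i k) \<and> card (Q\<inter>sector i k)\<le>C*(2^k)^(CARD('n) - 1)"
proof -
 let ?n = "real CARD('n)"
 \<comment> \<open>As the grid is refined, the bound of \<open>hB_same_cell\<close> tends to 1,
   hence falls below \<open>C0\<close>.\<close>
 have "(\<lambda>M. (1 + 1/real M) * (1 + (?n*(2/real M))\<^sup>2/2)) \<longlonglongrightarrow> (1 + 0)*(1 + (?n*0)\<^sup>2/2)"
  by (intro tendsto_intros lim_const_over_n) simp_all
 then have "eventually (\<lambda>M. (1 + 1/real M) * (1 + (?n*(2/real M))\<^sup>2/2) < C0) sequentially"
  using C0 by (intro order_tendstoD) auto
 moreover have "eventually (\<lambda>M::nat. M > 0) sequentially" by (rule eventually_gt_at_top)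
 ultimately obtain M :: nat where M: "(1 + 1/real M) * (1 + (?n*(2/real M))\<^sup>2/2) < C0" "M > 0"
  using eventually_happens'[OF sequentially_bot] eventually_conj by blast
 have "finite (Q\<inter>sector i k) \<and> card (Q\<inter>sector i k)\<le>(real M + 1)*(5*M)^(CARD('n) - 1)*(2^k)^(CARD('n) - 1)" for k
 proof -
  define idx where "idx q = (\<lambda>j. if j = i then \<lfloor>M*q$i/2^k\<rfloor> else \<lfloor>real M*2^k*(q$j/q$i)\<rfloor>)" for q :: "real^'n"
  have half: "hB q q' < C0" if q: "q\<in>sector i k" "q'\<in>sector i k" "idx q = idx q'" "q$i\<le>q'$i" for q q'
  proof -
   have "hB q q'\<le>(1 + 1/M) * (1 + (?n*(2/M))\<^sup>2/2)"
   proof (rule hB_same_cell)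
    show "(0::real) < 2^k" by simp
    show "2^k\<le>q$i" "q$i\<le>q'$i" using q unfolding sector_def by auto
    have "\<lfloor>M*q'$i/2^k\<rfloor> = \<lfloor>M*q$i/2^k\<rfloor>" using fun_cong[OF q(3), of i] unfolding idx_def by simp
    then have "\<bar>M*q'$i/2^k - M*q$i/2^k\<bar>\<le>1" by (rule floor_eq_diff)
    then have "M*(q'$i - q$i)/2^k\<le>1" by (simp add: algebra_simps diff_divide_distrib)
    then show "q'$i - q$i\<le>2^k*(1/M)" using M(2) by (simp add: field_simps)
    have p: "0 < q$i" "q$i\<le>2*2^k" using q(1) unfolding sector_def by (auto intro: less_le_trans[of 0 "2^k"])
    have p': "0 < q'$i" using p q(4) by simp
    fix j
    show "\<bar>q'$j/q'$i - q$j/q$i\<bar> * q$i\<le>2/M"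
    proof (cases "j = i")
     case True then show ?thesis using p p' by simp
    next
     case False
     then have "\<lfloor>real M*2^k*(q'$j/q'$i)\<rfloor> = \<lfloor>real M*2^k*(q$j/q$i)\<rfloor>"
      using fun_cong[OF q(3), of j] unfolding idx_def by simp
     then have "\<bar>real M*2^k*(q'$j/q'$i) - real M*2^k*(q$j/q$i)\<bar>\<le>1" by (rule floor_eq_diff)
     then have "real M*2^k * \<bar>q'$j/q'$i - q$j/q$i\<bar>\<le>1"
      unfolding right_diff_distrib[symmetric] abs_mult by simp
     then have "\<bar>q'$j/q'$i - q$j/q$i\<bar>\<le>1/(real M*2^k)" using M(2) by (simp add: field_simps)
     then have "\<bar>q'$j/q'$i - q$j/q$i\<bar> * q$i\<le>1/(real M*2^k) * (2*2^k)"
      using p by (intro mult_mono) auto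
     then show ?thesis by simp
    qed
   qed
   then show ?thesis using M(1) by simp
  qed
  have inj: "inj_on idx (Q\<inter>sector i k)"
  by (smt (verit, ccfv_SIG) Int_iff half inj_on_def sep)
  define B where "B j = (if j = i then {int M..2*int M} else {- 2*int M*2^k..2*int M*2^k})" for j
  have sub: "idx ` (Q\<inter>sector i k)\<subseteq>(\<Pi>\<^sub>E j\<in>UNIV. B j)"
  proof (clarsimp simp: PiE_iff)
   fix q j assume q: "q\<in>sector i k"
   have "1\<le>q$i/2^k" "q$i/2^k\<le>2" using q unfolding sector_def by (auto simp: field_simps)
   then have "real M*1\<le>M*(q$i/2^k)" "M*(q$i/2^k)\<le>real M*2"
    by (simp_all only: mult_left_mono of_nat_0_le_iff)
   then have 1: "int M\<le>\<lfloor>M*q$i/2^k\<rfloor>" "\<lfloor>M*q$i/2^k\<rfloor>\<le>2*int M" by (auto simp: le_floor_iff floor_le_iff)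
   have "\<bar>q$j/q$i\<bar>\<le>2" using q unfolding sector_def by auto
   then have "real M*2^k * \<bar>q$j/q$i\<bar>\<le>real M*2^k*2" by (rule mult_left_mono) simp
   then have "\<bar>real M*2^k*(q$j/q$i)\<bar>\<le>real M*2^k*2" by (simp add: abs_mult)
   moreover have "\<bar>x\<bar>\<le>b ==> - b\<le>x \<and> x\<le>b" for x b :: real by linarith
   ultimately have *: "- (real M*2^k*2)\<le>real M*2^k*(q$j/q$i)" "real M*2^k*(q$j/q$i)\<le>real M*2^k*2"
    by blast+
   have "- 2*int M*2^k\<le>\<lfloor>real M*2^k*(q$j/q$i)\<rfloor>"
    unfolding le_floor_iff using *(1) by (simp add: mult_ac)
   moreover have "\<lfloor>real M*2^k*(q$j/q$i)\<rfloor>\<le>2*int M*2^k"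
    unfolding floor_le_iff using *(2) by (simp add: mult_ac)
   ultimately show "idx q j\<in>B j" using 1 unfolding idx_def B_def by auto
  qed
  have finB: "finite (\<Pi>\<^sub>E j\<in>UNIV. B j)" by (rule finite_PiE) (auto simp: B_def)
  have fin: "finite (Q\<inter>sector i k)" using finite_subset[OF sub finB] inj finite_imageD by blast
  have "card (Q\<inter>sector i k) = card (idx ` (Q\<inter>sector i k))" using inj by (simp add: card_image)
  also have "\<dots>\<le>card (\<Pi>\<^sub>E j\<in>UNIV. B j)" by (rule card_mono[OF finB sub])
  also have "\<dots> = (\<Prod>j\<in>UNIV. if j = i then M + 1 else nat (4*int M*2^k + 1))"
   by (subst card_PiE) (auto intro!: prod.cong simp: B_def nat_add_distrib)
  also have "\<dots> = (M + 1)*nat (4*int M*2^k + 1)^(CARD('n) - 1)" by (rule prod_single)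
  finally have "real (card (Q\<inter>sector i k))\<le>real ((M + 1)*nat (4*int M*2^k + 1)^(CARD('n) - 1))"
   by (simp only: of_nat_le_iff)
  also have "\<dots> = (real M + 1)*(4*real M*2^k + 1)^(CARD('n) - 1)"
  proof -
   have "real (nat (4*int M*2^k + 1)) = 4*real M*2^k + 1" "real (M + 1) = real M + 1" by simp_all
   then show ?thesis by (simp only: of_nat_mult of_nat_power)
  qed
  also have "\<dots>\<le>(real M + 1)*(5*real M*2^k)^(CARD('n) - 1)"
  proof (intro mult_left_mono power_mono)
   have "1*1\<le>real M*2^k" using M(2) by (intro mult_mono) auto
   then show "4*real M*2^k + 1\<le>5*real M*2^k" by simp
  qed auto
  finally show ?thesis using fin by (simp add: power_mult_distrib mult_ac)
 qed
 then show ?thesis by blast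
qed

text \<open>Closeness is stated through \<open>sqrt (1 + r\<^sup>2)\<close>, in accordance with
  \<open>orbit_local\<close>, for the radius \<open>r = t powr - s\<close>.\<close>

definition hits :: "(real^'n::finite) set => real => real^'n => real => bool" where
 "hits Q s \<theta> t \<longleftrightarrow> (\<exists>q\<in>Q. hB (sinh t *\<^sub>R \<theta>) q < sqrt (1 + (t powr - s)\<^sup>2))"

text \<open>A hit at a late time comes from a point in a late shell, and it confines the direction
  to a box whose size depends on the shell only. Thus uncountably many times are reduced to
  countably many shells.\<close>

lemma hits_sector:
 fixes Q :: "(real^'n::finite) set"
 assumes s: "0 < s" and K: "4\<le>K"
 shows "\<exists>T. \<forall>t\<ge>T. \<forall>z. (\<forall>j. \<bar>z$j\<bar>\<le>1) --> hits Q s (sgn (gno i z)) t -->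
  (\<exists>k\<ge>K. \<exists>q\<in>Q\<inter>sector i k. \<forall>j. j\<noteq>i --> \<bar>z$j - q$j/q$i\<bar>\<le>3*(real k/4) powr - s/2^k)"
proof -
 define n where "n = real CARD('n)"
 have n1: "1\<le>n" unfolding n_def by simp
 define T where "T = 2 + ln (2*(16*n*(2 + 2*2^K)))"
 show ?thesis
 proof (rule exI[of _ T], intro allI impI)
  fix t z assume t: "T\<le>t" and z: "\<forall>j. \<bar>z$j\<bar>\<le>1" and h: "hits Q s (sgn (gno i z)) t"
  define f \<theta> \<delta> where "f = gno i z" and "\<theta> = sgn f" and "\<delta> = t powr - s"
  obtain q where q: "q\<in>Q" "hB (sinh t *\<^sub>R \<theta>) q\<le>sqrt (1 + \<delta>\<^sup>2)"
   using h unfolding hits_def \<theta>_def f_def \<delta>_def by (auto intro: less_imp_le)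
  have big: "1\<le>2*(16*n*(2 + 2*2^K))" using n1 mult_mono[of 1 n 1 "2 + 2*2^K"] by simp
  have T2: "2\<le>T" unfolding T_def using ln_ge_zero[OF big] by simp
  then have t2: "2\<le>t" using t by simp
  have et: "2*(16*n*(2 + 2*2^K))\<le>exp t"
  by (smt (verit, best) T_def big ln_ge_iff t)
  have ct: "exp t/2\<le>cosh t" "cosh t\<le>exp t" using t2 unfolding cosh_def by (auto simp: field_simps)
  have st: "1\<le>sinh t"
  proof -
   have "3\<le>exp t" using exp_ge_add_one_self[of t] t2 by linarith
   moreover have "exp (- t)\<le>1" using t2 by simp
   ultimately have "2\<le>exp t - exp (- t)" by linarith
   then show ?thesis unfolding sinh_field_def by simp
  qed
  have "t powr - s\<le>t powr 0" using s t2 by (intro powr_mono) auto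
  then have \<delta>: "0\<le>\<delta>" "\<delta>\<le>1" unfolding \<delta>_def using t2 by auto
  have n\<theta>: "norm \<theta> = 1" unfolding \<theta>_def f_def by simp
  have cX: "hz q\<le>2*(1 + \<delta>)*cosh t" "cosh t\<le>2*(1 + \<delta>)*hz q"
   using hB_ray_bounds[OF n\<theta> q(2) \<delta>(1)] st by auto
  have "2*(1 + \<delta>)*hz q\<le>4*hz q" "2*(1 + \<delta>)*cosh t\<le>4*cosh t"
   using \<delta> by (auto intro!: mult_right_mono less_imp_le)
  note X = order_trans[OF cX(2) this(1)] order_trans[OF cX(1) this(2)]
  have z2: "\<bar>z$j\<bar>\<le>2" for j using z[rule_format, of j] by simp
  have "8*n*(2 + 2*2^K)/2\<le>hz q" using et ct X by simp
  then have "2 + 2*2^K\<le>hz q/(4*n)" using n1 by (simp add: field_simps)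
  then have qi: "2^K\<le>q$i" using ray_components(1)[OF z2 q(2)[unfolded \<theta>_def f_def] \<delta>(1) st] \<delta>(2) zero_le_power[of "2::real" K] unfolding n_def by linarith
  have K1: "(16::real)\<le>2^K" using power_increasing[OF K, of "2::real"] by simp
  then have qi1: "1\<le>q$i" using qi by simp
  define k where "k = (LEAST k. q$i < 2^(k + 1))"
  have "\<exists>k. q$i < 2^(k + 1)"
  proof -
   obtain k where "q$i < 2^k" using real_arch_pow[of 2 "q$i"] by auto
   also have "(2::real)^k\<le>2^(k + 1)" by simp
   finally show ?thesis by blast
  qed
  then have k1: "q$i < 2^(k + 1)" unfolding k_def by (rule LeastI_ex)
  have k0: "2^k\<le>q$i"
  proof (cases k)
   case 0 then show ?thesis using qi1 by simp
  next
   case (Suc l)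
   then have "\<not> q$i < 2^(l + 1)" using not_less_Least[of l "\<lambda>k. q$i < 2^(k + 1)"] unfolding k_def by simp
   then show ?thesis using Suc by simp
  qed
  have "(2::real)^K < 2^(k + 1)" using qi k1 by linarith
  then have kK: "K\<le>k" using power_less_imp_less_exp[of "2::real" K "k + 1"] by simp
  have k4: "4\<le>real k" using kK K by simp
  have "2^k\<le>norm q" using k0 component_le_norm_cart[of q i] by linarith
  then have "2^k\<le>4*exp t" using norm_less_hz[of q] X ct by linarith
  then have "ln (2^k)\<le>ln (4*exp t)" by (subst ln_le_cancel_iff) auto
  moreover have "ln (4::real) = 2*ln 2" using ln_realpow[of 2 2] by simp
  ultimately have "(real k - 2)*ln 2\<le>t" by (simp add: ln_realpow ln_mult algebra_simps)
  moreover have "(real k - 2)*(1/2)\<le>(real k - 2)*ln 2"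
   using ln2_ge_two_thirds k4 by (intro mult_left_mono) auto
  \<comment> \<open>From 2^k \<le> 4 exp t follows (k - 2) ln 2 \<le> t; since ln 2 \<ge> 1/2 and k
    \<ge> 4, this is at least k/4. Hence the radius at time \<open>t\<close> is at most
    \<open>(real k/4) powr - s\<close>.\<close>
  ultimately have tk: "real k/4\<le>t" using k4 by (simp add: field_simps)
  have \<delta>k: "\<delta>\<le>(real k/4) powr - s"
   unfolding \<delta>_def using s tk k4 by (intro powr_mono2') auto
  have qp: "0 < q$i" using qi1 by simp
  have zq: "\<bar>z$j - q$j/q$i\<bar>\<le>3 * \<delta>/2^k" if "j\<noteq>i" for j
  proof -
   have "\<bar>z$j - q$j/q$i\<bar>\<le>3 * \<delta>/q$i"
    by (rule ray_components(2)[OF z2 q(2)[unfolded \<theta>_def f_def] \<delta>(1) st that qp])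
   also have "\<dots>\<le>3 * \<delta>/2^k" using k0 \<delta> qp by (intro divide_left_mono) auto
   finally show ?thesis .
  qed
  have "q\<in>sector i k"
   unfolding sector_def
  proof (intro CollectI conjI allI k0 k1)
   fix j
   show "\<bar>q$j/q$i\<bar>\<le>2"
   proof (cases "j = i")
    case True then show ?thesis using qp by simp
   next
    case False
    have "(16::real)\<le>2^k" using power_increasing[OF order_trans[OF K kK], of "2::real"] by simp
    then have "3 * \<delta>/2^k\<le>3*1/16" using \<delta> by (intro frac_le mult_left_mono) auto
    then show ?thesis using zq[OF False] z[rule_format, of j] by linarith
   qed
  qed
  moreover have "\<bar>z$j - q$j/q$i\<bar>\<le>3*(real k/4) powr - s/2^k" if "j\<noteq>i" for j
  proof -
   have "3 * \<delta>/2^k\<le>3*(real k/4) powr - s/2^k" using \<delta>k by (intro divide_right_mono) auto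
   then show ?thesis using zq[OF that] by linarith
  qed
  ultimately show "\<exists>k\<ge>K. \<exists>q\<in>Q\<inter>sector i k. \<forall>j. j\<noteq>i --> \<bar>z$j - q$j/q$i\<bar>\<le>3*(real k/4) powr - s/2^k"
   using kK q(1) by blast
 qed
qed

lemma content_slab:
 fixes \<zeta> :: "real^'n::finite"
 assumes "0\<le>r" "u\<le>v"
 shows "measure lborel (cbox (\<chi> j. if j = i then u else \<zeta>$j - r) (\<chi> j. if j = i then v else \<zeta>$j + r)) = (v - u) * (2*r)^(CARD('n) - 1)"
proof -
 have "measure lborel (cbox (\<chi> j. if j = i then u else \<zeta>$j - r) (\<chi> j. if j = i then v else \<zeta>$j + r))
  = (\<Prod>j\<in>UNIV. if j = i then v - u else 2*r)"
  by (subst content_cbox_cart) (use assms in \<open>auto intro!: prod.cong simp: interval_ne_empty_cart\<close>)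
 then show ?thesis by (simp only: prod_single)
qed

text \<open>The number of points of shell \<open>k\<close> cancels the powers of 2^k in the measures
  of the boxes, and a summable series in k^(-s (n - 1)) is left for the Borel-Cantelli lemma. In the
  dummy coordinate all boxes have length 2.\<close>

lemma rarely_hits:
 fixes Q :: "(real^'n::finite) set"
 assumes sep: "\<And>q q'. q\<in>Q ==> q'\<in>Q ==> q\<noteq>q' ==> C0\<le>hB q q'" and C0: "1 < C0"
  and n: "CARD('n) \<ge> 2" and s: "1 < s*(real CARD('n) - 1)"
 shows "negligible {z. (\<forall>j. \<bar>z$j\<bar>\<le>1) \<and> (\<forall>T. \<exists>t\<ge>T. hits Q s (sgn (gno i z)) t)}"
proof -
 define N where "N = CARD('n) - 1"
 have N: "real N = real CARD('n) - 1" unfolding N_def using n by simp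
 have s0: "0 < s" using s n by (metis N of_nat_0_le_iff less_trans not_less mult_nonpos_nonneg zero_less_one order.strict_trans1 not_le)
 obtain C :: real where C: "\<And>k. finite (Q\<inter>sector i k)" "\<And>k. card (Q\<inter>sector i k)\<le>C*(2^k)^N"
  using count_sector[where Q = Q and i = i, OF sep C0] unfolding N_def by blast
 define r where "r k = 3*(real k/4) powr - s/2^k" for k
 have r0: "0\<le>r k" for k unfolding r_def by simp
 define B where "B k q = cbox (\<chi> j. if j = i then - 1 else (q /\<^sub>R q$i)$j - r k) (\<chi> j. if j = i then 1 else (q /\<^sub>R q$i)$j + r k)" for k q
 define A where "A k = (\<Union>q\<in>Q\<inter>sector i k. B k q)" for k
 have mB: "measure lborel (B k q) = 2*(2*r k)^N" for k q
  unfolding B_def N_def using r0 by (subst content_slab) auto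
 have cA: "compact (A k)" for k unfolding A_def B_def using C(1) by (intro compact_UN) auto
 define E where "E = C*2*6^N*4 powr (s*N)"
 have "measure lborel (A k)\<le>E*real k powr - (s*N)" if k: "0 < k" for k
 proof -
  have "measure lborel (A k)\<le>(\<Sum>q\<in>Q\<inter>sector i k. measure lborel (B k q))"
   unfolding A_def using C(1) by (rule measure_UNION_le) (simp add: B_def)
  also have "\<dots> = card (Q\<inter>sector i k) * (2*(2*r k)^N)" by (simp add: mB)
  also have "\<dots>\<le>C*(2^k)^N*(2*(2*r k)^N)"
   using r0 by (intro mult_right_mono C(2)) simp
  also have "\<dots> = C*2*(2^k*(2*r k))^N" by (simp add: power_mult_distrib)
  also have "2^k*(2*r k) = 6*(4 powr s*real k powr - s)"
   unfolding r_def using k by (simp add: powr_divide powr_minus field_simps)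
  also have "C*2*(6*(4 powr s*real k powr - s))^N = E*real k powr - (s*N)"
   unfolding E_def using k by (simp add: power_mult_distrib powr_powr flip: powr_realpow[of "_ powr _"])
  finally show ?thesis .
 qed
 then have "eventually (\<lambda>k. norm (measure lborel (A k))\<le>E*real k powr - (s*N)) sequentially"
  by (intro eventually_mono[OF eventually_gt_at_top[of "0::nat"]]) simp
 moreover have "summable (\<lambda>k. E*real k powr - (s*N))"
  using s N by (intro summable_mult) (simp add: summable_real_powr_iff)
 ultimately have "summable (\<lambda>k. measure lborel (A k))" by (rule summable_comparison_test_ev)
 then have "AE z in lborel. eventually (\<lambda>k. z\<in>space lborel - A k) sequentially"
  using borel_compact[OF cA] emeasure_compact_finite[OF cA] by (intro borel_cantelli_AE1[where A = A]) simp_all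
 then obtain W where W: "{z\<in>space lborel. \<not> eventually (\<lambda>k. z\<in>space lborel - A k) sequentially}\<subseteq>W"
  "emeasure lborel W = 0" "W\<in>sets lborel" by (rule AE_E)
 then have "W\<in>null_sets lborel" by blast
 then have "negligible W" unfolding negligible_iff_null_sets by (rule null_sets_completionI)
 then show ?thesis
 proof (rule negligible_subset, intro subsetI)
  fix z assume "z\<in>{z. (\<forall>j. \<bar>z$j\<bar>\<le>1) \<and> (\<forall>T. \<exists>t\<ge>T. hits Q s (sgn (gno i z)) t)}"
  then have z: "\<forall>j. \<bar>z$j\<bar>\<le>1" and h: "\<And>T. \<exists>t\<ge>T. hits Q s (sgn (gno i z)) t" by auto
  have "\<exists>k\<ge>K. z\<in>A k" for K
  proof -
   obtain T where T: "\<And>t z. T\<le>t ==> \<forall>j. \<bar>z$j\<bar>\<le>1 ==> hits Q s (sgn (gno i z)) t ==>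
    \<exists>k\<ge>max 4 K. \<exists>q\<in>Q\<inter>sector i k. \<forall>j. j\<noteq>i --> \<bar>z$j - q$j/q$i\<bar>\<le>3*(real k/4) powr - s/2^k"
    using hits_sector[OF s0 max.cobounded1[of 4 K], where Q = Q and i = i] by (elim exE) blast
   obtain t where "T\<le>t" "hits Q s (sgn (gno i z)) t" using h by blast
   from T[OF this(1) z this(2)] obtain k q where k: "max 4 K\<le>k" "q\<in>Q\<inter>sector i k"
    and b: "\<And>j. j\<noteq>i ==> \<bar>z$j - q$j/q$i\<bar>\<le>r k" unfolding r_def by blast
   have "z\<in>B k q"
    unfolding B_def mem_box_cart
   proof
    fix j show "(\<chi> j. if j = i then - 1 else (q /\<^sub>R q$i)$j - r k)$j\<le>z$j
      \<and> z$j\<le>(\<chi> j. if j = i then 1 else (q /\<^sub>R q$i)$j + r k)$j"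
     using b[of j] z[rule_format, of j] by (auto simp: abs_le_iff field_simps)
   qed
   then show ?thesis using k unfolding A_def by auto
  qed
  then have "\<not> eventually (\<lambda>k. z\<in>space lborel - A k) sequentially"
   unfolding eventually_sequentially by blast
  then show "z\<in>W" using W(1) by auto
 qed
qed

text \<open>About N / log N removal steps, each with a proportion of order N^-\<sigma>: as \<sigma>
  < 1, their total is unbounded. The second factor is the lower bound for the number of steps in
  \<open>often_hits\<close>.\<close>

lemma removal_asymptotics:
 fixes a c s \<sigma> :: real
 assumes "0 < a" "0 < c" "0 < s" "0 < \<sigma>" "\<sigma> < 1"
 shows "filterlim (\<lambda>N::nat. a*(2*real N) powr (- \<sigma>)*(real N/(log 2 (2*(2*real N) powr s/c) + 1) - 1)) at_top sequentially"
 using assms by real_asymp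

text \<open>The points of the net at distance \<open>m log 2 + O(1)\<close> from the origin resolve the directions up to \<open>2^-m\<close>.\<close>

lemma net_near_center:
 fixes Q :: "(real^'n::finite) set"
 assumes dense: "\<And>h. \<exists>q\<in>Q. hB h q\<le>C1"
 shows "\<exists>D\<ge>1. \<forall>m::nat. \<forall>z. (\<forall>j. \<bar>z$j\<bar>\<le>2) -->
  (\<exists>q\<in>Q. 2*2^m\<le>q$i \<and> norm q\<le>D*2^m \<and> (\<forall>j. j\<noteq>i --> \<bar>q$j/q$i - z$j\<bar>\<le>1/(8*2^m)))"
proof -
 define n where "n = real CARD('n)"
 have n1: "1\<le>n" unfolding n_def by simp
 have C1: "1\<le>C1" using dense[of 0] hB_ge_1 order_trans by blast
 \<comment> \<open>With sinh t = A 2^m norm f, the point \<open>q\<close> near the ray has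
   \<open>q$i\<close> at least (26 - 2) P 2^m, and the gnomonic error 3 C1 / \<open>q$i\<close>
   becomes at most 1/(8 2^m). \<open>D\<close> is the resulting bound for
   \<open>norm q\<close>.\<close>
 define P A D where "P = 1 + C1" and "A = 8*n*P*(26*P)" and "D = 6*n*P*A"
 have P: "2\<le>P" "C1\<le>P" "0\<le>C1" unfolding P_def using C1 by auto
 have A: "1\<le>A" unfolding A_def using n1 P mult_mono[of 1 n 1 P] mult_mono[of 1 "n*P" 1 P] by (simp add: mult_ac)
 have D1: "1\<le>D" unfolding D_def using n1 P A mult_mono[of 1 n 1 P] mult_mono[of 1 "n*P" 1 A] by simp
 show ?thesis
 proof (intro exI[of _ D] conjI D1 allI impI)
  fix m and z :: "real^'n" assume z: "\<forall>j. \<bar>z$j\<bar>\<le>2"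
  define f \<theta> t where "f = gno i z" and "\<theta> = sgn f" and "t = arsinh (A*2^m*norm f)"
  have fn: "1\<le>norm f" "norm f\<le>2*n" unfolding f_def n_def using norm_gno_ge norm_gno_le z by auto
  have st: "sinh t = A*2^m*norm f" unfolding t_def by simp
  have p2: "(1::real)\<le>2^m" by simp
  have A2: "1\<le>A*2^m" using mult_mono[OF A p2] A by simp
  have st1: "1\<le>sinh t" "A*2^m\<le>sinh t" "sinh t\<le>A*2^m*(2*n)"
   unfolding st using mult_mono[OF A2 fn(1)] fn A A2 by (auto simp: mult_le_cancel_left1)
  obtain q where q: "q\<in>Q" "hB (sinh t *\<^sub>R \<theta>) q\<le>C1" using dense by blast
  have "C1\<le>sqrt (1 + C1\<^sup>2)" by (rule real_le_rsqrt) simp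
  then have "hB (sinh t *\<^sub>R \<theta>) q\<le>sqrt (1 + C1\<^sup>2)" using q(2) by simp
  moreover have n\<theta>: "norm \<theta> = 1" unfolding \<theta>_def f_def by simp
  ultimately have X: "hz q\<le>2*P*cosh t" "cosh t\<le>2*P*hz q" and hC: "hB (sinh t *\<^sub>R \<theta>) q\<le>sqrt (1 + C1\<^sup>2)"
   unfolding P_def using hB_ray_bounds(2,3)[of \<theta> t q C1] P(3) by auto
  have ch: "cosh t\<le>1 + sinh t" "sinh t\<le>cosh t"
  proof -
   have "0\<le>sinh t" using st1(1) by linarith
   then have "exp (- t)\<le>1" by simp
   moreover have "cosh t = sinh t + exp (- t)" unfolding cosh_field_def sinh_field_def by (simp add: field_simps)
   ultimately show "cosh t\<le>1 + sinh t" "sinh t\<le>cosh t" by auto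
  qed
  have D: "hz q\<le>D*2^m"
  proof -
   have "1\<le>A*2^m*n" using mult_mono[OF A2 n1] A2 by simp
   then have "cosh t\<le>A*2^m*(3*n)" using ch st1 by (simp add: algebra_simps)
   then have "2*P*cosh t\<le>2*P*(A*2^m*(3*n))" using P by (intro mult_left_mono) auto
   then show ?thesis using X(1) unfolding D_def by (simp add: mult_ac)
  qed
  have "A*2^m\<le>2*P*hz q" using X(2) ch(2) st1(2) by linarith
  then have "8*n*(26*P*2^m) * (2*P)\<le>2*hz q*(2*P)" unfolding A_def by (simp add: mult_ac)
  then have "8*n*(26*P*2^m)\<le>2*hz q" using P by simp
  then have "26*P*2^m\<le>hz q/(4*n)" using n1 by (simp add: field_simps)
  moreover have z2: "\<bar>z$j\<bar>\<le>2" for j using z by blast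
  note rc = ray_components[OF z2 hC[unfolded \<theta>_def f_def] P(3) st1(1)]
  note rc(1)[folded n_def]
  moreover have "2*C1\<le>2*P*2^m" using P p2 mult_mono[of C1 P 1 "2^m"] by simp
  ultimately have qi: "24*P*2^m\<le>q$i" by linarith
  have "2*2^m\<le>P*2^m" using P by (intro mult_right_mono) auto
  then have qi2: "2*2^m\<le>q$i" using qi p2 by linarith
  then have qp: "0 < q$i" using p2 by linarith
  show "\<exists>q\<in>Q. 2*2^m\<le>q$i \<and> norm q\<le>D*2^m \<and> (\<forall>j. j\<noteq>i --> \<bar>q$j/q$i - z$j\<bar>\<le>1/(8*2^m))"
  proof (intro bexI[OF _ q(1)] conjI allI impI qi2)
   show "norm q\<le>D*2^m" using D norm_less_hz[of q] by linarith
   fix j assume j: "j\<noteq>i"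
   have "\<bar>q$j/q$i - z$j\<bar>\<le>3*C1/q$i" using rc(2)[OF j qp] by (simp add: abs_minus_commute)
   also have "\<dots>\<le>3*P/q$i" using P qp by (intro divide_right_mono) auto
   also have "\<dots>\<le>3*P/(24*P*2^m)" using qi P qp by (intro divide_left_mono) auto
   also have "\<dots> = 1/(8*2^m)" using P by (simp add: field_simps)
   finally show "\<bar>q$j/q$i - z$j\<bar>\<le>1/(8*2^m)" .
  qed
 qed
qed

text \<open>A box of hit directions with centre near \<open>z\<close> and free dummy coordinate. The
  tolerance 1/8 of the cell size is what keeps the box inside a cell when \<open>z\<close> is the
  centre of that cell.\<close>

definition near_hits :: "(real^'n::finite) set => real => 'n => real => real => nat => real^'n => bool" where
 "near_hits Q s i c T m z \<longleftrightarrow> (\<exists>\<zeta>. (\<forall>j. j\<noteq>i --> \<bar>\<zeta>$j - z$j\<bar>\<le>1/(8*2^m)) \<and>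
   (\<forall>w. (\<forall>j. j\<noteq>i --> \<bar>w$j - \<zeta>$j\<bar>\<le>c*real m powr - s/2^m) --> (\<exists>t\<ge>T. hits Q s (sgn (gno i w)) t)))"

text \<open>The point supplied by \<open>net_near_center\<close> has norm of order 2^m, so a ray
  whose gnomonic coordinates differ from its own by c m^-s / 2^m passes it at distance of order c
  m^-s, at a time of order m.\<close>

lemma hits_near_center:
 fixes Q :: "(real^'n::finite) set"
 assumes dense: "\<And>h. \<exists>q\<in>Q. hB h q\<le>C1" and s: "0 < s"
 shows "\<exists>c>0. c\<le>1/8 \<and> (\<forall>T. \<exists>m0. \<forall>m\<ge>m0. \<forall>z. (\<forall>j. \<bar>z$j\<bar>\<le>2) --> near_hits Q s i c T m z)"
proof -
 define n where "n = real CARD('n)"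
 have n1: "1\<le>n" unfolding n_def by simp
 obtain D where D1: "1\<le>D" and D: "\<And>m z. \<forall>j. \<bar>z$j\<bar>\<le>2 ==>
  \<exists>q\<in>Q. 2*2^m\<le>q$i \<and> norm q\<le>D*2^m \<and> (\<forall>j. j\<noteq>i --> \<bar>q$j/q$i - z$j\<bar>\<le>1/(8*2^m))"
  using net_near_center[where Q = Q and i = i, OF dense] by (elim exE) blast
 \<comment> \<open>\<open>E * m\<close> bounds the time at which the ray passes \<open>q\<close>: it
   is at most ln (3 D) + m ln 2.\<close>
 define E where "E = 1 + ln (3*D)"
 have E: "1\<le>E" unfolding E_def using D1 by simp
 \<comment> \<open>The orthogonal distance is at most n D c m^-s. This \<open>c\<close> makes it
   half of (E m)^-s, hence smaller than t^-s at the time \<open>t\<close> of passage.\<close>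
 define c where "c = min (1/8) (E powr - s/(2*n*D))"
 have c: "0 < c" "c\<le>1/8" "n*(D*c)\<le>E powr - s/2"
 proof -
  show "0 < c" "c\<le>1/8" unfolding c_def using E n1 D1 by auto
  have "c\<le>E powr - s/(2*n*D)" unfolding c_def by simp
  then have "n*D*c\<le>n*D*(E powr - s/(2*n*D))" using n1 D1 by (intro mult_left_mono) auto
  also have "\<dots> = E powr - s/2" using n1 D1 by simp
  finally show "n*(D*c)\<le>E powr - s/2" by (simp only: mult.assoc)
 qed
 show ?thesis
 proof (intro exI[of _ c] conjI c(1,2) allI)
  fix T0 :: real
  define T where "T = max T0 1"
  obtain m1 where m1: "2 * sinh T < 2^m1" using real_arch_pow[of 2 "2 * sinh T"] by auto
  define m0 where "m0 = max m1 1"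
  have m0: "2 * sinh T\<le>2^m \<and> 1\<le>m" if "m \<ge> m0" for m
  by (smt (verit) m0_def m1 max.bounded_iff power_increasing that)
  show "\<exists>m0. \<forall>m\<ge>m0. \<forall>z. (\<forall>j. \<bar>z$j\<bar>\<le>2) --> near_hits Q s i c T0 m z"
  proof (intro exI[of _ m0] allI impI)
   fix m and z :: "real^'n" assume m: "m0\<le>m" and z: "\<forall>j. \<bar>z$j\<bar>\<le>2"
   have m1: "2 * sinh T\<le>2^m" "1\<le>real m" using m0[OF m] by auto
   obtain q where q: "q\<in>Q" "2*2^m\<le>q$i" "norm q\<le>D*2^m"
    and qj: "\<And>j. j\<noteq>i ==> \<bar>q$j/q$i - z$j\<bar>\<le>1/(8*2^m)" using D[OF z, of m] by blast
   have p2: "(1::real)\<le>2^m" by simp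
   have qp: "0 < q$i" using q(2) p2 by linarith
   have qq: "(q /\<^sub>R q$i)$j = q$j/q$i" for j by (simp add: divide_inverse)
   show "near_hits Q s i c T0 m z"
    unfolding near_hits_def
   proof (intro exI[of _ "q /\<^sub>R q$i"] conjI allI impI)
    fix j assume "j\<noteq>i"
    then show "\<bar>(q /\<^sub>R q$i)$j - z$j\<bar>\<le>1/(8*2^m)" unfolding qq by (rule qj)
   next
    fix w :: "real^'n" assume w: "\<forall>j. j\<noteq>i --> \<bar>w$j - (q /\<^sub>R q$i)$j\<bar>\<le>c*real m powr - s/2^m"
    define f \<theta> \<delta> where "f = gno i w" and "\<theta> = sgn f" and "\<delta> = n*(D*c) * real m powr - s"
    have mp: "real m powr - s\<le>1" using powr_mono[of "- s" 0 "real m"] m1 s by simp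
    have "\<delta>\<le>E powr - s/2*real m powr - s" unfolding \<delta>_def using c(3) by (intro mult_right_mono) auto
    also have "\<dots> = (E*real m) powr - s/2" using E by (simp add: powr_mult)
    finally have \<delta>E: "\<delta>\<le>(E*real m) powr - s/2" .
    have "1\<le>E*real m" using mult_mono[OF E m1(2)] E by simp
    then have "(E*real m) powr - s\<le>1" using powr_mono[of "- s" 0 "E*real m"] s E m1 by (auto split: if_splits)
    then have \<delta>: "0\<le>\<delta>" "\<delta>\<le>1" using \<delta>E unfolding \<delta>_def using n1 D1 c(1) by auto
    have "norm (q - q$i *\<^sub>R f)\<le>(\<Sum>j\<in>UNIV. \<bar>(q - q$i *\<^sub>R f)$j\<bar>)" by (rule norm_le_l1_cart)
    also have "\<dots>\<le>(\<Sum>j\<in>(UNIV::'n set). D*c*real m powr - s)"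
    proof (rule sum_mono)
     fix j show "\<bar>(q - q$i *\<^sub>R f)$j\<bar>\<le>D*c*real m powr - s"
     proof (cases "j = i")
      case True then show ?thesis unfolding f_def using D1 c(1) by (simp add: gno_nth)
     next
      case False
      have "(q - q$i *\<^sub>R f)$j = - q$i*(w$j - (q /\<^sub>R q$i)$j)"
       unfolding f_def using False qp by (simp add: gno_nth field_simps)
      then have "\<bar>(q - q$i *\<^sub>R f)$j\<bar> = q$i * \<bar>w$j - (q /\<^sub>R q$i)$j\<bar>" using qp by (simp only: abs_mult)
      also have "\<dots>\<le>(D*2^m) * (c*real m powr - s/2^m)"
       using w False qp q(3) component_le_norm_cart[of q i] D1 by (intro mult_mono) auto
      finally show ?thesis by simp
     qed
    qed
    finally have nq: "norm (q - q$i *\<^sub>R f)\<le>\<delta>" unfolding \<delta>_def n_def by (simp add: mult.assoc)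
    have f0: "f\<noteq>0" "1\<le>norm f" unfolding f_def by (auto simp: gno_nonzero norm_gno_ge)
    have perp: "norm (q - (q \<bullet> \<theta>) *\<^sub>R \<theta>)\<le>\<delta>" unfolding \<theta>_def using gno_perp_upper[OF f0(1)] nq by (rule order_trans)
    have "\<bar>(q - q$i *\<^sub>R f) \<bullet> \<theta>\<bar>\<le>norm (q - q$i *\<^sub>R f) * norm \<theta>" by (rule Cauchy_Schwarz_ineq2)
    then have "\<bar>(q - q$i *\<^sub>R f) \<bullet> \<theta>\<bar>\<le>1" using nq \<delta> unfolding \<theta>_def f_def by simp
    moreover have "f \<bullet> \<theta> = norm f" unfolding \<theta>_def sgn_div_norm using f0 by (simp add: dot_square_norm power2_eq_square)
    then have "(q - q$i *\<^sub>R f) \<bullet> \<theta> = q \<bullet> \<theta> - q$i*norm f" by (simp add: inner_diff_left)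
    moreover have "q$i\<le>q$i*norm f" using qp f0 mult_left_mono[of 1 "norm f" "q$i"] by simp
    ultimately have a: "2^m\<le>q \<bullet> \<theta>" using q(2) p2 by linarith
    obtain t where t: "T\<le>t" "sinh t\<le>norm q" "hB (sinh t *\<^sub>R \<theta>) q\<le>sqrt (1 + \<delta>\<^sup>2)"
    proof (rule ray_passes[OF _ perp \<delta>(2)])
     show "norm \<theta> = 1" unfolding \<theta>_def f_def by simp
     show "sinh T\<le>(q \<bullet> \<theta>)/2" "0 < q \<bullet> \<theta>" using a m1(1) p2 by linarith+
    qed
    have t1: "1\<le>t" "T0\<le>t" using t(1) unfolding T_def by auto
    have "exp t = 2 * sinh t + exp (- t)" unfolding sinh_field_def by (simp add: field_simps)
    also have "exp (- t)\<le>1" using t1 by simp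
    also have "2 * sinh t + 1\<le>3*(D*2^m)" using t(2) q(3) mult_mono[OF D1 p2] D1 by simp
    finally have "exp t\<le>3*D*2^m" by (simp add: mult_ac)
    then have "t\<le>ln (3*D*2^m)" by (subst ln_ge_iff) (use D1 in auto)
    also have "\<dots> = ln (3*D) + m*ln 2" using D1 by (simp add: ln_mult ln_realpow)
    also have "\<dots>\<le>ln (3*D) * m + m*1"
     using m1 D1 ln_2_less_1 by (intro add_mono mult_left_mono) (auto simp: mult_le_cancel_left1)
    finally have "t\<le>E*m" unfolding E_def by (simp add: algebra_simps)
    then have "(E*real m) powr - s\<le>t powr - s" using s t1 by (intro powr_mono2') auto
    moreover have "0 < (E*real m) powr - s" using E m1 by simp
    ultimately have "\<delta> < t powr - s" using \<delta>E by linarith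
    then have "sqrt (1 + \<delta>\<^sup>2) < sqrt (1 + (t powr - s)\<^sup>2)" using \<delta> by (simp add: power_strict_mono)
    then have "hits Q s (sgn (gno i w)) t" unfolding hits_def using q(1) t(3) unfolding \<theta>_def f_def by (meson le_less_trans)
    then show "\<exists>t\<ge>T0. hits Q s (sgn (gno i w)) t" using t1 by blast
   qed
  qed
 qed
qed

section \<open>Dyadic cells and the successive removal of hit directions\<close>

text \<open>\<open>H\<close> is a finite union of level sets of \<open>\<kappa>\<close>, so a loss
  that is proportional on each of them is proportional on \<open>H\<close>.\<close>

lemma measure_diff_partition:
 assumes fin: "finite (\<kappa> ` H)" and sat: "\<And>z w. z\<in>H ==> \<kappa> w = \<kappa> z ==> w\<in>H"
  and meas: "\<And>z. z\<in>H ==> {w. \<kappa> w = \<kappa> z}\<in>fmeasurable M" and G: "G\<in>sets M"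
  and le: "\<And>z. z\<in>H ==> measure M ({w. \<kappa> w = \<kappa> z} - G)\<le>a*measure M {w. \<kappa> w = \<kappa> z}"
 shows "measure M (H - G)\<le>a*measure M H"
proof -
 define C where "C k = {w. \<kappa> w = k}" for k
 have H: "H = (\<Union>k\<in>\<kappa> ` H. C k)" using sat unfolding C_def by auto
 have m: "C k\<in>fmeasurable M" "C k - G\<in>fmeasurable M" if "k\<in>\<kappa> ` H" for k
  using meas G that unfolding C_def by (auto intro: fmeasurable_Diff)
 have d: "disjoint_family_on C (\<kappa> ` H)" "disjoint_family_on (\<lambda>k. C k - G) (\<kappa> ` H)"
  unfolding disjoint_family_on_def C_def by auto
 have "H - G = (\<Union>k\<in>\<kappa> ` H. C k - G)" by (subst H) auto
 then have "measure M (H - G) = (\<Sum>k\<in>\<kappa> ` H. measure M (C k - G))"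
  using m(2)[THEN fmeasurableD] m(2)[THEN fmeasurableD2]
  by (simp only:) (intro measure_finite_Union[OF fin _ d(2)], auto)
 also have "\<dots>\<le>(\<Sum>k\<in>\<kappa> ` H. a*measure M (C k))" by (rule sum_mono) (use le in \<open>auto simp: C_def\<close>)
 also have "\<dots> = a*(\<Sum>k\<in>\<kappa> ` H. measure M (C k))" by (simp add: sum_distrib_left)
 also have "(\<Sum>k\<in>\<kappa> ` H. measure M (C k)) = measure M (\<Union>k\<in>\<kappa> ` H. C k)"
  using m(1)[THEN fmeasurableD] m(1)[THEN fmeasurableD2]
  by (intro measure_finite_Union[OF fin _ d(1), symmetric]) auto
 finally show ?thesis unfolding H[symmetric] .
qed

text \<open>The index of the dyadic cell that contains \<open>z\<close>. The dummy coordinate is cut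
  at integers at all scales; the other ones have cell size 2^-m.\<close>

definition cell :: "'n => nat => real^'n::finite => 'n => int" where
 "cell i m z = (\<lambda>j. \<lfloor>(if j = i then 1 else 2^m) * z$j\<rfloor>)"

lemma cell_mono:
 assumes "m\<le>m'" "cell i m' w = cell i m' z"
 shows "cell i m w = cell i m z"
proof
 fix j
 have fl: "\<lfloor>x\<rfloor> = \<lfloor>y\<rfloor>" if "\<lfloor>2^d*x\<rfloor> = \<lfloor>2^d*y\<rfloor>" for d and x y :: real
 proof -
  have *: "\<lfloor>x\<rfloor> = \<lfloor>2^d*x\<rfloor> div 2^d" for x :: real
   using floor_divide_real_eq_div[of "2^d" "2^d*x"] by simp
  show ?thesis unfolding *[of x] *[of y] that ..
 qed
 show "cell i m w j = cell i m z j"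
 proof (cases "j = i")
  case True then show ?thesis using fun_cong[OF assms(2), of j] unfolding cell_def by simp
 next
  case False
  have e: "(2::real)^m' = 2^(m' - m) * 2^m" using assms(1) by (simp flip: power_add)
  have "\<lfloor>2^(m' - m) * (2^m*w$j)\<rfloor> = \<lfloor>2^(m' - m) * (2^m*z$j)\<rfloor>"
   using fun_cong[OF assms(2), of j] False unfolding cell_def e by (simp add: mult.assoc)
  from fl[OF this] show ?thesis using False unfolding cell_def by simp
 qed
qed

lemma cell_close:
 assumes "cell i m w = cell i m z" "j\<noteq>i"
 shows "\<bar>w$j - z$j\<bar>\<le>1/2^m"
proof -
 have "\<lfloor>2^m*w$j\<rfloor> = \<lfloor>2^m*z$j\<rfloor>" using fun_cong[OF assms(1), of j] assms(2) unfolding cell_def by simp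
 then have "\<bar>2^m*w$j - 2^m*z$j\<bar>\<le>1" by (rule floor_eq_diff)
 then have "2^m * \<bar>w$j - z$j\<bar>\<le>1" unfolding right_diff_distrib[symmetric] abs_mult by simp
 then show ?thesis by (simp add: field_simps)
qed

lemma cell_center:
 assumes "\<And>j. j\<noteq>i ==> \<bar>w$j - (cell i m z j + 1/2)/2^m\<bar>\<le>1/(4*2^m)"
  and "cell i m z i\<le>w$i" "w$i < cell i m z i + 1"
 shows "cell i m w = cell i m z"
proof
 fix j show "cell i m w j = cell i m z j"
 proof (cases "j = i")
  case True then show ?thesis using assms(2,3) unfolding cell_def[of i m w] by (simp add: floor_eq_iff)
 next
  case False
  have "2^m * \<bar>w$j - (cell i m z j + 1/2)/2^m\<bar>\<le>2^m*(1/(4*2^m))"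
   using assms(1)[OF False] by (intro mult_left_mono) auto
  moreover have "2^m * \<bar>w$j - (cell i m z j + 1/2)/2^m\<bar> = \<bar>2^m*(w$j - (cell i m z j + 1/2)/2^m)\<bar>"
   unfolding abs_mult by simp
  ultimately have "\<bar>2^m*w$j - (cell i m z j + 1/2)\<bar>\<le>1/4" by (simp add: right_diff_distrib)
  then have "cell i m z j\<le>2^m*w$j" "2^m*w$j < cell i m z j + 1" by linarith+
  then show ?thesis using False unfolding cell_def[of i m w] by (simp add: floor_eq_iff)
 qed
qed

text \<open>Half-open, so that it is a union of whole cells at every scale. The bound 2 leaves room
  around the cube of interest, which is closed and has bound 1.\<close>

definition slab :: "(real^'n::finite) set" where
 "slab = {z. \<forall>j. - 2\<le>z$j \<and> z$j < 2}"

lemma cell_slab_iff: "z\<in>slab \<longleftrightarrow> (\<forall>j. cell i m z j\<in>{- 2*(if j = i then 1 else 2^m)..<2*(if j = i then 1 else 2^m)})"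
proof -
 have *: "- 2\<le>x \<and> x < 2 \<longleftrightarrow> - 2*2^d\<le>\<lfloor>2^d*x\<rfloor> \<and> \<lfloor>2^d*x\<rfloor> < 2*2^d" for x :: real and d
 proof -
  have p: "(0::real) < 2^d" by simp
  have "- 2*2^d\<le>\<lfloor>2^d*x\<rfloor> \<longleftrightarrow> 2^d*(- 2)\<le>2^d*x"
   unfolding le_floor_iff by (simp only: of_int_mult of_int_minus of_int_numeral of_int_power mult.commute)
  moreover have "\<lfloor>2^d*x\<rfloor> < 2*2^d \<longleftrightarrow> 2^d*x < 2^d*2"
   unfolding floor_less_iff by (simp only: of_int_mult of_int_numeral of_int_power mult.commute)
  ultimately show ?thesis unfolding mult_le_cancel_left_pos[OF p] mult_less_cancel_left_pos[OF p] by blast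
 qed
 have "- 2\<le>z$j \<and> z$j < 2 \<longleftrightarrow> cell i m z j\<in>{- 2*(if j = i then 1 else 2^m)..<2*(if j = i then 1 else 2^m)}" for j
  using *[of "z$j" 0] *[of "z$j" m] unfolding cell_def atLeastLessThan_iff
  by (cases "j = i") (simp_all only: simp_thms if_True if_False power_0 mult_1 mult_1_right)
 then show ?thesis unfolding slab_def by blast
qed

lemma finite_cells: "finite (cell i m ` slab)"
proof (rule finite_subset)
 show "cell i m ` slab\<subseteq>(\<Pi>\<^sub>E j\<in>UNIV. {- 2*(if j = i then 1 else 2^m)..<2*(if j = i then 1 else 2^m)})"
  using cell_slab_iff[of _ i m] by (auto simp: PiE_iff simp del: atLeastLessThan_iff)
qed (rule finite_PiE, auto)

lemma cell_slab: "z\<in>slab ==> cell i m w = cell i m z ==> w\<in>slab"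
 unfolding cell_slab_iff[of _ i m] by simp

lemma cell_measurable: "{w. cell i m w = k}\<in>sets lborel"
proof -
 have "{w. cell i m w = k} = {w. \<forall>j. \<lfloor>(if j = i then 1 else 2^m) * w$j\<rfloor> = k j}" unfolding cell_def by auto
 also have "\<dots>\<in>sets lborel" by measurable
 finally show ?thesis .
qed

lemma cell_fmeasurable:
 fixes i :: "'n::finite"
 shows "{w. cell i m w = cell i m z}\<in>fmeasurable lborel"
  and "measure lborel {w. cell i m w = cell i m z}\<le>(1/2^m)^(CARD('n) - 1)"
proof -
 define lo hi where "lo = (\<chi> j. if j = i then real_of_int (cell i m z i) else (\<chi> j. (cell i m z j + 1/2)/2^m)$j - 1/(2*2^m))"
  and "hi = (\<chi> j. if j = i then real_of_int (cell i m z i) + 1 else (\<chi> j. (cell i m z j + 1/2)/2^m)$j + 1/(2*2^m))"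
 have sub: "{w. cell i m w = cell i m z}\<subseteq>cbox lo hi"
 proof
  fix w assume w: "w\<in>{w. cell i m w = cell i m z}"
  show "w\<in>cbox lo hi"
   unfolding mem_box_cart
  proof
   fix j
   have "cell i m w j = cell i m z j" using w by simp
   then have c: "\<lfloor>(if j = i then 1 else 2^m) * w$j\<rfloor> = cell i m z j" unfolding cell_def[of i m w] .
   have "cell i m z j\<le>(if j = i then 1 else 2^m) * w$j" unfolding c[symmetric] by (rule of_int_floor_le)
   moreover have "(if j = i then 1 else 2^m) * w$j < of_int (cell i m z j) + 1" unfolding c[symmetric] by (rule real_of_int_floor_add_one_gt)
   ultimately show "lo$j\<le>w$j \<and> w$j\<le>hi$j" unfolding lo_def hi_def by (auto simp: field_simps)
  qed
 qed
 show f: "{w. cell i m w = cell i m z}\<in>fmeasurable lborel"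
  by (rule fmeasurableI2[OF _ sub cell_measurable]) (rule fmeasurable_cbox)
 have "measure lborel {w. cell i m w = cell i m z}\<le>measure lborel (cbox lo hi)"
  using f by (intro measure_mono_fmeasurable sub fmeasurable_cbox) auto
 also have "\<dots> = (1/2^m)^(CARD('n) - 1)" unfolding lo_def hi_def by (subst content_slab) auto
 finally show "measure lborel {w. cell i m w = cell i m z}\<le>(1/2^m)^(CARD('n) - 1)" .
qed

lemma saturated_measurable:
 assumes "S\<subseteq>slab" "\<And>z w. z\<in>S ==> cell i m w = cell i m z ==> w\<in>S"
 shows "S\<in>fmeasurable lborel"
proof -
 have S: "S = (\<Union>k\<in>cell i m ` S. {w. cell i m w = k})" using assms(2) by auto
 have "finite (cell i m ` S)" using assms(1) finite_cells[of i m] by (meson finite_subset image_mono)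
 then show ?thesis by (subst S) (rule fmeasurable.finite_UN, auto intro: cell_fmeasurable)
qed

text \<open>The box around the point near the centre of a cell lies in that cell, and its share of
  the cell is at least (r 2^m)^(n-1)/2. Since \<open>H\<close> is a union of cells, the loss does
  not depend on how \<open>H\<close> arose.\<close>

lemma removal_step:
 fixes H :: "(real^'n::finite) set" and G :: "(real^'n) set"
 assumes H: "H\<subseteq>slab" "\<And>z w. z\<in>H ==> cell i m w = cell i m z ==> w\<in>H"
  and r: "0\<le>r" "r\<le>1/(8*2^m)" and G: "G\<in>sets lborel"
  and hit: "\<And>z :: real^'n. (\<forall>j. \<bar>z$j\<bar>\<le>2) ==> \<exists>\<zeta>. (\<forall>j. j\<noteq>i --> \<bar>\<zeta>$j - z$j\<bar>\<le>1/(8*2^m)) \<and>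
   (\<forall>w\<in>slab. (\<forall>j. j\<noteq>i --> \<bar>w$j - \<zeta>$j\<bar>\<le>r/2) --> w\<in>G)"
 shows "measure lborel (H - G)\<le>(1 - (r*2^m)^(CARD('n) - 1)/2)*measure lborel H"
proof (rule measure_diff_partition[where \<kappa> = "cell i m"])
 show "finite (cell i m ` H)" using H(1) finite_cells[of i m] by (meson finite_subset image_mono)
 show "\<And>z w. z\<in>H ==> cell i m w = cell i m z ==> w\<in>H" by (rule H(2))
 show "{w. cell i m w = cell i m z}\<in>fmeasurable lborel" for z by (rule cell_fmeasurable)
 show "G\<in>sets lborel" by (rule G)
 fix z assume z: "z\<in>H"
 define k where "k = cell i m z"
 define C where "C = {w. cell i m w = cell i m z}"
 \<comment> \<open>The centre of the cell, with dummy coordinate 0.\<close>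
 define z0 where "z0 = (\<chi> j. if j = i then 0 else (k j + 1/2)/2^m)"
 have "\<bar>z0$j\<bar>\<le>2" for j
 proof (cases "j = i")
  case False
  have "k j\<in>{- 2*(if j = i then 1 else 2^m)..<2*(if j = i then 1 else 2^m)}"
   using z H(1) cell_slab_iff[of z i m] unfolding k_def by blast
  then have "- 2*2^m\<le>k j" "k j + 1\<le>2*2^m" using False by auto
  then have "real_of_int (- 2*2^m)\<le>k j" "real_of_int (k j + 1)\<le>of_int (2*2^m)" by (simp_all only: of_int_le_iff)
  then have "\<bar>k j + 1/2\<bar>\<le>2*2^m" by simp
  then have "\<bar>k j + 1/2\<bar>/2^m\<le>2" by (simp add: divide_le_eq)
  then show ?thesis unfolding z0_def using False by (simp add: abs_divide)
 qed (simp add: z0_def)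
 then have "\<forall>j. \<bar>z0$j\<bar>\<le>2" by blast
 from hit[OF this] obtain \<zeta> where \<zeta>: "\<And>j. j\<noteq>i ==> \<bar>\<zeta>$j - z0$j\<bar>\<le>1/(8*2^m)"
  and sub: "\<forall>w\<in>slab. (\<forall>j. j\<noteq>i --> \<bar>w$j - \<zeta>$j\<bar>\<le>r/2) --> w\<in>G"
  by (elim exE conjE) blast
 \<comment> \<open>A closed box in a half-open cell: in the dummy coordinate only the lower half of
   the unit interval is taken. This is the origin of the factor 1/2 in the proportion.\<close>
 define B where "B = cbox (\<chi> j. if j = i then real_of_int (k i) else \<zeta>$j - r/2) (\<chi> j. if j = i then k i + 1/2 else \<zeta>$j + r/2)"
 have mB: "measure lborel B = r^(CARD('n) - 1)/2" unfolding B_def using r by (subst content_slab) auto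
 have BC: "B\<subseteq>C\<inter>G"
 proof
  fix w assume w: "w\<in>B"
  have wi: "k i\<le>w$i" "w$i\<le>k i + 1/2" using w[unfolded B_def mem_box_cart, rule_format, of i] by auto
  have wj: "\<bar>w$j - \<zeta>$j\<bar>\<le>r/2" if "j\<noteq>i" for j
  by (smt (verit, del_insts) B_def mem_box_cart(2) that vec_lambda_beta w)
  have c: "cell i m w = cell i m z"
  proof (rule cell_center)
   fix j assume j: "j\<noteq>i"
   have "\<bar>w$j - z0$j\<bar>\<le>r/2 + 1/(8*2^m)" using wj[OF j] \<zeta>[OF j] by linarith
   also have "\<dots>\<le>1/(8*2^m) + 1/(8*2^m)" using r by (intro add_right_mono) simp
   also have "\<dots> = 1/(4*2^m)" by (simp add: field_simps)
   finally show "\<bar>w$j - (cell i m z j + 1/2)/2^m\<bar>\<le>1/(4*2^m)" using j unfolding z0_def k_def by simp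
  qed (use wi in \<open>auto simp: k_def\<close>)
  have "w\<in>slab" using cell_slab[OF _ c] z H(1) by blast
  then have "w\<in>G" using sub wj by blast
  then show "w\<in>C\<inter>G" using c unfolding C_def by simp
 qed
 have fC: "C\<in>fmeasurable lborel" unfolding C_def by (rule cell_fmeasurable)
 then have fCG: "C\<inter>G\<in>fmeasurable lborel" using G by (rule fmeasurable_Int_fmeasurable)
 have "r^(CARD('n) - 1)/2\<le>measure lborel (C\<inter>G)"
  unfolding mB[symmetric] using BC fCG by (intro measure_mono_fmeasurable) (auto simp: B_def)
 moreover have "measure lborel C*(r*2^m)^(CARD('n) - 1)/2\<le>r^(CARD('n) - 1)/2"
 proof -
  have "measure lborel C*(r*2^m)^(CARD('n) - 1)\<le>(1/2^m)^(CARD('n) - 1)*(r*2^m)^(CARD('n) - 1)"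
   unfolding C_def using r by (intro mult_right_mono cell_fmeasurable) auto
  also have "\<dots> = r^(CARD('n) - 1)" unfolding power_mult_distrib[symmetric] by simp
  finally show ?thesis by simp
 qed
 moreover have "measure lborel (C - G) = measure lborel C - measure lborel (C\<inter>G)"
  using measure_Diff[of lborel C "C\<inter>G"] fmeasurableD2[OF fC] fmeasurableD[OF fC] fmeasurableD[OF fCG] by (simp add: Diff_Int)
 ultimately have "measure lborel (C - G)\<le>(1 - (r*2^m)^(CARD('n) - 1)/2)*measure lborel C"
  by (simp add: algebra_simps)
 then show "measure lborel ({w. cell i m w = cell i m z} - G)\<le>(1 - (r*2^m)^(CARD('n) - 1)/2)*measure lborel {w. cell i m w = cell i m z}"
  unfolding C_def .
qed

text \<open>At the scales \<open>2^-m\<close> with \<open>m = N + l L\<close>, \<open>l\<le>N/L\<close>, each step removes from what is left a proportion at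
 least \<open>q\<close>, of order \<open>N\<close> to the power \<open>- s (n - 1)\<close>. As \<open>L\<close> only grows like \<open>log N\<close>, the product of all
 \<open>1 - q\<close> tends to \<open>0\<close>.\<close>

lemma often_hits:
 fixes Q :: "(real^'n::finite) set"
 assumes dense: "\<And>h. \<exists>q\<in>Q. hB h q\<le>C1" and n: "CARD('n) \<ge> 2" and s: "0 < s" "s*(real CARD('n) - 1) < 1"
 shows "negligible {z. (\<forall>j. \<bar>z$j\<bar>\<le>1) \<and> \<not> (\<forall>T. \<exists>t\<ge>T. hits Q s (sgn (gno i z)) t)}"
proof -
 define p where "p = CARD('n) - 1"
 have p: "real p = real CARD('n) - 1" "0 < p" unfolding p_def using n by auto
 obtain c where c: "0 < c" "c\<le>1/8" and hit: "\<And>T. \<exists>m0. \<forall>m\<ge>m0. \<forall>z. (\<forall>j. \<bar>z$j\<bar>\<le>2) --> near_hits Q s i c T m z"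
  using hits_near_center[where Q = Q and i = i, OF dense s(1)] by (elim exE conjE) blast
 define mU where "mU = measure lborel (slab :: (real^'n) set)"
 have main: "negligible {z. (\<forall>j. \<bar>z$j\<bar>\<le>1) \<and> \<not> (\<exists>t\<ge>T. hits Q s (sgn (gno i z)) t)}" for T
  unfolding negligible_outer
 proof (intro allI impI)
  fix e :: real assume e: "0 < e"
  define hit1 where "hit1 w \<longleftrightarrow> (\<exists>t\<ge>T. hits Q s (sgn (gno i w)) t)" for w
  obtain m0 where m0: "\<And>m z. m0\<le>m ==> \<forall>j. \<bar>z$j\<bar>\<le>2 ==> near_hits Q s i c T m z"
   using hit[of T] by (elim exE) blast
  \<comment> \<open>The proportion for radius c (2N)^-s, which is valid at all scales from
    \<open>N\<close> to \<open>2*N\<close> used below.\<close>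
  define q where "q N = c^p/2*(2*real N) powr (- (s*p))" for N :: nat
  \<comment> \<open>Cells that are finer by \<open>lg N\<close> scales have a size of at most half
    the radius of a hit box, so a cell that meets the inner half of the box consists of hit
    directions.\<close>
  define lg where "lg N = log 2 (2*(2*real N) powr s/c)" for N :: nat
  define K where "K = ln ((mU + 1)/e)"
  have mU0: "0\<le>mU" unfolding mU_def by simp
  have "filterlim (\<lambda>N. q N*(real N/(lg N + 1) - 1)) at_top sequentially"
   unfolding q_def lg_def using c s p by (intro removal_asymptotics) auto
  then have "eventually (\<lambda>N. K < q N*(real N/(lg N + 1) - 1)) sequentially"
   unfolding filterlim_at_top_dense by blast
  then have "eventually (\<lambda>N. K < q N*(real N/(lg N + 1) - 1) \<and> max m0 1\<le>N) sequentially"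
   by (rule eventually_conj) (rule eventually_ge_at_top)
  then obtain N where N: "K < q N*(real N/(lg N + 1) - 1)" "m0\<le>N" "1\<le>N"
   using eventually_happens'[OF sequentially_bot] by (metis (no_types, lifting) max.bounded_iff)
  have P: "(2*real N) powr - s\<le>1" using powr_mono[of "- s" 0 "2*real N"] s N by simp
  define L where "L = nat \<lceil>lg N\<rceil>"
  have N1: "1\<le>(2*real N) powr s" using ge_one_powr_ge_zero[of "2*real N" s] s N by simp
  have "2 powr 1\<le>2*(2*real N) powr s/c" using N1 c by (simp add: field_simps)
  then have "1\<le>lg N" unfolding lg_def using c N1 by (subst le_log_iff) auto
  then have L: "1\<le>L" "lg N\<le>L" "L\<le>lg N + 1" unfolding L_def by linarith+
  have "2*(2*real N) powr s/c = 2 powr lg N" unfolding lg_def using c N1 N by (subst powr_log_cancel) (auto intro!: divide_pos_pos)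
  also have "\<dots>\<le>2 powr L" using L(2) by simp
  also have "\<dots> = 2^L" by (simp add: powr_realpow)
  finally have "1/2^L\<le>1/(2*(2*real N) powr s/c)"
   using c N N1 by (intro divide_left_mono) (auto intro!: divide_pos_pos mult_pos_pos)
  also have "\<dots> = c/(2*real N) powr s/2" using c by simp
  also have "c/(2*real N) powr s = c*(2*real N) powr - s" unfolding powr_minus by (rule divide_real_def)
  finally have L2: "1/2^L\<le>c*(2*real N) powr - s/2" .
  define k where "k = N div L"
  have "real N = real (L*k + N mod L)" unfolding k_def by simp
  then have "real N = L*real k + real (N mod L)" by (simp only: of_nat_add of_nat_mult)
  moreover have "real (N mod L)\<le>L" using L by (simp add: less_imp_le)
  ultimately have "real N\<le>L*(real k + 1)" by (simp add: algebra_simps)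
  then have "real N/L\<le>real k + 1" using L by (simp add: divide_le_eq mult.commute)
  moreover have "real N/(lg N + 1)\<le>real N/L" using L \<open>1\<le>lg N\<close> by (intro divide_left_mono) auto
  ultimately have k: "real N/(lg N + 1) - 1\<le>k" by linarith
  have q0: "0\<le>q N" unfolding q_def using c by simp
  have qe: "q N = (c*(2*real N) powr - s)^p/2"
   unfolding q_def power_mult_distrib using N p by (simp add: powr_powr flip: powr_realpow[of "_ powr _"])
  have "(c*(2*real N) powr - s)^p\<le>1" using c P mult_mono[of c 1 "(2*real N) powr - s" 1] by (intro power_le_one) auto
  then have q1: "q N\<le>1" unfolding qe by simp
  \<comment> \<open>Whole cells of the next scale that consist of hit directions, instead of the set
    of hit directions: they are measurable, and what is left remains a union of cells for the
    following step.\<close>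
  define G where "G l = {w\<in>slab. \<forall>w'. cell i (N + l*L + L) w' = cell i (N + l*L + L) w --> hit1 w'}" for l
  define H where "H l = slab - (\<Union>l'<l. G l')" for l
  have Gsat: "w\<in>G l" if "z\<in>G l" "cell i (N + l*L + L) w = cell i (N + l*L + L) z" for z w l
   using that cell_slab[OF _ that(2)] unfolding G_def by auto
  have Gm: "G l\<in>sets lborel" for l
  proof (rule fmeasurableD, rule saturated_measurable)
   show "G l\<subseteq>slab" unfolding G_def by blast
  qed (rule Gsat)
  \<comment> \<open>Everything removed before step \<open>l\<close> is a union of cells of scale at
    most \<open>N + l*L\<close>, hence also of cells of exactly that scale.\<close>
  have Hsat: "w\<in>H l" if z: "z\<in>H l" and w: "cell i (N + l*L) w = cell i (N + l*L) z" for z w l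
  proof -
   have "w \<notin> G l'" if "l' < l" for l'
   proof
    assume "w\<in>G l'"
    moreover have "N + l' * L + L\<le>N + l*L" using mult_le_mono1[of "Suc l'" l L] that by simp
    then have "cell i (N + l' * L + L) z = cell i (N + l' * L + L) w" by (rule cell_mono[OF _ w[symmetric]])
    ultimately have "z\<in>G l'" by (rule Gsat)
    then show False using z that unfolding H_def by blast
   qed
   moreover have "w\<in>slab" using z cell_slab[OF _ w] unfolding H_def by blast
   ultimately show ?thesis unfolding H_def by blast
  qed
  have Hm: "H l\<in>fmeasurable lborel" for l
  proof (rule saturated_measurable)
   show "H l\<subseteq>slab" unfolding H_def by blast
  qed (rule Hsat)
  have "l\<le>k ==> measure lborel (H l)\<le>(1 - q N)^l*mU" for l
  proof (induction l)
   case 0 then show ?case unfolding H_def mU_def by simp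
  next
   case (Suc l)
   define m where "m = N + l*L"
   have "l*L\<le>k*L" using Suc.prems by simp
   also have "\<dots>\<le>N" unfolding k_def by simp
   finally have m: "m\<le>2*N" "N\<le>m" unfolding m_def by auto
   define r where "r = c*(2*real N) powr - s/2^m"
   have rm: "r\<le>c*real m powr - s/2^m"
    unfolding r_def using c m N s by (intro divide_right_mono mult_left_mono powr_mono2') auto
   have "H (Suc l) = H l - G l" unfolding H_def by (auto simp: less_Suc_eq)
   moreover have "measure lborel (H l - G l)\<le>(1 - (r*2^m)^(CARD('n) - 1)/2)*measure lborel (H l)"
   proof (rule removal_step[where i = i and m = m])
    show "H l\<subseteq>slab" unfolding H_def by auto
    show "\<And>z w. z\<in>H l ==> cell i m w = cell i m z ==> w\<in>H l" unfolding m_def by (rule Hsat)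
    show "0\<le>r" unfolding r_def using c by simp
    have "c*(2*real N) powr - s\<le>1/8" using c P mult_mono[of c "1/8" "(2*real N) powr - s" 1] by simp
    then have "c*(2*real N) powr - s/2^m\<le>1/8/2^m" by (intro divide_right_mono) auto
    then show "r\<le>1/(8*2^m)" unfolding r_def by simp
    have "1/2^L/2^m\<le>c*(2*real N) powr - s/2/2^m" using L2 by (intro divide_right_mono) auto
    then have rL: "1/2^(m + L)\<le>r/2" unfolding r_def by (simp add: power_add mult.commute)
    show "G l\<in>sets lborel" by (rule Gm)
    fix z :: "real^'n" assume z: "\<forall>j. \<bar>z$j\<bar>\<le>2"
    have "m0\<le>m" using N m by simp
    from m0[OF this z] obtain \<zeta> where z1: "\<forall>j. j\<noteq>i --> \<bar>\<zeta>$j - z$j\<bar>\<le>1/(8*2^m)"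
     and z2: "\<And>w. (\<forall>j. j\<noteq>i --> \<bar>w$j - \<zeta>$j\<bar>\<le>c*real m powr - s/2^m) ==> hit1 w"
     unfolding near_hits_def hit1_def by (elim exE conjE) simp
    have "w\<in>G l" if w: "w\<in>slab" "\<forall>j. j\<noteq>i --> \<bar>w$j - \<zeta>$j\<bar>\<le>r/2" for w
     unfolding G_def m_def[symmetric]
    proof (intro CollectI conjI w(1) allI impI z2)
     \<comment> \<open>\<open>w'\<close> lies in the fine cell of \<open>w\<close>, so it is within
       r/2 of \<open>w\<close>, and \<open>w\<close> is within r/2 of the centre of the box.\<close>
     fix w' j assume c': "cell i (m + L) w' = cell i (m + L) w" and j: "j\<noteq>i"
     have "\<bar>w$j - \<zeta>$j\<bar>\<le>r/2" using w(2) j by blast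
     then show "\<bar>w'$j - \<zeta>$j\<bar>\<le>c*real m powr - s/2^m" using cell_close[OF c' j] rL rm by linarith
    qed
    with z1 show "\<exists>\<zeta>. (\<forall>j. j\<noteq>i --> \<bar>\<zeta>$j - z$j\<bar>\<le>1/(8*2^m)) \<and>
     (\<forall>w\<in>slab. (\<forall>j. j\<noteq>i --> \<bar>w$j - \<zeta>$j\<bar>\<le>r/2) --> w\<in>G l)"
     by (intro exI[of _ \<zeta>] conjI) simp_all
   qed
   moreover have "(r*2^m)^(CARD('n) - 1)/2 = q N" unfolding qe r_def p_def by simp
   ultimately have "measure lborel (H (Suc l))\<le>(1 - q N) * measure lborel (H l)" by (simp only:)
   also have "\<dots>\<le>(1 - q N) * ((1 - q N)^l*mU)" using Suc q1 by (intro mult_left_mono) auto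
   finally show ?case by (simp add: mult_ac)
  qed
  then have "measure lborel (H k)\<le>(1 - q N)^k*mU" by simp
  also have "\<dots>\<le>exp (- K) * mU"
  proof (rule mult_right_mono[OF _ mU0])
   have "(1 - q N)^k\<le>exp (- q N)^k" using q1 exp_ge_add_one_self[of "- q N"] by (intro power_mono) auto
   also have "\<dots> = exp (- (q N*k))" by (simp add: exp_of_nat_mult[symmetric] mult.commute)
   also have "\<dots>\<le>exp (- K)" using N(1) mult_left_mono[OF k q0] by simp
   finally show "(1 - q N)^k\<le>exp (- K)" .
  qed
  also have "exp (- K) = e/(mU + 1)" unfolding K_def using e mU0 by (simp add: exp_minus)
  also have "e/(mU + 1)*mU < e" using e mU0 by (simp add: field_simps)
  finally have me: "measure lborel (H k) < e" .
  have "{z. (\<forall>j. \<bar>z$j\<bar>\<le>1) \<and> \<not> hit1 z}\<subseteq>H k"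
  proof
   fix z assume z: "z\<in>{z. (\<forall>j. \<bar>z$j\<bar>\<le>1) \<and> \<not> hit1 z}"
   have "- 2\<le>z$j \<and> z$j < 2" for j using z by (auto dest!: spec[of _ j])
   then have "z\<in>slab" unfolding slab_def by blast
   moreover have "z \<notin> G l" for l using z unfolding G_def by auto
   ultimately show "z\<in>H k" unfolding H_def by blast
  qed
  moreover have "H k\<in>lmeasurable" using Hm[of k] by (simp add: fmeasurable_def)
  moreover have "measure lebesgue (H k) = measure lborel (H k)" using Hm[of k] by (intro measure_completion) (auto dest: fmeasurableD)
  ultimately show "\<exists>S. {z. (\<forall>j. \<bar>z$j\<bar>\<le>1) \<and> \<not> (\<exists>t\<ge>T. hits Q s (sgn (gno i z)) t)}\<subseteq>S \<and> S\<in>lmeasurable \<and> measure lebesgue S < e"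
   using me unfolding hit1_def by (intro exI[of _ "H k"]) simp
 qed
 have "negligible (\<Union>T::nat. {z. (\<forall>j. \<bar>z$j\<bar>\<le>1) \<and> \<not> (\<exists>t\<ge>real T. hits Q s (sgn (gno i z)) t)})"
 proof (rule negligible_countable_Union)
  fix S assume "S\<in>range (\<lambda>T::nat. {z. (\<forall>j. \<bar>z$j\<bar>\<le>1) \<and> \<not> (\<exists>t\<ge>real T. hits Q s (sgn (gno i z)) t)})"
  then show "negligible S" using main by (elim rangeE) (simp only:)
 qed simp
 then show ?thesis
 proof (rule negligible_subset, intro subsetI)
  fix z assume "z\<in>{z. (\<forall>j. \<bar>z$j\<bar>\<le>1) \<and> \<not> (\<forall>T. \<exists>t\<ge>T. hits Q s (sgn (gno i z)) t)}"
  then obtain T where z: "\<forall>j. \<bar>z$j\<bar>\<le>1" and T: "\<not> (\<exists>t\<ge>T. hits Q s (sgn (gno i z)) t)" by blast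
  have "T\<le>real (nat \<lceil>T\<rceil>)" by linarith
  then have "\<not> (\<exists>t\<ge>real (nat \<lceil>T\<rceil>). hits Q s (sgn (gno i z)) t)" using T order_trans by blast
  then show "z\<in>(\<Union>T::nat. {z. (\<forall>j. \<bar>z$j\<bar>\<le>1) \<and> \<not> (\<exists>t\<ge>real T. hits Q s (sgn (gno i z)) t)})" using z by blast
 qed
qed

definition good_direction :: "(real^'n::finite) set => real^'n => bool" where
 "good_direction Q \<theta> \<longleftrightarrow>
   (\<forall>s>1/(real CARD('n) - 1). \<exists>T. \<forall>t\<ge>T. \<not> hits Q s \<theta> t) \<and>
   (\<forall>s. 0 < s \<and> s < 1/(real CARD('n) - 1) --> (\<forall>T. \<exists>t\<ge>T. hits Q s \<theta> t))"

lemma hits_mono: "hits Q s' \<theta> t ==> s\<le>s' ==> 1\<le>t ==> hits Q s \<theta> t"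
proof -
 assume h: "hits Q s' \<theta> t" and "s\<le>s'" "1\<le>t"
 then have "t powr - s'\<le>t powr - s" by (intro powr_mono) auto
 then have "sqrt (1 + (t powr - s')\<^sup>2)\<le>sqrt (1 + (t powr - s)\<^sup>2)" by (simp add: power_mono)
 then show ?thesis using h unfolding hits_def by (meson less_le_trans)
qed

lemma hits_uminus: "hits (uminus ` Q) s \<theta> t \<longleftrightarrow> hits Q s (- \<theta>) t"
 unfolding hits_def by (simp add: hB_def)

lemma good_direction_uminus: "good_direction (uminus ` Q) \<theta> \<longleftrightarrow> good_direction Q (- \<theta>)"
 unfolding good_direction_def hits_uminus ..

text \<open>By \<open>hits_mono\<close> countably many exponents on both sides of \<open>a\<close>
  suffice. The shift by 2 keeps the lower ones positive.\<close>

lemma good_direction_countable: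
 fixes Q :: "(real^'n::finite) set"
 assumes n: "CARD('n) \<ge> 2" and a: "a = 1/(real CARD('n) - 1)"
  and up: "\<And>m::nat. \<not> (\<forall>T. \<exists>t\<ge>T. hits Q (a*(1 + 1/(real m + 2))) \<theta> t)"
  and low: "\<And>m::nat. \<forall>T. \<exists>t\<ge>T. hits Q (a*(1 - 1/(real m + 2))) \<theta> t"
 shows "good_direction Q \<theta>"
 unfolding good_direction_def a[symmetric]
proof (intro conjI allI impI)
 have a0: "0 < a" unfolding a using n by simp
 have arch: "\<exists>m::nat. a*(1/(real m + 2))\<le>d" if "0 < d" for d
 proof -
  obtain m :: nat where m: "a/d < m" using reals_Archimedean2 by blast
  have "a\<le>d*(real m + 2)" using m that by (simp add: field_simps)
  then show ?thesis by (intro exI[of _ m]) (simp add: field_simps)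
 qed
 show "\<exists>T. \<forall>t\<ge>T. \<not> hits Q s \<theta> t" if s: "a < s" for s
 proof -
  have "0 < s - a" using s by simp
  from arch[OF this] obtain m :: nat where m: "a*(1/(real m + 2))\<le>s - a" by blast
  obtain T where T: "\<forall>t\<ge>T. \<not> hits Q (a*(1 + 1/(real m + 2))) \<theta> t" using up[of m] by blast
  have "\<not> hits Q s \<theta> t" if "max T 1\<le>t" for t
   using T that hits_mono[of Q s \<theta> t "a*(1 + 1/(real m + 2))"] m by (auto simp: algebra_simps)
  then show ?thesis by blast
 qed
 show "\<exists>t\<ge>T. hits Q s \<theta> t" if s: "0 < s \<and> s < a" for s T
 proof -
  have "0 < a - s" using s by simp
  from arch[OF this] obtain m :: nat where m: "a*(1/(real m + 2))\<le>a - s" by blast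
  obtain t where "max T 1\<le>t" "hits Q (a*(1 - 1/(real m + 2))) \<theta> t" using low[of m] by blast
  then show ?thesis
   using hits_mono[of Q "a*(1 - 1/(real m + 2))" \<theta> t s] m by (auto simp: algebra_simps)
 qed
qed

lemma good_direction_gno:
 fixes Q :: "(real^'n::finite) set"
 assumes sep: "\<And>q q'. q\<in>Q ==> q'\<in>Q ==> q\<noteq>q' ==> C0\<le>hB q q'" and C0: "1 < C0"
  and dense: "\<And>h. \<exists>q\<in>Q. hB h q\<le>C1" and n: "CARD('n) \<ge> 2"
 shows "negligible {z. (\<forall>j. \<bar>z$j\<bar>\<le>1) \<and> \<not> good_direction Q (sgn (gno i z))}"
proof -
 define a where "a = 1/(real CARD('n) - 1)"
 have a0: "0 < a" and an: "a*(real CARD('n) - 1) = 1" unfolding a_def using n by auto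
 define U where "U m = {z. (\<forall>j. \<bar>z$j\<bar>\<le>1) \<and> (\<forall>T. \<exists>t\<ge>T. hits Q (a*(1 + 1/(real m + 2))) (sgn (gno i z)) t)}" for m :: nat
 define V where "V m = {z. (\<forall>j. \<bar>z$j\<bar>\<le>1) \<and> \<not> (\<forall>T. \<exists>t\<ge>T. hits Q (a*(1 - 1/(real m + 2))) (sgn (gno i z)) t)}" for m :: nat
 have "negligible (U m)" for m
  unfolding U_def
 proof (rule rarely_hits[OF sep C0 n])
  have e: "a*(1 + 1/(real m + 2))*(real CARD('n) - 1) = 1 + 1/(real m + 2)" using an by (metis mult.assoc mult.commute mult.left_neutral)
  show "1 < a*(1 + 1/(real m + 2))*(real CARD('n) - 1)" unfolding e by simp
 qed
 moreover have "negligible (V m)" for m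
  unfolding V_def
 proof (rule often_hits[OF dense n])
  have e: "a*(1 - 1/(real m + 2))*(real CARD('n) - 1) = 1 - 1/(real m + 2)" using an by (metis mult.assoc mult.commute mult.left_neutral)
  show "a*(1 - 1/(real m + 2))*(real CARD('n) - 1) < 1" unfolding e by simp
  show "0 < a*(1 - 1/(real m + 2))" using a0 by (intro mult_pos_pos) (auto simp: field_simps)
 qed
 ultimately have "negligible ((\<Union>m. U m)\<union>(\<Union>m. V m))"
  by (intro negligible_Un negligible_countable_Union) auto
 moreover have "{z. (\<forall>j. \<bar>z$j\<bar>\<le>1) \<and> \<not> good_direction Q (sgn (gno i z))}\<subseteq>(\<Union>m. U m)\<union>(\<Union>m. V m)"
 proof (rule subsetI, rule ccontr)
  fix z assume z: "z\<in>{z. (\<forall>j. \<bar>z$j\<bar>\<le>1) \<and> \<not> good_direction Q (sgn (gno i z))}" and nz: "z \<notin> (\<Union>m. U m)\<union>(\<Union>m. V m)"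
  have "good_direction Q (sgn (gno i z))"
  proof (rule good_direction_countable[OF n a_def])
   fix m
   have "z \<notin> U m" "z \<notin> V m" using nz by blast+
   then show "\<not> (\<forall>T. \<exists>t\<ge>T. hits Q (a*(1 + 1/(real m + 2))) (sgn (gno i z)) t)"
    "\<forall>T. \<exists>t\<ge>T. hits Q (a*(1 - 1/(real m + 2))) (sgn (gno i z)) t"
    using z unfolding U_def V_def by blast+
  qed
  then show False using z by blast
 qed
 ultimately show ?thesis by (rule negligible_subset)
qed

text \<open>Every nonzero vector is a multiple of a point on a face of the cube, for a face on which
  its component is largest in absolute value. The bad vectors are thus covered by countably many
  smooth images of null sets.\<close>

lemma good_direction_ae:
 fixes Q :: "(real^'n::finite) set"
 assumes sep: "\<And>q q'. q\<in>Q ==> q'\<in>Q ==> q\<noteq>q' ==> C0\<le>hB q q'" and C0: "1 < C0"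
  and dense: "\<And>h. \<exists>q\<in>Q. hB h q\<le>C1" and n: "CARD('n) \<ge> 2"
 shows "negligible {y. \<not> good_direction Q (sgn y)}"
proof -
 \<comment> \<open>\<open>gno\<close> describes directions with positive component \<open>i\<close>;
   the opposite ones are obtained by reflecting \<open>Q\<close>.\<close>
 define Z where "Z i = {z. (\<forall>j. \<bar>z$j\<bar>\<le>1) \<and> \<not> good_direction Q (sgn (gno i z))}
 \<union>{z. (\<forall>j. \<bar>z$j\<bar>\<le>1) \<and> \<not> good_direction (uminus ` Q) (sgn (gno i z))}" for i
 have hBm: "hB (- x) (- y) = hB x y" for x y :: "real^'n" unfolding hB_def by simp
 have Z: "negligible (Z i)" for i
  unfolding Z_def
 proof (rule negligible_Un)
  show "negligible {z. (\<forall>j. \<bar>z$j\<bar>\<le>1) \<and> \<not> good_direction Q (sgn (gno i z))}" by (rule good_direction_gno[OF sep C0 dense n])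
  show "negligible {z. (\<forall>j. \<bar>z$j\<bar>\<le>1) \<and> \<not> good_direction (uminus ` Q) (sgn (gno i z))}"
  proof (rule good_direction_gno[OF _ C0 _ n])
   show "\<And>q q'. q\<in>uminus ` Q ==> q'\<in>uminus ` Q ==> q\<noteq>q' ==> C0\<le>hB q q'" using sep by (auto simp: hBm)
   fix h
   obtain q where "q\<in>Q" "hB (- h) q\<le>C1" using dense by blast
   then show "\<exists>q\<in>uminus ` Q. hB h q\<le>C1" using hBm[of h "- q"] by (intro bexI[of _ "- q"]) auto
  qed
 qed
 \<comment> \<open>The dummy coordinate is put to use: \<open>N\<close> times its value is the scale
   of the vector \<open>gno i z\<close>. The integer \<open>N\<close> is there because
   \<open>z\<close> ranges over a bounded cube.\<close>
 define \<Psi> where "\<Psi> i N z = (real N*z$i) *\<^sub>R (z + (1 - z$i) *\<^sub>R axis i 1)" for i N and z :: "real^'n"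
 have "negligible (\<Psi> i N ` Z i)" for i N
 proof (rule negligible_differentiable_image_negligible[OF _ Z])
  have "\<Psi> i N differentiable (at z)" for z
   unfolding \<Psi>_def[abs_def]
   by (intro differentiable_scaleR differentiable_mult differentiable_add differentiable_diff differentiable_const
     differentiable_ident bounded_linear_imp_differentiable[OF bounded_linear_vec_nth])
  then show "\<Psi> i N differentiable_on Z i" unfolding differentiable_on_def using differentiable_at_withinI by blast
 qed simp
 then have "negligible (insert 0 (\<Union>i. \<Union>N. \<Psi> i N ` Z i))"
  by (intro negligible_insert[THEN iffD2] negligible_Union negligible_countable_Union) (auto intro!: negligible_countable_Union)
 then show ?thesis
 proof (rule negligible_subset, intro subsetI)
  fix y :: "real^'n" assume y: "y\<in>{y. \<not> good_direction Q (sgn y)}"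
  show "y\<in>insert 0 (\<Union>i. \<Union>N. \<Psi> i N ` Z i)"
  proof (cases "y = 0")
   case False
   define R where "R = range (\<lambda>j. \<bar>y$j\<bar>)"
   have R: "finite R" "R\<noteq>{}" unfolding R_def by auto
   then obtain i where "Max R = \<bar>y$i\<bar>" using Max_in[OF R] unfolding R_def by blast
   then have i: "\<bar>y$j\<bar>\<le>\<bar>y$i\<bar>" for j using Max_ge[OF R(1), of "\<bar>y$j\<bar>"] unfolding R_def by simp
   have yi: "y$i\<noteq>0" using False i by (auto simp: vec_eq_iff)
   obtain N :: nat where N: "\<bar>y$i\<bar> < N" using reals_Archimedean2 by blast
   define z where "z = (\<chi> j. if j = i then y$i/N else y$j/y$i)"
   have yz: "y = y$i *\<^sub>R gno i z" unfolding z_def by (simp add: vec_eq_iff gno_nth yi)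
   have zj: "\<bar>z$j\<bar>\<le>1" for j unfolding z_def using i[of j] N yi by (simp add: abs_divide divide_le_eq)
   have s: "sgn y = sgn (y$i) *\<^sub>R sgn (gno i z)" by (subst yz) (rule sgn_scaleR)
   have "z\<in>Z i"
   proof (cases "0 < y$i")
    case True then show ?thesis using y zj s unfolding Z_def by simp
   next
    case False
    then have "sgn y = - sgn (gno i z)" using yi s by simp
    then show ?thesis using y zj unfolding Z_def good_direction_uminus by simp
   qed
   moreover have "y = \<Psi> i N z"
   proof -
    have "z + (1 - z$i) *\<^sub>R axis i 1 = gno i z" by (simp add: vec_eq_iff gno_nth axis_def)
    moreover have "real N*z$i = y$i" unfolding z_def using N by simp
    ultimately show ?thesis unfolding \<Psi>_def using yz by simp
   qed
   ultimately show ?thesis by blast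
  qed simp
 qed
qed

section \<open>Excursions of the geodesic flow\<close>

lemma linear_dhtr: "linear (dhtr y x)"
 unfolding dhtr_def[abs_def] hzd_def
 by (intro linearI) (simp_all add: inner_add_left inner_add_right add_divide_distrib algebra_simps)

locale developed_manifold = compact_hyp_manifold M x0 for M :: "('a, 'n::finite) riem" and x0 :: 'a +
 fixes F :: "real^'n => 'a" and c0 :: "('a, 'n) chart" and \<rho> :: real and J :: "real^'n => 'a" and B \<phi> \<xi> \<eta>
 assumes F: "liso UNIV F" and c0: "c0\<in>man_atlas M" and ad: "adapted c0 x0 \<rho> J B \<phi> \<xi> \<eta>"
  and FJ: "\<And>z. z\<in>ball 0 \<rho> ==> F z = J z"
begin

lemma rho: "0 < \<rho>" and paramJ: "param \<rho> J" and J0: "J 0 = x0"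
 using adaptedD[OF ad] by auto

lemma F0: "F 0 = x0"
 using FJ[of 0] rho J0 by simp

lemma F_onto: "range F = topspace X"
 by (rule orbit_dense(1)[OF F F0])

text \<open>The radius is cut off at \<open>\<rho>\<close>, so that the set lies in the parametrised
  ball for every \<open>r\<close>; in the limit only small radii matter.\<close>

definition nbhd :: "real => 'a set" where
 "nbhd r = J ` ball 0 (min r \<rho>)"

lemma nbhd_open: "openin X (nbhd r)"
 unfolding nbhd_def using paramJ unfolding param_def by (meson ball_subset_ball_iff min.cobounded2 open_ball subset_ball)

lemma nbhd_iff: "0 < r ==> F h\<in>nbhd r \<longleftrightarrow> (\<exists>q. F q = x0 \<and> hB h q < sqrt (1 + (min r \<rho>)\<^sup>2))"
 unfolding nbhd_def using rho by (intro orbit_local(2)[OF F paramJ J0]) auto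

lemma dist_nbhd: "p\<in>nbhd r ==> riem_dist M p x0\<le>r"
proof -
 assume "p\<in>nbhd r"
 then obtain z where z: "z\<in>ball 0 (min r \<rho>)" "p = J z" unfolding nbhd_def by blast
 have "F z = p" using FJ[of z] z by simp
 then have "riem_dist M p x0\<le>norm (0 - z)" using riem_dist_upper(2)[OF F, of z 0] F0 by simp
 then show ?thesis using z by simp
qed

lemma dist_outside_nbhd: "p\<in>topspace X ==> p \<notin> nbhd r ==> 0 < r ==> r < \<rho> ==> r\<le>1 ==> r/2\<le>riem_dist M p x0"
proof -
 assume p: "p\<in>topspace X" "p \<notin> nbhd r" and r: "0 < r" "r < \<rho>" "r\<le>1"
 obtain h where h: "p = F h" using p(1) F_onto by blast
 have "F h \<notin> J ` ball 0 r" using p(2) r unfolding nbhd_def h by simp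
 then have "r/2\<le>riem_dist M (F h) (F 0)"
  by (rule riem_dist_lower[OF F c0 ad[folded F0] r])
 then show ?thesis unfolding h F0 .
qed

definition exponent :: real where
 "exponent = 1/(real CARD('n) - 1)"

lemma exponent_pos: "0 < exponent"
 unfolding exponent_def using card by simp

definition visits :: "real => real => ('a, 'n) tvec set" where
 "visits s T = {v\<in>unit_tangent_bundle M. \<exists>t>T. base_point (geodesic_flow M t v)\<in>nbhd (t powr - s)}"

text \<open>Countably many conditions on visits after integer times, which makes measurability
  accessible. They are stated with balls about \<open>x0\<close> in the parametrisation, comparable
  to metric balls up to a factor.\<close>

definition generic :: "('a, 'n) tvec => bool" where
 "generic v \<longleftrightarrow> v\<in>unit_tangent_bundle M \<and>
   (\<forall>m::nat. \<exists>T::nat. v \<notin> visits (exponent * (1 + 1/(real m + 2))) (real T)) \<and>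
   (\<forall>m T::nat. v\<in>visits (exponent * (1 - 1/(real m + 2))) (real T))"

lemma exponent_approx:
 assumes "0 < d"
 shows "\<exists>m::nat. exponent * (1/(real m + 2))\<le>d"
proof -
 obtain m :: nat where m: "exponent/d < m" using reals_Archimedean2 by blast
 have "exponent\<le>d*(real m + 2)" using m assms by (simp add: field_simps)
 then show ?thesis by (intro exI[of _ m]) (simp add: field_simps)
qed

text \<open>A visit gives distance at most t^-s and its absence gives distance at least t^-s / 2;
  the factor 2 disappears after division by \<open>ln t\<close>.\<close>

lemma generic_Limsup:
 assumes v: "generic v"
 shows "Limsup at_top (\<lambda>t::real. neg_log (riem_dist M (base_point (geodesic_flow M t v)) x0)/ereal (ln t)) = ereal exponent"
  (is "Limsup at_top ?f = _")
proof -
 have vU: "v\<in>unit_tangent_bundle M" using v unfolding generic_def by blast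
 then obtain h w where hw: "v = TF F h w" "gH h w w = 1" unfolding unit_tangent_bundle_TF[OF F F_onto] by blast
 define p where "p t = base_point (geodesic_flow M t v)" for t
 have pX: "p t\<in>topspace X" for t
  unfolding p_def hw(1) base_point_flow[OF F hw(2)] using liso_topspace[OF F] by blast
 have up: "Limsup at_top ?f\<le>ereal b" if b: "exponent < b" for b
 proof -
  \<comment> \<open>Half of the gap between \<open>exponent\<close> and \<open>b\<close> is spent on
    \<open>s\<close>, the other half on ln 2 / ln t, which is at most \<open>d\<close> for late
    times.\<close>
  define d where "d = (b - exponent)/2"
  have d: "0 < d" unfolding d_def using b by simp
  obtain m :: nat where m: "exponent * (1/(real m + 2))\<le>d" using exponent_approx[OF d] by blast
  define s where "s = exponent * (1 + 1/(real m + 2))"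
  have "s = exponent + exponent * (1/(real m + 2))" unfolding s_def by (simp add: distrib_left)
  moreover have "0 < exponent * (1/(real m + 2))" using exponent_pos by simp
  moreover have "b = exponent + 2*d" unfolding d_def by (simp add: field_simps)
  ultimately have s: "0 < s" "s + d\<le>b" using m exponent_pos by linarith+
  obtain T :: nat where "v \<notin> visits s (real T)" using v unfolding generic_def s_def by blast
  then have out: "p t \<notin> nbhd (t powr - s)" if "real T < t" for t using vU that unfolding visits_def p_def by blast
  have "((\<lambda>t. t powr - s) \<longlongrightarrow> 0) at_top" using s by (intro tendsto_neg_powr filterlim_ident) auto
  then have "eventually (\<lambda>t. t powr - s < min \<rho> 1) at_top" using rho by (intro order_tendstoD) auto
  moreover have "eventually (\<lambda>t::real. t > max (real T) 1) at_top" by (rule eventually_gt_at_top)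
  moreover have "eventually (\<lambda>t::real. t > exp (ln 2/d)) at_top" by (rule eventually_gt_at_top)
  ultimately have "eventually (\<lambda>t. ?f t\<le>ereal b) at_top"
  proof eventually_elim
   fix t :: real assume t: "t powr - s < min \<rho> 1" "max (real T) 1 < t" "exp (ln 2/d) < t"
   define r where "r = riem_dist M (p t) x0"
   have t0: "0 < t powr - s" using t by simp
   have r: "t powr - s/2\<le>r" unfolding r_def using t t0 out[of t] by (intro dist_outside_nbhd pX) auto
   then have r0: "0 < r" using t0 by linarith
   have "ln (t powr - s/2)\<le>ln r" using r t0 r0 by (subst ln_le_cancel_iff) auto
   moreover have "ln (t powr - s/2) = - s*ln t - ln 2" using t t0 by (subst ln_div) (auto simp: ln_powr)
   moreover have lt: "0 < ln t" using t by simp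
   moreover have "ln 2\<le>d*ln t"
   proof -
    have "ln (exp (ln 2/d)) < ln t" using t by (subst ln_less_cancel_iff) auto
    then have "ln 2/d < ln t" by simp
    then show ?thesis using d by (simp add: field_simps)
   qed
   ultimately have "- ln r\<le>(s + d) * ln t" by (simp add: algebra_simps)
   also have "\<dots>\<le>b*ln t" using s lt by (intro mult_right_mono) auto
   finally have "- ln r/ln t\<le>b" using lt pos_divide_le_eq[OF lt, of "- ln r" b] by simp
   then show "?f t\<le>ereal b" unfolding p_def[symmetric] r_def[symmetric] neg_log_def using r0 lt by simp
  qed
  then show ?thesis by (rule Limsup_bounded)
 qed
 have low: "ereal b\<le>Limsup at_top ?f" if b: "b < exponent" for b
 proof (rule ccontr)
  assume "\<not> ereal b\<le>Limsup at_top ?f"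
  then have "eventually (\<lambda>t. ?f t < ereal b) at_top" by (intro Limsup_lessD) simp
  then obtain T where T: "\<And>t. T\<le>t ==> ?f t < ereal b" unfolding eventually_at_top_linorder by blast
  have "0 < exponent - b" using b by simp
  from exponent_approx[OF this] obtain m :: nat where m: "exponent * (1/(real m + 2))\<le>exponent - b" by blast
  define s where "s = exponent * (1 - 1/(real m + 2))"
  have s: "b\<le>s" unfolding s_def using m by (simp add: algebra_simps)
  define K where "K = nat \<lceil>max T 2\<rceil>"
  have "v\<in>visits s (real K)" using v unfolding generic_def s_def by blast
  then obtain t where t: "real K < t" "p t\<in>nbhd (t powr - s)" unfolding visits_def p_def by blast
  have "max T 2\<le>real K" unfolding K_def by linarith
  then have t2: "T\<le>t" "2\<le>t" using t(1) by linarith+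
  define r where "r = riem_dist M (p t) x0"
  have r: "r\<le>t powr - s" unfolding r_def by (rule dist_nbhd[OF t(2)])
  have rn: "0\<le>r" unfolding r_def riem_dist_def by simp
  have lt: "0 < ln t" using t2 by simp
  have "ereal b\<le>?f t"
   unfolding p_def[symmetric] r_def[symmetric] neg_log_def
  \<comment> \<open>At distance 0 the value is infinite, which is on the right side of a lower
    bound.\<close>
  proof (cases "r = 0")
   case True then show "ereal b\<le>(if r = 0 then \<infinity> else ereal (- ln r))/ereal (ln t)" using lt by simp
  next
   case False
   then have "ln r\<le>ln (t powr - s)" using r rn by (subst ln_le_cancel_iff) auto
   then have "s*ln t\<le>- ln r" using t2 by (simp add: ln_powr)
   moreover have "b*ln t\<le>s*ln t" using s lt by (intro mult_right_mono) auto
   ultimately have "b\<le>- ln r/ln t" using pos_le_divide_eq[OF lt, of b "- ln r"] by linarith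
   then show "ereal b\<le>(if r = 0 then \<infinity> else ereal (- ln r))/ereal (ln t)" using False lt by simp
  qed
  then show False using T[OF t2(1)] by simp
 qed
 show ?thesis
 proof (rule antisym)
  show "Limsup at_top ?f\<le>ereal exponent"
  proof (rule dense_ge)
   fix y assume "ereal exponent < y" then show "Limsup at_top ?f\<le>y" by (cases y) (auto intro: up)
  qed
  show "ereal exponent\<le>Limsup at_top ?f"
  proof (rule dense_le)
   fix y assume "y < ereal exponent" then show "y\<le>Limsup at_top ?f" by (cases y) (auto intro: low)
  qed
 qed
qed

text \<open>The boost that takes the origin to \<open>h\<close> turns the geodesics from
  \<open>h\<close> into the rays from the origin, so \<open>good_direction_ae\<close> applies to the
  fibre moved back by that boost.\<close>

lemma generic_directions:
 "negligible {u. u\<noteq>0 \<and> \<not> generic (TF F h (dhtr h 0 (sgn u)))}"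
proof -
 \<comment> \<open>Separation and coboundedness are invariant under the boost, with the same
   constants for all \<open>h\<close>.\<close>
 define Q where "Q = htr (- h) ` {q. F q = x0}"
 have sep: "sqrt (1 + \<rho>\<^sup>2)\<le>hB q q'" if q: "q\<in>Q" "q'\<in>Q" "q\<noteq>q'" for q q'
 proof -
  obtain p p' where p: "F p = x0" "F p' = x0" "q = htr (- h) p" "q' = htr (- h) p'" using q(1,2) unfolding Q_def by blast
  then have "p\<noteq>p'" using q(3) by blast
  from orbit_local(1)[OF F paramJ J0 p(1,2) this] show ?thesis unfolding p(3,4) hB_htr .
 qed
 obtain D where D: "\<And>h. \<exists>q. F q = x0 \<and> hB h q\<le>D" using orbit_dense(2)[OF F F0] by blast
 have dense: "\<exists>q\<in>Q. hB g q\<le>D" for g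
 proof -
  obtain q where q: "F q = x0" "hB (htr h g) q\<le>D" using D by blast
  have "hB (htr h g) q = hB g (htr (- h) q)" using hB_htr[of "- h" "htr h g" q] by simp
  then show ?thesis using q unfolding Q_def by (intro bexI[of _ "htr (- h) q"]) auto
 qed
 have "1 < sqrt (1 + \<rho>\<^sup>2)" using rho by simp
 from good_direction_ae[OF sep this dense card]
 have "negligible {u. \<not> good_direction Q (sgn u)}" .
 then show ?thesis
 proof (rule negligible_subset, intro subsetI CollectI)
  fix u :: "real^'n" assume u: "u\<in>{u. u\<noteq>0 \<and> \<not> generic (TF F h (dhtr h 0 (sgn u)))}"
  show "\<not> good_direction Q (sgn u)"
  proof
   assume good: "good_direction Q (sgn u)"
   define w v where "w = dhtr h 0 (sgn u)" and "v = TF F h w"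
   have u1: "sgn u \<bullet> sgn u = 1" using u by (simp add: norm_sgn flip: norm_eq_1)
   have g1: "gH h w w = 1" using gH_dhtr[of h 0 "sgn u" "sgn u"] u1 unfolding w_def by simp
   have geo: "geo h w t = htr h (sinh t *\<^sub>R sgn u)" for t
    using htr_geodesic[of 0 "sgn u" h t] u1 unfolding geo_def w_def by simp
   have hitiff: "(\<exists>q. F q = x0 \<and> hB (geo h w t) q < C) \<longleftrightarrow> (\<exists>q\<in>Q. hB (sinh t *\<^sub>R sgn u) q < C)" for t C
   proof -
    have "hB (geo h w t) q = hB (sinh t *\<^sub>R sgn u) (htr (- h) q)" for q
     unfolding geo using hB_htr[of "- h" "htr h (sinh t *\<^sub>R sgn u)" q] by simp
    then show ?thesis unfolding Q_def by auto
   qed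
   have base: "base_point (geodesic_flow M t v) = F (geo h w t)" for t unfolding v_def by (rule base_point_flow[OF F g1])
   have vU: "v\<in>unit_tangent_bundle M" unfolding unit_tangent_bundle_TF[OF F F_onto] v_def using g1 by blast
   have vh: "hits Q s (sgn u) t" if "0 < t" "base_point (geodesic_flow M t v)\<in>nbhd (t powr - s)" for s t
   proof -
    have "0 < t powr - s" using that by simp
    from nbhd_iff[OF this] that have "\<exists>q. F q = x0 \<and> hB (geo h w t) q < sqrt (1 + (min (t powr - s) \<rho>)\<^sup>2)" unfolding base by blast
    then obtain q where q: "q\<in>Q" "hB (sinh t *\<^sub>R sgn u) q < sqrt (1 + (min (t powr - s) \<rho>)\<^sup>2)" unfolding hitiff by blast
    have "(min (t powr - s) \<rho>)\<^sup>2\<le>(t powr - s)\<^sup>2" using rho by (intro power_mono) auto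
    then have "sqrt (1 + (min (t powr - s) \<rho>)\<^sup>2)\<le>sqrt (1 + (t powr - s)\<^sup>2)" by simp
    then show ?thesis unfolding hits_def using q by (meson less_le_trans)
   qed
   have hv: "base_point (geodesic_flow M t v)\<in>nbhd (t powr - s)" if "hits Q s (sgn u) t" "0 < t" "t powr - s\<le>\<rho>" for s t
   proof -
    have "\<exists>q. F q = x0 \<and> hB (geo h w t) q < sqrt (1 + (min (t powr - s) \<rho>)\<^sup>2)"
     unfolding hitiff using that unfolding hits_def by (simp add: min_absorb1)
    moreover have "0 < t powr - s" using that by simp
    ultimately show ?thesis unfolding base using nbhd_iff by blast
   qed
   have "generic v"
    unfolding generic_def
   proof (intro conjI vU allI)
    fix m :: nat
    define s where "s = exponent * (1 + 1/(real m + 2))"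
    have "1/(real CARD('n) - 1) < s" unfolding s_def exponent_def[symmetric] using exponent_pos by (simp add: distrib_left)
    then obtain T where T: "\<forall>t\<ge>T. \<not> hits Q s (sgn u) t" using good unfolding good_direction_def by blast
    have "v \<notin> visits s (real (nat \<lceil>max T 0\<rceil>))"
    proof
     assume "v\<in>visits s (real (nat \<lceil>max T 0\<rceil>))"
     then obtain t where t: "real (nat \<lceil>max T 0\<rceil>) < t" "base_point (geodesic_flow M t v)\<in>nbhd (t powr - s)"
      unfolding visits_def by blast
     have "max T 0\<le>real (nat \<lceil>max T 0\<rceil>)" by linarith
     then have "T\<le>t" "0 < t" using t(1) by linarith+
     then show False using vh[OF _ t(2)] T by blast
    qed
    then show "\<exists>T::nat. v \<notin> visits (exponent * (1 + 1/(real m + 2))) (real T)" unfolding s_def by blast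
   next
    fix m T :: nat
    define s where "s = exponent * (1 - 1/(real m + 2))"
    have s: "0 < s" unfolding s_def using exponent_pos by (intro mult_pos_pos) (auto simp: field_simps)
    have "s < 1/(real CARD('n) - 1)" unfolding s_def exponent_def[symmetric] using exponent_pos by (simp add: algebra_simps)
    then have io: "\<exists>t\<ge>T'. hits Q s (sgn u) t" for T' using good s unfolding good_direction_def by blast
    have "((\<lambda>t. t powr - s) \<longlongrightarrow> 0) at_top" using s by (intro tendsto_neg_powr filterlim_ident) auto
    then have "eventually (\<lambda>t. t powr - s < \<rho>) at_top" using rho by (intro order_tendstoD) auto
    then obtain T1 where T1: "\<And>t. T1\<le>t ==> t powr - s < \<rho>" unfolding eventually_at_top_linorder by blast
    obtain t where t: "max T1 (real T + 1)\<le>t" "hits Q s (sgn u) t" using io by blast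
    have "base_point (geodesic_flow M t v)\<in>nbhd (t powr - s)" using t T1[of t] by (intro hv) auto
    then show "v\<in>visits (exponent * (1 - 1/(real m + 2))) (real T)"
     unfolding visits_def s_def[symmetric] using vU t(1) by (intro CollectI conjI exI[of _ t]) auto
   qed
   then show False using u unfolding v_def w_def by simp
  qed
 qed
qed

text \<open>The derivative of the boost followed by that of \<open>F\<close> is a linear isomorphism
  from Euclidean space to the fibre coordinates. It is isometric, so it respects radial projection,
  and it preserves null sets.\<close>

lemma generic_fibre:
 assumes c: "c\<in>man_atlas M" and x: "x\<in>chart_img c"
 shows "negligible {y. y\<noteq>0 \<and> \<not> generic (tangent_vector M c x (y /\<^sub>R sqrt (inner_at M c x y y)))}"
proof -
 obtain h where h: "F h\<in>chart_dom c" "x = chart_map c (F h)" using tangent_vector_TF[OF F F_onto c x] by blast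
 define D where "D = dcf c F h"
 have lD: "linear D" unfolding D_def by (rule has_derivative_linear[OF liso_has_derivative[OF F c UNIV_I h(1)]])
 have sD: "surj D" unfolding D_def by (rule dcf_surj[OF F c UNIV_I h(1)])
 define S where "S = dhtr h 0"
 have lS: "linear S" unfolding S_def by (rule linear_dhtr)
 have gS: "gH h (S u) (S u) = u \<bullet> u" for u using gH_dhtr[of h 0 u u] unfolding S_def by simp
 have "inj S"
 proof (rule linear_injective_0[THEN iffD2, OF lS], intro allI impI)
  fix u assume "S u = 0" then show "u = 0" using gS[of u] by (simp add: gH_def hzd_def)
 qed
 then have sS: "surj S" by (rule linear_inj_imp_surj[OF lS])
 have "negligible ((D \<circ> S) ` {u. u\<noteq>0 \<and> \<not> generic (TF F h (dhtr h 0 (sgn u)))})"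
  by (rule negligible_differentiable_image_negligible[OF _ generic_directions linear_imp_differentiable_on[OF linear_compose[OF lS lD]]]) simp
 then show ?thesis
 proof (rule negligible_subset, intro subsetI)
  fix y assume y: "y\<in>{y. y\<noteq>0 \<and> \<not> generic (tangent_vector M c x (y /\<^sub>R sqrt (inner_at M c x y y)))}"
  obtain u where u: "y = D (S u)" using comp_surj[OF sS sD] unfolding surj_def by auto
  have u0: "u\<noteq>0" using y u linear_0[OF lS] linear_0[OF lD] by auto
  have "inner_at M c x y y = u \<bullet> u"
   unfolding h(2) u D_def liso_isometry[OF F c UNIV_I h(1)] by (rule gS)
  then have "y /\<^sub>R sqrt (inner_at M c x y y) = y /\<^sub>R norm u" by (simp add: norm_eq_sqrt_inner)
  also have "\<dots> = D (S (sgn u))" unfolding sgn_div_norm u linear_scale[OF lS] linear_scale[OF lD] ..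
  finally have "tangent_vector M c x (y /\<^sub>R sqrt (inner_at M c x y y)) = TF F h (S (sgn u))"
   unfolding D_def h(2) by (simp only: TF_tangent_vector[OF F c h(1)])
  then show "y\<in>(D \<circ> S) ` {u. u\<noteq>0 \<and> \<not> generic (TF F h (dhtr h 0 (sgn u)))}"
   using y u u0 unfolding S_def by auto
 qed
qed

end

text \<open>A measure that dominates every measure with the null set \<open>N\<close> gives an upper bound for a supremum of measures.\<close>

lemma AE_SUP_measure:
 fixes A :: "'b measure"
 assumes I: "I\<noteq>{}" and sets: "\<And>i. i\<in>I ==> sets (\<mu> i) = sets A"
  and P: "{x\<in>space A. P x}\<in>sets A" and ae: "\<And>i. i\<in>I ==> AE x in \<mu> i. P x"
 shows "AE x in (SUP i\<in>I. \<mu> i). P x"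
proof -
 define N where "N = {x\<in>space A. \<not> P x}"
 have N: "N\<in>sets A" unfolding N_def using P by (rule sets.sets_Collect_neg)
 define \<nu> where "\<nu> = measure_of (space A) (sets A) (\<lambda>B. if B\<subseteq>N then 0 else top :: ennreal)"
 have s\<nu>: "sets \<nu> = sets A" unfolding \<nu>_def by simp
 have e\<nu>: "emeasure \<nu> B = (if B\<subseteq>N then 0 else top)" if "B\<in>sets A" for B
  unfolding \<nu>_def
 proof (rule emeasure_measure_of_sigma[OF sets.sigma_algebra_axioms _ _ that])
  show "positive (sets A) (\<lambda>B. if B\<subseteq>N then 0 else top :: ennreal)" unfolding positive_def by simp
  show "countably_additive (sets A) (\<lambda>B. if B\<subseteq>N then 0 else top :: ennreal)"
  proof (rule countably_additiveI)
   fix C :: "nat => 'b set"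
   show "(\<Sum>i. if C i\<subseteq>N then 0 else top :: ennreal) = (if \<Union> (range C)\<subseteq>N then 0 else top)"
   proof (cases "\<Union> (range C)\<subseteq>N")
    case True
    then have "C i\<subseteq>N" for i by blast
    then show ?thesis using True by simp
   next
    case False
    then obtain i where "\<not> C i\<subseteq>N" by blast
    then have "(\<Sum>i. if C i\<subseteq>N then 0 else top :: ennreal) \<ge> top"
     using sum_le_suminf[of "\<lambda>i. if C i\<subseteq>N then 0 else top :: ennreal" "{i}"] by simp
    then show ?thesis using False by (simp add: top_unique)
   qed
  qed
 qed
 have "(SUP i\<in>I. \<mu> i)\<le>\<nu>"
 proof (rule SUP_least)
  fix i assume i: "i\<in>I"
  have "emeasure (\<mu> i) N = 0"
   using AE_iff_measurable[of N "\<mu> i" P] ae[OF i] N sets[OF i] sets_eq_imp_space_eq[OF sets[OF i]] unfolding N_def by simp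
  then have "emeasure (\<mu> i) B\<le>emeasure \<nu> B" if "B\<in>sets A" for B
   using e\<nu>[OF that] emeasure_mono[of B N "\<mu> i"] N sets[OF i] by (auto simp: top_greatest)
  then show "\<mu> i\<le>\<nu>" using sets[OF i] s\<nu> by (subst le_measure) auto
 qed
 moreover have sS: "sets (SUP i\<in>I. \<mu> i) = sets A" by (rule sets_SUP[OF sets I])
 ultimately have "emeasure (SUP i\<in>I. \<mu> i) N\<le>emeasure \<nu> N"
  using s\<nu> N by (subst (asm) le_measure) auto
 then have "emeasure (SUP i\<in>I. \<mu> i) N = 0" using e\<nu>[OF N] by simp
 then show ?thesis
  using AE_iff_measurable[of N "SUP i\<in>I. \<mu> i" P] N sS sets_eq_imp_space_eq[OF sS] unfolding N_def by simp
qed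

lemma negligible_AE_lborel: "negligible {x. \<not> P x} ==> AE x in lborel. P x"
 unfolding negligible_iff_null_sets null_sets_completion_iff2 by (auto intro: AE_I')

section \<open>Measurability and transfer to the Liouville measure\<close>

context developed_manifold begin

lemma TF_eq_gH: "TF F h w = TF F h' w' ==> gH h w w = gH h' w' w'"
proof -
 assume eq: "TF F h w = TF F h' w'"
 have "F h\<in>topspace X" using liso_topspace[OF F] by blast
 then obtain c where c: "c\<in>man_atlas M" "F h\<in>chart_dom c" using atlas_cover by blast
 have F': "F h = F h'" using eq unfolding TF_def by simp
 have "snd (TF F h w) c = snd (TF F h' w') c" using eq by simp
 then have d: "dcf c F h w = dcf c F h' w'" using c F' unfolding TF_def by simp
 have "gH h w w = inner_at M c (chart_map c (F h)) (dcf c F h w) (dcf c F h w)"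
  by (rule liso_isometry[OF F c(1) UNIV_I c(2), symmetric])
 also have "\<dots> = gH h' w' w'"
  unfolding d F' by (rule liso_isometry[OF F c(1) UNIV_I]) (use c(2) F' in simp)
 finally show ?thesis .
qed

text \<open>The map is continuous and, over a small set of base points, injective. As the derivative
  of \<open>F\<close> is only known to be continuous, openness comes from invariance of domain and
  not from an inverse function theorem.\<close>

lemma coordinates_open:
 assumes c: "c\<in>man_atlas M" and D: "open D" "\<And>h w. (h, w)\<in>D ==> F h\<in>chart_dom c"
 shows "open ((\<lambda>p. (chart_map c (F (fst p)), dcf c F (fst p) (snd p))) ` D)" (is "open (?\<Theta> ` D)")
proof (subst open_subopen, intro ballI)
 have cF: "continuous_on {h. F h\<in>chart_dom c} (\<lambda>h. chart_map c (F h))"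
  by (rule has_derivative_continuous_on[OF has_derivative_at_withinI[OF liso_has_derivative[OF F c UNIV_I]]]) simp
 have cD: "continuous_on {h. F h\<in>chart_dom c} (\<lambda>h. dcf c F h u)" for u
  using C1_on_frechet(2)[OF liso_C1[OF F c], of u] unfolding dcf_def by simp
 have DD: "fst ` D\<subseteq>{h. F h\<in>chart_dom c}" using D(2) by auto
 have cont: "continuous_on D ?\<Theta>"
 proof (rule continuous_on_Pair)
  show "continuous_on D (\<lambda>p. chart_map c (F (fst p)))"
   by (rule continuous_on_compose2[OF cF continuous_on_fst[OF continuous_on_id] DD])
  have "continuous_on D (\<lambda>p. \<Sum>i\<in>UNIV. (snd p$i) *\<^sub>R dcf c F (fst p) (axis i 1))"
   by (intro continuous_intros continuous_on_compose2[OF cD continuous_on_fst[OF continuous_on_id] DD])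
  moreover have "dcf c F (fst p) (snd p) = (\<Sum>i\<in>UNIV. (snd p$i) *\<^sub>R dcf c F (fst p) (axis i 1))" if "p\<in>D" for p
  proof -
   have "F (fst p)\<in>chart_dom c" using DD that by blast
   then have l: "linear (dcf c F (fst p))" by (rule has_derivative_linear[OF liso_has_derivative[OF F c UNIV_I]])
   show ?thesis by (subst vec_expand[of "snd p"]) (simp only: linear_sum[OF l] linear_scale[OF l])
  qed
  ultimately show "continuous_on D (\<lambda>p. dcf c F (fst p) (snd p))" by (subst continuous_on_cong[OF refl])
 qed
 fix y assume "y\<in>?\<Theta> ` D"
 then obtain h w where hw: "(h, w)\<in>D" "y = ?\<Theta> (h, w)" by auto
 obtain U V b where U: "open U" "h\<in>U" "homeomorphism U V (\<lambda>z. chart_map c (F z)) b"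
  using liso_local_inverse[OF F c UNIV_I D(2)[OF hw(1)]] by (elim exE conjE) blast
 define D' where "D' = D\<inter>U\<times>UNIV"
 have D': "open D'" "(h, w)\<in>D'" "D'\<subseteq>D" unfolding D'_def using D(1) U hw(1) by (auto intro: open_Int open_Times)
 have "inj_on ?\<Theta> D'"
 proof (rule inj_onI)
  fix p p' assume p: "p\<in>D'" "p'\<in>D'" "?\<Theta> p = ?\<Theta> p'"
  have "fst p\<in>U" "fst p'\<in>U" using p unfolding D'_def by auto
  then have f: "fst p = fst p'" using p(3) homeomorphism_apply1[OF U(3)] by (metis fst_conv)
  have "F (fst p)\<in>chart_dom c" using p(1) D'(3) DD by blast
  from dcf_inj[OF F c UNIV_I this] have "snd p = snd p'" using p(3) f by (simp add: inj_eq)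
  then show "p = p'" using f by (simp add: prod_eq_iff)
 qed
 then have "open (?\<Theta> ` D')"
  by (intro invariance_of_domain_gen[OF D'(1) continuous_on_subset[OF cont D'(3)]]) auto
 then show "\<exists>T. open T \<and> y\<in>T \<and> T\<subseteq>?\<Theta> ` D"
  using D' hw(2) by (intro exI[of _ "?\<Theta> ` D'"]) blast
qed

text \<open>Taken over all pairs and not only those of unit vectors, because
  \<open>tangent_open\<close> speaks of open sets of the whole tangent bundle.\<close>

definition visiting :: "real => real => ((real^'n)\<times>(real^'n)) set" where
 "visiting s T = {p. \<exists>t>T. F (geo (fst p) (snd p) t)\<in>nbhd (t powr - s)}"

lemma open_visiting: "open (visiting s T)"
proof -
 have "open {z. F z\<in>nbhd r}" for r using liso_preimage[OF F nbhd_open] by simp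
 moreover have "continuous_on UNIV (\<lambda>p :: (real^'n)\<times>(real^'n). geo (fst p) (snd p) t)" for t
  unfolding geo_def by (intro continuous_intros)
 ultimately have "open ((\<lambda>p :: (real^'n)\<times>(real^'n). geo (fst p) (snd p) t) -` {z. F z\<in>nbhd (t powr - s)})" for t
  by (intro open_vimage) auto
 then have "open (\<Union>t\<in>{T<..}. (\<lambda>p :: (real^'n)\<times>(real^'n). geo (fst p) (snd p) t) -` {z. F z\<in>nbhd (t powr - s)})"
  by (intro open_UN) auto
 moreover have "visiting s T = (\<Union>t\<in>{T<..}. (\<lambda>p :: (real^'n)\<times>(real^'n). geo (fst p) (snd p) t) -` {z. F z\<in>nbhd (t powr - s)})"
  unfolding visiting_def by auto
 ultimately show ?thesis by simp
qed

text \<open>In a chart the set becomes the image of an open set of pairs under the map of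
  \<open>coordinates_open\<close>.\<close>

lemma tangent_open_visiting: "tangent_open M {TF F h w | h w. (h, w)\<in>visiting s T}" (is "tangent_open M ?W")
 unfolding tangent_open_def
proof (intro conjI ballI)
 show "?W\<subseteq>tangent_bundle M" using TF_in_tangent_bundle[OF F] by blast
 fix c assume c: "c\<in>man_atlas M"
 define D where "D = visiting s T\<inter>{h. F h\<in>chart_dom c}\<times>UNIV"
 have "open {h. F h\<in>chart_dom c}" using liso_preimage[OF F chart_dom_open[OF c]] by simp
 then have "open D" unfolding D_def by (intro open_Int open_visiting open_Times open_UNIV)
 then have "open ((\<lambda>p. (chart_map c (F (fst p)), dcf c F (fst p) (snd p))) ` D)"
  by (rule coordinates_open[OF c]) (auto simp: D_def)
 moreover have "{(x, y). x\<in>chart_img c \<and> tangent_vector M c x y\<in>?W} = (\<lambda>p. (chart_map c (F (fst p)), dcf c F (fst p) (snd p))) ` D"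
 proof (intro set_eqI iffI)
  fix p assume "p\<in>{(x, y). x\<in>chart_img c \<and> tangent_vector M c x y\<in>?W}"
  then obtain x y h w where p: "p = (x, y)" "x\<in>chart_img c" "tangent_vector M c x y = TF F h w" "(h, w)\<in>visiting s T" by auto
  obtain h1 w1 where 1: "F h1\<in>chart_dom c" "x = chart_map c (F h1)" "y = dcf c F h1 w1" "tangent_vector M c x y = TF F h1 w1"
   using tangent_vector_TF[OF F F_onto c p(2), of y] by blast
  have eq: "TF F h1 w1 = TF F h w" using p(3) 1(4) by simp
  then have Fe: "F h1 = F h" unfolding TF_def by simp
  have "snd (TF F h1 w1) c = snd (TF F h w) c" using eq by simp
  then have "dcf c F h1 w1 = dcf c F h w" using c 1(1) Fe unfolding TF_def by simp
  then have "p = (chart_map c (F h), dcf c F h w)" using p(1) 1 Fe by simp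
  moreover have "(h, w)\<in>D" unfolding D_def using p(4) 1(1) Fe by simp
  ultimately show "p\<in>(\<lambda>p. (chart_map c (F (fst p)), dcf c F (fst p) (snd p))) ` D" by force
 next
  fix p assume "p\<in>(\<lambda>p. (chart_map c (F (fst p)), dcf c F (fst p) (snd p))) ` D"
  then obtain h w where p: "p = (chart_map c (F h), dcf c F h w)" "(h, w)\<in>visiting s T" "F h\<in>chart_dom c" unfolding D_def by auto
  have "tangent_vector M c (chart_map c (F h)) (dcf c F h w) = TF F h w" by (rule TF_tangent_vector[OF F c p(3), symmetric])
  then show "p\<in>{(x, y). x\<in>chart_img c \<and> tangent_vector M c x y\<in>?W}" using p chart_map_img[OF p(3)] by auto
 qed
 ultimately show "open {(x, y). x\<in>chart_img c \<and> tangent_vector M c x y\<in>?W}" by (simp only:)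
qed

lemma space_utb: "space (unit_tangent_borel M) = unit_tangent_bundle M"
 unfolding unit_tangent_borel_def by (rule space_measure_of) auto

lemma visits_sets: "visits s T\<in>sets (unit_tangent_borel M)"
proof -
 have "visits s T = {TF F h w | h w. (h, w)\<in>visiting s T}\<inter>unit_tangent_bundle M"
 proof (intro set_eqI iffI)
  fix v assume "v\<in>visits s T"
  then obtain t where v: "v\<in>unit_tangent_bundle M" "t > T" "base_point (geodesic_flow M t v)\<in>nbhd (t powr - s)"
   unfolding visits_def by blast
  obtain h w where hw: "v = TF F h w" "gH h w w = 1" using v(1) unfolding unit_tangent_bundle_TF[OF F F_onto] by blast
  have "(h, w)\<in>visiting s T" using v(2,3) unfolding hw(1) base_point_flow[OF F hw(2)] visiting_def by auto
  then show "v\<in>{TF F h w | h w. (h, w)\<in>visiting s T}\<inter>unit_tangent_bundle M" using v(1) hw(1) by blast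
 next
  fix v assume v: "v\<in>{TF F h w | h w. (h, w)\<in>visiting s T}\<inter>unit_tangent_bundle M"
  then obtain h w h' w' where hw: "v = TF F h w" "(h, w)\<in>visiting s T" and hw': "v = TF F h' w'" "gH h' w' w' = 1"
   unfolding unit_tangent_bundle_TF[OF F F_onto] by blast
  \<comment> \<open>The pair that witnesses \<open>visiting\<close> need not be the one that
    witnesses unit length. Equal tangent vectors have equal length, so the formula for the flow
    holds for this pair too.\<close>
  have g: "gH h w w = 1" using TF_eq_gH[of h w h' w'] hw hw' by simp
  obtain t where "t > T" "F (geo h w t)\<in>nbhd (t powr - s)" using hw(2) unfolding visiting_def by auto
  then show "v\<in>visits s T" unfolding visits_def using v base_point_flow[OF F g] hw(1) by auto
 qed
 then show ?thesis
  unfolding unit_tangent_borel_def using tangent_open_visiting[of s T]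
  by (subst sets_measure_of) (auto intro!: sigma_sets.Basic)
qed

lemma generic_sets: "{v\<in>space (unit_tangent_borel M). generic v}\<in>sets (unit_tangent_borel M)"
proof -
 have v: "{v\<in>space (unit_tangent_borel M). v\<in>visits s T}\<in>sets (unit_tangent_borel M)" for s T
 proof -
  have "{v\<in>space (unit_tangent_borel M). v\<in>visits s T} = visits s T" unfolding space_utb visits_def by blast
  then show ?thesis using visits_sets by simp
 qed
 have "{v\<in>space (unit_tangent_borel M). generic v} = {v\<in>space (unit_tangent_borel M).
   (\<forall>m::nat. \<exists>T::nat. v \<notin> visits (exponent * (1 + 1/(real m + 2))) (real T)) \<and>
   (\<forall>m::nat. \<forall>T::nat. v\<in>visits (exponent * (1 - 1/(real m + 2))) (real T))}"
  unfolding generic_def space_utb by blast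
 also have "\<dots>\<in>sets (unit_tangent_borel M)"
  by (intro sets.sets_Collect_conj sets.sets_Collect_countable_All sets.sets_Collect_countable_Ex sets.sets_Collect_neg v)
 finally show ?thesis .
qed

end

context developed_manifold begin

text \<open>For fixed base coordinate \<open>generic_fibre\<close> gives a null set of fibre
  coordinates. Fubini then yields a null set of the ball bundle, which stays null under the density
  and under radial projection.\<close>

lemma AE_chart_liouville:
 assumes c: "c\<in>man_atlas M"
 shows "AE v in chart_liouville M c. generic v"
proof -
 define G where "G = man_metric M c"
 define N where "N p = (\<Sum>i\<in>UNIV. snd p$i*(\<Sum>j\<in>UNIV. G (fst p)$i$j * snd p$j))" for p :: "(real^'n)\<times>(real^'n)"
 have N: "inner_at M c x y y = N (x, y)" for x y
  unfolding inner_at_def N_def G_def by (simp add: inner_vec_def matrix_vector_mult_def)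
 \<comment> \<open>On this open set the radial projection is continuous; the domain \<open>S\<close>
   of integration is a Borel subset of it.\<close>
 define Om where "Om = chart_img c\<times>(- {0 :: real^'n})"
 have oOm: "open Om" unfolding Om_def using chart_img_open[OF c] by (intro open_Times) auto
 define S where "S = {(x, y). x\<in>chart_img c \<and> y\<noteq>0 \<and> inner_at M c x y y\<le>1}"
 define g where "g = (\<lambda>(x, y). tangent_vector M c x (y /\<^sub>R sqrt (inner_at M c x y y)))"
 define f where "f = (\<lambda>(x :: real^'n, y :: real^'n). ennreal (real CARD('n) * det (man_metric M c x)))"
 have "continuous_on (chart_img c) G"
  using riem c unfolding riemannian_manifold_def smooth_on_def G_def by (auto dest!: bspec[of _ _ c] spec[of _ 0])
 then have cG: "continuous_on Om (\<lambda>p. G (fst p))"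
  by (rule continuous_on_compose2[OF _ continuous_on_fst[OF continuous_on_id]]) (auto simp: Om_def)
 have cN: "continuous_on Om N" unfolding N_def by (intro continuous_intros cG)
 have Npos: "0 < N p" if "p\<in>Om" for p
 proof -
  have "fst p\<in>chart_img c" "snd p\<noteq>0" using that unfolding Om_def by auto
  then have "0 < snd p \<bullet> (man_metric M c (fst p) *v snd p)"
   using riem c unfolding riemannian_manifold_def by blast
  then show ?thesis using N[of "fst p" "snd p"] unfolding inner_at_def by simp
 qed
 have SO: "S\<subseteq>Om" unfolding S_def Om_def by auto
 have Sm: "S\<in>sets lborel"
 proof -
  have "open (Om\<inter>N -` {1<..})" using continuous_open_preimage[OF cN oOm] by simp
  moreover have "S = Om - (Om\<inter>N -` {1<..})" unfolding S_def Om_def N by auto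
  ultimately show ?thesis using oOm by (simp add: borel_open sets.Diff)
 qed
 have gm: "g\<in>measurable (restrict_space lborel S) (unit_tangent_borel M)"
  unfolding unit_tangent_borel_def
 proof (rule measurable_measure_of)
  show "{W\<inter>unit_tangent_bundle M |W. tangent_open M W}\<subseteq>Pow (unit_tangent_bundle M)" by auto
  define k where "k p = (fst p, snd p /\<^sub>R sqrt (N p))" for p
  have gk: "g p = tangent_vector M c (fst (k p)) (snd (k p))" for p unfolding g_def k_def by (cases p) (simp add: N)
  have kO: "fst (k p)\<in>chart_img c" if "p\<in>Om" for p using that unfolding k_def Om_def by auto
  have k1: "inner_at M c (fst (k p)) (snd (k p)) (snd (k p)) = 1" if "p\<in>Om" for p
  proof -
   have "N (x, a *\<^sub>R y) = a*a*N (x, y)" for a x y unfolding N_def by (simp add: sum_distrib_left mult_ac)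
   from this[of "fst p" "inverse (sqrt (N p))" "snd p"]
   have "N (k p) = inverse (sqrt (N p))*inverse (sqrt (N p))*N p" unfolding k_def by simp
   also have "\<dots> = inverse (sqrt (N p) * sqrt (N p))*N p" by (simp only: inverse_mult_distrib)
   also have "\<dots> = 1" using Npos[OF that] by simp
   finally show ?thesis using N[of "fst (k p)" "snd (k p)"] by simp
  qed
  have gU: "g p\<in>unit_tangent_bundle M" if "p\<in>Om" for p
   unfolding unit_tangent_bundle_def gk using c kO[OF that] k1[OF that] by blast
  then show "g\<in>space (restrict_space lborel S) \<rightarrow> unit_tangent_bundle M" using SO by (auto simp: space_restrict_space)
  fix A assume "A\<in>{W\<inter>unit_tangent_bundle M |W. tangent_open M W}"
  then obtain W where W: "A = W\<inter>unit_tangent_bundle M" "tangent_open M W" by blast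
  define O' where "O' = {(x, y). x\<in>chart_img c \<and> tangent_vector M c x y\<in>W}"
  have "open O'" unfolding O'_def using W(2) c unfolding tangent_open_def by blast
  have ck: "continuous_on Om k"
   unfolding k_def by (intro continuous_intros cN) (use Npos in \<open>auto simp: less_imp_neq[symmetric]\<close>)
  have "open (Om\<inter>k -` O')" by (rule continuous_open_preimage[OF ck oOm \<open>open O'\<close>])
  then have "Om\<inter>k -` O'\<in>sets lborel" by (simp add: borel_open)
  moreover have "g -` A\<inter>space (restrict_space lborel S) = S\<inter>(Om\<inter>k -` O')"
   using SO gU kO unfolding W(1) O'_def by (auto simp: space_restrict_space gk split_beta)
  ultimately show "g -` A\<inter>space (restrict_space lborel S)\<in>sets (restrict_space lborel S)"
   unfolding sets_restrict_space by simp
 qed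
 have "continuous_on Om (\<lambda>p. real CARD('n) * det (G (fst p)))"
  unfolding det_def by (intro continuous_intros cG)
 then have "(\<lambda>p. real CARD('n) * det (G (fst p)))\<in>borel_measurable (restrict_space borel S)"
  by (intro borel_measurable_continuous_on_restrict) (rule continuous_on_subset[OF _ SO])
 then have "(\<lambda>p. ennreal (real CARD('n) * det (G (fst p))))\<in>borel_measurable (restrict_space lborel S)"
  by (intro measurable_compose[OF _ measurable_ennreal]) (simp cong: measurable_cong_sets sets_restrict_space_cong)
 moreover have "f = (\<lambda>p. ennreal (real CARD('n) * det (G (fst p))))" unfolding f_def G_def by (auto simp: fun_eq_iff)
 ultimately have fm: "f\<in>borel_measurable (restrict_space lborel S)" by simp
 \<comment> \<open>Passing from all slices to the product requires measurability of the exceptional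
   set, which is why \<open>generic\<close> was shown to be measurable.\<close>
 have "AE p in (lborel :: ((real^'n)\<times>(real^'n)) measure). p\<in>S --> generic (g p)"
  unfolding lborel_prod[symmetric]
 proof (rule lborel_pair.AE_pair_measure)
  have "{p\<in>space (restrict_space lborel S). \<not> generic (g p)}\<in>sets (restrict_space lborel S)"
  proof -
   have "{p\<in>space (restrict_space lborel S). generic (g p)} = g -` {v\<in>space (unit_tangent_borel M). generic v}\<inter>space (restrict_space lborel S)"
    using measurable_space[OF gm] by auto
   then have "{p\<in>space (restrict_space lborel S). generic (g p)}\<in>sets (restrict_space lborel S)"
    using measurable_sets[OF gm generic_sets] by simp
   then show ?thesis by (rule sets.sets_Collect_neg)
  qed
  then have "{p\<in>S. \<not> generic (g p)}\<in>sets lborel"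
   using Sm by (subst (asm) sets_restrict_space_iff) (auto simp: space_restrict_space)
  then have "space lborel - {p\<in>S. \<not> generic (g p)}\<in>sets lborel" by (rule sets.compl_sets)
  moreover have "space lborel - {p\<in>S. \<not> generic (g p)} = {p\<in>space lborel. p\<in>S --> generic (g p)}" by auto
  ultimately show "{p\<in>space (lborel \<Otimes>\<^sub>M lborel). p\<in>S --> generic (g p)}\<in>sets (lborel \<Otimes>\<^sub>M lborel)"
   unfolding lborel_prod by simp
  show "AE x in lborel. AE y in lborel. (x, y)\<in>S --> generic (g (x, y))"
  proof (rule AE_I2)
   fix x :: "real^'n"
   show "AE y in lborel. (x, y)\<in>S --> generic (g (x, y))"
   proof (cases "x\<in>chart_img c")
    case True
    show ?thesis
     by (rule negligible_AE_lborel, rule negligible_subset[OF generic_fibre[OF c True]]) (auto simp: S_def g_def)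
   qed (simp add: S_def)
  qed
 qed
 then have "AE p in restrict_space lborel S. generic (g p)" using Sm by (subst AE_restrict_space_iff) auto
 then have "AE p in density (restrict_space lborel S) f. generic (g p)" by (subst AE_density[OF fm]) (auto elim: eventually_mono)
 then have "AE v in distr (density (restrict_space lborel S) f) (unit_tangent_borel M) g. generic v"
  using gm by (subst AE_distr_iff[OF _ generic_sets]) (auto cong: measurable_cong_sets)
 then show ?thesis unfolding chart_liouville_def S_def f_def g_def .
qed

lemma AE_liouville: "AE v in liouville M. generic v"
 unfolding liouville_def
proof (rule AE_SUP_measure[OF _ _ generic_sets AE_chart_liouville])
 show "man_atlas M\<noteq>{}" using c0 by blast
 show "sets (chart_liouville M c) = sets (unit_tangent_borel M)" for c unfolding chart_liouville_def by simp
qed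

end

theorem theorem1p7:
  fixes M :: "('a, 'n::finite) riem" and x0 :: 'a
  assumes "riemannian_manifold M"
    and "compact_space (man_top M)"
    and "connected_space (man_top M)"
    and "CARD('n) \<ge> 2"
    and "constant_curvature M (-1)"
    and "x0 \<in> topspace (man_top M)"
  shows "AE v in liouville M.
           Limsup at_top (\<lambda>t::real. neg_log (riem_dist M (base_point (geodesic_flow M t v)) x0) / ereal (ln t))
             = ereal (1 / (real CARD('n) - 1))"
proof -
 interpret compact_hyp_manifold M x0 by unfold_locales (fact assms)+
 obtain c0 where c0: "c0\<in>man_atlas M" "x0\<in>chart_dom c0" using atlas_cover[OF x0] by blast
 obtain \<rho> J B \<phi> \<xi> \<eta> where ad: "adapted c0 x0 \<rho> J B \<phi> \<xi> \<eta>" by (rule adapted_exists[OF c0])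
 \<comment> \<open>The adapted parametrisation at \<open>x0\<close> itself is extended, so that one
   \<open>J\<close> serves both for the fibre over \<open>x0\<close> and for the distance
   estimates.\<close>
 obtain F where F: "liso UNIV F" "\<forall>z\<in>ball 0 \<rho>. F z = J z" using global_extension[OF adaptedD(2,1)[OF ad]] by blast
 interpret developed_manifold M x0 F c0 \<rho> J B \<phi> \<xi> \<eta>
  by unfold_locales (use F c0 ad in auto)
 show ?thesis
  using AE_liouville
 proof (rule eventually_mono)
  fix v assume "generic v"
  from generic_Limsup[OF this]
  show "Limsup at_top (\<lambda>t::real. neg_log (riem_dist M (base_point (geodesic_flow M t v)) x0)/ereal (ln t))
       = ereal (1/(real CARD('n) - 1))"
   unfolding exponent_def .
 qed
qed

end
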